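(* Let $A$ be a finite dimensional self-injective algebra over a field $k$. Then the embedding $\iota^*:\mathcal D^*(A,A)\hookrightarrow C^*_{\mathrm{sg}}(A,A)$ of the generalized Tate-Hochschild complex into the singular Hochschild cochain complex is a quasi-isomorphism.
   Context: $A$ is self-injective if it is injective as a left (equivalently, right) module over itself. Notation. $k$ is a field, $\otimes=\otimes_k$, $\overline A=A/(k\cdot 1)$, $s\overline A$ is $\overline A$ placed in degree $-1$, $s\overline a_{i,j}:=s\overline a_i\otimes\cdots\otimes s\overline a_j$ (empty tensor if $j<i$). $\Omega^p_{\mathrm{nc}}(A):=A\otimes (s\overline A)^{\otimes p}$, in degree $-p$, is an $A$-$A$-bimodule: left action by multiplication on the first factor, right action $$(a_0\otimes s\overline a_{1,p})\blacktriangleleft a_{p+1}=\sum_{i=0}^{p}(-1)^{p-i}a_0\otimes s\overline a_{1,i-1}\otimes s\overline{a_ia_{i+1}}\otimes s\overline a_{i+2,p+1}$$ (the $i=0$ term is $(-1)^pa_0a_1\otimes s\overline a_{2,p+1}$). For $m\in\mathbb Z$, $p\ge0$, $N=m+p$: $C^m(A,\Omega^p_{\mathrm{nc}}(A))=\mathrm{Hom}_k((s\overline A)^{\otimes N},A\otimes(s\overline A)^{\otimes p})$ (zero if $N<0$) with differential $$(-1)^{m+1}\delta(f)(s\overline a_{1,N+1})=a_1f(s\overline a_{2,N+1})+\sum_{j=1}^{N}(-1)^jf(s\overline a_{1,j-1}\otimes s\overline{a_ja_{j+1}}\otimes s\overline a_{j+2,N+1})+(-1)^{N+1}f(s\overline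 a_{1,N})\blacktriangleleft a_{N+1}.$$ $C^*_{\mathrm{sg}}(A,A)$ is the colimit of the complexes $C^*(A,\Omega^p_{\mathrm{nc}}(A))$ along the injective cochain maps $\theta_p(f)=f\otimes\mathrm{id}_{s\overline A}$. The case $p=0$ is the normalized Hochschild cochain complex $C^*(A,A)$. Generalized Tate-Hochschild complex. $A^\vee:=\mathrm{Hom}_{A\otimes A^{\mathrm{op}}}(A,A\otimes A^{\mathrm{op}})$ is identified with $\{\sum_ix_i\otimes y_i\in A\otimes A:\ \sum_iax_i\otimes y_i=\sum_ix_i\otimes y_ia\ \ \forall a\in A\}$, with bimodule structure $a\cdot(\sum x_i\otimes y_i)\cdot b=\sum x_ib\otimes ay_i$. $C_p(A,A^\vee)=A^\vee\otimes(s\overline A)^{\otimes p}$ has the Hochschild differential $$b(m\otimes s\overline a_{1,p})=ma_1\otimes s\overline a_{2,p}+\sum_{j=1}^{p-1}(-1)^jm\otimes s\overline a_{1,j-1}\otimes s\overline{a_ja_{j+1}}\otimes s\overline a_{j+2,p}+(-1)^pa_pm\otimes s\overline a_{1,p-1}.$$ $\mathcal D^*(A,A)$ is the complex $\cdots\xrightarrow{b_2}C_1(A,A^\vee)\xrightarrow{b_1}A^\vee\xrightarrow{\mu}A\xrightarrow{\delta^0}C^1(A,A)\xrightarrow{\delta^1}\cdots$ with $C^i(A,A)$ in degree $i\geq 0$ and $C_p(A,A^\vee)$ in degree $-p-1$, where $\mu(\sum x_i\otimes y_i)=\sum x_iy_i$. The cochain map $\iota^*$ is the inclusion $C^i(A,A)\subset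 C^i_{\mathrm{sg}}(A,A)$ in degrees $i\ge0$, and in degree $-p-1$, $p\ge0$, it sends $(\sum_jx_j\otimes y_j)\otimes s\overline a_{1,p}$ to $\sum_jx_j\otimes s\overline a_{1,p}\otimes s\overline{y_j}\in\Omega^{p+1}_{\mathrm{nc}}(A)=C^{-p-1}(A,\Omega^{p+1}_{\mathrm{nc}}(A))\subset C^{-p-1}_{\mathrm{sg}}(A,A)$. *)

theory Defs
  imports "HOL-Algebra.Module" "HOL-Algebra.AbelCoset"
begin

section \<open>Linear algebra over a ring\<close>

text \<open>
  Modules are records of type \<^typ>\<open>('k, 'v) module\<close>; their fields for multiplication and unit play
  no role unless the module is an algebra. Linear maps are extensional functions, so that equality
  of linear maps is equality in HOL.
\<close>

definition mk_module ::
    "'v set \<Rightarrow> 'v \<Rightarrow> ('v \<Rightarrow> 'v \<Rightarrow> 'v) \<Rightarrow> ('k \<Rightarrow> 'v \<Rightarrow> 'v) \<Rightarrow> ('k, 'v) module" where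
  "mk_module C z a s =
     \<lparr>carrier = C, mult = (\<lambda>x y. undefined), one = undefined, zero = z, add = a, smult = s\<rparr>"

definition lin_maps ::
    "('k, 'r) ring_scheme \<Rightarrow> ('k, 'v) module \<Rightarrow> ('k, 'w) module \<Rightarrow> ('v \<Rightarrow> 'w) set" where
  "lin_maps K V W =
     {f \<in> carrier V \<rightarrow>\<^sub>E carrier W.
        (\<forall>x\<in>carrier V. \<forall>y\<in>carrier V. f (x \<oplus>\<^bsub>V\<^esub> y) = f x \<oplus>\<^bsub>W\<^esub> f y) \<and>
        (\<forall>c\<in>carrier K. \<forall>x\<in>carrier V. f (c \<odot>\<^bsub>V\<^esub> x) = c \<odot>\<^bsub>W\<^esub> f x)}"

definition hom_mod ::
    "('k, 'r) ring_scheme \<Rightarrow> ('k, 'v) module \<Rightarrow> ('k, 'w) module \<Rightarrow> ('k, 'v \<Rightarrow> 'w) module" where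
  "hom_mod K V W = mk_module (lin_maps K V W)
     (\<lambda>x\<in>carrier V. \<zero>\<^bsub>W\<^esub>)
     (\<lambda>f g. \<lambda>x\<in>carrier V. f x \<oplus>\<^bsub>W\<^esub> g x)
     (\<lambda>c f. \<lambda>x\<in>carrier V. c \<odot>\<^bsub>W\<^esub> f x)"

text \<open>
  \<open>lin_ext K V W I e w\<close> is the linear map \<open>V \<rightarrow> W\<close> with \<open>e i \<mapsto> w i\<close> for \<open>i \<in> I\<close>. It is used only where
  the \<open>e i\<close> span \<open>V\<close> and the values \<open>w i\<close> respect the relations between them, so that the map exists
  and is unique.
\<close>

definition lin_ext ::
    "('k, 'r) ring_scheme \<Rightarrow> ('k, 'v) module \<Rightarrow> ('k, 'w) module \<Rightarrow>
     'i set \<Rightarrow> ('i \<Rightarrow> 'v) \<Rightarrow> ('i \<Rightarrow> 'w) \<Rightarrow> 'v \<Rightarrow> 'w" where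
  "lin_ext K V W I e w = (THE h. h \<in> lin_maps K V W \<and> (\<forall>i\<in>I. h (e i) = w i))"

definition mod_span :: "('k, 'r) ring_scheme \<Rightarrow> ('k, 'v) module \<Rightarrow> 'v set \<Rightarrow> 'v set" where
  "mod_span K V S = \<Inter> {H. submodule H K V \<and> S \<subseteq> H}"

definition quot_mod :: "('k, 'v) module \<Rightarrow> 'v set \<Rightarrow> ('k, 'v set) module" where
  "quot_mod V S = mk_module (a_rcosets\<^bsub>V\<^esub> S) S (\<lambda>X Y. X <+>\<^bsub>V\<^esub> Y)
     (\<lambda>c X. \<Union>x\<in>X. S +>\<^bsub>V\<^esub> (c \<odot>\<^bsub>V\<^esub> x))"

definition free_mod :: "('k, 'r) ring_scheme \<Rightarrow> 'b set \<Rightarrow> ('k, 'b \<Rightarrow> 'k) module" where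
  "free_mod K B = mk_module {f \<in> B \<rightarrow>\<^sub>E carrier K. finite {b \<in> B. f b \<noteq> \<zero>\<^bsub>K\<^esub>}}
     (\<lambda>b\<in>B. \<zero>\<^bsub>K\<^esub>)
     (\<lambda>f g. \<lambda>b\<in>B. f b \<oplus>\<^bsub>K\<^esub> g b)
     (\<lambda>c f. \<lambda>b\<in>B. c \<otimes>\<^bsub>K\<^esub> f b)"

definition free_gen :: "('k, 'r) ring_scheme \<Rightarrow> 'b set \<Rightarrow> 'b \<Rightarrow> 'b \<Rightarrow> 'k" where
  "free_gen K B b = (\<lambda>b'\<in>B. if b' = b then \<one>\<^bsub>K\<^esub> else \<zero>\<^bsub>K\<^esub>)"


subsection \<open>Tensor products and tensor powers\<close>

definition tensor_rel ::
    "('k, 'r) ring_scheme \<Rightarrow> ('k, 'v) module \<Rightarrow> ('k, 'w) module \<Rightarrow> ('v \<times> 'w \<Rightarrow> 'k) set" where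
  "tensor_rel K V W =
     (let F = free_mod K (carrier V \<times> carrier W); g = free_gen K (carrier V \<times> carrier W) in
      mod_span K F
       ({g (x \<oplus>\<^bsub>V\<^esub> x', y) \<ominus>\<^bsub>F\<^esub> (g (x, y) \<oplus>\<^bsub>F\<^esub> g (x', y)) | x x' y.
           x \<in> carrier V \<and> x' \<in> carrier V \<and> y \<in> carrier W} \<union>
        {g (x, y \<oplus>\<^bsub>W\<^esub> y') \<ominus>\<^bsub>F\<^esub> (g (x, y) \<oplus>\<^bsub>F\<^esub> g (x, y')) | x y y'.
           x \<in> carrier V \<and> y \<in> carrier W \<and> y' \<in> carrier W} \<union>
        {g (c \<odot>\<^bsub>V\<^esub> x, y) \<ominus>\<^bsub>F\<^esub> c \<odot>\<^bsub>F\<^esub> g (x, y) | c x y.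
           c \<in> carrier K \<and> x \<in> carrier V \<and> y \<in> carrier W} \<union>
        {g (x, c \<odot>\<^bsub>W\<^esub> y) \<ominus>\<^bsub>F\<^esub> c \<odot>\<^bsub>F\<^esub> g (x, y) | c x y.
           c \<in> carrier K \<and> x \<in> carrier V \<and> y \<in> carrier W}))"

definition tensor_mod ::
    "('k, 'r) ring_scheme \<Rightarrow> ('k, 'v) module \<Rightarrow> ('k, 'w) module \<Rightarrow> ('k, ('v \<times> 'w \<Rightarrow> 'k) set) module" where
  "tensor_mod K V W = quot_mod (free_mod K (carrier V \<times> carrier W)) (tensor_rel K V W)"

definition tensor_el ::
    "('k, 'r) ring_scheme \<Rightarrow> ('k, 'v) module \<Rightarrow> ('k, 'w) module \<Rightarrow> 'v \<Rightarrow> 'w \<Rightarrow> ('v \<times> 'w \<Rightarrow> 'k) set" where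
  "tensor_el K V W x y =
     tensor_rel K V W +>\<^bsub>free_mod K (carrier V \<times> carrier W)\<^esub> free_gen K (carrier V \<times> carrier W) (x, y)"

definition tuples :: "'v set \<Rightarrow> nat \<Rightarrow> 'v list set" where
  "tuples X n = {xs. set xs \<subseteq> X \<and> length xs = n}"

definition tpow_rel ::
    "('k, 'r) ring_scheme \<Rightarrow> ('k, 'w) module \<Rightarrow> nat \<Rightarrow> ('w list \<Rightarrow> 'k) set" where
  "tpow_rel K W n =
     (let F = free_mod K (tuples (carrier W) n); g = free_gen K (tuples (carrier W) n) in
      mod_span K F
       ({g (xs @ (x \<oplus>\<^bsub>W\<^esub> y) # ys) \<ominus>\<^bsub>F\<^esub> (g (xs @ x # ys) \<oplus>\<^bsub>F\<^esub> g (xs @ y # ys)) | xs x y ys.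
           xs @ x # ys \<in> tuples (carrier W) n \<and> y \<in> carrier W} \<union>
        {g (xs @ (c \<odot>\<^bsub>W\<^esub> x) # ys) \<ominus>\<^bsub>F\<^esub> c \<odot>\<^bsub>F\<^esub> g (xs @ x # ys) | c xs x ys.
           c \<in> carrier K \<and> xs @ x # ys \<in> tuples (carrier W) n}))"

text \<open>For \<open>n = 0\<close> the following is the free module on the empty list, i.e. \<open>K\<close>.\<close>

definition tpow_mod ::
    "('k, 'r) ring_scheme \<Rightarrow> ('k, 'w) module \<Rightarrow> nat \<Rightarrow> ('k, ('w list \<Rightarrow> 'k) set) module" where
  "tpow_mod K W n = quot_mod (free_mod K (tuples (carrier W) n)) (tpow_rel K W n)"

definition tpow_el ::
    "('k, 'r) ring_scheme \<Rightarrow> ('k, 'w) module \<Rightarrow> 'w list \<Rightarrow> ('w list \<Rightarrow> 'k) set" where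
  "tpow_el K W xs =
     tpow_rel K W (length xs) +>\<^bsub>free_mod K (tuples (carrier W) (length xs))\<^esub>
       free_gen K (tuples (carrier W) (length xs)) xs"


subsection \<open>Sequential colimits\<close>

definition dirsum_mod :: "(nat \<Rightarrow> ('k, 'v) module) \<Rightarrow> ('k, nat \<Rightarrow> 'v) module" where
  "dirsum_mod M = mk_module
     {s. (\<forall>p. s p \<in> carrier (M p)) \<and> finite {p. s p \<noteq> \<zero>\<^bsub>M p\<^esub>}}
     (\<lambda>p. \<zero>\<^bsub>M p\<^esub>)
     (\<lambda>s t p. s p \<oplus>\<^bsub>M p\<^esub> t p)
     (\<lambda>c s p. c \<odot>\<^bsub>M p\<^esub> s p)"

definition dirsum_in :: "(nat \<Rightarrow> ('k, 'v) module) \<Rightarrow> nat \<Rightarrow> 'v \<Rightarrow> nat \<Rightarrow> 'v" where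
  "dirsum_in M p x = (\<lambda>q. if q = p then x else \<zero>\<^bsub>M q\<^esub>)"

text \<open>The colimit of \<open>M 0 \<rightarrow> M 1 \<rightarrow> \<dots>\<close> along \<open>t p : M p \<rightarrow> M (p + 1)\<close>.\<close>

definition colim_rel ::
    "('k, 'r) ring_scheme \<Rightarrow> (nat \<Rightarrow> ('k, 'v) module) \<Rightarrow> (nat \<Rightarrow> 'v \<Rightarrow> 'v) \<Rightarrow> (nat \<Rightarrow> 'v) set" where
  "colim_rel K M t = mod_span K (dirsum_mod M)
     {dirsum_in M p x \<ominus>\<^bsub>dirsum_mod M\<^esub> dirsum_in M (Suc p) (t p x) | p x. x \<in> carrier (M p)}"

definition colim_mod ::
    "('k, 'r) ring_scheme \<Rightarrow> (nat \<Rightarrow> ('k, 'v) module) \<Rightarrow> (nat \<Rightarrow> 'v \<Rightarrow> 'v) \<Rightarrow>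
     ('k, (nat \<Rightarrow> 'v) set) module" where
  "colim_mod K M t = quot_mod (dirsum_mod M) (colim_rel K M t)"

definition colim_in ::
    "('k, 'r) ring_scheme \<Rightarrow> (nat \<Rightarrow> ('k, 'v) module) \<Rightarrow> (nat \<Rightarrow> 'v \<Rightarrow> 'v) \<Rightarrow>
     nat \<Rightarrow> 'v \<Rightarrow> (nat \<Rightarrow> 'v) set" where
  "colim_in K M t p x = colim_rel K M t +>\<^bsub>dirsum_mod M\<^esub> dirsum_in M p x"


subsection \<open>Cochain complexes and quasi-isomorphisms\<close>

definition cochain_complex ::
    "('k, 'r) ring_scheme \<Rightarrow> (int \<Rightarrow> ('k, 'v) module) \<Rightarrow> (int \<Rightarrow> 'v \<Rightarrow> 'v) \<Rightarrow> bool" where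
  "cochain_complex K C d \<longleftrightarrow>
     (\<forall>n. module K (C n) \<and> d n \<in> lin_maps K (C n) (C (n + 1)) \<and>
        (\<forall>x\<in>carrier (C n). d (n + 1) (d n x) = \<zero>\<^bsub>C (n + 2)\<^esub>))"

definition cochain_map ::
    "('k, 'r) ring_scheme \<Rightarrow> (int \<Rightarrow> ('k, 'v) module) \<Rightarrow> (int \<Rightarrow> 'v \<Rightarrow> 'v) \<Rightarrow>
     (int \<Rightarrow> ('k, 'w) module) \<Rightarrow> (int \<Rightarrow> 'w \<Rightarrow> 'w) \<Rightarrow> (int \<Rightarrow> 'v \<Rightarrow> 'w) \<Rightarrow> bool" where
  "cochain_map K C d C' d' f \<longleftrightarrow>
     (\<forall>n. f n \<in> lin_maps K (C n) (C' n) \<and>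
        (\<forall>x\<in>carrier (C n). f (n + 1) (d n x) = d' n (f n x)))"

definition cocycles :: "(int \<Rightarrow> ('k, 'v) module) \<Rightarrow> (int \<Rightarrow> 'v \<Rightarrow> 'v) \<Rightarrow> int \<Rightarrow> 'v set" where
  "cocycles C d n = {x \<in> carrier (C n). d n x = \<zero>\<^bsub>C (n + 1)\<^esub>}"

definition coboundaries :: "(int \<Rightarrow> ('k, 'v) module) \<Rightarrow> (int \<Rightarrow> 'v \<Rightarrow> 'v) \<Rightarrow> int \<Rightarrow> 'v set" where
  "coboundaries C d n = d (n - 1) ` carrier (C (n - 1))"

definition cohomology ::
    "(int \<Rightarrow> ('k, 'v) module) \<Rightarrow> (int \<Rightarrow> 'v \<Rightarrow> 'v) \<Rightarrow> int \<Rightarrow> ('k, 'v set) module" where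
  "cohomology C d n = quot_mod ((C n)\<lparr>carrier := cocycles C d n\<rparr>) (coboundaries C d n)"

definition cohomology_map ::
    "(int \<Rightarrow> ('k, 'w) module) \<Rightarrow> (int \<Rightarrow> 'w \<Rightarrow> 'w) \<Rightarrow> (int \<Rightarrow> 'v \<Rightarrow> 'w) \<Rightarrow> int \<Rightarrow> 'v set \<Rightarrow> 'w set" where
  "cohomology_map C' d' f n X = (\<Union>x\<in>X. coboundaries C' d' n +>\<^bsub>C' n\<^esub> f n x)"

definition quasi_isomorphism ::
    "('k, 'r) ring_scheme \<Rightarrow> (int \<Rightarrow> ('k, 'v) module) \<Rightarrow> (int \<Rightarrow> 'v \<Rightarrow> 'v) \<Rightarrow>
     (int \<Rightarrow> ('k, 'w) module) \<Rightarrow> (int \<Rightarrow> 'w \<Rightarrow> 'w) \<Rightarrow> (int \<Rightarrow> 'v \<Rightarrow> 'w) \<Rightarrow> bool" where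
  "quasi_isomorphism K C d C' d' f \<longleftrightarrow>
     cochain_complex K C d \<and> cochain_complex K C' d' \<and> cochain_map K C d C' d' f \<and>
     (\<forall>n. bij_betw (cohomology_map C' d' f n)
            (carrier (cohomology C d n)) (carrier (cohomology C' d' n)))"


section \<open>Finite dimensional and self-injective algebras\<close>

text \<open>HOL-Algebra's locale \<^locale>\<open>algebra\<close> is restricted to commutative algebras.\<close>

locale assoc_algebra = module + ring M +
  assumes smult_mult_left:
      "\<lbrakk>a \<in> carrier R; x \<in> carrier M; y \<in> carrier M\<rbrakk> \<Longrightarrow>
       (a \<odot>\<^bsub>M\<^esub> x) \<otimes>\<^bsub>M\<^esub> y = a \<odot>\<^bsub>M\<^esub> (x \<otimes>\<^bsub>M\<^esub> y)"
    and smult_mult_right: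
      "\<lbrakk>a \<in> carrier R; x \<in> carrier M; y \<in> carrier M\<rbrakk> \<Longrightarrow>
       x \<otimes>\<^bsub>M\<^esub> (a \<odot>\<^bsub>M\<^esub> y) = a \<odot>\<^bsub>M\<^esub> (x \<otimes>\<^bsub>M\<^esub> y)"

definition finite_dimensional :: "('k, 'r) ring_scheme \<Rightarrow> ('k, 'v) module \<Rightarrow> bool" where
  "finite_dimensional K V \<longleftrightarrow> (\<exists>S. finite S \<and> S \<subseteq> carrier V \<and> mod_span K V S = carrier V)"

text \<open>HOL-Algebra's locale \<^locale>\<open>module\<close> requires a commutative ring of scalars.\<close>

locale left_module = R?: ring R + M?: abelian_group M for R (structure) and M (structure) +
  assumes smult_closed:
      "\<lbrakk>a \<in> carrier R; x \<in> carrier M\<rbrakk> \<Longrightarrow> a \<odot>\<^bsub>M\<^esub> x \<in> carrier M"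
    and smult_l_distr:
      "\<lbrakk>a \<in> carrier R; b \<in> carrier R; x \<in> carrier M\<rbrakk> \<Longrightarrow>
       (a \<oplus> b) \<odot>\<^bsub>M\<^esub> x = a \<odot>\<^bsub>M\<^esub> x \<oplus>\<^bsub>M\<^esub> b \<odot>\<^bsub>M\<^esub> x"
    and smult_r_distr:
      "\<lbrakk>a \<in> carrier R; x \<in> carrier M; y \<in> carrier M\<rbrakk> \<Longrightarrow>
       a \<odot>\<^bsub>M\<^esub> (x \<oplus>\<^bsub>M\<^esub> y) = a \<odot>\<^bsub>M\<^esub> x \<oplus>\<^bsub>M\<^esub> a \<odot>\<^bsub>M\<^esub> y"
    and smult_assoc:
      "\<lbrakk>a \<in> carrier R; b \<in> carrier R; x \<in> carrier M\<rbrakk> \<Longrightarrow>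
       (a \<otimes> b) \<odot>\<^bsub>M\<^esub> x = a \<odot>\<^bsub>M\<^esub> (b \<odot>\<^bsub>M\<^esub> x)"
    and smult_one:
      "x \<in> carrier M \<Longrightarrow> \<one> \<odot>\<^bsub>M\<^esub> x = x"

definition regular_module :: "('a, 'r) ring_scheme \<Rightarrow> ('a, 'a) module" where
  "regular_module A = mk_module (carrier A) \<zero>\<^bsub>A\<^esub> (add A) (mult A)"

text \<open>
  Injectivity of \<open>Q\<close>: every linear map \<open>f : X \<rightarrow> Q\<close> extends along every injective linear map
  \<open>i : X \<rightarrow> Y\<close>. HOL cannot quantify over the types of the test modules \<open>X\<close> and \<open>Y\<close> inside a
  formula; here their elements are taken from the type of the elements of the ring. This is no
  restriction: it includes all inclusions of left ideals into the ring, to which the condition for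
  arbitrary \<open>X\<close> and \<open>Y\<close> reduces by Baer's criterion.
\<close>

definition injective_module :: "('a, 'r) ring_scheme \<Rightarrow> ('a, 'q) module \<Rightarrow> bool" where
  "injective_module R Q \<longleftrightarrow> left_module R Q \<and>
     (\<forall>(X :: ('a, 'a) module) (Y :: ('a, 'a) module) i f.
        left_module R X \<and> left_module R Y \<and>
        i \<in> lin_maps R X Y \<and> inj_on i (carrier X) \<and> f \<in> lin_maps R X Q \<longrightarrow>
        (\<exists>g \<in> lin_maps R Y Q. \<forall>x\<in>carrier X. g (i x) = f x))"

definition self_injective :: "('a, 'r) ring_scheme \<Rightarrow> bool" where
  "self_injective A \<longleftrightarrow> injective_module A (regular_module A)"


section \<open>The singular Hochschild cochain complex\<close>

type_synonym ('k, 'a) bar_tensor = "('a set list \<Rightarrow> 'k) set"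
type_synonym ('k, 'a) nc_form = "('a \<times> ('k, 'a) bar_tensor \<Rightarrow> 'k) set"
type_synonym ('k, 'a) nc_cochain = "('k, 'a) bar_tensor \<Rightarrow> ('k, 'a) nc_form"
type_synonym ('k, 'a) hoch_chain = "(('a \<times> 'a \<Rightarrow> 'k) set \<times> ('k, 'a) bar_tensor \<Rightarrow> 'k) set"

text \<open>The sign \<open>(-1)\<^sup>j\<close> acting on a module.\<close>

definition signed :: "('k, 'v) module \<Rightarrow> int \<Rightarrow> 'v \<Rightarrow> 'v" where
  "signed V j x = (if even j then x else \<ominus>\<^bsub>V\<^esub> x)"

context
  fixes K :: "'k ring" and A :: "('k, 'a) module"
begin

text \<open>
  The desuspension \<open>s\<close> only affects degrees and signs. The degrees are recorded by the indices of
  the modules below, the signs are those of the explicit formulas.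
\<close>

definition bar_rel :: "'a set" where
  "bar_rel = {c \<odot>\<^bsub>A\<^esub> \<one>\<^bsub>A\<^esub> | c. c \<in> carrier K}"

definition bar_mod :: "('k, 'a set) module" where
  "bar_mod = quot_mod A bar_rel"

abbreviation tup :: "nat \<Rightarrow> 'a list set" where
  "tup n \<equiv> tuples (carrier A) n"

definition bar_pow :: "nat \<Rightarrow> ('k, ('k, 'a) bar_tensor) module" where
  "bar_pow n = tpow_mod K bar_mod n"

text \<open>\<open>bar [a\<^sub>1, \<dots>, a\<^sub>n]\<close> is the tensor of the classes of the \<open>a\<^sub>i\<close>.\<close>

definition bar :: "'a list \<Rightarrow> ('k, 'a) bar_tensor" where
  "bar as = tpow_el K bar_mod (map (\<lambda>a. bar_rel +>\<^bsub>A\<^esub> a) as)"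

definition nc_forms :: "nat \<Rightarrow> ('k, ('k, 'a) nc_form) module" where
  "nc_forms p = tensor_mod K A (bar_pow p)"

text \<open>
  \<open>form [a\<^sub>0, a\<^sub>1, \<dots>, a\<^sub>p]\<close> is the tensor of \<open>a\<^sub>0\<close> with \<open>bar [a\<^sub>1, \<dots>, a\<^sub>p]\<close>; the argument must not be
  empty.
\<close>

definition form :: "'a list \<Rightarrow> ('k, 'a) nc_form" where
  "form as = tensor_el K A (bar_pow (length as - 1)) (hd as) (bar (tl as))"

text \<open>Multiplies the adjacent entries at the positions \<open>i\<close> and \<open>i + 1\<close>, counted from \<open>0\<close>.\<close>

definition merge_at :: "nat \<Rightarrow> 'a list \<Rightarrow> 'a list" where
  "merge_at i as = take i as @ (as ! i \<otimes>\<^bsub>A\<^esub> as ! (i + 1)) # drop (i + 2) as"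

definition form_left :: "nat \<Rightarrow> 'a \<Rightarrow> ('k, 'a) nc_form \<Rightarrow> ('k, 'a) nc_form" where
  "form_left p a = lin_ext K (nc_forms p) (nc_forms p) (tup (p + 1)) form
     (\<lambda>as. form ((a \<otimes>\<^bsub>A\<^esub> hd as) # tl as))"

definition form_right :: "nat \<Rightarrow> 'a \<Rightarrow> ('k, 'a) nc_form \<Rightarrow> ('k, 'a) nc_form" where
  "form_right p a = lin_ext K (nc_forms p) (nc_forms p) (tup (p + 1)) form
     (\<lambda>as. \<Oplus>\<^bsub>nc_forms p\<^esub>i\<in>{0..p}. signed (nc_forms p) (int p - int i) (form (merge_at i (as @ [a]))))"

text \<open>\<open>C\<^sup>m(A, \<Omega>\<^sup>p)\<close>, which is the zero module if \<open>m + p < 0\<close>.\<close>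

definition nc_cochains :: "int \<Rightarrow> nat \<Rightarrow> ('k, ('k, 'a) nc_cochain) module" where
  "nc_cochains m p =
     (let H = hom_mod K (bar_pow (nat (m + int p))) (nc_forms p) in
      if m + int p < 0 then H\<lparr>carrier := {\<zero>\<^bsub>H\<^esub>}\<rparr> else H)"

text \<open>
  The Hochschild differential. For \<open>as = [a\<^sub>1, \<dots>, a\<^sub>N\<^sub>+\<^sub>1]\<close> the entry \<open>a\<^sub>j\<close> is at position \<open>j - 1\<close>.
\<close>

definition hoch_diff :: "int \<Rightarrow> nat \<Rightarrow> ('k, 'a) nc_cochain \<Rightarrow> ('k, 'a) nc_cochain" where
  "hoch_diff m p f =
     (if m + int p < 0 then \<zero>\<^bsub>nc_cochains (m + 1) p\<^esub>
      else let N = nat (m + int p) in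
        lin_ext K (bar_pow (N + 1)) (nc_forms p) (tup (N + 1)) bar
          (\<lambda>as. signed (nc_forms p) (m + 1)
             (form_left p (hd as) (f (bar (tl as)))
              \<oplus>\<^bsub>nc_forms p\<^esub> (\<Oplus>\<^bsub>nc_forms p\<^esub>j\<in>{1..N}. signed (nc_forms p) (int j) (f (bar (merge_at (j - 1) as))))
              \<oplus>\<^bsub>nc_forms p\<^esub> signed (nc_forms p) (int N + 1) (form_right p (last as) (f (bar (butlast as)))))))"

definition form_append :: "nat \<Rightarrow> 'a \<Rightarrow> ('k, 'a) nc_form \<Rightarrow> ('k, 'a) nc_form" where
  "form_append p a = lin_ext K (nc_forms p) (nc_forms (p + 1)) (tup (p + 1)) form
     (\<lambda>as. form (as @ [a]))"

text \<open>\<open>\<theta>\<^sub>p : C\<^sup>m(A, \<Omega>\<^sup>p) \<rightarrow> C\<^sup>m(A, \<Omega>\<^sup>p\<^sup>+\<^sup>1)\<close>, tensoring with the identity on the right.\<close>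

definition theta :: "int \<Rightarrow> nat \<Rightarrow> ('k, 'a) nc_cochain \<Rightarrow> ('k, 'a) nc_cochain" where
  "theta m p f =
     (if m + int p < 0 then \<zero>\<^bsub>nc_cochains m (p + 1)\<^esub>
      else let N = nat (m + int p) in
        lin_ext K (bar_pow (N + 1)) (nc_forms (p + 1)) (tup (N + 1)) bar
          (\<lambda>as. form_append p (last as) (f (bar (butlast as)))))"

definition sg_cochains :: "int \<Rightarrow> ('k, (nat \<Rightarrow> ('k, 'a) nc_cochain) set) module" where
  "sg_cochains m = colim_mod K (nc_cochains m) (theta m)"

definition sg_in :: "int \<Rightarrow> nat \<Rightarrow> ('k, 'a) nc_cochain \<Rightarrow> (nat \<Rightarrow> ('k, 'a) nc_cochain) set" where
  "sg_in m p = colim_in K (nc_cochains m) (theta m) p"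

definition sg_diff ::
    "int \<Rightarrow> (nat \<Rightarrow> ('k, 'a) nc_cochain) set \<Rightarrow> (nat \<Rightarrow> ('k, 'a) nc_cochain) set" where
  "sg_diff m = lin_ext K (sg_cochains m) (sg_cochains (m + 1))
     (SIGMA p:UNIV. carrier (nc_cochains m p))
     (\<lambda>(p, f). sg_in m p f)
     (\<lambda>(p, f). sg_in (m + 1) p (hoch_diff m p f))"


section \<open>The generalized Tate-Hochschild complex\<close>

definition AA :: "('k, ('a \<times> 'a \<Rightarrow> 'k) set) module" where
  "AA = tensor_mod K A A"

abbreviation pairs :: "('a \<times> 'a) set" where
  "pairs \<equiv> carrier A \<times> carrier A"

abbreviation AA_el :: "'a \<times> 'a \<Rightarrow> ('a \<times> 'a \<Rightarrow> 'k) set" where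
  "AA_el \<equiv> \<lambda>(x, y). tensor_el K A A x y"

text \<open>\<open>A\<^sup>\<or>\<close>, realised as the subspace of \<open>A \<otimes> A\<close> on which outer left and right multiplication agree.\<close>

definition dual_mod :: "('k, ('a \<times> 'a \<Rightarrow> 'k) set) module" where
  "dual_mod = AA\<lparr>carrier := {z \<in> carrier AA. \<forall>a\<in>carrier A.
     lin_ext K AA AA pairs AA_el (\<lambda>(x, y). AA_el (a \<otimes>\<^bsub>A\<^esub> x, y)) z =
     lin_ext K AA AA pairs AA_el (\<lambda>(x, y). AA_el (x, y \<otimes>\<^bsub>A\<^esub> a)) z}\<rparr>"

text \<open>
  The bimodule structure \<open>a \<cdot> z \<cdot> b\<close> of \<open>A\<^sup>\<or>\<close>, given by inner multiplication.
\<close>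

definition dual_act :: "'a \<Rightarrow> ('a \<times> 'a \<Rightarrow> 'k) set \<Rightarrow> 'a \<Rightarrow> ('a \<times> 'a \<Rightarrow> 'k) set" where
  "dual_act a z b = lin_ext K AA AA pairs AA_el (\<lambda>(x, y). AA_el (x \<otimes>\<^bsub>A\<^esub> b, a \<otimes>\<^bsub>A\<^esub> y)) z"

definition hoch_chains :: "nat \<Rightarrow> ('k, ('k, 'a) hoch_chain) module" where
  "hoch_chains p = tensor_mod K dual_mod (bar_pow p)"

definition hoch_chain_el :: "('a \<times> 'a \<Rightarrow> 'k) set \<times> 'a list \<Rightarrow> ('k, 'a) hoch_chain" where
  "hoch_chain_el = (\<lambda>(z, as). tensor_el K dual_mod (bar_pow (length as)) z (bar as))"

text \<open>\<open>b\<^sub>p : C\<^sub>p(A, A\<^sup>\<or>) \<rightarrow> C\<^sub>p\<^sub>-\<^sub>1(A, A\<^sup>\<or>)\<close> for \<open>p \<ge> 1\<close>.\<close>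

definition hoch_b :: "nat \<Rightarrow> ('k, 'a) hoch_chain \<Rightarrow> ('k, 'a) hoch_chain" where
  "hoch_b p = lin_ext K (hoch_chains p) (hoch_chains (p - 1))
     (carrier dual_mod \<times> tup p) hoch_chain_el
     (\<lambda>(z, as).
        hoch_chain_el (dual_act \<one>\<^bsub>A\<^esub> z (hd as), tl as)
        \<oplus>\<^bsub>hoch_chains (p - 1)\<^esub> (\<Oplus>\<^bsub>hoch_chains (p - 1)\<^esub>j\<in>{1..p - 1}.
            signed (hoch_chains (p - 1)) (int j) (hoch_chain_el (z, merge_at (j - 1) as)))
        \<oplus>\<^bsub>hoch_chains (p - 1)\<^esub> signed (hoch_chains (p - 1)) (int p)
            (hoch_chain_el (dual_act (last as) z \<one>\<^bsub>A\<^esub>, butlast as)))"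

text \<open>
  Identifies \<open>\<Omega>\<^sup>p\<close> with \<open>Hom(k, \<Omega>\<^sup>p) = C\<^sup>-\<^sup>p(A, \<Omega>\<^sup>p)\<close>, where \<open>k\<close> is the zeroth tensor power.
\<close>

definition const_cochain :: "nat \<Rightarrow> ('k, 'a) nc_form \<Rightarrow> ('k, 'a) nc_cochain" where
  "const_cochain p w = lin_ext K (bar_pow 0) (nc_forms p) {[]} bar (\<lambda>_. w)"

text \<open>\<open>\<mu> : A\<^sup>\<or> = C\<^sub>0(A, A\<^sup>\<or>) \<rightarrow> C\<^sup>0(A, A) = A\<close>.\<close>

definition mu :: "('k, 'a) hoch_chain \<Rightarrow> ('k, 'a) nc_cochain" where
  "mu = lin_ext K (hoch_chains 0) (nc_cochains 0 0) (carrier dual_mod \<times> tup 0) hoch_chain_el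
     (\<lambda>(z, as). const_cochain 0 (form [lin_ext K AA A pairs AA_el (\<lambda>(x, y). x \<otimes>\<^bsub>A\<^esub> y) z]))"

text \<open>
  The terms in degrees \<open>i \<ge> 0\<close> and \<open>-p - 1 < 0\<close> have elements of different types, so the terms of
  the complex are transported into a sum type.
\<close>

definition tate_index :: "int \<Rightarrow> nat" where
  "tate_index n = nat (- n - 1)"

definition tate_mod :: "int \<Rightarrow> ('k, ('k, 'a) nc_cochain + ('k, 'a) hoch_chain) module" where
  "tate_mod n =
     (if 0 \<le> n then
        (let M = nc_cochains n 0 in
         mk_module (Inl ` carrier M) (Inl \<zero>\<^bsub>M\<^esub>)
           (\<lambda>x y. Inl (projl x \<oplus>\<^bsub>M\<^esub> projl y)) (\<lambda>c x. Inl (c \<odot>\<^bsub>M\<^esub> projl x)))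
      else
        (let M = hoch_chains (tate_index n) in
         mk_module (Inr ` carrier M) (Inr \<zero>\<^bsub>M\<^esub>)
           (\<lambda>x y. Inr (projr x \<oplus>\<^bsub>M\<^esub> projr y)) (\<lambda>c x. Inr (c \<odot>\<^bsub>M\<^esub> projr x))))"

definition tate_diff ::
    "int \<Rightarrow> ('k, 'a) nc_cochain + ('k, 'a) hoch_chain \<Rightarrow> ('k, 'a) nc_cochain + ('k, 'a) hoch_chain" where
  "tate_diff n = (\<lambda>x\<in>carrier (tate_mod n).
     if 0 \<le> n then Inl (hoch_diff n 0 (projl x))
     else if n = - 1 then Inl (mu (projr x))
     else Inr (hoch_b (tate_index n) (projr x)))"

text \<open>\<open>form_insert as\<close> sends the tensor of \<open>x\<close> and \<open>y\<close> to \<open>form (x # as @ [y])\<close>.\<close>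

definition form_insert :: "'a list \<Rightarrow> ('a \<times> 'a \<Rightarrow> 'k) set \<Rightarrow> ('k, 'a) nc_form" where
  "form_insert as = lin_ext K AA (nc_forms (length as + 1)) pairs AA_el (\<lambda>(x, y). form (x # as @ [y]))"

definition iota ::
    "int \<Rightarrow> ('k, 'a) nc_cochain + ('k, 'a) hoch_chain \<Rightarrow> (nat \<Rightarrow> ('k, 'a) nc_cochain) set" where
  "iota n = (\<lambda>x\<in>carrier (tate_mod n).
     if 0 \<le> n then sg_in n 0 (projl x)
     else let p = tate_index n in
       sg_in n (p + 1)
         (lin_ext K (hoch_chains p) (nc_cochains n (p + 1)) (carrier dual_mod \<times> tup p) hoch_chain_el
            (\<lambda>(z, as). const_cochain (p + 1) (form_insert as z)) (projr x)))"

end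

end

theory Submission
  imports Defs
begin

text \<open>
  A form in \<open>\<Omega>\<^sup>p\<^sup>+\<^sup>1\<close> can be split off its last tensor factor: there is an exact sequence of bimodules
  \<open>0 \<rightarrow> \<Omega>\<^sup>p\<^sup>+\<^sup>1 \<rightarrow> F\<^sub>p \<rightarrow> \<Omega>\<^sup>p \<rightarrow> 0\<close> with \<open>F\<^sub>p = A \<otimes> (sA/k)\<^sup>\<otimes>\<^sup>p \<otimes> A\<close>, which splits as a sequence of left modules, and the
  connecting map of its Hochschild cohomology is induced by \<open>\<theta>\<close>. For self-injective \<open>A\<close> the free left module \<open>A\<close>
  is a retract of \<open>Hom(A, A)\<close> (Baer's criterion), and this retraction yields a contracting homotopy
  of the Hochschild complex of \<open>F\<^sub>p\<close> in positive degrees. Hence \<open>\<theta>\<close> is bijective on cohomology as long as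
  the cochains have at least one argument, and surjective from cochains without arguments. In this last step the central
  elements of \<open>F\<^sub>p\<close> enter; since \<open>A\<close> is finite dimensional they are \<open>A\<^sup>\<or> \<otimes> (sA/k)\<^sup>\<otimes>\<^sup>p\<close>, that is, pairs of a
  form in \<open>\<Omega>\<^sup>p\<^sup>+\<^sup>1\<close> and one in \<open>\<Omega>\<^sup>p\<close>. In terms of such pairs \<open>\<iota>\<close> is the first component, and the Hochschild differential
  moves the second component, up to sign, into the first and replaces it by zero. The chains of negative degree
  therefore account exactly for what the colimit adds and kills below degree one.
\<close>

text \<open>As a left module \<open>F_p\<close> is \<open>A\<close> tensor a vector space. Tensored
  with that space, the retraction of \<open>A \<rightarrow> Hom(A, A)\<close> makes
  \<open>F_p\<close> a bimodule retract of a coinduced bimodule, and a cocycle with coinduced values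
  bounds by evaluation of its first argument. That argument has to exist: the only obstruction sits,
  for each \<open>p\<close>, where cochains have no arguments, and it is the centre of
  \<open>F_p\<close>. No long exact sequence is set up. The section of
  \<open>F_p \<rightarrow> \<Omega>\<^sup>p\<close> and the projection
  \<open>F_p \<rightarrow> \<Omega>\<^sup>p\<^sup>+\<^sup>1\<close> are left linear, and their
  failure to be right linear is given by \<open>\<theta>\<close>, so the chase along the connecting
  map consists of explicit formulas. Finite dimension enters three times: Baer extension adjoins
  finitely many generators, the retraction is written in a finite dual basis, and coordinates on the
  bar powers identify the centre of \<open>F_p\<close>. Alternating sums are treated by peeling off
  one argument \<open>a\<close> at a time, which turns the Hochschild differential into a commutator
  with \<open>a\<close>.\<close>

lemmas (in abelian_group) abelian_group_simprules
  [algebra abelian_group "zero G" "add G" "a_inv G" "a_minus G"] =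
  a_closed zero_closed a_inv_closed minus_closed a_assoc l_zero l_neg a_comm minus_eq
  r_zero r_neg r_neg2 r_neg1 minus_add minus_minus a_lcomm

abbreviation in_carrier :: "'v => ('v, 'm) partial_object_scheme => bool" (infix "IN" 50) where
  "x IN V \<equiv> x \<in> carrier V"

lemma (in abelian_group) minus_zero': "\<ominus> \<zero> = \<zero>"
  by (metis l_zero r_neg zero_closed a_inv_closed)

section \<open>Linear maps and spanning sets\<close>

text \<open>\<open>lin_maps\<close> consists of extensional functions, which lambda terms and
  composites usually are not. \<open>linear\<close> drops extensionality, so that maps can be
  composed and added freely; \<open>restrict\<close> turns the result into an element of
  \<open>lin_maps\<close>.\<close>

definition linear ::
    "('k, 'r) ring_scheme => ('k, 'v) module => ('k, 'w) module => ('v => 'w) => bool" where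
  "linear K V W f \<longleftrightarrow> f \<in> carrier V \<rightarrow> carrier W \<and>
     (\<forall>x\<in>carrier V. \<forall>y\<in>carrier V. f (x \<oplus>\<^bsub>V\<^esub> y) = f x \<oplus>\<^bsub>W\<^esub> f y) \<and>
     (\<forall>c\<in>carrier K. \<forall>x\<in>carrier V. f (c \<odot>\<^bsub>V\<^esub> x) = c \<odot>\<^bsub>W\<^esub> f x)"

lemma linearI:
  assumes "!!x. x IN V ==> f x IN W"
    and "!!x y. x IN V ==> y IN V ==> f (x \<oplus>\<^bsub>V\<^esub> y) = f x \<oplus>\<^bsub>W\<^esub> f y"
    and "!!c x. c IN K ==> x IN V ==> f (c \<odot>\<^bsub>V\<^esub> x) = c \<odot>\<^bsub>W\<^esub> f x"
  shows "linear K V W f"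
  using assms by (simp add: linear_def)

lemma linear_closed: "linear K V W f ==> x IN V ==> f x IN W"
  by (auto simp: linear_def)

lemma linear_add:
  "linear K V W f ==> x IN V ==> y IN V ==> f (x \<oplus>\<^bsub>V\<^esub> y) = f x \<oplus>\<^bsub>W\<^esub> f y"
  by (auto simp: linear_def)

lemma linear_smult:
  "linear K V W f ==> c IN K ==> x IN V ==> f (c \<odot>\<^bsub>V\<^esub> x) = c \<odot>\<^bsub>W\<^esub> f x"
  by (auto simp: linear_def)

lemma module_zero: "module K V ==> \<zero>\<^bsub>V\<^esub> IN V"
  using abelian_group.axioms(1) abelian_monoid.zero_closed module.axioms(2) by blast

lemma linear_zero:
  fixes V (structure)
  assumes f: "linear K V W f" and "module K V" "module K W"
  shows "f \<zero> = \<zero>\<^bsub>W\<^esub>"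
proof -
  interpret V: module K V by fact
  interpret W: module K W by fact
  have "f \<zero> \<oplus>\<^bsub>W\<^esub> f \<zero> = f \<zero>"
    using linear_add[OF f V.M.zero_closed V.M.zero_closed] by simp
  then show ?thesis
    using linear_closed[OF f V.M.zero_closed] W.M.add.l_cancel_one by auto
qed

lemma linear_uminus:
  fixes V (structure)
  assumes f: "linear K V W f" and "module K V" "module K W" and x: "x IN V"
  shows "f (\<ominus> x) = \<ominus>\<^bsub>W\<^esub> f x"
proof -
  interpret V: module K V by fact
  interpret W: module K W by fact
  have "f x \<oplus>\<^bsub>W\<^esub> f (\<ominus> x) = \<zero>\<^bsub>W\<^esub>"
    using linear_add[OF f x, of "\<ominus> x"] x linear_zero[OF f assms(2,3)] by (simp add: V.M.r_neg)
  then show ?thesis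
    using linear_closed[OF f] x by (metis V.M.a_inv_closed W.M.minus_equality W.M.a_comm)
qed

lemma linear_minus:
  assumes f: "linear K V W f" and "module K V" "module K W" and "x IN V" "y IN V"
  shows "f (x \<ominus>\<^bsub>V\<^esub> y) = f x \<ominus>\<^bsub>W\<^esub> f y"
proof -
  interpret V: module K V by fact
  interpret W: module K W by fact
  show ?thesis
    using assms linear_add[OF f, of x "\<ominus>\<^bsub>V\<^esub> y"] linear_uminus[OF f assms(2,3)]
    by (simp add: a_minus_def)
qed

lemma linear_signed:
  assumes f: "linear K V W f" and "module K V" "module K W" and "x IN V"
  shows "f (signed V j x) = signed W j (f x)"
  using assms by (simp add: signed_def linear_uminus)

lemma linear_finsum:
  fixes V (structure)
  assumes f: "linear K V W f" and V: "module K V" and W: "module K W"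
    and g: "g \<in> I \<rightarrow> carrier V"
  shows "f (\<Oplus>i\<in>I. g i) = (\<Oplus>\<^bsub>W\<^esub>i\<in>I. f (g i))"
proof -
  interpret V: module K V by fact
  interpret W: module K W by fact
  show ?thesis
  proof (cases "finite I")
    case True
    then show ?thesis using g
    proof induct
      case empty
      then show ?case using linear_zero[OF f V W] by simp
    next
      case (insert i I)
      have "f (\<Oplus>i\<in>insert i I. g i) = f (g i \<oplus> (\<Oplus>i\<in>I. g i))"
        using insert by (subst V.M.finsum_insert) auto
      also have "... = f (g i) \<oplus>\<^bsub>W\<^esub> (\<Oplus>\<^bsub>W\<^esub>i\<in>I. f (g i))"
        using insert linear_add[OF f, of "g i" "\<Oplus>i\<in>I. g i"] by auto
      also have "... = (\<Oplus>\<^bsub>W\<^esub>i\<in>insert i I. f (g i))"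
        using insert linear_closed[OF f] by (subst W.M.finsum_insert) auto
      finally show ?case .
    qed
  next
    \<comment> \<open>\<open>finsum\<close> over an infinite index set is zero by convention, and
      \<open>f\<close> preserves zero.\<close>
    case False
    then show ?thesis
      using linear_zero[OF f V W] by (simp add: V.M.finsum_infinite W.M.finsum_infinite)
  qed
qed

lemma linear_comp:
  "linear K U V f ==> linear K V W g ==> linear K U W (%x. g (f x))"
  by (auto simp: linear_def Pi_def)

lemma linear_id: "linear K V V (%x. x)"
  by (auto simp: linear_def)

lemma linear_cong:
  assumes f: "linear K V W f" and V: "module K V" and "!!x. x IN V ==> f x = g x"
  shows "linear K V W g"
proof -
  interpret V: module K V by fact
  show ?thesis using f assms(3) by (auto simp: linear_def Pi_def)
qed

lemma linear_restrict:
  "module K V ==> linear K V W f ==> linear K V W (restrict f (carrier V))"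
  by (rule linear_cong) auto

lemma linear_plus:
  assumes f: "linear K V W f" and g: "linear K V W g" and W: "module K W"
  shows "linear K V W (%x. f x \<oplus>\<^bsub>W\<^esub> g x)"
proof -
  interpret W: module K W by fact
  note fg = linear_closed[OF f] linear_closed[OF g]
  show ?thesis
    by (rule linearI)
      (auto simp: fg linear_add[OF f] linear_add[OF g] linear_smult[OF f] linear_smult[OF g]
        W.M.a_ac W.smult_r_distr)
qed

lemma linear_scale:
  fixes W (structure)
  assumes f: "linear K V W f" and W: "module K W" and c: "c IN K"
  shows "linear K V W (%x. c \<odot> f x)"
proof -
  interpret W: module K W by fact
  note fg = linear_closed[OF f]
  show ?thesis
  proof (rule linearI)
    fix d x assume "d IN K" "x IN V"
    then show "c \<odot> f (d \<odot>\<^bsub>V\<^esub> x) = d \<odot> (c \<odot> f x)"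
      using c by (simp add: linear_smult[OF f] fg W.smult_assoc1[symmetric] W.R.m_comm)
  qed (auto simp: c fg linear_add[OF f] W.smult_r_distr)
qed

lemma linear_neg:
  assumes f: "linear K V W f" and W: "module K W"
  shows "linear K V W (%x. \<ominus>\<^bsub>W\<^esub> f x)"
proof -
  interpret W: module K W by fact
  note fg = linear_closed[OF f]
  show ?thesis
    by (rule linearI)
      (auto simp: fg linear_add[OF f] linear_smult[OF f] W.M.minus_add W.M.a_comm W.smult_r_minus)
qed

lemma linear_diff:
  assumes f: "linear K V W f" and g: "linear K V W g" and W: "module K W"
  shows "linear K V W (%x. f x \<ominus>\<^bsub>W\<^esub> g x)"
  unfolding a_minus_def by (intro linear_plus linear_neg assms)

lemma linear_const_zero:
  assumes W: "module K W"
  shows "linear K V W (%x. \<zero>\<^bsub>W\<^esub>)"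
proof -
  interpret W: module K W by fact
  show ?thesis by (rule linearI) auto
qed

lemma linear_sum:
  fixes W (structure)
  assumes f: "!!i. i \<in> I ==> linear K V W (f i)" and V: "module K V" and W: "module K W"
  shows "linear K V W (%x. \<Oplus>i\<in>I. f i x)"
proof -
  interpret W: module K W by fact
  show ?thesis
  proof (cases "finite I")
    case True
    then show ?thesis using f
    proof induct
      case empty
      show ?case by (simp add: linear_const_zero[OF W])
    next
      case (insert i I)
      have *: "linear K V W (%x. f i x \<oplus> (\<Oplus>i\<in>I. f i x))"
        using insert by (intro linear_plus[OF _ _ W]) auto
      show ?case
      proof (rule linear_cong[OF * V])
        fix x assume "x IN V"
        then show "f i x \<oplus> (\<Oplus>i\<in>I. f i x) = (\<Oplus>i\<in>insert i I. f i x)"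
          using insert linear_closed by (subst W.M.finsum_insert) fastforce+
      qed
    qed
  next
    case False
    then show ?thesis by (simp add: W.M.finsum_infinite linear_const_zero[OF W])
  qed
qed

lemma lin_maps_iff:
  "f \<in> lin_maps K V W \<longleftrightarrow> linear K V W f \<and> f \<in> extensional (carrier V)"
  by (auto simp: lin_maps_def linear_def PiE_def)

lemma lin_maps_linear: "f \<in> lin_maps K V W ==> linear K V W f"
  by (simp add: lin_maps_iff)

lemma restrict_lin_maps:
  "module K V ==> linear K V W f ==> restrict f (carrier V) \<in> lin_maps K V W"
  by (simp add: lin_maps_iff linear_restrict)

section \<open>Submodules, spanning sets and linear extension\<close>

lemma submoduleI':
  fixes V (structure)
  assumes V: "module K V" and "H \<subseteq> carrier V" "\<zero> \<in> H"
    and "!!x y. x \<in> H ==> y \<in> H ==> x \<oplus> y \<in> H"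
    and sm: "!!c x. c IN K ==> x \<in> H ==> c \<odot> x \<in> H"
  shows "submodule H K V"
proof -
  interpret V: module K V by fact
  show ?thesis
  proof (rule V.submoduleI)
    fix x assume x: "x \<in> H"
    then have "\<ominus> x = (\<ominus>\<^bsub>K\<^esub> \<one>\<^bsub>K\<^esub>) \<odot> x"
      using assms(2) by (subst V.smult_l_minus) auto
    then show "\<ominus> x \<in> H" using sm x by simp
  qed fact+
qed

lemma mod_span_submodule:
  assumes V: "module K V" and S: "S \<subseteq> carrier V"
  shows "submodule (mod_span K V S) K V"
proof -
  interpret V: module K V by fact
  have c: "submodule (carrier V) K V" by (rule V.carrier_is_submodule)
  show ?thesis
    unfolding mod_span_def
  proof (rule submoduleI'[OF V])
    show "\<Inter> {H. submodule H K V \<and> S \<subseteq> H} \<subseteq> carrier V" using c S by blast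
  qed (use V.submoduleE(4,5) in "auto dest: subgroup.one_closed[OF submodule.axioms(1)]")
qed

lemma mod_span_subset: "S \<subseteq> mod_span K V S"
  by (auto simp: mod_span_def)

lemma mod_span_least: "submodule H K V ==> S \<subseteq> H ==> mod_span K V S \<subseteq> H"
  by (auto simp: mod_span_def)

definition spans :: "('k, 'r) ring_scheme => ('k, 'v) module => 'v set => bool" where
  "spans K V S \<longleftrightarrow> S \<subseteq> carrier V \<and> mod_span K V S = carrier V"

text \<open>The elements with property \<open>P\<close> form a submodule that contains
  \<open>S\<close>, hence everything. Closure properties and linear identities are reduced to
  generators by this rule.\<close>

lemma spans_induct [consumes 3, case_names zero gen add smult]:
  fixes V (structure)
  assumes S: "spans K V S" and V: "module K V" and x: "x IN V"
    and "P \<zero>" "!!s. s \<in> S ==> P s"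
    and "!!x y. x IN V ==> y IN V ==> P x ==> P y ==> P (x \<oplus> y)"
    and "!!c x. c IN K ==> x IN V ==> P x ==> P (c \<odot> x)"
  shows "P x"
proof -
  interpret V: module K V by fact
  have "submodule {x \<in> carrier V. P x} K V"
    using assms by (intro submoduleI'[OF V]) auto
  then have "mod_span K V S \<subseteq> {x \<in> carrier V. P x}"
    using S assms(5) by (intro mod_span_least) (auto simp: spans_def)
  then show ?thesis using x S by (auto simp: spans_def)
qed

lemma spansI:
  assumes V: "module K V" and "S \<subseteq> carrier V"
    and "!!H x. submodule H K V ==> S \<subseteq> H ==> x IN V ==> x \<in> H"
  shows "spans K V S"
proof -
  interpret V: module K V by fact
  show ?thesis
    using assms V.submoduleE(1)[OF mod_span_submodule[OF V assms(2)]]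
    by (auto simp: spans_def mod_span_def)
qed

lemma linear_eq_spans:
  assumes S: "spans K V S" and V: "module K V" and W: "module K W"
    and f: "linear K V W f" and g: "linear K V W g"
    and eq: "!!s. s \<in> S ==> f s = g s" and x: "x IN V"
  shows "f x = g x"
  using S V x
  by (induct rule: spans_induct)
    (auto simp: linear_zero[OF f V W] linear_zero[OF g V W] eq
      linear_add[OF f] linear_add[OF g] linear_smult[OF f] linear_smult[OF g])

text \<open>The definite description picks \<open>restrict h\<close>: extensionality fixes a map
  outside the carrier, the spanning set fixes it inside. Every map defined by \<open>lin_ext\<close>
  is evaluated through this statement or the next one, after a linear \<open>h\<close> with the
  prescribed values has been exhibited.\<close>

lemma lin_ext_eq_restrict:
  assumes V: "module K V" and W: "module K W" and S: "spans K V (e ` I)"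
    and h: "linear K V W h" and hw: "!!i. i \<in> I ==> h (e i) = w i"
  shows "lin_ext K V W I e w = restrict h (carrier V)"
  unfolding lin_ext_def
proof (rule the_equality)
  have sub: "e ` I \<subseteq> carrier V" using S by (simp add: spans_def)
  then show "restrict h (carrier V) \<in> lin_maps K V W \<and> (\<forall>i\<in>I. restrict h (carrier V) (e i) = w i)"
    using restrict_lin_maps[OF V h] hw by auto
  fix g assume g: "g \<in> lin_maps K V W \<and> (\<forall>i\<in>I. g (e i) = w i)"
  have "g x = h x" if "x IN V" for x
    by (rule linear_eq_spans[OF S V W _ h _ that]) (use g hw in "auto simp: lin_maps_iff")
  then show "g = restrict h (carrier V)"
    using g by (auto simp: lin_maps_iff extensional_def)
qed

lemma lin_ext:
  assumes V: "module K V" and W: "module K W" and S: "spans K V (e ` I)"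
    and "\<exists>h. linear K V W h \<and> (\<forall>i\<in>I. h (e i) = w i)"
  shows "lin_ext K V W I e w \<in> lin_maps K V W"
    and "linear K V W (lin_ext K V W I e w)"
    and "!!i. i \<in> I ==> lin_ext K V W I e w (e i) = w i"
proof -
  obtain h where h: "linear K V W h" "!!i. i \<in> I ==> h (e i) = w i" using assms by blast
  have eq: "lin_ext K V W I e w = restrict h (carrier V)"
    by (rule lin_ext_eq_restrict[OF V W S h])
  show "lin_ext K V W I e w \<in> lin_maps K V W"
    unfolding eq by (rule restrict_lin_maps[OF V h(1)])
  then show "linear K V W (lin_ext K V W I e w)" by (rule lin_maps_linear)
  show "lin_ext K V W I e w (e i) = w i" if "i \<in> I" for i
    using that S h(2) unfolding eq by (auto simp: spans_def)
qed

section \<open>Constructions of modules\<close>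

lemma mk_module_simps [simp]:
  "carrier (mk_module C z a s) = C" "zero (mk_module C z a s) = z"
  "add (mk_module C z a s) = a" "smult (mk_module C z a s) = s"
  by (simp_all add: mk_module_def)

text \<open>The module axioms pass along a surjection \<open>q\<close> that respects the operations.
  This serves for cosets, and again for \<open>Inl\<close> and \<open>Inr\<close> in the sum type of
  the Tate complex.\<close>

lemma module_image:
  fixes W (structure)
  assumes V: "module K V" and C: "carrier W = q ` carrier V" and z: "\<zero> = q \<zero>\<^bsub>V\<^esub>"
    and a: "!!x y. x IN V ==> y IN V ==> q x \<oplus> q y = q (x \<oplus>\<^bsub>V\<^esub> y)"
    and s: "!!c x. c IN K ==> x IN V ==> c \<odot> q x = q (c \<odot>\<^bsub>V\<^esub> x)"
  shows "module K W" "linear K V W q"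
proof -
  interpret V: module K V by fact
  have "abelian_group W"
  proof (rule abelian_groupI)
    fix x assume "x IN W"
    then obtain x' where "x = q x'" "x' IN V" using C by auto
    then show "\<exists>y\<in>carrier W. y \<oplus> x = \<zero>"
      using C z a by (intro bexI[of _ "q (\<ominus>\<^bsub>V\<^esub> x')"]) (auto simp: V.M.l_neg)
  qed (auto simp: C z a V.M.a_ac)
  then show "module K W"
    by (intro moduleI) (auto simp: C a s V.smult_l_distr V.smult_r_distr V.smult_assoc1 V.R.cring_axioms)
  show "linear K V W q"
    by (rule linearI) (auto simp: C a s)
qed

lemma quot_mod:
  fixes V (structure)
  assumes V: "module K V" and S: "submodule S K V"
  shows "module K (quot_mod V S)" "linear K V (quot_mod V S) (%x. S +> x)"
    and "carrier (quot_mod V S) = (%x. S +> x) ` carrier V"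
    and "!!x y. x IN V ==> y IN V ==> S +> x = S +> y \<longleftrightarrow> x \<ominus> y \<in> S"
    and "!!x. x IN V ==> S +> x = \<zero>\<^bsub>quot_mod V S\<^esub> \<longleftrightarrow> x \<in> S"
proof -
  interpret V: module K V by fact
  have sg: "subgroup S (add_monoid V)" by (rule submodule.axioms(1)[OF S])
  interpret S: abelian_subgroup S V
    by (intro abelian_subgroupI3 additive_subgroupI sg V.abelian_group_axioms)
  have sub: "S \<subseteq> carrier V" by (rule S.a_subset)
  show C: "carrier (quot_mod V S) = (%x. S +> x) ` carrier V"
    by (auto simp: quot_mod_def A_RCOSETS_def')
  have eq: "S +> x = S +> y \<longleftrightarrow> x \<ominus> y \<in> S" if x: "x IN V" and y: "y IN V" for x y
  proof
    assume "S +> x = S +> y"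
    then have "x \<in> S +> y" using S.a_rcos_self[OF x] by simp
    then obtain h where "h \<in> S" "x = h \<oplus> y" by (auto simp: a_r_coset_def')
    then show "x \<ominus> y \<in> S" using y sub by (simp add: a_minus_def V.M.a_assoc V.M.r_neg subsetD)
  next
    assume "x \<ominus> y \<in> S"
    moreover have "x = (x \<ominus> y) \<oplus> y"
      using x y by (simp add: a_minus_def V.M.a_assoc V.M.l_neg)
    ultimately have "x \<in> S +> y" by (auto simp: a_r_coset_def')
    then show "S +> x = S +> y" using V.M.a_repr_independence[OF _ y sg] by auto
  qed
  show "!!x y. x IN V ==> y IN V ==> S +> x = S +> y \<longleftrightarrow> x \<ominus> y \<in> S"
    by (rule eq)
  have z: "\<zero>\<^bsub>quot_mod V S\<^esub> = S +> \<zero>" using sub by (simp add: quot_mod_def)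
  show "S +> x = \<zero>\<^bsub>quot_mod V S\<^esub> \<longleftrightarrow> x \<in> S" if "x IN V" for x
    using that eq[of x "\<zero>"] z by (simp add: a_minus_def V.M.minus_zero')
  have s: "c \<odot>\<^bsub>quot_mod V S\<^esub> (S +> x) = S +> (c \<odot> x)"
    if c: "c IN K" and x: "x IN V" for c x
  proof -
    \<comment> \<open>Scalar multiplication of cosets is defined as a union over representatives;
      all members of that union coincide.\<close>
    have "S +> (c \<odot> y) = S +> (c \<odot> x)" if "y \<in> S +> x" for y
    proof -
      obtain h where h: "h \<in> S" "y = h \<oplus> x" using \<open>y \<in> _\<close> by (auto simp: a_r_coset_def')
      then have "y IN V" using x sub by auto
      have hc: "h IN V" using h sub by auto
      have "c \<odot> y \<ominus> c \<odot> x = c \<odot> h"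
        using h hc x c by (simp add: V.smult_r_distr a_minus_def V.M.a_assoc V.M.r_neg)
      then show ?thesis
        using eq \<open>y IN V\<close> x c h submodule.smult_closed[OF S] by simp
    qed
    then have "(\<Union>y\<in>S +> x. S +> (c \<odot> y)) = (\<Union>y\<in>S +> x. S +> (c \<odot> x))"
      by (intro SUP_cong) auto
    also have "... = S +> (c \<odot> x)"
      using S.a_rcos_self[OF x] by (intro SUP_const) blast
    finally show ?thesis by (simp add: quot_mod_def)
  qed
  show "module K (quot_mod V S)" "linear K V (quot_mod V S) (%x. S +> x)"
    by (rule module_image[OF V C z]; (rule s)?; simp add: quot_mod_def S.a_rcos_sum)+
qed

lemma quot_mod_lift:
  fixes V (structure)
  assumes V: "module K V" and S: "submodule S K V" and W: "module K W"
    and g: "linear K V W g" and gS: "!!x. x \<in> S ==> g x = \<zero>\<^bsub>W\<^esub>"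
  shows "\<exists>h. linear K (quot_mod V S) W h \<and> (\<forall>x\<in>carrier V. h (S +> x) = g x)"
proof -
  interpret V: module K V by fact
  interpret W: module K W by fact
  note q = quot_mod[OF V S]
  \<comment> \<open>The value is read off at an arbitrary representative. It does not depend on the
    choice because \<open>g\<close> vanishes on \<open>S\<close>.\<close>
  define h where "h X = g (SOME x. x IN V \<and> X = S +> x)" for X
  have h: "h (S +> x) = g x" if x: "x IN V" for x
  proof -
    define y where "y = (SOME y. y IN V \<and> S +> x = S +> y)"
    have y: "y IN V \<and> S +> x = S +> y"
      unfolding y_def by (rule someI[of _ x]) (simp add: x)
    then have "g (x \<ominus> y) = \<zero>\<^bsub>W\<^esub>" using x q(4) gS by auto
    then have "g x \<ominus>\<^bsub>W\<^esub> g y = \<zero>\<^bsub>W\<^esub>" using x y linear_minus[OF g V W] by auto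
    then have "g x = g y" using W.M.add.inv_solve_right[of "\<zero>\<^bsub>W\<^esub>" "g x" "g y"] x y linear_closed[OF g]
      by (auto simp: a_minus_def)
    then show ?thesis by (simp add: h_def y_def)
  qed
  have "linear K (quot_mod V S) W h"
  proof (rule linearI)
    fix X assume "X IN quot_mod V S"
    then show "h X IN W" using q(3) h linear_closed[OF g] by auto
  next
    fix X Y assume "X IN quot_mod V S" "Y IN quot_mod V S"
    then obtain x y where xy: "x IN V" "y IN V" "X = S +> x" "Y = S +> y"
      using q(3) by auto
    then show "h (X \<oplus>\<^bsub>quot_mod V S\<^esub> Y) = h X \<oplus>\<^bsub>W\<^esub> h Y"
      using linear_add[OF q(2), of x y] h linear_add[OF g] by (metis V.M.a_closed)
  next
    fix c X assume c: "c IN K" and "X IN quot_mod V S"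
    then obtain x where xy: "x IN V" "X = S +> x"
      using q(3) by auto
    then show "h (c \<odot>\<^bsub>quot_mod V S\<^esub> X) = c \<odot>\<^bsub>W\<^esub> h X"
      using c linear_smult[OF q(2), of c x] h linear_smult[OF g] by (metis V.smult_closed)
  qed
  then show ?thesis using h by blast
qed

lemma spans_quot:
  fixes V (structure)
  assumes V: "module K V" and S: "submodule S K V" and B: "spans K V B"
  shows "spans K (quot_mod V S) ((%x. S +> x) ` B)"
proof -
  note q = quot_mod[OF V S]
  interpret Q: module K "quot_mod V S" by (rule q(1))
  show ?thesis
  proof (rule spansI[OF q(1)])
    show "(%x. S +> x) ` B \<subseteq> carrier (quot_mod V S)" using B q(3) by (auto simp: spans_def)
    fix H X assume H: "submodule H K (quot_mod V S)" and sub: "(%x. S +> x) ` B \<subseteq> H"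
      and "X IN quot_mod V S"
    then obtain x where x: "x IN V" "X = S +> x" using q(3) by auto
    have "S +> x \<in> H" using B V x(1)
    proof (induct rule: spans_induct)
      case zero
      show ?case using subgroup.one_closed[OF submodule.axioms(1)[OF H]] linear_zero[OF q(2) V q(1)] by simp
    next
      case (gen s) then show ?case using sub by auto
    next
      case (add x y) then show ?case
        using linear_add[OF q(2)] Q.submoduleE(5)[OF H] by metis
    next
      case (smult c x) then show ?case
        using linear_smult[OF q(2)] Q.submoduleE(4)[OF H] by metis
    qed
    then show "X \<in> H" using x by simp
  qed
qed

text \<open>Homomorphism modules, direct sums and free modules are all sets of functions with
  componentwise operations. The target \<open>M b\<close> may vary with \<open>b\<close>, as direct
  sums require.\<close>

lemma pointwise_module:
  assumes M: "!!b. b \<in> B ==> module K (M b)" and K: "cring K"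
    and sub: "!!f b. f \<in> C ==> b \<in> B ==> f b IN M b" and ext: "C \<subseteq> extensional B"
    and z: "(\<lambda>b\<in>B. \<zero>\<^bsub>M b\<^esub>) \<in> C"
    and a: "!!f g. f \<in> C ==> g \<in> C ==> (\<lambda>b\<in>B. f b \<oplus>\<^bsub>M b\<^esub> g b) \<in> C"
    and s: "!!c f. c IN K ==> f \<in> C ==> (\<lambda>b\<in>B. c \<odot>\<^bsub>M b\<^esub> f b) \<in> C"
  shows "module K (mk_module C (\<lambda>b\<in>B. \<zero>\<^bsub>M b\<^esub>) (%f g. \<lambda>b\<in>B. f b \<oplus>\<^bsub>M b\<^esub> g b) (%c f. \<lambda>b\<in>B. c \<odot>\<^bsub>M b\<^esub> f b))"
    (is "module K ?P")
proof -
  interpret K: cring K by fact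
  have ag: "abelian_group (M b)" if "b \<in> B" for b using M[OF that] module.axioms(2) by blast
  have eqI: "f = g" if "f \<in> C" "g \<in> C" "!!b. b \<in> B ==> f b = g b" for f g
    using that ext by (metis extensionalityI subsetD)
  define P where "P = ?P"
  have C: "carrier P = C" by (simp add: P_def)
  have za: "\<zero>\<^bsub>P\<^esub> \<in> C" "!!f g. f \<in> C ==> g \<in> C ==> f \<oplus>\<^bsub>P\<^esub> g \<in> C"
    "!!c f. c IN K ==> f \<in> C ==> c \<odot>\<^bsub>P\<^esub> f \<in> C"
    using z a s by (simp_all add: P_def)
  have ev: "\<zero>\<^bsub>P\<^esub> b = \<zero>\<^bsub>M b\<^esub>" "(f \<oplus>\<^bsub>P\<^esub> g) b = f b \<oplus>\<^bsub>M b\<^esub> g b" "(c \<odot>\<^bsub>P\<^esub> f) b = c \<odot>\<^bsub>M b\<^esub> f b"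
    if "b \<in> B" for b f g c
    using that by (simp_all add: P_def)
  note simps = za ev sub K.a_inv_closed K.one_closed K.a_closed K.m_closed
  \<comment> \<open>The inverse of \<open>f\<close> is taken to be \<open>- 1\<close> times
    \<open>f\<close>, so closure of \<open>C\<close> under negation comes from closure under
    scalars.\<close>
  have neg: "(\<ominus>\<^bsub>K\<^esub> \<one>\<^bsub>K\<^esub>) \<odot>\<^bsub>M b\<^esub> x \<oplus>\<^bsub>M b\<^esub> x = \<zero>\<^bsub>M b\<^esub>" if b: "b \<in> B" and x: "x IN M b" for b x
  proof -
    interpret Mb: module K "M b" by (rule M[OF b])
    show ?thesis using x by (simp add: Mb.smult_l_minus Mb.M.l_neg)
  qed
  have comm: "f b \<oplus>\<^bsub>M b\<^esub> g b = g b \<oplus>\<^bsub>M b\<^esub> f b" if "b \<in> B" "f \<in> C" "g \<in> C" for f g b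
    using that sub abelian_monoid.a_comm[OF abelian_group.axioms(1)[OF ag]] by blast
  have "abelian_group P"
  proof (rule abelian_groupI; unfold C)
    show "f \<oplus>\<^bsub>P\<^esub> g \<oplus>\<^bsub>P\<^esub> h = f \<oplus>\<^bsub>P\<^esub> (g \<oplus>\<^bsub>P\<^esub> h)" if "f \<in> C" "g \<in> C" "h \<in> C" for f g h
      by (rule eqI) (simp_all add: simps that abelian_monoid.a_assoc[OF abelian_group.axioms(1)[OF ag]])
    show "f \<oplus>\<^bsub>P\<^esub> g = g \<oplus>\<^bsub>P\<^esub> f" if "f \<in> C" "g \<in> C" for f g
      by (rule eqI) (simp_all add: simps that comm[OF _ that])
    show "\<zero>\<^bsub>P\<^esub> \<oplus>\<^bsub>P\<^esub> f = f" if "f \<in> C" for f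
      by (rule eqI) (simp_all add: simps that abelian_monoid.l_zero[OF abelian_group.axioms(1)[OF ag]])
    show "\<exists>g\<in>C. g \<oplus>\<^bsub>P\<^esub> f = \<zero>\<^bsub>P\<^esub>" if f: "f \<in> C" for f
      by (intro bexI[of _ "(\<ominus>\<^bsub>K\<^esub> \<one>\<^bsub>K\<^esub>) \<odot>\<^bsub>P\<^esub> f"] eqI) (simp_all add: simps f neg)
  qed (simp_all add: za)
  moreover have "c \<odot>\<^bsub>P\<^esub> (f \<oplus>\<^bsub>P\<^esub> g) = c \<odot>\<^bsub>P\<^esub> f \<oplus>\<^bsub>P\<^esub> c \<odot>\<^bsub>P\<^esub> g"
    if "c IN K" "f \<in> C" "g \<in> C" for c f g
    by (rule eqI) (simp_all add: simps that module.smult_r_distr[OF M])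
  moreover have "(c \<oplus>\<^bsub>K\<^esub> d) \<odot>\<^bsub>P\<^esub> f = c \<odot>\<^bsub>P\<^esub> f \<oplus>\<^bsub>P\<^esub> d \<odot>\<^bsub>P\<^esub> f"
    if "c IN K" "d IN K" "f \<in> C" for c d f
    by (rule eqI) (simp_all add: simps that module.smult_l_distr[OF M])
  moreover have "(c \<otimes>\<^bsub>K\<^esub> d) \<odot>\<^bsub>P\<^esub> f = c \<odot>\<^bsub>P\<^esub> (d \<odot>\<^bsub>P\<^esub> f)"
    if "c IN K" "d IN K" "f \<in> C" for c d f
    by (rule eqI) (simp_all add: simps that module.smult_assoc1[OF M])
  moreover have "\<one>\<^bsub>K\<^esub> \<odot>\<^bsub>P\<^esub> f = f" if "f \<in> C" for f
    by (rule eqI) (simp_all add: simps that module.smult_one[OF M])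
  ultimately have "module K P" using K by (intro moduleI) (simp_all add: C za)
  then show ?thesis by (simp add: P_def)
qed

lemma regular_module:
  assumes "cring K" shows "module K (regular_module K)"
proof -
  interpret K: cring K by fact
  have "abelian_group (regular_module K)"
    by (rule abelian_groupI) (auto simp: regular_module_def K.a_ac intro: K.l_neg)
  then show ?thesis
    by (intro moduleI) (auto simp: regular_module_def K.l_distr K.r_distr K.m_assoc K.cring_axioms)
qed

lemma hom_mod:
  fixes W (structure)
  assumes V: "module K V" and W: "module K W"
  shows "module K (hom_mod K V W)"
proof -
  interpret V: module K V by fact
  show ?thesis
    unfolding hom_mod_def
  proof (rule pointwise_module)
    show "lin_maps K V W \<subseteq> extensional (carrier V)" by (auto simp: lin_maps_iff)
    show "(\<lambda>b\<in>carrier V. \<zero>) \<in> lin_maps K V W"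
      by (intro restrict_lin_maps V linear_const_zero W)
    show "(\<lambda>x\<in>carrier V. f x \<oplus> g x) \<in> lin_maps K V W"
      if "f \<in> lin_maps K V W" "g \<in> lin_maps K V W" for f g
      using that by (intro restrict_lin_maps V linear_plus W lin_maps_linear)
    show "(\<lambda>x\<in>carrier V. c \<odot> f x) \<in> lin_maps K V W"
      if "c IN K" "f \<in> lin_maps K V W" for c f
      using that by (intro restrict_lin_maps V linear_scale W lin_maps_linear)
    show "f b IN W" if "f \<in> lin_maps K V W" "b IN V" for f b
      using linear_closed[OF lin_maps_linear[OF that(1)] that(2)] .
    show "cring K" by (rule V.R.cring_axioms)
  qed (rule W)
qed

lemma hom_mod_simps [simp]:
  "carrier (hom_mod K V W) = lin_maps K V W"
  "\<zero>\<^bsub>hom_mod K V W\<^esub> = (\<lambda>x\<in>carrier V. \<zero>\<^bsub>W\<^esub>)"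
  "f \<oplus>\<^bsub>hom_mod K V W\<^esub> g = (\<lambda>x\<in>carrier V. f x \<oplus>\<^bsub>W\<^esub> g x)"
  "c \<odot>\<^bsub>hom_mod K V W\<^esub> f = (\<lambda>x\<in>carrier V. c \<odot>\<^bsub>W\<^esub> f x)"
  by (simp_all add: hom_mod_def)

lemma dirsum_mod:
  assumes M: "!!p. module K (M p)" and K: "cring K"
  shows "module K (dirsum_mod M)"
proof -
  have ag: "abelian_monoid (M p)" for p
    using abelian_group.axioms(1) module.axioms(2)[OF M] by blast
  \<comment> \<open>Restriction to \<open>UNIV\<close> changes nothing and brings the record into
    the shape of \<open>pointwise_module\<close>.\<close>
  have *: "dirsum_mod M = mk_module {s. (\<forall>p. s p IN M p) \<and> finite {p. s p ~= \<zero>\<^bsub>M p\<^esub>}}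
     (\<lambda>p\<in>UNIV. \<zero>\<^bsub>M p\<^esub>) (%s t. \<lambda>p\<in>UNIV. s p \<oplus>\<^bsub>M p\<^esub> t p) (%c s. \<lambda>p\<in>UNIV. c \<odot>\<^bsub>M p\<^esub> s p)"
    by (simp add: dirsum_mod_def restrict_UNIV)
  show ?thesis
    unfolding *
  proof (rule pointwise_module)
    fix f g assume fg: "f \<in> {s. (\<forall>p. s p IN M p) \<and> finite {p. s p ~= \<zero>\<^bsub>M p\<^esub>}}"
      "g \<in> {s. (\<forall>p. s p IN M p) \<and> finite {p. s p ~= \<zero>\<^bsub>M p\<^esub>}}"
    then have "finite ({p. f p ~= \<zero>\<^bsub>M p\<^esub>} \<union> {p. g p ~= \<zero>\<^bsub>M p\<^esub>})" by blast
    then have "finite {p. f p \<oplus>\<^bsub>M p\<^esub> g p ~= \<zero>\<^bsub>M p\<^esub>}"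
      by (rule rev_finite_subset) (auto simp: abelian_monoid.l_zero[OF ag] abelian_monoid.zero_closed[OF ag])
    then show "(\<lambda>b\<in>UNIV. f b \<oplus>\<^bsub>M b\<^esub> g b) \<in> {s. (\<forall>p. s p IN M p) \<and> finite {p. s p ~= \<zero>\<^bsub>M p\<^esub>}}"
      using fg by (auto simp: abelian_monoid.a_closed[OF ag])
  next
    fix c f assume c: "c IN K" and fg: "f \<in> {s. (\<forall>p. s p IN M p) \<and> finite {p. s p ~= \<zero>\<^bsub>M p\<^esub>}}"
    then have "finite {p. c \<odot>\<^bsub>M p\<^esub> f p ~= \<zero>\<^bsub>M p\<^esub>}"
      by (auto simp: module.smult_r_null[OF M] elim!: rev_finite_subset)
    then show "(\<lambda>b\<in>UNIV. c \<odot>\<^bsub>M b\<^esub> f b) \<in> {s. (\<forall>p. s p IN M p) \<and> finite {p. s p ~= \<zero>\<^bsub>M p\<^esub>}}"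
      using c fg by (auto simp: module.smult_closed[OF M])
  qed (use assms abelian_monoid.zero_closed[OF ag] in auto)
qed

lemma free_mod:
  fixes K (structure)
  assumes K: "cring K"
  shows "module K (free_mod K B)"
proof -
  interpret K: cring K by fact
  have *: "free_mod K B = mk_module {f \<in> B \<rightarrow>\<^sub>E carrier K. finite {b \<in> B. f b ~= \<zero>}}
     (\<lambda>b\<in>B. \<zero>\<^bsub>regular_module K\<^esub>) (%f g. \<lambda>b\<in>B. f b \<oplus>\<^bsub>regular_module K\<^esub> g b)
     (%c f. \<lambda>b\<in>B. c \<odot>\<^bsub>regular_module K\<^esub> f b)"
    by (simp add: free_mod_def regular_module_def)
  show ?thesis
    unfolding *
  proof (rule pointwise_module[where M = "%_. regular_module K"])
    fix f g assume fg: "f \<in> {f \<in> B \<rightarrow>\<^sub>E carrier K. finite {b \<in> B. f b ~= \<zero>}}"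
      "g \<in> {f \<in> B \<rightarrow>\<^sub>E carrier K. finite {b \<in> B. f b ~= \<zero>}}"
    then have "finite ({b \<in> B. f b ~= \<zero>} \<union> {b \<in> B. g b ~= \<zero>})" by blast
    then have "finite {b \<in> B. f b \<oplus> g b ~= \<zero>}" by (rule rev_finite_subset) auto
    moreover have "{b \<in> B. (\<lambda>b\<in>B. f b \<oplus> g b) b ~= \<zero>} = {b \<in> B. f b \<oplus> g b ~= \<zero>}" by auto
    ultimately show "(\<lambda>b\<in>B. f b \<oplus>\<^bsub>regular_module K\<^esub> g b) \<in> {f \<in> B \<rightarrow>\<^sub>E carrier K. finite {b \<in> B. f b ~= \<zero>}}"
      using fg by (auto simp: regular_module_def)
  next
    fix c f assume c: "c IN K" and f: "f \<in> {f \<in> B \<rightarrow>\<^sub>E carrier K. finite {b \<in> B. f b ~= \<zero>}}"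
    then have "finite {b \<in> B. f b ~= \<zero>}" by blast
    then have "finite {b \<in> B. c \<otimes> f b ~= \<zero>}" by (rule rev_finite_subset) (use c in auto)
    moreover have "{b \<in> B. (\<lambda>b\<in>B. c \<otimes> f b) b ~= \<zero>} = {b \<in> B. c \<otimes> f b ~= \<zero>}" by auto
    ultimately show "(\<lambda>b\<in>B. c \<odot>\<^bsub>regular_module K\<^esub> f b) \<in> {f \<in> B \<rightarrow>\<^sub>E carrier K. finite {b \<in> B. f b ~= \<zero>}}"
      using c f by (auto simp: regular_module_def)
  qed (use K regular_module[OF K] in "auto simp: regular_module_def PiE_def")
qed

lemma free_gen_closed:
  assumes K: "cring K" and b: "b \<in> B"
  shows "free_gen K B b IN free_mod K B"
proof -
  interpret K: cring K by fact
  have "{b' \<in> B. free_gen K B b b' ~= \<zero>\<^bsub>K\<^esub>} \<subseteq> {b}" by (auto simp: free_gen_def)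
  then have "finite {b' \<in> B. free_gen K B b b' ~= \<zero>\<^bsub>K\<^esub>}" by (rule finite_subset) simp
  then show ?thesis by (auto simp: free_mod_def free_gen_def)
qed

lemma free_mod_spans:
  fixes K (structure)
  assumes K: "cring K"
  shows "spans K (free_mod K B) (free_gen K B ` B)"
proof -
  interpret F: module K "free_mod K B" by (rule free_mod[OF K])
  show ?thesis
  proof (rule spansI[OF F.module_axioms])
    show "free_gen K B ` B \<subseteq> carrier (free_mod K B)" using free_gen_closed[OF K] by auto
    fix H f assume H: "submodule H K (free_mod K B)" and gH: "free_gen K B ` B \<subseteq> H"
      and f: "f IN free_mod K B"
    \<comment> \<open>Induction over a finite set that contains the support: the value at
      \<open>s\<close> is replaced by zero and then restored by a multiple of a generator.\<close>
    have "f \<in> H" if "finite S" "S \<subseteq> B" "f \<in> B \<rightarrow>\<^sub>E carrier K" "\<forall>b\<in>B - S. f b = \<zero>" for S f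
      using that
    proof (induct S arbitrary: f)
      case empty
      then have "f = \<zero>\<^bsub>free_mod K B\<^esub>" by (auto simp: free_mod_def PiE_def extensional_def)
      then show ?case using subgroup.one_closed[OF submodule.axioms(1)[OF H]] by simp
    next
      case (insert s S)
      let ?g = "f(s := \<zero>)"
      have g: "?g \<in> H" using insert by (intro insert.hyps) (auto simp: PiE_def extensional_def)
      have "f s IN K" using insert by auto
      then have "f s \<odot>\<^bsub>free_mod K B\<^esub> free_gen K B s \<in> H"
        using gH insert.prems(1) by (intro F.submoduleE(4)[OF H]) auto
      moreover have "f = ?g \<oplus>\<^bsub>free_mod K B\<^esub> (f s \<odot>\<^bsub>free_mod K B\<^esub> free_gen K B s)"
      proof
        fix b
        have "f b IN K" if "b \<in> B" using that insert.prems by auto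
        then show "f b = (?g \<oplus>\<^bsub>free_mod K B\<^esub> (f s \<odot>\<^bsub>free_mod K B\<^esub> free_gen K B s)) b"
          using insert.prems \<open>f s IN K\<close>
          by (cases "b \<in> B") (auto simp: free_mod_def free_gen_def PiE_def extensional_def)
      qed
      ultimately show ?case using g F.submoduleE(5)[OF H] by metis
    qed
    note * = this
    show "f \<in> H"
      by (rule *[of "{b \<in> B. f b ~= \<zero>}"]) (use f in "auto simp: free_mod_def")
  qed
qed

lemma free_mod_lift:
  fixes W (structure)
  assumes W: "module K W" and w: "!!b. b \<in> B ==> w b IN W"
  shows "\<exists>h. linear K (free_mod K B) W h \<and> (\<forall>b\<in>B. h (free_gen K B b) = w b)"
proof -
  interpret W: module K W by fact
  have K: "cring K" by (rule W.R.cring_axioms)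
  define h where "h f = (\<Oplus>b\<in>{b\<in>B. f b ~= \<zero>\<^bsub>K\<^esub>}. f b \<odot> w b)" for f
  \<comment> \<open>The sum over the support may be enlarged to any finite set containing it, so two
    functions can be summed over the union of their supports.\<close>
  have hS: "h f = (\<Oplus>b\<in>S. f b \<odot> w b)"
    if "finite S" "{b\<in>B. f b ~= \<zero>\<^bsub>K\<^esub>} \<subseteq> S" "S \<subseteq> B" "f \<in> B \<rightarrow> carrier K" for f S
    unfolding h_def
    by (rule W.M.add.finprod_mono_neutral_cong_left) (use that w in "auto simp: Pi_def")
  have "linear K (free_mod K B) W h"
  proof (rule linearI)
    fix f assume "f IN free_mod K B"
    then show "h f IN W" unfolding h_def
      by (intro W.M.finsum_closed) (auto simp: free_mod_def w PiE_def Pi_def)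
  next
    fix f g assume f: "f IN free_mod K B" and g: "g IN free_mod K B"
    let ?S = "{b\<in>B. f b ~= \<zero>\<^bsub>K\<^esub>} \<union> {b\<in>B. g b ~= \<zero>\<^bsub>K\<^esub>}"
    have fin: "finite ?S" and fc: "!!b. b \<in> B ==> f b IN K" and gc: "!!b. b \<in> B ==> g b IN K"
      using f g by (auto simp: free_mod_def)
    have "h (f \<oplus>\<^bsub>free_mod K B\<^esub> g) = (\<Oplus>b\<in>?S. (f \<oplus>\<^bsub>free_mod K B\<^esub> g) b \<odot> w b)"
      by (rule hS[OF fin]) (use fc gc in "auto simp: free_mod_def")
    also have "... = (\<Oplus>b\<in>?S. f b \<odot> w b \<oplus> g b \<odot> w b)"
      by (rule W.M.finsum_cong') (use fc gc w in "auto simp: free_mod_def W.smult_l_distr")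
    also have "... = (\<Oplus>b\<in>?S. f b \<odot> w b) \<oplus> (\<Oplus>b\<in>?S. g b \<odot> w b)"
      by (rule W.M.finsum_addf) (use fc gc w in auto)
    also have "... = h f \<oplus> h g"
      using fc gc by (subst (1 2) hS[OF fin]) auto
    finally show "h (f \<oplus>\<^bsub>free_mod K B\<^esub> g) = h f \<oplus> h g" .
  next
    fix c f assume c: "c IN K" and f: "f IN free_mod K B"
    let ?S = "{b\<in>B. f b ~= \<zero>\<^bsub>K\<^esub>}"
    have fin: "finite ?S" and fc: "!!b. b \<in> B ==> f b IN K"
      using f by (auto simp: free_mod_def)
    have "h (c \<odot>\<^bsub>free_mod K B\<^esub> f) = (\<Oplus>b\<in>?S. (c \<odot>\<^bsub>free_mod K B\<^esub> f) b \<odot> w b)"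
      by (rule hS[OF fin]) (use c fc in "auto simp: free_mod_def")
    also have "... = (\<Oplus>b\<in>?S. c \<odot> (f b \<odot> w b))"
      by (rule W.M.finsum_cong') (use c fc w in "auto simp: free_mod_def W.smult_assoc1")
    also have "... = c \<odot> h f"
      unfolding h_def by (rule W.finsum_smult_ldistr[symmetric]) (use c fc w fin in auto)
    finally show "h (c \<odot>\<^bsub>free_mod K B\<^esub> f) = c \<odot> h f" .
  qed
  moreover have "h (free_gen K B b) = w b" if b: "b \<in> B" for b
  proof -
    have "h (free_gen K B b) = (\<Oplus>b'\<in>{b}. free_gen K B b b' \<odot> w b')"
      by (rule hS) (use b in "auto simp: free_gen_def split: if_splits")
    also have "... = w b" using b w by (simp add: free_gen_def)
    finally show ?thesis .
  qed
  ultimately show ?thesis by blast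
qed

text \<open>Tensor products and tensor powers are both a free module modulo the span of explicit
  relators. What they share is collected here: the classes of the generators span, the relators
  become zero, and a map on the free module that kills \<open>R\<close> descends.\<close>

lemma presented_module:
  fixes B :: "'b set" and R
  assumes K: "cring K" and R: "R \<subseteq> carrier (free_mod K B)"
  defines "S \<equiv> mod_span K (free_mod K B) R"
  defines "Q \<equiv> quot_mod (free_mod K B) S"
  defines "e \<equiv> %b. S +>\<^bsub>free_mod K B\<^esub> free_gen K B b"
  shows "module K Q" "spans K Q (e ` B)"
    and "\<exists>q. linear K (free_mod K B) Q q \<and> (\<forall>b\<in>B. q (free_gen K B b) = e b) \<and> (\<forall>r\<in>R. q r = \<zero>\<^bsub>Q\<^esub>)"
    and "!!(W :: ('a, 'w) module) w l. module K W ==> linear K (free_mod K B) W l ==>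
           (!!b. b \<in> B ==> l (free_gen K B b) = w b) ==> (!!r. r \<in> R ==> l r = \<zero>\<^bsub>W\<^esub>) ==>
           \<exists>h. linear K Q W h \<and> (\<forall>b\<in>B. h (e b) = w b)"
proof -
  let ?F = "free_mod K B"
  interpret F: module K ?F by (rule free_mod[OF K])
  have S: "submodule S K ?F" unfolding S_def by (rule mod_span_submodule[OF F.module_axioms R])
  note q = quot_mod[OF F.module_axioms S, folded Q_def]
  show "module K Q" by (rule q(1))
  show "spans K Q (e ` B)"
    using spans_quot[OF F.module_axioms S free_mod_spans[OF K]]
    unfolding Q_def e_def by (simp add: image_image)
  have "S +>\<^bsub>?F\<^esub> r = \<zero>\<^bsub>Q\<^esub>" if "r \<in> R" for r
    using that R mod_span_subset[of R K ?F] q(5)[of r] unfolding S_def by auto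
  then show "\<exists>q. linear K ?F Q q \<and> (\<forall>b\<in>B. q (free_gen K B b) = e b) \<and> (\<forall>r\<in>R. q r = \<zero>\<^bsub>Q\<^esub>)"
    using q(2) by (intro exI[of _ "%x. S +>\<^bsub>?F\<^esub> x"]) (auto simp: e_def)
  fix W :: "('a, 'w) module" and w l
  assume W: "module K W" and l: "linear K ?F W l"
    and lw: "!!b. b \<in> B ==> l (free_gen K B b) = w b" and lR: "!!r. r \<in> R ==> l r = \<zero>\<^bsub>W\<^esub>"
  interpret W: module K W by fact
  have "submodule {x \<in> carrier ?F. l x = \<zero>\<^bsub>W\<^esub>} K ?F"
    by (rule submoduleI'[OF F.module_axioms])
      (auto simp: linear_zero[OF l F.module_axioms W] linear_add[OF l] linear_smult[OF l])
  then have "S \<subseteq> {x \<in> carrier ?F. l x = \<zero>\<^bsub>W\<^esub>}"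
    unfolding S_def using R lR by (intro mod_span_least) auto
  then obtain h where "linear K Q W h" "\<forall>x\<in>carrier ?F. h (S +>\<^bsub>?F\<^esub> x) = l x"
    using quot_mod_lift[OF F.module_axioms S W l] unfolding Q_def by blast
  then show "\<exists>h. linear K Q W h \<and> (\<forall>b\<in>B. h (e b) = w b)"
    using lw free_gen_closed[OF K, of _ B] by (intro exI[of _ h]) (auto simp: e_def)
qed

lemma (in abelian_group) diff_eq_zero_iff:
  "x IN G ==> y IN G ==> x \<ominus> y = \<zero> \<longleftrightarrow> x = y"
  using add.inv_solve_right[of \<zero> x y] by (auto simp: a_minus_def r_neg)

section \<open>Tensor products and multilinear maps\<close>

lemma tensor_mod:
  fixes V (structure)
  assumes V: "module K V" and W: "module K W"
  shows "module K (tensor_mod K V W)"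
    and "spans K (tensor_mod K V W) ((%(x, y). tensor_el K V W x y) ` (carrier V \<times> carrier W))"
    and "!!y. y IN W ==> linear K V (tensor_mod K V W) (%x. tensor_el K V W x y)"
    and "!!x. x IN V ==> linear K W (tensor_mod K V W) (tensor_el K V W x)"
    and "!!(U :: ('a, 'u) module) \<beta>. module K U ==> (!!y. y IN W ==> linear K V U (%x. \<beta> x y)) ==>
           (!!x. x IN V ==> linear K W U (\<beta> x)) ==>
           \<exists>h. linear K (tensor_mod K V W) U h \<and>
             (\<forall>x\<in>carrier V. \<forall>y\<in>carrier W. h (tensor_el K V W x y) = \<beta> x y)"
proof -
  interpret V: module K V by fact
  interpret W: module K W by fact
  have K: "cring K" by (rule V.R.cring_axioms)
  let ?B = "carrier V \<times> carrier W"
  let ?F = "free_mod K ?B" and ?g = "free_gen K ?B"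
  interpret F: module K ?F by (rule free_mod[OF K])
  define R where "R =
       ({?g (x \<oplus> x', y) \<ominus>\<^bsub>?F\<^esub> (?g (x, y) \<oplus>\<^bsub>?F\<^esub> ?g (x', y)) | x x' y.
           x IN V \<and> x' IN V \<and> y IN W} \<union>
        {?g (x, y \<oplus>\<^bsub>W\<^esub> y') \<ominus>\<^bsub>?F\<^esub> (?g (x, y) \<oplus>\<^bsub>?F\<^esub> ?g (x, y')) | x y y'.
           x IN V \<and> y IN W \<and> y' IN W} \<union>
        {?g (c \<odot> x, y) \<ominus>\<^bsub>?F\<^esub> c \<odot>\<^bsub>?F\<^esub> ?g (x, y) | c x y.
           c IN K \<and> x IN V \<and> y IN W} \<union>
        {?g (x, c \<odot>\<^bsub>W\<^esub> y) \<ominus>\<^bsub>?F\<^esub> c \<odot>\<^bsub>?F\<^esub> ?g (x, y) | c x y.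
           c IN K \<and> x IN V \<and> y IN W})"
  have g: "?g (x, y) IN ?F" if "x IN V" "y IN W" for x y
    using that by (intro free_gen_closed[OF K]) simp
  have R: "R \<subseteq> carrier ?F" by (auto simp: R_def g)
  note pres = presented_module[OF K R]
  have T: "tensor_mod K V W = quot_mod ?F (mod_span K ?F R)"
    and e: "tensor_el K V W x y = mod_span K ?F R +>\<^bsub>?F\<^esub> ?g (x, y)" for x y
    unfolding tensor_mod_def tensor_el_def tensor_rel_def R_def Let_def by (rule refl)+
  show Q: "module K (tensor_mod K V W)" unfolding T by (rule pres(1))
  then interpret Q: module K "tensor_mod K V W" .
  show sp: "spans K (tensor_mod K V W) ((%(x, y). tensor_el K V W x y) ` ?B)"
    using pres(2) unfolding T e by (simp add: case_prod_unfold)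
  have ec: "tensor_el K V W x y IN tensor_mod K V W" if "x IN V" "y IN W" for x y
    using sp that by (auto simp: spans_def)
  obtain q where q: "linear K ?F (tensor_mod K V W) q"
      "!!b. b \<in> ?B ==> q (?g b) = mod_span K ?F R +>\<^bsub>?F\<^esub> ?g b"
      "!!r. r \<in> R ==> q r = \<zero>\<^bsub>tensor_mod K V W\<^esub>"
    using pres(3) unfolding T by blast
  have qe: "q (?g (x, y)) = tensor_el K V W x y" if "x IN V" "y IN W" for x y
    using q(2) that by (simp add: e)
  \<comment> \<open>Every relator is a difference of two elements; that it is killed means that
    these have the same class.\<close>
  have qR: "q u = q v" if "u \<ominus>\<^bsub>?F\<^esub> v \<in> R" "u IN ?F" "v IN ?F" for u v
  proof -
    have "q u \<ominus>\<^bsub>tensor_mod K V W\<^esub> q v = \<zero>\<^bsub>tensor_mod K V W\<^esub>"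
      using q(3)[OF that(1)] linear_minus[OF q(1) F.module_axioms Q] that by simp
    then show ?thesis
      using linear_closed[OF q(1)] that
        Q.M.add.inv_solve_right[of "\<zero>\<^bsub>tensor_mod K V W\<^esub>" "q u" "q v"] by (auto simp: a_minus_def)
  qed
  show "linear K V (tensor_mod K V W) (%x. tensor_el K V W x y)" if y: "y IN W" for y
  proof (rule linearI)
    fix x x' assume x: "x IN V" "x' IN V"
    have "q (?g (x \<oplus> x', y)) = q (?g (x, y) \<oplus>\<^bsub>?F\<^esub> ?g (x', y))"
      by (rule qR, unfold R_def, use x y in blast) (use x y g in simp_all)
    then show "tensor_el K V W (x \<oplus> x') y = tensor_el K V W x y \<oplus>\<^bsub>tensor_mod K V W\<^esub> tensor_el K V W x' y"
      using x y g linear_add[OF q(1)] by (simp add: qe)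
  next
    fix c x assume x: "c IN K" "x IN V"
    have "q (?g (c \<odot> x, y)) = q (c \<odot>\<^bsub>?F\<^esub> ?g (x, y))"
      by (rule qR, unfold R_def, use x y in blast) (use x y g in simp_all)
    then show "tensor_el K V W (c \<odot> x) y = c \<odot>\<^bsub>tensor_mod K V W\<^esub> tensor_el K V W x y"
      using x y g linear_smult[OF q(1)] by (simp add: qe)
  qed (use y ec in auto)
  show "linear K W (tensor_mod K V W) (tensor_el K V W x)" if x: "x IN V" for x
  proof (rule linearI)
    fix y y' assume y: "y IN W" "y' IN W"
    have "q (?g (x, y \<oplus>\<^bsub>W\<^esub> y')) = q (?g (x, y) \<oplus>\<^bsub>?F\<^esub> ?g (x, y'))"
      by (rule qR, unfold R_def, use x y in blast) (use x y g in simp_all)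
    then show "tensor_el K V W x (y \<oplus>\<^bsub>W\<^esub> y') = tensor_el K V W x y \<oplus>\<^bsub>tensor_mod K V W\<^esub> tensor_el K V W x y'"
      using x y g linear_add[OF q(1)] by (simp add: qe)
  next
    fix c y assume y: "c IN K" "y IN W"
    have "q (?g (x, c \<odot>\<^bsub>W\<^esub> y)) = q (c \<odot>\<^bsub>?F\<^esub> ?g (x, y))"
      by (rule qR, unfold R_def, use x y in blast) (use x y g in simp_all)
    then show "tensor_el K V W x (c \<odot>\<^bsub>W\<^esub> y) = c \<odot>\<^bsub>tensor_mod K V W\<^esub> tensor_el K V W x y"
      using x y g linear_smult[OF q(1)] by (simp add: qe)
  qed (use x ec in auto)
  fix U :: "('a, 'u) module" and \<beta>
  assume U: "module K U" and \<beta>1: "!!y. y IN W ==> linear K V U (%x. \<beta> x y)"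
    and \<beta>2: "!!x. x IN V ==> linear K W U (\<beta> x)"
  interpret U: module K U by fact
  have \<beta>c: "\<beta> x y IN U" if "x IN V" "y IN W" for x y
    using linear_closed[OF \<beta>2] that by blast
  have "\<exists>l. linear K ?F U l \<and> (\<forall>b\<in>?B. l (?g b) = (case b of (x, y) => \<beta> x y))"
    by (rule free_mod_lift[OF U]) (use \<beta>c in auto)
  then obtain l where l: "linear K ?F U l"
    "!!x y. x IN V ==> y IN W ==> l (?g (x, y)) = \<beta> x y" by auto
  have lR: "l r = \<zero>\<^bsub>U\<^esub>" if "r \<in> R" for r
    using that unfolding R_def
    by (auto simp: g linear_uminus[OF l(1) F.module_axioms U] linear_add[OF l(1)] linear_smult[OF l(1)]
        l(2) linear_add[OF \<beta>1] linear_add[OF \<beta>2] linear_smult[OF \<beta>1] linear_smult[OF \<beta>2]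
        \<beta>c a_minus_def U.M.r_neg)
  have "\<exists>h. linear K (tensor_mod K V W) U h \<and>
      (\<forall>b\<in>?B. h (mod_span K ?F R +>\<^bsub>?F\<^esub> ?g b) = (case b of (x, y) => \<beta> x y))"
    unfolding T by (rule pres(4)[OF U l(1)]) (use l(2) lR in auto)
  then show "\<exists>h. linear K (tensor_mod K V W) U h \<and>
      (\<forall>x\<in>carrier V. \<forall>y\<in>carrier W. h (tensor_el K V W x y) = \<beta> x y)"
    by (auto simp: e)
qed

lemma tensor_el_closed:
  "module K V ==> module K W ==> x IN V ==> y IN W ==>
    tensor_el K V W x y IN tensor_mod K V W"
  by (rule linear_closed[OF tensor_mod(4)])

text \<open>
  With \<open>Z\<close> consisting of the unit of the algebra these are the multilinear maps that factor through
  the powers of the bar construction.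
\<close>

fun mlin ::
    "('k, 'r) ring_scheme => ('k, 'v) module => 'v set => ('k, 'w) module => nat => ('v list => 'w) => bool" where
  "mlin K V Z W 0 F \<longleftrightarrow> F [] IN W"
| "mlin K V Z W (Suc n) F \<longleftrightarrow>
     (\<forall>a\<in>carrier V. mlin K V Z W n (%l. F (a # l))) \<and>
     (\<forall>l\<in>tuples (carrier V) n. linear K V W (%a. F (a # l)) \<and> (\<forall>z\<in>Z. F (z # l) = \<zero>\<^bsub>W\<^esub>))"

lemma tuples_0 [simp]: "xs \<in> tuples X 0 \<longleftrightarrow> xs = []"
  by (auto simp: tuples_def)

lemma tuples_Nil [simp]: "[] \<in> tuples X n \<longleftrightarrow> n = 0"
  by (auto simp: tuples_def)

lemma tuples_Cons [simp]: "a # l \<in> tuples X (Suc n) \<longleftrightarrow> a \<in> X \<and> l \<in> tuples X n"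
  by (auto simp: tuples_def)

lemma tuples_Suc: "xs \<in> tuples X (Suc n) \<longleftrightarrow> (\<exists>a\<in>X. \<exists>l\<in>tuples X n. xs = a # l)"
  by (cases xs) (auto simp: tuples_def)

lemma tuples_length: "xs \<in> tuples X n ==> length xs = n"
  by (auto simp: tuples_def)

lemma mlin_closed: "mlin K V Z W n F ==> l \<in> tuples (carrier V) n ==> F l IN W"
  by (induct n arbitrary: F l) (auto simp: tuples_Suc)

text \<open>The recursion of \<open>mlin\<close> speaks about the first argument only. Fixing the
  leading arguments one after the other carries its two properties to every position.\<close>

lemma mlin_linear:
  "mlin K V Z W n F ==> xs @ a # ys \<in> tuples (carrier V) n ==> linear K V W (%a. F (xs @ a # ys))"
  "mlin K V Z W n F ==> xs @ a # ys \<in> tuples (carrier V) n ==> z \<in> Z ==> F (xs @ z # ys) = \<zero>\<^bsub>W\<^esub>"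
proof -
  have "linear K V W (%a. F (xs @ a # ys)) \<and> (\<forall>z\<in>Z. F (xs @ z # ys) = \<zero>\<^bsub>W\<^esub>)"
    if "mlin K V Z W n F" "xs @ a # ys \<in> tuples (carrier V) n" for F
    using that
  proof (induct xs arbitrary: n F)
    case Nil
    then show ?case by (cases n) auto
  next
    case (Cons x xs)
    then obtain m where m: "n = Suc m" by (cases n) auto
    show ?case using Cons(1)[of m "%l. F (x # l)"] Cons(2,3) by (auto simp: m)
  qed
  then show "mlin K V Z W n F ==> xs @ a # ys \<in> tuples (carrier V) n ==> linear K V W (%a. F (xs @ a # ys))"
    "mlin K V Z W n F ==> xs @ a # ys \<in> tuples (carrier V) n ==> z \<in> Z ==> F (xs @ z # ys) = \<zero>\<^bsub>W\<^esub>"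
    by blast+
qed

lemma mlinI:
  fixes W (structure)
  assumes "!!l. l \<in> tuples (carrier V) n ==> F l IN W"
    and "!!xs a ys. xs @ a # ys \<in> tuples (carrier V) n ==> linear K V W (%a. F (xs @ a # ys))"
    and "!!xs a ys z. xs @ a # ys \<in> tuples (carrier V) n ==> z \<in> Z ==> F (xs @ z # ys) = \<zero>"
    and "carrier V ~= {}"
  shows "mlin K V Z W n F"
  using assms(1-3)
proof (induct n arbitrary: F)
  case (Suc n)
  have "mlin K V Z W n (%l. F (a # l))" if a: "a IN V" for a
  proof (rule Suc(1))
    fix xs b ys assume "xs @ b # ys \<in> tuples (carrier V) n"
    then have *: "(a # xs) @ b # ys \<in> tuples (carrier V) (Suc n)" using a by simp
    show "linear K V W (%b. F (a # xs @ b # ys))" using Suc(3)[OF *] by simp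
    show "F (a # xs @ z # ys) = \<zero>" if "z \<in> Z" for z using Suc(4)[OF * that] by simp
  qed (use a Suc(2) in auto)
  moreover have "linear K V W (%a. F (a # l)) \<and> (\<forall>z\<in>Z. F (z # l) = \<zero>)"
    if l: "l \<in> tuples (carrier V) n" for l
  proof -
    \<comment> \<open>The hypotheses about a position are stated for a full tuple, so some element
      must be available to occupy the slot that is about to vary.\<close>
    obtain a where "a IN V" using assms(4) by blast
    then have *: "[] @ a # l \<in> tuples (carrier V) (Suc n)" using l by simp
    show ?thesis using Suc(3)[OF *] Suc(4)[OF *] by simp
  qed
  ultimately show ?case by simp
qed simp

lemma mlin_comp:
  assumes "mlin K V Z W n F" and g: "linear K W U g" and W: "module K W" and U: "module K U"
  shows "mlin K V Z U n (%l. g (F l))"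
  using assms(1)
  by (induct n arbitrary: F)
    (auto simp: linear_closed[OF g] linear_zero[OF g W U] intro!: linear_comp[OF _ g])

lemma mlin_cong:
  fixes W (structure)
  assumes "mlin K V Z W n F" and V: "module K V" and Z: "Z \<subseteq> carrier V"
    and "!!l. l \<in> tuples (carrier V) n ==> F l = G l"
  shows "mlin K V Z W n G"
  using assms(1,4)
proof (induct n arbitrary: F G)
  case (Suc n)
  have "mlin K V Z W n (%l. G (a # l))" if "a IN V" for a
    by (rule Suc(1)[of "%l. F (a # l)"]) (use that Suc(2,3) in auto)
  moreover have "linear K V W (%a. G (a # l)) \<and> (\<forall>z\<in>Z. G (z # l) = \<zero>)"
    if l: "l \<in> tuples (carrier V) n" for l
  proof
    show "linear K V W (%a. G (a # l))"
      by (rule linear_cong[of K V W "%a. F (a # l)"]) (use Suc(2,3) l V in auto)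
    show "\<forall>z\<in>Z. G (z # l) = \<zero>"
    proof
      fix z assume z: "z \<in> Z"
      then have "F (z # l) = G (z # l)" using Suc(3) l Z by auto
      then show "G (z # l) = \<zero>" using Suc(2) l z by auto
    qed
  qed
  ultimately show ?case by simp
qed simp

lemma mlin_const_zero:
  assumes "module K W" shows "mlin K V Z W n (%l. \<zero>\<^bsub>W\<^esub>)"
  using module_zero[OF assms] linear_const_zero[OF assms] by (induct n) auto

lemma mlin_plus:
  assumes W: "module K W" and "mlin K V Z W n F" "mlin K V Z W n G"
  shows "mlin K V Z W n (%l. F l \<oplus>\<^bsub>W\<^esub> G l)"
proof -
  interpret W: module K W by fact
  show ?thesis
    using assms(2,3) by (induct n arbitrary: F G) (auto intro!: linear_plus[OF _ _ W])
qed

lemma mlin_neg: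
  assumes W: "module K W" and "mlin K V Z W n F"
  shows "mlin K V Z W n (%l. \<ominus>\<^bsub>W\<^esub> F l)"
proof -
  interpret W: module K W by fact
  show ?thesis
    using assms(2) by (induct n arbitrary: F) (auto intro!: linear_neg[OF _ W] simp: W.M.minus_zero')
qed

lemma mlin_diff:
  assumes W: "module K W" and "mlin K V Z W n F" "mlin K V Z W n G"
  shows "mlin K V Z W n (%l. F l \<ominus>\<^bsub>W\<^esub> G l)"
  unfolding a_minus_def by (intro mlin_plus mlin_neg assms)

lemma mlin_signed:
  assumes W: "module K W" and "mlin K V Z W n F"
  shows "mlin K V Z W n (%l. signed W j (F l))"
  using assms mlin_neg[OF assms] by (cases "even j") (simp_all add: signed_def)

lemma mlin_scale:
  assumes W: "module K W" and c: "c IN K" and F: "mlin K V Z W n F"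
  shows "mlin K V Z W n (%l. c \<odot>\<^bsub>W\<^esub> F l)"
  by (rule mlin_comp[OF F _ W W]) (rule linear_scale[OF linear_id W c])

lemma mlin_sum:
  fixes W (structure)
  assumes V: "module K V" and Z: "Z \<subseteq> carrier V" and W: "module K W" and I: "finite I"
    and "!!i. i \<in> I ==> mlin K V Z W n (F i)"
  shows "mlin K V Z W n (%l. \<Oplus>i\<in>I. F i l)"
proof -
  interpret W: module K W by fact
  show ?thesis
    using I assms(5)
  proof induct
    case empty
    show ?case by (simp add: mlin_const_zero[OF W])
  next
    case (insert i I)
    have *: "mlin K V Z W n (%l. F i l \<oplus> (\<Oplus>i\<in>I. F i l))"
      by (rule mlin_plus[OF W]) (use insert in auto)
    show ?case
    proof (rule mlin_cong[OF * V Z])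
      fix l assume "l \<in> tuples (carrier V) n"
      then have "F j l IN W" if "j \<in> insert i I" for j
        using mlin_closed[OF insert(4)[OF that]] by blast
      then show "F i l \<oplus> (\<Oplus>i\<in>I. F i l) = (\<Oplus>i\<in>insert i I. F i l)"
        using insert(1,2) by (subst W.M.finsum_insert) auto
    qed
  qed
qed

text \<open>Here \<open>Z\<close> is empty, since plain tensor powers impose multilinearity alone.
  Vanishing on the unit arises later, when the tensor power of the quotient \<open>A/k\<close> is
  formed.\<close>

lemma tpow_mod:
  fixes W (structure)
  assumes W: "module K W"
  shows "module K (tpow_mod K W n)"
    and "spans K (tpow_mod K W n) (tpow_el K W ` tuples (carrier W) n)"
    and "mlin K W {} (tpow_mod K W n) n (tpow_el K W)"
    and "!!(U :: ('a, 'u) module) F. module K U ==> mlin K W {} U n F ==>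
           \<exists>h. linear K (tpow_mod K W n) U h \<and> (\<forall>xs\<in>tuples (carrier W) n. h (tpow_el K W xs) = F xs)"
proof -
  interpret W: module K W by fact
  have K: "cring K" by (rule W.R.cring_axioms)
  let ?B = "tuples (carrier W) n"
  let ?F = "free_mod K ?B" and ?g = "free_gen K ?B"
  interpret F: module K ?F by (rule free_mod[OF K])
  define R where "R =
       ({?g (xs @ (x \<oplus> y) # ys) \<ominus>\<^bsub>?F\<^esub> (?g (xs @ x # ys) \<oplus>\<^bsub>?F\<^esub> ?g (xs @ y # ys)) | xs x y ys.
           xs @ x # ys \<in> ?B \<and> y IN W} \<union>
        {?g (xs @ (c \<odot> x) # ys) \<ominus>\<^bsub>?F\<^esub> c \<odot>\<^bsub>?F\<^esub> ?g (xs @ x # ys) | c xs x ys.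
           c IN K \<and> xs @ x # ys \<in> ?B})"
  have g: "?g xs IN ?F" if "xs \<in> ?B" for xs
    using that by (rule free_gen_closed[OF K])
  have B: "xs @ y # ys \<in> ?B" if "xs @ x # ys \<in> ?B" "y IN W" for xs x y ys
    using that by (auto simp: tuples_def)
  have Bx: "x IN W" if "xs @ x # ys \<in> ?B" for xs x ys
    using that by (auto simp: tuples_def)
  have R: "R \<subseteq> carrier ?F"
    unfolding R_def
    by (rule subsetI, elim UnE CollectE exE conjE, hypsubst)
      (simp_all add: g B[OF _ W.M.a_closed[OF Bx]] B[OF _ W.smult_closed[OF _ Bx]] B[where x = x for x])
  note pres = presented_module[OF K R]
  have T: "tpow_mod K W n = quot_mod ?F (mod_span K ?F R)"
    unfolding tpow_mod_def tpow_rel_def R_def Let_def by (rule refl)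
  have e: "tpow_el K W xs = mod_span K ?F R +>\<^bsub>?F\<^esub> ?g xs" if "xs \<in> ?B" for xs
    using tuples_length[OF that] unfolding tpow_el_def tpow_rel_def R_def Let_def by simp
  show Q: "module K (tpow_mod K W n)" unfolding T by (rule pres(1))
  then interpret Q: module K "tpow_mod K W n" .
  have "(%b. mod_span K ?F R +>\<^bsub>?F\<^esub> ?g b) ` ?B = tpow_el K W ` ?B"
    using e by (intro image_cong) auto
  with pres(2) show sp: "spans K (tpow_mod K W n) (tpow_el K W ` ?B)"
    unfolding T by metis
  have ec: "tpow_el K W xs IN tpow_mod K W n" if "xs \<in> ?B" for xs
    using sp that by (auto simp: spans_def)
  obtain q where q: "linear K ?F (tpow_mod K W n) q"
      "!!b. b \<in> ?B ==> q (?g b) = mod_span K ?F R +>\<^bsub>?F\<^esub> ?g b"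
      "!!r. r \<in> R ==> q r = \<zero>\<^bsub>tpow_mod K W n\<^esub>"
    using pres(3) unfolding T by blast
  have qe: "q (?g xs) = tpow_el K W xs" if "xs \<in> ?B" for xs
    using q(2) that by (simp add: e)
  have qR: "q u = q v" if "u \<ominus>\<^bsub>?F\<^esub> v \<in> R" "u IN ?F" "v IN ?F" for u v
  proof -
    have "q u \<ominus>\<^bsub>tpow_mod K W n\<^esub> q v = \<zero>\<^bsub>tpow_mod K W n\<^esub>"
      using q(3)[OF that(1)] linear_minus[OF q(1) F.module_axioms Q] that by simp
    then show ?thesis
      using linear_closed[OF q(1)] that
        Q.M.add.inv_solve_right[of "\<zero>\<^bsub>tpow_mod K W n\<^esub>" "q u" "q v"] by (auto simp: a_minus_def)
  qed
  show "mlin K W {} (tpow_mod K W n) n (tpow_el K W)"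
  proof (rule mlinI)
    fix xs a ys assume axs: "xs @ a # ys \<in> tuples (carrier W) n"
    note Bg = B[OF axs] g[OF B[OF axs]]
    show "linear K W (tpow_mod K W n) (%a. tpow_el K W (xs @ a # ys))"
    proof (rule linearI)
      fix x y assume xy: "x IN W" "y IN W"
      have "q (?g (xs @ (x \<oplus> y) # ys)) = q (?g (xs @ x # ys) \<oplus>\<^bsub>?F\<^esub> ?g (xs @ y # ys))"
        by (rule qR, unfold R_def, use xy Bg(1)[OF xy(1)] in blast) (use xy Bg in simp_all)
      then show "tpow_el K W (xs @ (x \<oplus> y) # ys) =
          tpow_el K W (xs @ x # ys) \<oplus>\<^bsub>tpow_mod K W n\<^esub> tpow_el K W (xs @ y # ys)"
        using xy Bg linear_add[OF q(1)] by (simp add: qe)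
    next
      fix c x assume xy: "c IN K" "x IN W"
      have "q (?g (xs @ (c \<odot> x) # ys)) = q (c \<odot>\<^bsub>?F\<^esub> ?g (xs @ x # ys))"
        by (rule qR, unfold R_def, use xy Bg(1)[OF xy(2)] in blast) (use xy Bg in simp_all)
      then show "tpow_el K W (xs @ (c \<odot> x) # ys) = c \<odot>\<^bsub>tpow_mod K W n\<^esub> tpow_el K W (xs @ x # ys)"
        using xy Bg linear_smult[OF q(1)] by (simp add: qe)
    qed (use Bg ec in auto)
  qed (use ec in auto)
  fix U :: "('a, 'u) module" and G
  assume U: "module K U" and G: "mlin K W {} U n G"
  interpret U: module K U by fact
  note Gc = mlin_closed[OF G]
  obtain l where l: "linear K ?F U l" "!!xs. xs \<in> ?B ==> l (?g xs) = G xs"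
    using free_mod_lift[OF U, of ?B G] Gc by blast
  have "l (?g (xs @ (x \<oplus> y) # ys) \<ominus>\<^bsub>?F\<^esub> (?g (xs @ x # ys) \<oplus>\<^bsub>?F\<^esub> ?g (xs @ y # ys))) = \<zero>\<^bsub>U\<^esub>"
    if x: "xs @ x # ys \<in> ?B" and y: "y IN W" for xs x y ys
    using g B[OF x] Bx[OF x] y x Gc linear_add[OF mlin_linear(1)[OF G x]]
    by (simp add: linear_uminus[OF l(1) F.module_axioms U] linear_add[OF l(1)] l(2) a_minus_def U.M.r_neg)
  moreover have "l (?g (xs @ (c \<odot> x) # ys) \<ominus>\<^bsub>?F\<^esub> c \<odot>\<^bsub>?F\<^esub> ?g (xs @ x # ys)) = \<zero>\<^bsub>U\<^esub>"
    if x: "xs @ x # ys \<in> ?B" and y: "c IN K" for xs x c ys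
    using g B[OF x] Bx[OF x] y x Gc linear_smult[OF mlin_linear(1)[OF G x]]
    by (simp add: linear_uminus[OF l(1) F.module_axioms U] linear_add[OF l(1)] linear_smult[OF l(1)] l(2) a_minus_def U.M.r_neg)
  ultimately have lR: "l r = \<zero>\<^bsub>U\<^esub>" if "r \<in> R" for r
    using that unfolding R_def by blast
  have "\<exists>h. linear K (tpow_mod K W n) U h \<and> (\<forall>b\<in>?B. h (mod_span K ?F R +>\<^bsub>?F\<^esub> ?g b) = G b)"
    unfolding T by (rule pres(4)[OF U l(1)]) (use l(2) lR in auto)
  then show "\<exists>h. linear K (tpow_mod K W n) U h \<and> (\<forall>xs\<in>?B. h (tpow_el K W xs) = G xs)"
    by (auto simp: e)
qed

section \<open>Dual bases\<close>

definition dual_basis ::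
    "('k, 'r) ring_scheme => ('k, 'v) module => 'v set => ('v => 'v => 'k) => bool" where
  "dual_basis K V S c \<longleftrightarrow> finite S \<and> S \<subseteq> carrier V \<and> (\<forall>s\<in>S. linear K V (regular_module K) (c s)) \<and>
     (\<forall>v\<in>carrier V. v = (\<Oplus>\<^bsub>V\<^esub>s\<in>S. c s v \<odot>\<^bsub>V\<^esub> s))"

lemma regular_module_simps [simp]:
  "carrier (regular_module K) = carrier K" "zero (regular_module K) = \<zero>\<^bsub>K\<^esub>"
  "add (regular_module K) = add K" "smult (regular_module K) = mult K"
  by (simp_all add: regular_module_def)

text \<open>A finite spanning set of least cardinality is independent: a relation with a nonzero
  coefficient could be solved for one generator, the scalars being a field. The evaluation map from
  the free module is then bijective, and the coordinates of its inverse are the functionals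
  \<open>c\<close>.\<close>

lemma ex_dual_basis:
  fixes V (structure)
  assumes K: "field K" and V: "module K V" and fd: "finite_dimensional K V"
  shows "\<exists>S c. dual_basis K V S c"
proof -
  interpret K: field K by fact
  interpret V: module K V by fact
  have Kc: "cring K" by (rule K.cring_axioms)
  define P where "P S \<longleftrightarrow> finite S \<and> spans K V S" for S
  have "\<exists>S. P S" using fd by (auto simp: P_def spans_def finite_dimensional_def)
  then obtain S where S: "P S" and min: "!!T. P T ==> card S \<le> card T"
    using ex_has_least_nat[of P _ card] by blast
  have fin: "finite S" and sp: "spans K V S" and Sc: "S \<subseteq> carrier V"
    using S by (auto simp: P_def spans_def)
  let ?F = "free_mod K S"
  interpret F: module K ?F by (rule free_mod[OF Kc])
  have Fc: "f IN ?F \<longleftrightarrow> f \<in> S \<rightarrow>\<^sub>E carrier K" for f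
    using fin by (auto simp: free_mod_def)
  define L where "L f = (\<Oplus>s\<in>S. f s \<odot> s)" for f
  have lin: "linear K ?F V L"
    unfolding L_def
  proof (rule linear_sum[OF _ F.module_axioms V])
    fix s assume s: "s \<in> S"
    then show "linear K ?F V (%f. f s \<odot> s)"
      using Sc by (intro linearI)
        (auto simp: free_mod_def V.smult_l_distr V.smult_assoc1 PiE_def Pi_def subsetD)
  qed
  have surj: "v \<in> L ` carrier ?F" if v: "v IN V" for v
    using sp V v
  proof (induct rule: spans_induct)
    case zero
    show ?case
      by (rule image_eqI[of _ _ "\<zero>\<^bsub>?F\<^esub>"]) (simp_all only: linear_zero[OF lin F.module_axioms V] F.M.zero_closed)
  next
    case (gen s)
    have "L (free_gen K S s) = (\<Oplus>t\<in>S. (if s = t then t else \<zero>))"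
      unfolding L_def by (rule V.M.finsum_cong') (use Sc in "auto simp: free_gen_def")
    also have "... = s" by (rule V.M.finsum_singleton[OF gen fin, of "%t. t"]) (use Sc in auto)
    finally show ?case using free_gen_closed[OF Kc gen] by (metis imageI)
  next
    case (add x y)
    then obtain f g where fg: "f IN ?F" "g IN ?F" "x = L f" "y = L g" by blast
    show ?case
      by (rule image_eqI[of _ _ "f \<oplus>\<^bsub>?F\<^esub> g"]) (simp_all only: fg linear_add[OF lin fg(1,2)] F.M.a_closed)
  next
    case (smult c x)
    then obtain f where f: "f IN ?F" "x = L f" by blast
    show ?case
      by (rule image_eqI[of _ _ "c \<odot>\<^bsub>?F\<^esub> f"]) (simp_all only: f linear_smult[OF lin smult(1) f(1)] F.smult_closed smult(1))
  qed
  have indep: "f = \<zero>\<^bsub>?F\<^esub>" if f: "f IN ?F" and 0: "L f = \<zero>" for f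
  proof (rule ccontr)
    assume "f ~= \<zero>\<^bsub>?F\<^esub>"
    then obtain t where t: "t \<in> S" "f t ~= \<zero>\<^bsub>K\<^esub>"
      using f by (auto simp: free_mod_def PiE_def extensional_def fun_eq_iff) metis
    have fc: "f s IN K" if "s \<in> S" for s using f that by (auto simp: Fc)
    let ?H = "mod_span K V (S - {t})"
    have H: "submodule ?H K V" using Sc by (intro mod_span_submodule[OF V]) auto
    note HE = V.submoduleE[OF H]
    \<comment> \<open>\<open>r\<close> is the relation without its term at \<open>t\<close>. It lies
      in the span of the other generators, and so does \<open>t\<close>, which is a scalar multiple
      of \<open>r\<close>.\<close>
    define r where "r = (\<Oplus>s\<in>S - {t}. f s \<odot> s)"
    have "(\<Oplus>s\<in>T. f s \<odot> s) \<in> ?H" if "finite T" "T \<subseteq> S - {t}" for T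
      using that
    proof induct
      case empty
      show ?case using subgroup.one_closed[OF submodule.axioms(1)[OF H]] by simp
    next
      case (insert x T)
      have "f x \<odot> x \<in> ?H"
        by (rule HE(4)) (use insert mod_span_subset[of "S - {t}" K V] fc in auto)
      moreover have "(\<Oplus>s\<in>insert x T. f s \<odot> s) = f x \<odot> x \<oplus> (\<Oplus>s\<in>T. f s \<odot> s)"
        by (rule V.M.finsum_insert) (use insert fc Sc in "auto simp: subsetD")
      ultimately show ?case using insert HE(5) by auto
    qed
    then have rH: "r \<in> ?H" unfolding r_def using fin by blast
    then have rc: "r IN V" using HE(1) by blast
    have tc: "t IN V" using t Sc by auto
    have "L f = (\<Oplus>s\<in>insert t (S - {t}). f s \<odot> s)"
      unfolding L_def using t by (simp add: insert_absorb)
    also have "... = f t \<odot> t \<oplus> r"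
      unfolding r_def by (rule V.M.finsum_insert) (use fin fc t Sc in "auto simp: subsetD")
    finally have "f t \<odot> t = \<ominus> r"
      using 0 fc[OF t(1)] tc rc by (metis V.M.minus_equality V.smult_closed)
    then have "f t \<odot> t \<in> ?H" using HE(3) rH by simp
    then have "inv\<^bsub>K\<^esub> (f t) \<odot> (f t \<odot> t) \<in> ?H"
      using HE(4) fc t K.field_Units by auto
    moreover have "inv\<^bsub>K\<^esub> (f t) \<odot> (f t \<odot> t) = t"
      using fc[OF t(1)] t tc K.field_Units by (subst V.smult_assoc1[symmetric]) auto
    ultimately have "t \<in> ?H" by simp
    then have "S \<subseteq> ?H" using mod_span_subset[of "S - {t}" K V] by auto
    then have "mod_span K V S \<subseteq> ?H" by (rule mod_span_least[OF H])
    then have "P (S - {t})"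
      using HE(1) sp fin Sc by (auto simp: P_def spans_def)
    from min[OF this] t fin show False
      by (metis card_Diff1_less not_le)
  qed
  have inj: "inj_on L (carrier ?F)"
  proof (rule inj_onI)
    fix f g assume fg: "f IN ?F" "g IN ?F" "L f = L g"
    then have "L (f \<ominus>\<^bsub>?F\<^esub> g) = \<zero>"
      using linear_closed[OF lin] by (simp add: linear_minus[OF lin F.module_axioms V] V.M.diff_eq_zero_iff)
    then have "f \<ominus>\<^bsub>?F\<^esub> g = \<zero>\<^bsub>?F\<^esub>" using indep fg by auto
    then show "f = g" using fg F.M.add.inv_solve_right[of "\<zero>\<^bsub>?F\<^esub>" f g] by (auto simp: a_minus_def)
  qed
  define J where "J = inv_into (carrier ?F) L"
  have J: "J v IN ?F" "L (J v) = v" if "v IN V" for v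
    using surj[OF that] by (auto simp: J_def inv_into_into f_inv_into_f)
  have JL: "J (L f) = f" if "f IN ?F" for f
    using that inj by (simp add: J_def)
  have Jlin: "linear K V ?F J"
  proof (rule linearI)
    fix x y assume "x IN V" "y IN V"
    then show "J (x \<oplus> y) = J x \<oplus>\<^bsub>?F\<^esub> J y"
      using J linear_add[OF lin] JL by (metis F.M.a_closed)
  next
    fix c x assume "c IN K" "x IN V"
    then show "J (c \<odot> x) = c \<odot>\<^bsub>?F\<^esub> J x"
      using J linear_smult[OF lin] JL by (metis F.smult_closed)
  qed (use J in auto)
  have "dual_basis K V S (%s v. J v s)"
    unfolding dual_basis_def
  proof (intro conjI ballI)
    fix s assume s: "s \<in> S"
    have ev: "linear K ?F (regular_module K) (%f. f s)"
      using s by (intro linearI) (auto simp: free_mod_def)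
    show "linear K V (regular_module K) (%v. J v s)"
      using linear_comp[OF Jlin ev] .
  next
    fix v assume "v IN V"
    then show "v = (\<Oplus>s\<in>S. J v s \<odot> s)" using J by (simp add: L_def)
  qed (use fin Sc in auto)
  then show ?thesis by blast
qed

text \<open>The coordinates are the maps \<open>id \<otimes> c s\<close>, with values in
  \<open>V\<close>. One dual basis of \<open>W\<close> can be used for several \<open>V\<close> at
  once, which will make the coordinates compatible with maps
  \<open>\<alpha> \<otimes> id\<close>.\<close>

lemma tensor_coordinates:
  fixes V (structure)
  assumes V: "module K V" and W: "module K W" and db: "dual_basis K W S c"
  shows "\<exists>C. (\<forall>s\<in>S. linear K (tensor_mod K V W) V (C s)) \<and>
     (\<forall>s\<in>S. \<forall>x\<in>carrier V. \<forall>y\<in>carrier W. C s (tensor_el K V W x y) = c s y \<odot> x) \<and>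
     (\<forall>\<xi>\<in>carrier (tensor_mod K V W). \<xi> = (\<Oplus>\<^bsub>tensor_mod K V W\<^esub>s\<in>S. tensor_el K V W (C s \<xi>) s))"
proof -
  interpret V: module K V by fact
  interpret W: module K W by fact
  have fin: "finite S" and Sc: "S \<subseteq> carrier W"
    and cl: "!!s. s \<in> S ==> linear K W (regular_module K) (c s)"
    and exp: "!!v. v IN W ==> v = (\<Oplus>\<^bsub>W\<^esub>s\<in>S. c s v \<odot>\<^bsub>W\<^esub> s)"
    using db by (auto simp: dual_basis_def)
  have cc: "c s y IN K" if "s \<in> S" "y IN W" for s y
    using linear_closed[OF cl that(2)] that by simp
  note T = tensor_mod[OF V W]
  interpret T: module K "tensor_mod K V W" by (rule T(1))
  have "\<exists>h. linear K (tensor_mod K V W) V h \<and>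
      (\<forall>x\<in>carrier V. \<forall>y\<in>carrier W. h (tensor_el K V W x y) = c s y \<odot> x)" if s: "s \<in> S" for s
  proof (rule T(5)[OF V])
    fix y assume y: "y IN W"
    show "linear K V V (%x. c s y \<odot> x)"
      by (rule linear_scale[OF linear_id V cc[OF s y]])
  next
    fix x assume x: "x IN V"
    have "linear K (regular_module K) V (%c. c \<odot> x)"
      using x by (intro linearI) (auto simp: V.smult_l_distr V.smult_assoc1)
    then show "linear K W V (%y. c s y \<odot> x)"
      by (rule linear_comp[OF cl[OF s]])
  qed
  then obtain C where C: "!!s. s \<in> S ==> linear K (tensor_mod K V W) V (C s)"
    "!!s x y. s \<in> S ==> x IN V ==> y IN W ==> C s (tensor_el K V W x y) = c s y \<odot> x"
    by metis
  have "\<xi> = (\<Oplus>\<^bsub>tensor_mod K V W\<^esub>s\<in>S. tensor_el K V W (C s \<xi>) s)" if "\<xi> IN tensor_mod K V W" for \<xi>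
  proof (rule linear_eq_spans[OF T(2) T(1) T(1) linear_id _ _ that])
    show "linear K (tensor_mod K V W) (tensor_mod K V W) (%\<xi>. \<Oplus>\<^bsub>tensor_mod K V W\<^esub>s\<in>S. tensor_el K V W (C s \<xi>) s)"
    proof (rule linear_sum[OF _ T(1) T(1)])
      fix s assume s: "s \<in> S"
      show "linear K (tensor_mod K V W) (tensor_mod K V W) (%\<xi>. tensor_el K V W (C s \<xi>) s)"
        by (rule linear_comp[OF C(1)[OF s]], rule T(3)) (use s Sc in auto)
    qed
    fix \<xi> assume "\<xi> \<in> (%(x, y). tensor_el K V W x y) ` (carrier V \<times> carrier W)"
    then obtain x y where xy: "x IN V" "y IN W" "\<xi> = tensor_el K V W x y" by auto
    have "\<xi> = tensor_el K V W x (\<Oplus>\<^bsub>W\<^esub>s\<in>S. c s y \<odot>\<^bsub>W\<^esub> s)" using exp xy by simp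
    also have "... = (\<Oplus>\<^bsub>tensor_mod K V W\<^esub>s\<in>S. tensor_el K V W x (c s y \<odot>\<^bsub>W\<^esub> s))"
      by (rule linear_finsum[OF T(4)[OF xy(1)] W T(1)]) (use cc xy Sc in "auto simp: subsetD")
    also have "... = (\<Oplus>\<^bsub>tensor_mod K V W\<^esub>s\<in>S. tensor_el K V W (C s \<xi>) s)"
    proof (rule T.M.finsum_cong')
      fix s assume s: "s \<in> S"
      then have sc: "s IN W" using Sc by auto
      show "tensor_el K V W x (c s y \<odot>\<^bsub>W\<^esub> s) = tensor_el K V W (C s \<xi>) s"
        using s sc xy cc by (simp add: C(2) linear_smult[OF T(4)] linear_smult[OF T(3)[OF sc]])
    qed (use C linear_closed[OF C(1)] tensor_el_closed[OF V W] Sc xy in "auto simp: cc")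
    finally show "\<xi> = (\<Oplus>\<^bsub>tensor_mod K V W\<^esub>s\<in>S. tensor_el K V W (C s \<xi>) s)" .
  qed
  with C show ?thesis by blast
qed

section \<open>Signs\<close>

lemma signed_closed: "module K W ==> x IN W ==> signed W j x IN W"
  using abelian_group.a_inv_closed module.axioms(2) by (fastforce simp: signed_def)

lemma signed_zero: "module K W ==> signed W j \<zero>\<^bsub>W\<^esub> = \<zero>\<^bsub>W\<^esub>"
  using abelian_group.minus_zero' module.axioms(2) by (fastforce simp: signed_def)

lemma linear_signed_comp:
  assumes W: "module K W" and "linear K V W f"
  shows "linear K V W (%x. signed W j (f x))"
  using assms linear_neg[OF assms(2) W] by (cases "even j") (simp_all add: signed_def)

lemma linear_signed_self: "module K W ==> linear K W W (signed W j)"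
  using linear_signed_comp[OF _ linear_id] .

lemma signed_0 [simp]: "signed W 0 x = x"
  by (simp add: signed_def)

lemma signed_1 [simp]: "signed W 1 x = \<ominus>\<^bsub>W\<^esub> x"
  by (simp add: signed_def)

lemma signed_signed:
  assumes "module K W" "x IN W"
  shows "signed W i (signed W j x) = signed W (i + j) x"
proof -
  interpret W: module K W by fact
  show ?thesis using assms by (auto simp: signed_def)
qed

lemma signed_Suc:
  assumes "module K W" "x IN W"
  shows "signed W (j + 1) x = \<ominus>\<^bsub>W\<^esub> signed W j x"
proof -
  interpret W: module K W by fact
  show ?thesis using assms by (auto simp: signed_def)
qed

lemma signed_add:
  assumes "module K W" "x IN W" "y IN W"
  shows "signed W j (x \<oplus>\<^bsub>W\<^esub> y) = signed W j x \<oplus>\<^bsub>W\<^esub> signed W j y"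
  by (rule linear_add[OF linear_signed_self[OF assms(1)] assms(2,3)])

lemma signed_cancel:
  assumes "module K W" "x IN W"
  shows "signed W j (signed W j x) = x"
  using assms by (simp add: signed_signed) (simp add: signed_def)

lemma (in abelian_group) add_diff_add:
  "[|x IN G; y IN G; u IN G; v IN G|] ==>
    (x \<oplus> y) \<ominus> (u \<oplus> v) = (x \<ominus> u) \<oplus> (y \<ominus> v)"
  by algebra

section \<open>The bar construction\<close>

locale hochschild_base =
  fixes K :: "'k ring" and A :: "('k, 'a) module" (structure)
  assumes field_K: "field K" and algebra_A: "assoc_algebra K A"
begin

sublocale K: field K by (rule field_K)
sublocale A: assoc_algebra K A by (rule algebra_A)

lemma cring_K: "cring K" by (rule K.cring_axioms)

lemma module_A: "module K A" by (rule A.module_axioms)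

lemma ring_A: "ring A" by (rule A.ring_axioms)

sublocale A: ring A by (rule ring_A)

lemma linear_mult_left: "a IN A ==> linear K A A (%x. a \<otimes> x)"
  by (rule linearI) (auto simp: A.smult_mult_right ring.ring_simprules[OF ring_A])

lemma linear_mult_right: "a IN A ==> linear K A A (%x. x \<otimes> a)"
  by (rule linearI) (auto simp: A.smult_mult_left ring.ring_simprules[OF ring_A])

lemma one_A: "\<one> IN A"
  by (rule ring.ring_simprules(6)[OF ring_A])

lemma mult_A: "a IN A ==> b IN A ==> a \<otimes> b IN A"
  by (rule ring.ring_simprules(5)[OF ring_A])

lemma assoc_A:
  "a IN A ==> b IN A ==> c IN A ==> (a \<otimes> b) \<otimes> c = a \<otimes> (b \<otimes> c)"
  by (rule ring.ring_simprules(11)[OF ring_A])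

lemma one_mult_A: "a IN A ==> \<one> \<otimes> a = a" "a IN A ==> a \<otimes> \<one> = a"
  by (auto simp: ring.ring_simprules(12)[OF ring_A] A.r_one)

abbreviation "BR \<equiv> bar_rel K A"
abbreviation "BM \<equiv> bar_mod K A"
abbreviation "BP \<equiv> bar_pow K A"
abbreviation "br \<equiv> bar K A"
abbreviation "Om \<equiv> nc_forms K A"
abbreviation "fm \<equiv> form K A"
abbreviation "tp n \<equiv> tuples (carrier A) n"
abbreviation "cl a \<equiv> BR +> a"
abbreviation "nlin \<equiv> mlin K A {\<one>}"
abbreviation "fl \<equiv> form_left K A"
abbreviation "fr \<equiv> form_right K A"
abbreviation "fa \<equiv> form_append K A"

lemma bar_relI: "c IN K ==> c \<odot> \<one> \<in> BR"
  by (auto simp: bar_rel_def)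

lemma bar_rel_submodule: "submodule BR K A"
proof (rule submoduleI'[OF module_A])
  show "BR \<subseteq> carrier A" by (auto simp: bar_rel_def one_A)
  show "\<zero> \<in> BR" using bar_relI[OF K.zero_closed] A.smult_l_null[OF one_A] by simp
  fix x y assume "x \<in> BR" "y \<in> BR"
  then obtain c d where cd: "c IN K" "d IN K" "x = c \<odot> \<one>" "y = d \<odot> \<one>"
    by (auto simp: bar_rel_def)
  then show "x \<oplus> y \<in> BR"
    using A.smult_l_distr[OF cd(1,2) one_A] bar_relI[OF K.a_closed[OF cd(1,2)]] by simp
next
  fix c x assume c: "c IN K" and "x \<in> BR"
  then obtain d where d: "d IN K" "x = d \<odot> \<one>" by (auto simp: bar_rel_def)
  then show "c \<odot> x \<in> BR"
    using A.smult_assoc1[OF c d(1) one_A] bar_relI[OF K.m_closed[OF c d(1)]] by simp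
qed

lemma one_bar_rel: "\<one> \<in> BR"
  using bar_relI[OF K.one_closed] A.smult_one[OF one_A] by simp

lemma bar_mod:
  shows "module K BM" "linear K A BM (%a. cl a)" "carrier BM = (%a. cl a) ` carrier A"
  using quot_mod[OF module_A bar_rel_submodule] by (simp_all add: bar_mod_def)

lemma cl_one: "cl \<one> = \<zero>\<^bsub>BM\<^esub>"
  using quot_mod(5)[OF module_A bar_rel_submodule one_A] one_bar_rel by (simp add: bar_mod_def)

lemma bar_mod_lift:
  assumes W: "module K W" and g: "linear K A W g" and g1: "g \<one> = \<zero>\<^bsub>W\<^esub>"
  shows "\<exists>h. linear K BM W h \<and> (\<forall>a\<in>carrier A. h (cl a) = g a)"
proof -
  interpret W: module K W by fact
  have "g x = \<zero>\<^bsub>W\<^esub>" if "x \<in> BR" for x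
    using that linear_smult[OF g _ one_A] g1 by (auto simp: bar_rel_def)
  then show ?thesis using quot_mod_lift[OF module_A bar_rel_submodule W g] by (simp add: bar_mod_def)
qed

text \<open>A section of \<open>A \<rightarrow> A/k\<close> as a map of sets, with no linearity
  claimed. It is inserted only into maps whose values depend on the classes alone.\<close>

definition rep :: "'a set => 'a" where
  "rep X = (SOME a. a IN A \<and> X = cl a)"

lemma rep:
  assumes "X IN BM" shows "rep X IN A" "cl (rep X) = X"
proof -
  have "\<exists>a. a IN A \<and> X = cl a" using assms by (auto simp: bar_mod(3))
  then have "rep X IN A \<and> X = cl (rep X)" unfolding rep_def by (rule someI_ex)
  then show "rep X IN A" "cl (rep X) = X" by auto
qed

text \<open>A linear map that vanishes at the unit factors through \<open>A/k\<close>, and in each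
  slot the factorization agrees with inserting representatives. Multilinearity in the classes is
  thus inherited although \<open>rep\<close> itself need not be linear.\<close>

lemma mlin_rep:
  assumes W: "module K W" and F: "nlin W n F"
  shows "mlin K BM {} W n (%l. F (map rep l)) \<and>
    (\<forall>l\<in>tp n. F (map rep (map (%a. cl a) l)) = F l)"
  using F
proof (induct n arbitrary: F)
  case (Suc n)
  have clc: "cl a IN BM" if "a IN A" for a using that by (auto simp: bar_mod(3))
  have IH: "mlin K BM {} W n (%l. F (a # map rep l))"
      "!!l. l \<in> tp n ==> F (a # map rep (map (%a. cl a) l)) = F (a # l)" if "a IN A" for a
    using Suc(1)[of "%l. F (a # l)"] Suc(2) that by auto
  have key: "\<exists>h. linear K BM W h \<and> (\<forall>a\<in>carrier A. h (cl a) = F (a # l))" if "l \<in> tp n" for l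
    using bar_mod_lift[OF W, of "%a. F (a # l)"] Suc(2) that by auto
  have "linear K BM W (%X. F (rep X # map rep l))" if l: "l \<in> tuples (carrier BM) n" for l
  proof -
    have "map rep l \<in> tp n" using l rep(1) by (auto simp: tuples_def)
    from key[OF this] obtain h where h: "linear K BM W h" "\<forall>a\<in>carrier A. h (cl a) = F (a # map rep l)"
      by blast
    show ?thesis
      by (rule linear_cong[OF h(1) bar_mod(1)]) (use h(2) rep in fastforce)
  qed
  moreover have "F (map rep (map (%a. cl a) l)) = F l" if l: "l \<in> tp (Suc n)" for l
  proof -
    obtain a m where am: "l = a # m" "a IN A" "m \<in> tp n" using l by (auto simp: tuples_Suc)
    obtain h where h: "\<forall>a\<in>carrier A. h (cl a) = F (a # m)" using key[OF am(3)] by blast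
    have "F (map rep (map (%a. cl a) l)) = F (rep (cl a) # m)"
      using am IH(2) rep(1)[OF clc] by simp
    also have "... = h (cl (rep (cl a)))" using h rep(1)[OF clc] am by simp
    also have "... = F l" using h rep(2)[OF clc] am by simp
    finally show ?thesis .
  qed
  ultimately show ?case using IH(1) rep(1) by simp
qed simp

lemma bar_pow_module: "module K (BP n)"
  unfolding bar_pow_def by (rule tpow_mod(1)[OF bar_mod(1)])

lemma bar_mlin: "nlin (BP n) n br"
proof -
  \<comment> \<open>Conversely, a multilinear map on classes becomes a normalized one when composed
    with \<open>A \<rightarrow> A/k\<close>, because the class of the unit is zero.\<close>
  have *: "nlin W n (%l. F (map (%a. cl a) l))" if "mlin K BM {} W n F" and W: "module K W"
    for W :: "('k, 'w) module" and F
    using that(1)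
  proof (induct n arbitrary: F)
    case (Suc n)
    have clc: "cl a IN BM" if "a IN A" for a using that by (auto simp: bar_mod(3))
    have "linear K A W (%a. F (cl a # map (%a. cl a) l)) \<and> F (cl \<one> # map (%a. cl a) l) = \<zero>\<^bsub>W\<^esub>"
      if l: "l \<in> tp n" for l
    proof -
      have "map (%a. cl a) l \<in> tuples (carrier BM) n" using l clc by (auto simp: tuples_def)
      then have lin: "linear K BM W (%X. F (X # map (%a. cl a) l))" using Suc(2) by auto
      show ?thesis
        using linear_comp[OF bar_mod(2) lin] linear_zero[OF lin bar_mod(1) W] by (simp add: cl_one)
    qed
    moreover have "nlin W n (%l. F (cl a # map (%a. cl a) l))" if "a IN A" for a
      by (rule Suc(1)[of "%l. F (cl a # l)"]) (use Suc(2) clc that in auto)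
    ultimately show ?case by simp
  qed simp
  show ?thesis
    using *[OF tpow_mod(3)[OF bar_mod(1)] tpow_mod(1)[OF bar_mod(1)]]
    unfolding bar_def bar_pow_def .
qed

lemma bar_closed: "l \<in> tp n ==> br l IN BP n"
  by (rule mlin_closed[OF bar_mlin])

lemma bar_spans: "spans K (BP n) (br ` tp n)"
proof -
  have "tpow_el K BM ` tuples (carrier BM) n = br ` tp n"
  proof (intro equalityI subsetI)
    fix x assume "x \<in> tpow_el K BM ` tuples (carrier BM) n"
    then obtain l where l: "l \<in> tuples (carrier BM) n" "x = tpow_el K BM l" by blast
    have "map (%a. cl a) (map rep l) = l"
      using l rep(2) by (auto simp: tuples_def intro!: map_idI)
    then have "x = br (map rep l)" using l by (simp add: bar_def)
    moreover have "map rep l \<in> tp n" using l rep(1) by (auto simp: tuples_def)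
    ultimately show "x \<in> br ` tp n" by blast
  next
    fix x assume "x \<in> br ` tp n"
    then show "x \<in> tpow_el K BM ` tuples (carrier BM) n"
      by (auto simp: bar_def tuples_def bar_mod(3) intro!: imageI)
  qed
  with tpow_mod(2)[OF bar_mod(1), of n] show ?thesis by (simp add: bar_pow_def)
qed

lemma bar_lift:
  assumes W: "module K W" and F: "nlin W n F"
  shows "\<exists>h. linear K (BP n) W h \<and> (\<forall>l\<in>tp n. h (br l) = F l)"
proof -
  note r = mlin_rep[OF W F]
  obtain h where h: "linear K (BP n) W h"
    "\<forall>X\<in>tuples (carrier BM) n. h (tpow_el K BM X) = F (map rep X)"
    using tpow_mod(4)[OF bar_mod(1) W conjunct1[OF r]] by (auto simp: bar_pow_def)
  have "h (br l) = F l" if l: "l \<in> tp n" for l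
  proof -
    have "map (%a. cl a) l \<in> tuples (carrier BM) n" using l by (auto simp: tuples_def bar_mod(3))
    then show ?thesis using h(2) r l by (auto simp: bar_def)
  qed
  with h show ?thesis by blast
qed

lemma linear_eq_bar:
  assumes "module K W" "linear K (BP n) W f" "linear K (BP n) W g"
    and "!!l. l \<in> tp n ==> f (br l) = g (br l)" and "x IN BP n"
  shows "f x = g x"
  by (rule linear_eq_spans[OF bar_spans bar_pow_module assms(1-3) _ assms(5)]) (use assms(4) in auto)

text \<open>The bar tensors whose entries all come from a finite spanning set \<open>S\<close> of
  \<open>A\<close> span the bar power, and there are finitely many of them.\<close>

lemma bar_pow_finite_dimensional:
  assumes "finite_dimensional K A"
  shows "finite_dimensional K (BP n)"
proof -
  obtain S where S: "finite S" "spans K A S"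
    using assms by (auto simp: finite_dimensional_def spans_def)
  have Sc: "S \<subseteq> carrier A" using S by (simp add: spans_def)
  interpret P: module K "BP n" by (rule bar_pow_module)
  have "spans K (BP n) (br ` tuples S n)"
  proof (rule spansI[OF bar_pow_module])
    show "br ` tuples S n \<subseteq> carrier (BP n)" using bar_closed Sc by (auto simp: tuples_def)
    fix H x assume H: "submodule H K (BP n)" and sub: "br ` tuples S n \<subseteq> H" and x: "x IN BP n"
    \<comment> \<open>\<open>ss\<close> is the part already taken from \<open>S\<close>. Each step
      expands the first entry of \<open>as\<close> in terms of \<open>S\<close> and moves it into
      \<open>ss\<close>.\<close>
    have key: "br (ss @ as) \<in> H"
      if "ss \<in> tuples S i" "as \<in> tp j" "i + j = n" for ss as i j
      using that
    proof (induct j arbitrary: as ss i)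
      case 0
      then show ?case using sub by auto
    next
      case (Suc j)
      obtain a m where am: "as = a # m" "a IN A" "m \<in> tp j" using Suc(3) by (auto simp: tuples_Suc)
      have n: "ss @ a # m \<in> tp n" using Suc(2-4) am Sc by (auto simp: tuples_def)
      have lin: "linear K A (BP n) (%a. br (ss @ a # m))" by (rule mlin_linear(1)[OF bar_mlin n])
      have "br (ss @ a # m) \<in> H" using S(2) module_A am(2)
      proof (induct rule: spans_induct)
        case zero
        then show ?case
          using linear_zero[OF lin module_A bar_pow_module] subgroup.one_closed[OF submodule.axioms(1)[OF H]]
          by simp
      next
        case (gen s)
        have "ss @ [s] \<in> tuples S (i + 1)" using Suc(2) gen by (auto simp: tuples_def)
        then show ?case using Suc(1)[of "ss @ [s]" "i + 1" m] am Suc(4) by simp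
      next
        case (add x y)
        then show ?case using linear_add[OF lin] P.submoduleE(5)[OF H] by simp
      next
        case (smult c x)
        then show ?case using linear_smult[OF lin] P.submoduleE(4)[OF H] by simp
      qed
      then show ?case using am by simp
    qed
    show "x \<in> H" using bar_spans bar_pow_module x
    proof (induct rule: spans_induct)
      case zero
      then show ?case using subgroup.one_closed[OF submodule.axioms(1)[OF H]] by simp
    next
      case (gen s)
      then show ?case using key[of "[]" 0 _ n] by auto
    next
      case (add x y)
      then show ?case using P.submoduleE(5)[OF H] by simp
    next
      case (smult c x)
      then show ?case using P.submoduleE(4)[OF H] by simp
    qed
  qed
  moreover have "tuples S n \<subseteq> {xs. set xs \<subseteq> S \<and> length xs = n}" by (auto simp: tuples_def)
  then have "finite (tuples S n)" using finite_lists_length_eq[OF S(1)] finite_subset by blast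
  ultimately show ?thesis
    unfolding finite_dimensional_def spans_def by blast
qed

subsection \<open>Tensor products with bar powers\<close>

text \<open>One construction covers three families: \<open>X = A\<close> gives the forms, the dual
  bimodule gives the Hochschild chains, and \<open>A \<otimes> A\<close> gives the bimodules
  \<open>F_p\<close>.\<close>

definition tb :: "('k, 'x) module => 'x => 'a list => ('x \<times> ('k, 'a) bar_tensor => 'k) set" where
  "tb X x l = tensor_el K X (BP (length l)) x (br l)"

abbreviation "TB X n \<equiv> tensor_mod K X (BP n)"

context
  fixes X :: "('k, 'x) module"
  assumes X: "module K X"
begin

lemma TB_module: "module K (TB X n)"
  by (rule tensor_mod(1)[OF X bar_pow_module])

lemma tb_linear: "l \<in> tp n ==> linear K X (TB X n) (%x. tb X x l)"
  unfolding tb_def using tensor_mod(3)[OF X bar_pow_module bar_closed] by (simp add: tuples_length)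

lemma tb_mlin:
  assumes "x IN X" shows "nlin (TB X n) n (tb X x)"
proof (rule mlin_cong[OF _ module_A])
  show "nlin (TB X n) n (%l. tensor_el K X (BP n) x (br l))"
    by (rule mlin_comp[OF bar_mlin tensor_mod(4)[OF X bar_pow_module assms] bar_pow_module TB_module])
qed (auto simp: tb_def tuples_length one_A)

lemma tb_closed: "x IN X ==> l \<in> tp n ==> tb X x l IN TB X n"
  by (rule mlin_closed[OF tb_mlin])

lemma tb_spans: "spans K (TB X n) ((%(x, l). tb X x l) ` (carrier X \<times> tp n))"
proof (rule spansI[OF TB_module])
  show "(%(x, l). tb X x l) ` (carrier X \<times> tp n) \<subseteq> carrier (TB X n)" using tb_closed by auto
  interpret P: module K "TB X n" by (rule TB_module)
  fix H w assume H: "submodule H K (TB X n)" and sub: "(%(x, l). tb X x l) ` (carrier X \<times> tp n) \<subseteq> H"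
    and w: "w IN TB X n"
  have 0: "\<zero>\<^bsub>TB X n\<^esub> \<in> H" using subgroup.one_closed[OF submodule.axioms(1)[OF H]] by simp
  have key: "tensor_el K X (BP n) x v \<in> H" if x: "x IN X" and v: "v IN BP n" for x v
    using bar_spans bar_pow_module v
  proof (induct rule: spans_induct)
    case zero
    then show ?case using linear_zero[OF tensor_mod(4)[OF X bar_pow_module x] bar_pow_module TB_module] 0 by simp
  next
    case (gen s)
    then obtain l where l: "l \<in> tp n" "s = br l" by blast
    then show ?case using sub x tuples_length[OF l(1)] by (auto simp: tb_def)
  next
    case (add u v)
    then show ?case using linear_add[OF tensor_mod(4)[OF X bar_pow_module x]] P.submoduleE(5)[OF H] by simp
  next
    case (smult c u)
    then show ?case using linear_smult[OF tensor_mod(4)[OF X bar_pow_module x]] P.submoduleE(4)[OF H] by simp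
  qed
  show "w \<in> H" using tensor_mod(2)[OF X bar_pow_module] TB_module w
  proof (induct rule: spans_induct)
    case (gen s)
    then show ?case using key by auto
  qed (use 0 P.submoduleE(4,5)[OF H] in auto)
qed

text \<open>The map is built in two stages, for fixed \<open>x\<close> by the universal property of
  the bar power and then by that of the tensor product. Linearity in \<open>x\<close> at an
  arbitrary element of the bar power is checked on bar tensors.\<close>

lemma tb_lift:
  assumes W: "module K W" and \<beta>1: "!!l. l \<in> tp n ==> linear K X W (%x. \<beta> x l)"
    and \<beta>2: "!!x. x IN X ==> nlin W n (\<beta> x)"
  shows "\<exists>h. linear K (TB X n) W h \<and> (\<forall>x\<in>carrier X. \<forall>l\<in>tp n. h (tb X x l) = \<beta> x l)"
proof -
  interpret X: module K X by (rule X)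
  have "\<exists>g. \<forall>x\<in>carrier X. linear K (BP n) W (g x) \<and> (\<forall>l\<in>tp n. g x (br l) = \<beta> x l)"
    using bar_lift[OF W \<beta>2] by meson
  then obtain g where g: "!!x. x IN X ==> linear K (BP n) W (g x)"
    "!!x l. x IN X ==> l \<in> tp n ==> g x (br l) = \<beta> x l" by blast
  have "\<exists>h. linear K (TB X n) W h \<and>
      (\<forall>x\<in>carrier X. \<forall>v\<in>carrier (BP n). h (tensor_el K X (BP n) x v) = g x v)"
  proof (rule tensor_mod(5)[OF X bar_pow_module W _ g(1)])
    fix v assume v: "v IN BP n"
    show "linear K X W (%x. g x v)"
    proof (rule linearI)
      fix x assume "x IN X" then show "g x v IN W" using linear_closed[OF g(1) v] by simp
    next
      fix x y assume xy: "x IN X" "y IN X"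
      show "g (x \<oplus>\<^bsub>X\<^esub> y) v = g x v \<oplus>\<^bsub>W\<^esub> g y v"
        by (rule linear_eq_bar[OF W g(1) linear_plus[OF g(1) g(1) W] _ v])
          (use xy g(2) linear_add[OF \<beta>1] in auto)
    next
      fix c x assume xy: "c IN K" "x IN X"
      show "g (c \<odot>\<^bsub>X\<^esub> x) v = c \<odot>\<^bsub>W\<^esub> g x v"
        by (rule linear_eq_bar[OF W g(1) linear_scale[OF g(1) W] _ v])
          (use xy g(2) linear_smult[OF \<beta>1] in auto)
    qed
  qed
  then obtain h where h: "linear K (TB X n) W h"
    "!!x v. x IN X ==> v IN BP n ==> h (tensor_el K X (BP n) x v) = g x v" by blast
  have "h (tb X x l) = \<beta> x l" if "x IN X" "l \<in> tp n" for x l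
    using h(2)[OF that(1) bar_closed[OF that(2)]] g(2)[OF that] tuples_length[OF that(2)] by (simp add: tb_def)
  with h(1) show ?thesis by blast
qed

lemma linear_eq_tb:
  assumes "module K W" "linear K (TB X n) W f" "linear K (TB X n) W g"
    and "!!x l. x IN X ==> l \<in> tp n ==> f (tb X x l) = g (tb X x l)" and "w IN TB X n"
  shows "f w = g w"
  by (rule linear_eq_spans[OF tb_spans TB_module assms(1-3) _ assms(5)]) (use assms(4) in auto)

end

lemma form_tb: "fm (a # l) = tb A a l"
  by (simp add: form_def tb_def)

lemma nc_forms_TB: "Om p = TB A p"
  by (simp add: nc_forms_def)

lemma Om_module: "module K (Om p)"
  unfolding nc_forms_TB by (rule TB_module[OF module_A])

lemma form_linear: "l \<in> tp p ==> linear K A (Om p) (%a. fm (a # l))"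
  unfolding nc_forms_TB form_tb by (rule tb_linear[OF module_A])

lemma form_mlin: "a IN A ==> nlin (Om p) p (%l. fm (a # l))"
  unfolding nc_forms_TB form_tb by (rule tb_mlin[OF module_A])

lemma form_closed: "l \<in> tp (Suc p) ==> fm l IN Om p"
  unfolding nc_forms_TB using tb_closed[OF module_A] by (auto simp: tuples_Suc form_tb)

lemma form_spans: "spans K (Om p) (fm ` tp (Suc p))"
proof -
  have "(%(x, l). tb A x l) ` (carrier A \<times> tp p) = fm ` tp (Suc p)"
    by (force simp: tuples_Suc form_tb image_iff)
  with tb_spans[OF module_A, of p] show ?thesis by (simp add: nc_forms_TB)
qed

lemma form_lift:
  assumes W: "module K W" and \<beta>1: "!!l. l \<in> tp p ==> linear K A W (%x. F (x # l))"
    and \<beta>2: "!!x. x IN A ==> nlin W p (%l. F (x # l))"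
  shows "\<exists>h. linear K (Om p) W h \<and> (\<forall>l\<in>tp (Suc p). h (fm l) = F l)"
proof -
  obtain h where "linear K (TB A p) W h" "\<forall>x\<in>carrier A. \<forall>l\<in>tp p. h (tb A x l) = F (x # l)"
    using tb_lift[OF module_A W, of p "%x l. F (x # l)"] assms by blast
  then show ?thesis
    unfolding nc_forms_TB by (intro exI[of _ h]) (auto simp: tuples_Suc form_tb)
qed

lemma linear_eq_form:
  assumes "module K W" "linear K (Om p) W f" "linear K (Om p) W g"
    and "!!l. l \<in> tp (Suc p) ==> f (fm l) = g (fm l)" and "w IN Om p"
  shows "f w = g w"
  by (rule linear_eq_spans[OF form_spans Om_module assms(1-3) _ assms(5)]) (use assms(4) in auto)

subsection \<open>Alternating sums of merged tuples\<close>

text \<open>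
  \<open>tsum W F H a [b\<^sub>1, ..., b\<^sub>n]\<close> is \<open>F [a b\<^sub>1, b\<^sub>2, ...] - F [a, b\<^sub>1 b\<^sub>2, ...] + ... \<plusminus> F [..., b\<^sub>n\<^sub>-\<^sub>1 b\<^sub>n] \<minusplus> H [a, b\<^sub>1, ..., b\<^sub>n]\<close>. The
  recursion replaces index manipulations in all the differentials below.
\<close>

fun tsum :: "('k, 'w) module => ('a list => 'w) => ('a list => 'w) => 'a => 'a list => 'w" where
  "tsum W F H a [] = H [a]"
| "tsum W F H a (b # bs) =
     F ((a \<otimes> b) # bs) \<ominus>\<^bsub>W\<^esub> tsum W (%l. F (a # l)) (%l. H (a # l)) b bs"

lemma tsum_closed:
  assumes W: "module K W"
    and "!!l. l \<in> tp n ==> F l IN W" "!!l. l \<in> tp (Suc n) ==> H l IN W"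
    and "a IN A" "l \<in> tp n"
  shows "tsum W F H a l IN W"
proof -
  interpret W: module K W by fact
  show ?thesis
    using assms(2-)
    by (induct n arbitrary: F H a l) (auto simp: tuples_Suc mult_A simp del: W.M.minus_closed intro!: W.M.minus_closed)
qed

lemma tsum_cong:
  assumes "!!l. l \<in> tp n ==> F l = F' l" "!!l. l \<in> tp (Suc n) ==> H l = H' l"
    and "a IN A" "l \<in> tp n"
  shows "tsum W F H a l = tsum W F' H' a l"
  using assms
proof (induct n arbitrary: F H F' H' a l)
  case 0
  then show ?case by simp
next
  case (Suc n)
  obtain b bs where l: "l = b # bs" "b IN A" "bs \<in> tp n" using Suc by (auto simp: tuples_Suc)
  have "tsum W (%l. F (a # l)) (%l. H (a # l)) b bs = tsum W (%l. F' (a # l)) (%l. H' (a # l)) b bs"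
    by (rule Suc(1)) (use Suc(2-5) l in auto)
  then show ?case using Suc(2-5) l by (simp add: mult_A)
qed

lemma tsum_map:
  assumes g: "linear K W U g" and W: "module K W" and U: "module K U"
    and "!!l. l \<in> tp n ==> F l IN W" "!!l. l \<in> tp (Suc n) ==> H l IN W"
    and "a IN A" "l \<in> tp n"
  shows "g (tsum W F H a l) = tsum U (%l. g (F l)) (%l. g (H l)) a l"
  using assms(4-)
proof (induct n arbitrary: F H a l)
  case 0
  then show ?case by simp
next
  case (Suc n)
  obtain b bs where l: "l = b # bs" "b IN A" "bs \<in> tp n" using Suc by (auto simp: tuples_Suc)
  have "tsum W (%l. F (a # l)) (%l. H (a # l)) b bs IN W"
    by (rule tsum_closed[OF W, of n]) (use Suc(2-5) l in auto)
  moreover have "g (tsum W (%l. F (a # l)) (%l. H (a # l)) b bs) =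
      tsum U (%l. g (F (a # l))) (%l. g (H (a # l))) b bs"
    by (rule Suc(1)) (use Suc(2-5) l in auto)
  ultimately show ?case using Suc(2-5) l by (simp add: mult_A linear_minus[OF g W U])
qed

lemma tsum_add:
  assumes W: "module K W"
    and "!!l. l \<in> tp n ==> F l IN W" "!!l. l \<in> tp (Suc n) ==> H l IN W"
    and "!!l. l \<in> tp n ==> F' l IN W" "!!l. l \<in> tp (Suc n) ==> H' l IN W"
    and "a IN A" "l \<in> tp n"
  shows "tsum W (%l. F l \<oplus>\<^bsub>W\<^esub> F' l) (%l. H l \<oplus>\<^bsub>W\<^esub> H' l) a l = tsum W F H a l \<oplus>\<^bsub>W\<^esub> tsum W F' H' a l"
proof -
  interpret W: module K W by fact
  show ?thesis
    using assms(2-)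
  proof (induct n arbitrary: F H F' H' a l)
    case 0
    then show ?case by simp
  next
    case (Suc n)
    obtain b bs where l: "l = b # bs" "b IN A" "bs \<in> tp n" using Suc by (auto simp: tuples_Suc)
    have t: "tsum W (%l. F (a # l)) (%l. H (a # l)) b bs IN W"
      "tsum W (%l. F' (a # l)) (%l. H' (a # l)) b bs IN W"
      by (rule tsum_closed[OF W, of n]; use Suc(2-7) l in auto)+
    have f: "F ((a \<otimes> b) # bs) IN W" "F' ((a \<otimes> b) # bs) IN W"
      using Suc(2-7) l by (auto simp: mult_A)
    have *: "tsum W (%l. F (a # l) \<oplus>\<^bsub>W\<^esub> F' (a # l)) (%l. H (a # l) \<oplus>\<^bsub>W\<^esub> H' (a # l)) b bs =
      tsum W (%l. F (a # l)) (%l. H (a # l)) b bs \<oplus>\<^bsub>W\<^esub> tsum W (%l. F' (a # l)) (%l. H' (a # l)) b bs"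
      by (rule Suc(1)) (use Suc(2-7) l in auto)
    show ?case using W.M.add_diff_add[OF f t] unfolding l tsum.simps * .
  qed
qed

lemma tsum_diff:
  assumes W: "module K W"
    and "!!l. l \<in> tp n ==> F l IN W" "!!l. l \<in> tp (Suc n) ==> H l IN W"
    and "!!l. l \<in> tp n ==> F' l IN W" "!!l. l \<in> tp (Suc n) ==> H' l IN W"
    and "a IN A" "l \<in> tp n"
  shows "tsum W (%l. F l \<ominus>\<^bsub>W\<^esub> F' l) (%l. H l \<ominus>\<^bsub>W\<^esub> H' l) a l = tsum W F H a l \<ominus>\<^bsub>W\<^esub> tsum W F' H' a l"
proof -
  interpret W: module K W by fact
  have neg: "linear K W W (%x. \<ominus>\<^bsub>W\<^esub> x)" by (rule linear_neg[OF linear_id W])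
  show ?thesis
    unfolding a_minus_def using assms(2-)
    by (subst tsum_add[OF W, of n]) (auto simp: tsum_map[OF neg W W, of n])
qed

lemma tsum_zero:
  assumes W: "module K W" and "a IN A" "l \<in> tp n"
    and "!!l. l \<in> tp n ==> F l = \<zero>\<^bsub>W\<^esub>" "!!l. l \<in> tp (Suc n) ==> H l = \<zero>\<^bsub>W\<^esub>"
  shows "tsum W F H a l = \<zero>\<^bsub>W\<^esub>"
proof -
  interpret W: module K W by fact
  have "tsum W F H a l = tsum W (%l. \<zero>\<^bsub>W\<^esub>) (%l. \<zero>\<^bsub>W\<^esub>) a l"
    by (rule tsum_cong[of n]) (use assms in auto)
  also have "... = \<zero>\<^bsub>W\<^esub>"
    by (induct l arbitrary: a) (auto simp: a_minus_def W.M.minus_zero')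
  finally show ?thesis .
qed

text \<open>The hypothesis under which \<open>tsum\<close> is compatible with the normalization.\<close>

fun tsum_ok :: "('k, 'w) module => nat => ('a list => 'w) => ('a list => 'w) => bool" where
  "tsum_ok W 0 F H \<longleftrightarrow> F [] IN W \<and> linear K A W (%a. H [a]) \<and> H [\<one>] = F []"
| "tsum_ok W (Suc n) F H \<longleftrightarrow>
     (\<forall>a\<in>carrier A. tsum_ok W n (%l. F (a # l)) (%l. H (a # l))) \<and>
     (\<forall>l\<in>tp n. linear K A W (%a. F (a # l)) \<and> F (\<one> # l) = \<zero>\<^bsub>W\<^esub>) \<and>
     (\<forall>l\<in>tp (Suc n). linear K A W (%a. H (a # l)) \<and> H (\<one> # l) = \<zero>\<^bsub>W\<^esub>)"

lemma tsum_ok_mlin: "tsum_ok W n F H ==> nlin W n F"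
  by (induct n arbitrary: F H) auto

lemma tsum_ok_mlin2: "tsum_ok W n F H ==> mlin K A {} W (Suc n) H"
proof (induct n arbitrary: F H)
  case (Suc n)
  have "mlin K A {} W (Suc n) (%l. H (a # l))" if "a IN A" for a
    by (rule Suc(1)[of "%l. F (a # l)"]) (use Suc(2) that in simp)
  moreover have "linear K A W (%a. H (a # l))" if "l \<in> tp (Suc n)" for l
    using Suc(2) that by simp
  ultimately show ?case by (subst mlin.simps(2)) (intro conjI ballI; simp only: empty_iff)
qed (auto dest: linear_closed)

text \<open>A unit in the first place leaves only the term \<open>F l\<close>, since the others have
  it as an entry. A unit further on makes two consecutive terms equal with opposite signs.\<close>

lemma tsum_mlin:
  assumes W: "module K W" and ok: "tsum_ok W n F H"
  shows "(\<forall>l\<in>tp n. linear K A W (%a. tsum W F H a l) \<and> tsum W F H \<one> l = F l) \<and>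
    (\<forall>a\<in>carrier A. nlin W n (tsum W F H a))"
  using ok
proof (induct n arbitrary: F H)
  case 0
  then show ?case by (auto dest: linear_closed)
next
  case (Suc n)
  interpret W: module K W by fact
  note Fc = mlin_closed[OF tsum_ok_mlin[OF Suc(2)]]
  note Hc = mlin_closed[OF tsum_ok_mlin2[OF Suc(2)]]
  have IH: "(\<forall>l\<in>tp n. linear K A W (%b. tsum W (%l. F (a # l)) (%l. H (a # l)) b l) \<and>
      tsum W (%l. F (a # l)) (%l. H (a # l)) \<one> l = F (a # l)) \<and>
    (\<forall>b\<in>carrier A. nlin W n (tsum W (%l. F (a # l)) (%l. H (a # l)) b))"
    if "a IN A" for a
    by (rule Suc(1)) (use Suc(2) that in simp)
  have F1: "linear K A W (%a. F (a # l))" "F (\<one> # l) = \<zero>\<^bsub>W\<^esub>" if "l \<in> tp n" for l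
    using Suc(2) that by auto
  have H1: "linear K A W (%a. H (a # l))" "H (\<one> # l) = \<zero>\<^bsub>W\<^esub>" if "l \<in> tp (Suc n)" for l
    using Suc(2) that by auto
  have tc: "tsum W (%l. F (a # l)) (%l. H (a # l)) b bs IN W"
    if "a IN A" "b IN A" "bs \<in> tp n" for a b bs
    by (rule tsum_closed[OF W, of n]) (use that Fc Hc in auto)
  have lin: "linear K A W (%a. tsum W (%l. F (a # l)) (%l. H (a # l)) b bs)"
    if b: "b IN A" "bs \<in> tp n" for b bs
  proof (rule linearI)
    fix x y assume xy: "x IN A" "y IN A"
    have "tsum W (%l. F ((x \<oplus> y) # l)) (%l. H ((x \<oplus> y) # l)) b bs =
       tsum W (%l. F (x # l) \<oplus>\<^bsub>W\<^esub> F (y # l)) (%l. H (x # l) \<oplus>\<^bsub>W\<^esub> H (y # l)) b bs"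
      by (rule tsum_cong[of n]) (use b xy linear_add[OF F1(1)] linear_add[OF H1(1)] in auto)
    also have "... = tsum W (%l. F (x # l)) (%l. H (x # l)) b bs \<oplus>\<^bsub>W\<^esub> tsum W (%l. F (y # l)) (%l. H (y # l)) b bs"
      by (rule tsum_add[OF W, of n]) (use b xy Fc Hc in auto)
    finally show "tsum W (%l. F ((x \<oplus> y) # l)) (%l. H ((x \<oplus> y) # l)) b bs = ..." .
  next
    fix c x assume xy: "c IN K" "x IN A"
    have "tsum W (%l. F ((c \<odot> x) # l)) (%l. H ((c \<odot> x) # l)) b bs =
       tsum W (%l. c \<odot>\<^bsub>W\<^esub> F (x # l)) (%l. c \<odot>\<^bsub>W\<^esub> H (x # l)) b bs"
      by (rule tsum_cong[of n]) (use b xy linear_smult[OF F1(1)] linear_smult[OF H1(1)] in auto)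
    also have "... = c \<odot>\<^bsub>W\<^esub> tsum W (%l. F (x # l)) (%l. H (x # l)) b bs"
      by (rule tsum_map[OF linear_scale[OF linear_id W xy(1)] W W, of n, symmetric])
        (use b xy Fc Hc in auto)
    finally show "tsum W (%l. F ((c \<odot> x) # l)) (%l. H ((c \<odot> x) # l)) b bs = ..." .
  qed (use tc b in auto)
  show ?case
  proof (intro conjI ballI)
    fix l assume "l \<in> tp (Suc n)"
    then obtain b bs where l: "l = b # bs" "b IN A" "bs \<in> tp n" by (auto simp: tuples_Suc)
    show "linear K A W (%a. tsum W F H a l)"
      unfolding l tsum.simps
      by (intro linear_diff[OF _ lin[OF l(2,3)] W] linear_comp[OF linear_mult_right[OF l(2)] F1(1)[OF l(3)]])
    have "tsum W (%l. F (\<one> # l)) (%l. H (\<one> # l)) b bs = \<zero>\<^bsub>W\<^esub>"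
      by (rule tsum_zero[OF W, of _ _ n]) (use l F1 H1 in auto)
    then show "tsum W F H \<one> l = F l" using l Fc by (simp add: one_mult_A a_minus_def W.M.minus_zero')
  next
    fix a assume a: "a IN A"
    have Fa: "nlin W n (%l. F (b # l))" if "b IN A" for b
      using tsum_ok_mlin[OF Suc(2)] that by simp
    show "nlin W (Suc n) (tsum W F H a)"
      unfolding mlin.simps(2) tsum.simps
    proof (intro conjI ballI)
      fix b assume b: "b IN A"
      show "nlin W n (%l. F ((a \<otimes> b) # l) \<ominus>\<^bsub>W\<^esub> tsum W (%l. F (a # l)) (%l. H (a # l)) b l)"
        using IH[OF a] b by (intro mlin_diff[OF W] Fa) (auto simp: mult_A a)
    next
      fix l assume l: "l \<in> tp n"
      show "linear K A W (%b. F ((a \<otimes> b) # l) \<ominus>\<^bsub>W\<^esub> tsum W (%l. F (a # l)) (%l. H (a # l)) b l)"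
        using IH[OF a] l
        by (intro linear_diff[OF _ _ W] linear_comp[OF linear_mult_left[OF a] F1(1)[OF l]]) auto
      fix z assume "z \<in> {\<one>}"
      then show "F ((a \<otimes> z) # l) \<ominus>\<^bsub>W\<^esub> tsum W (%l. F (a # l)) (%l. H (a # l)) z l = \<zero>\<^bsub>W\<^esub>"
        using IH[OF a] l a Fc by (simp add: one_mult_A W.M.diff_eq_zero_iff)
    qed
  qed
qed

text \<open>\<open>L\<close> supplies the outer term on the left. At a unit in first place it equals
  \<open>F l\<close>, which is also what \<open>tsum\<close> contributes there, so the difference is
  normalized. This is why the differentials preserve normalized maps.\<close>

lemma tsum_differential_mlin:
  assumes W: "module K W" and ok: "tsum_ok W n F H"
    and L1: "!!a. a IN A ==> nlin W n (L a)"
    and L2: "!!l. l \<in> tp n ==> linear K A W (%a. L a l)"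
    and L3: "!!l. l \<in> tp n ==> L \<one> l = F l"
  shows "nlin W (Suc n) (%l. L (hd l) (tl l) \<ominus>\<^bsub>W\<^esub> tsum W F H (hd l) (tl l))"
proof -
  interpret W: module K W by fact
  note t = tsum_mlin[OF W ok]
  note Fc = mlin_closed[OF tsum_ok_mlin[OF ok]]
  show ?thesis
    using t L1 L2 by (auto intro!: mlin_diff[OF W] linear_diff[OF _ _ W] simp: L3 Fc W.M.diff_eq_zero_iff)
qed

lemma merge_at_0: "merge_at A 0 (a # b # l) = (a \<otimes> b) # l"
  by (simp add: merge_at_def)

lemma merge_at_Suc: "merge_at A (Suc i) (a # l) = a # merge_at A i l"
  by (simp add: merge_at_def)

lemma merge_at_closed:
  "l \<in> tp (Suc n) ==> i < n ==> merge_at A i l \<in> tp n"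
proof (induct i arbitrary: l n)
  case 0
  then obtain m where "n = Suc m" by (cases n) auto
  with 0 show ?case by (auto simp: tuples_Suc merge_at_0 mult_A)
next
  case (Suc i)
  then obtain m where m: "n = Suc m" by (cases n) auto
  with Suc show ?case by (auto simp: tuples_Suc[of _ _ "Suc m"] merge_at_Suc)
qed

text \<open>The bridge from the indexed sums of the definitions to the recursion: the summand
  \<open>j = 1\<close> is the head of \<open>tsum\<close>, and shifting the other indices by one
  reverses all their signs.\<close>

lemma tsum_eq_sum:
  assumes W: "module K W"
    and "!!l. l \<in> tp n ==> F l IN W" "!!l. l \<in> tp (Suc n) ==> H l IN W"
    and "a IN A" "l \<in> tp n"
  shows "(\<Oplus>\<^bsub>W\<^esub>j\<in>{1..n}. signed W (int j) (F (merge_at A (j - 1) (a # l)))) \<oplus>\<^bsub>W\<^esub>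
    signed W (int n + 1) (H (a # l)) = \<ominus>\<^bsub>W\<^esub> tsum W F H a l"
proof -
  interpret W: module K W by fact
  show ?thesis
    using assms(2-)
  proof (induct n arbitrary: F H a l)
    case 0
    then show ?case by simp
  next
    case (Suc n)
    obtain b bs where l: "l = b # bs" "b IN A" "bs \<in> tp n" using Suc by (auto simp: tuples_Suc)
    let ?G = "%j. F (a # merge_at A (j - 1) (b # bs))"
    have Gc: "?G j IN W" if "j \<in> {1..n}" for j
      using that Suc(2,4) l merge_at_closed[of "b # bs" n "j - 1"] by auto
    have "(\<Oplus>\<^bsub>W\<^esub>j\<in>{1..Suc n}. signed W (int j) (F (merge_at A (j - 1) (a # l)))) =
      (\<Oplus>\<^bsub>W\<^esub>j\<in>insert 1 (Suc ` {1..n}). signed W (int j) (F (merge_at A (j - 1) (a # l))))"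
    proof (rule arg_cong2[where f = "finsum W", OF refl])
      show "{1..Suc n} = insert 1 (Suc ` {1..n})"
        by (auto simp: image_iff)
    qed
    also have "... = signed W 1 (F (merge_at A 0 (a # l))) \<oplus>\<^bsub>W\<^esub>
        (\<Oplus>\<^bsub>W\<^esub>j\<in>Suc ` {1..n}. signed W (int j) (F (merge_at A (j - 1) (a # l))))"
      using merge_at_closed[of "a # l" "Suc n"] Suc(2,4,5) l
      by (subst W.M.finsum_insert) (auto intro!: signed_closed[OF W])
    also have "(\<Oplus>\<^bsub>W\<^esub>j\<in>Suc ` {1..n}. signed W (int j) (F (merge_at A (j - 1) (a # l)))) =
        (\<Oplus>\<^bsub>W\<^esub>j\<in>{1..n}. signed W (int (Suc j)) (F (merge_at A j (a # l))))"
      using merge_at_closed[of "a # l" "Suc n"] Suc(2,4,5) l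
      by (subst W.M.finsum_reindex) (auto intro!: signed_closed[OF W])
    also have "... = (\<Oplus>\<^bsub>W\<^esub>j\<in>{1..n}. \<ominus>\<^bsub>W\<^esub> signed W (int j) (?G j))"
    proof (rule W.M.finsum_cong')
      fix j assume j: "j \<in> {1..n}"
      then obtain i where i: "j = Suc i" by (cases j) auto
      show "signed W (int (Suc j)) (F (merge_at A j (a # l))) = \<ominus>\<^bsub>W\<^esub> signed W (int j) (?G j)"
        using signed_Suc[OF W Gc[OF j], of "int j"] i l by (simp add: merge_at_Suc add.commute)
    qed (use Gc in "auto intro!: signed_closed[OF W]")
    also have "... = \<ominus>\<^bsub>W\<^esub> (\<Oplus>\<^bsub>W\<^esub>j\<in>{1..n}. signed W (int j) (?G j))"
      by (rule linear_finsum[OF linear_neg[OF linear_id W] W W, symmetric])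
        (use Gc in "auto intro!: signed_closed[OF W]")
    finally have 1: "(\<Oplus>\<^bsub>W\<^esub>j\<in>{1..Suc n}. signed W (int j) (F (merge_at A (j - 1) (a # l)))) =
       \<ominus>\<^bsub>W\<^esub> F ((a \<otimes> b) # bs) \<oplus>\<^bsub>W\<^esub> \<ominus>\<^bsub>W\<^esub> (\<Oplus>\<^bsub>W\<^esub>j\<in>{1..n}. signed W (int j) (?G j))"
      using l by (simp add: merge_at_0)
    have Hc: "H (a # b # bs) IN W" using Suc(2-5) l by auto
    have 2: "signed W (int (Suc n) + 1) (H (a # l)) = \<ominus>\<^bsub>W\<^esub> signed W (int n + 1) (H (a # b # bs))"
      using signed_Suc[OF W Hc, of "int n + 1"] l by (simp add: add.commute)
    have 3: "(\<Oplus>\<^bsub>W\<^esub>j\<in>{1..n}. signed W (int j) (?G j)) \<oplus>\<^bsub>W\<^esub> signed W (int n + 1) (H (a # b # bs)) =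
      \<ominus>\<^bsub>W\<^esub> tsum W (%l. F (a # l)) (%l. H (a # l)) b bs"
      by (rule Suc(1)) (use Suc(2-5) l in auto)
    have c: "(\<Oplus>\<^bsub>W\<^esub>j\<in>{1..n}. signed W (int j) (?G j)) IN W"
      using Gc by (auto intro!: signed_closed[OF W] W.M.finsum_closed)
    have c2: "signed W (int n + 1) (H (a # b # bs)) IN W" by (rule signed_closed[OF W Hc])
    have c3: "F ((a \<otimes> b) # bs) IN W" using Suc(2-5) l by (auto simp: mult_A)
    have c4: "tsum W (%l. F (a # l)) (%l. H (a # l)) b bs IN W"
      by (rule tsum_closed[OF W, of n]) (use Suc(2-5) l in auto)
    have "(\<ominus>\<^bsub>W\<^esub> f \<oplus>\<^bsub>W\<^esub> \<ominus>\<^bsub>W\<^esub> s) \<oplus>\<^bsub>W\<^esub> \<ominus>\<^bsub>W\<^esub> h = \<ominus>\<^bsub>W\<^esub> (f \<ominus>\<^bsub>W\<^esub> t)"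
      if "f IN W" "s IN W" "h IN W" "t IN W" "s \<oplus>\<^bsub>W\<^esub> h = \<ominus>\<^bsub>W\<^esub> t" for f s h t
    proof -
      have "(\<ominus>\<^bsub>W\<^esub> f \<oplus>\<^bsub>W\<^esub> \<ominus>\<^bsub>W\<^esub> s) \<oplus>\<^bsub>W\<^esub> \<ominus>\<^bsub>W\<^esub> h = \<ominus>\<^bsub>W\<^esub> (f \<oplus>\<^bsub>W\<^esub> (s \<oplus>\<^bsub>W\<^esub> h))"
        using that(1-4) by (simp add: W.M.minus_add W.M.a_ac)
      then show ?thesis using that by (simp add: a_minus_def)
    qed
    from this[OF c3 c c2 c4 3] show ?case unfolding 1 2 unfolding l by simp
  qed
qed

end

lemma (in abelian_group) diff_telescope:
  "[|x IN G; y IN G; z IN G|] ==> (x \<ominus> y) \<ominus> (z \<ominus> y) = x \<ominus> z"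
  by algebra

lemma (in abelian_group) diff_diff_swap:
  "[|x IN G; y IN G; z IN G; u IN G|] ==>
    (x \<ominus> y) \<ominus> ((x \<ominus> z) \<ominus> (y \<ominus> z)) = \<zero>"
  by algebra

lemma tuples_snoc: "xs \<in> tuples X (Suc n) \<longleftrightarrow> (\<exists>l\<in>tuples X n. \<exists>a\<in>X. xs = l @ [a])"
proof
  assume "xs \<in> tuples X (Suc n)"
  then show "\<exists>l\<in>tuples X n. \<exists>a\<in>X. xs = l @ [a]"
    by (intro bexI[of _ "butlast xs"] bexI[of _ "last xs"])
      (auto simp: tuples_def dest: in_set_butlastD, metis append_butlast_last_id length_0_conv nat.distinct(1),
       metis last_in_set length_0_conv nat.distinct(1) subsetD)
qed (auto simp: tuples_def)

lemma tuples_snocI: "l \<in> tuples X n ==> a \<in> X ==> l @ [a] \<in> tuples X (Suc n)"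
  by (auto simp: tuples_def)

context hochschild_base
begin

lemma mlin_snoc:
  assumes "mlin K V Z W (Suc n) F" and b: "b IN V"
  shows "mlin K V Z W n (%l. F (l @ [b]))"
  using assms(1)
proof (induct n arbitrary: F)
  case 0
  then show ?case using b by (auto dest: linear_closed)
next
  case (Suc n)
  have IH: "mlin K V Z W n (%l. F (a # l @ [b]))" if "a IN V" for a
    by (rule Suc(1)[of "%l. F (a # l)"]) (use Suc(2) that in simp)
  have "linear K V W (%a. F (a # l)) \<and> (\<forall>z\<in>Z. F (z # l) = \<zero>\<^bsub>W\<^esub>)" if "l \<in> tuples (carrier V) (Suc n)" for l
    using Suc(2) that unfolding mlin.simps(2)[of _ _ _ _ "Suc n"] by blast
  then have "linear K V W (%a. F (a # l @ [b])) \<and> (\<forall>z\<in>Z. F (z # l @ [b]) = \<zero>\<^bsub>W\<^esub>)"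
    if "l \<in> tuples (carrier V) n" for l
    using tuples_snocI[OF that b] by simp
  with IH show ?case by simp
qed

lemma mlin_last_linear:
  assumes "mlin K V Z W (Suc n) F" and "l \<in> tuples (carrier V) n" and "b IN V"
  shows "linear K V W (%b. F (l @ [b]))"
  by (rule mlin_linear(1)[OF assms(1)]) (rule tuples_snocI[OF assms(2,3)])

lemma tsum_ok_cong:
  assumes "tsum_ok W n F H" and "!!l. l \<in> tp n ==> F l = F' l" "!!l. l \<in> tp (Suc n) ==> H l = H' l"
  shows "tsum_ok W n F' H'"
  using assms
proof (induct n arbitrary: F H F' H')
  case 0
  have "linear K A W (%a. H' [a])"
    by (rule linear_cong[of K A W "%a. H [a]", OF _ module_A]) (use 0 in auto)
  moreover have "F [] = F' []" "H [\<one>] = H' [\<one>]" using 0(2,3) one_A by auto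
  ultimately show ?case using 0(1) by simp
next
  case (Suc n)
  have 1: "tsum_ok W n (%l. F' (a # l)) (%l. H' (a # l))" if "a IN A" for a
    by (rule Suc(1)[of "%l. F (a # l)" "%l. H (a # l)"]) (use Suc(2-4) that in auto)
  have 2: "linear K A W (%a. F' (a # l)) \<and> F' (\<one> # l) = \<zero>\<^bsub>W\<^esub>" if l: "l \<in> tp n" for l
  proof
    show "linear K A W (%a. F' (a # l))"
      by (rule linear_cong[of K A W "%a. F (a # l)", OF _ module_A]) (use Suc(2,3) l in auto)
    have "F (\<one> # l) = F' (\<one> # l)" by (rule Suc(3)) (use l one_A in auto)
    then show "F' (\<one> # l) = \<zero>\<^bsub>W\<^esub>" using Suc(2) l by auto
  qed
  have 3: "linear K A W (%a. H' (a # l)) \<and> H' (\<one> # l) = \<zero>\<^bsub>W\<^esub>" if l: "l \<in> tp (Suc n)" for l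
  proof
    show "linear K A W (%a. H' (a # l))"
      by (rule linear_cong[of K A W "%a. H (a # l)", OF _ module_A]) (use Suc(2,4) l in auto)
    have "H (\<one> # l) = H' (\<one> # l)" by (rule Suc(4)) (use l one_A in auto)
    then show "H' (\<one> # l) = \<zero>\<^bsub>W\<^esub>" using Suc(2) l by auto
  qed
  show ?case using 1 2 3 by simp
qed

text \<open>The shape of right multiplication of a form by \<open>b\<close>: every term but the last
  keeps \<open>b\<close> as a separate entry, and the last one absorbs it. With a unit as last entry
  both versions agree.\<close>

lemma tsum_ok_mult_last:
  assumes "nlin W (Suc n) G" and b: "b IN A"
  shows "tsum_ok W n (%m. G (m @ [b])) (%m. G (butlast m @ [last m \<otimes> b]))"
  using assms(1)
proof (induct n arbitrary: G)
  case 0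
  then show ?case
    using b linear_comp[OF linear_mult_right[OF b], of W "%a. G [a]"]
    by (auto simp: one_mult_A dest: linear_closed)
next
  case (Suc n)
  have IH: "tsum_ok W n (%m. G (a # m @ [b])) (%m. G (butlast (a # m) @ [last (a # m) \<otimes> b]))"
    if a: "a IN A" for a
  proof (rule tsum_ok_cong)
    show "tsum_ok W n (%m. G (a # m @ [b])) (%m. G (a # butlast m @ [last m \<otimes> b]))"
      by (rule Suc(1)[of "%l. G (a # l)"]) (use Suc(2) a in simp)
  qed (auto simp: tuples_Suc)
  have G: "linear K A W (%a. G (a # l)) \<and> G (\<one> # l) = \<zero>\<^bsub>W\<^esub>" if "l \<in> tp (Suc n)" for l
    using Suc(2) that unfolding mlin.simps(2)[of _ _ _ _ "Suc n"] by blast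
  have "linear K A W (%a. G (butlast (a # l) @ [last (a # l) \<otimes> b])) \<and>
      G (butlast (\<one> # l) @ [last (\<one> # l) \<otimes> b]) = \<zero>\<^bsub>W\<^esub>" if l: "l \<in> tp (Suc n)" for l
  proof -
    obtain m c where m: "l = m @ [c]" "m \<in> tp n" "c IN A" using l by (auto simp: tuples_snoc)
    have "m @ [c \<otimes> b] \<in> tp (Suc n)" using m b by (auto intro: tuples_snocI mult_A)
    from G[OF this] show ?thesis by (simp add: m(1) butlast_append)
  qed
  moreover have "linear K A W (%a. G (a # m @ [b])) \<and> G (\<one> # m @ [b]) = \<zero>\<^bsub>W\<^esub>" if "m \<in> tp n" for m
    using G[OF tuples_snocI[OF that b]] .
  ultimately show ?case using IH by simp
qed

section \<open>The bimodules of noncommutative differential forms\<close>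

lemma form_spans': "spans K (Om p) (fm ` tp (p + 1))"
  using form_spans[of p] by simp

lemma form_left:
  assumes a: "a IN A"
  shows "linear K (Om p) (Om p) (fl p a)"
    and "!!x l. x IN A ==> l \<in> tp p ==> fl p a (fm (x # l)) = fm ((a \<otimes> x) # l)"
proof -
  have ex: "\<exists>h. linear K (Om p) (Om p) h \<and> (\<forall>l\<in>tp (p + 1). h (fm l) = fm ((a \<otimes> hd l) # tl l))"
    using form_lift[OF Om_module[of p], of p "%l. fm ((a \<otimes> hd l) # tl l)"]
      form_mlin linear_comp[OF linear_mult_left[OF a] form_linear] a
    by (simp add: mult_A)
  note le = lin_ext[OF Om_module Om_module form_spans' ex]
  show "linear K (Om p) (Om p) (fl p a)" unfolding form_left_def by (rule le(2))
  show "fl p a (fm (x # l)) = fm ((a \<otimes> x) # l)" if "x IN A" "l \<in> tp p" for x l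
    using le(3)[of "x # l"] that by (simp add: form_left_def)
qed

lemma form_append:
  assumes b: "b IN A"
  shows "linear K (Om p) (Om (Suc p)) (fa p b)"
    and "!!l. l \<in> tp (Suc p) ==> fa p b (fm l) = fm (l @ [b])"
proof -
  have ex: "\<exists>h. linear K (Om p) (Om (p + 1)) h \<and> (\<forall>l\<in>tp (p + 1). h (fm l) = fm (l @ [b]))"
  proof -
    have "nlin (Om (Suc p)) p (%l. fm (x # l @ [b]))" if "x IN A" for x
      using mlin_snoc[OF form_mlin[OF that] b] .
    moreover have "linear K A (Om (Suc p)) (%x. fm (x # l @ [b]))" if "l \<in> tp p" for l
      using form_linear[OF tuples_snocI[OF that b]] .
    ultimately show ?thesis
      using form_lift[OF Om_module[of "Suc p"], of p "%l. fm (l @ [b])"] by simp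
  qed
  note le = lin_ext[OF Om_module Om_module form_spans' ex]
  show "linear K (Om p) (Om (Suc p)) (fa p b)"
    using le(2) by (simp add: form_append_def)
  show "fa p b (fm l) = fm (l @ [b])" if "l \<in> tp (Suc p)" for l
    using le(3)[of l] that by (simp add: form_append_def)
qed

lemma merge_at_append:
  "i + 1 < length l ==> merge_at A i (l @ m) = merge_at A i l @ m"
  by (simp add: merge_at_def nth_append)

lemma merge_at_last:
  "length l = Suc p ==> merge_at A p (l @ [b]) = butlast l @ [last l \<otimes> b]"
  by (cases l rule: rev_cases) (auto simp: merge_at_def nth_append)

text \<open>The value that \<open>form_right\<close> prescribes on generators. It is kept apart
  because it must be shown to be linear and normalized before \<open>lin_ext\<close> yields a
  map.\<close>

definition right_sum :: "nat => 'a => 'a list => ('k, 'a) nc_form" where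
  "right_sum p b l = (\<Oplus>\<^bsub>Om p\<^esub>i\<in>{0..p}. signed (Om p) (int p - int i) (fm (merge_at A i (l @ [b]))))"

lemma right_sum_tsum:
  assumes b: "b IN A" and x: "x IN A" and l: "l \<in> tp p"
  shows "right_sum p b (x # l) = signed (Om p) (int p)
    (tsum (Om p) (%m. fm (m @ [b])) (%m. fm (butlast m @ [last m \<otimes> b])) x l)"
proof -
  note W = Om_module[of p]
  interpret W: module K "Om p" by (rule W)
  let ?F = "%m. fm (m @ [b])" and ?H = "%m. fm (butlast m @ [last m \<otimes> b])"
  have Fc: "?F m IN Om p" if "m \<in> tp p" for m
    using form_closed[OF tuples_snocI[OF that b]] .
  have Hc: "?H m IN Om p" if "m \<in> tp (Suc p)" for m
    using that b by (auto simp: tuples_snoc[of _ _ p] butlast_append intro!: form_closed tuples_snocI mult_A)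
  have xl: "x # l \<in> tp (Suc p)" using x l by simp
  have t: "tsum (Om p) ?F ?H x l IN Om p"
    by (rule tsum_closed[OF W Fc Hc x l])
  have mc: "?F (merge_at A i (x # l)) IN Om p" if "i < p" for i
    by (rule Fc[OF merge_at_closed[OF xl that]])
  let ?t = "%i. signed (Om p) (int p - int i) (fm (merge_at A i ((x # l) @ [b])))"
  \<comment> \<open>The parities of \<open>p - i\<close> and \<open>p + i\<close> agree, so a common
    sign \<open>(-1)\<^sup>p\<close> can be taken out of the sum.\<close>
  have ti: "?t i = signed (Om p) (int p + int i) (?F (merge_at A i (x # l)))" if "i < p" for i
    using that tuples_length[OF l] merge_at_append[of i "x # l" "[b]"]
    by (simp add: signed_def)
  have tp': "?t p = ?H (x # l)"
    using merge_at_last[of "x # l" p b] tuples_length[OF l] by simp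
  have "right_sum p b (x # l) = ?t p \<oplus>\<^bsub>Om p\<^esub> (\<Oplus>\<^bsub>Om p\<^esub>i\<in>{0..<p}. ?t i)"
  proof -
    have "{0..p} = insert p {0..<p}" by auto
    note * = this
    have c1: "?t i IN Om p" if "i < p" for i
      unfolding ti[OF that] by (rule signed_closed[OF W mc[OF that]])
    have c2: "?t p IN Om p" unfolding tp' by (rule Hc[OF xl])
    show ?thesis
      unfolding right_sum_def * by (rule W.M.finsum_insert) (use c1 c2 in auto)
  qed
  also have "(\<Oplus>\<^bsub>Om p\<^esub>i\<in>{0..<p}. ?t i) =
      (\<Oplus>\<^bsub>Om p\<^esub>i\<in>{0..<p}. signed (Om p) (int p + int i) (?F (merge_at A i (x # l))))"
    by (rule W.M.finsum_cong') (use ti mc in "auto intro!: signed_closed[OF W]")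
  also have "... = (\<Oplus>\<^bsub>Om p\<^esub>j\<in>{1..p}. signed (Om p) (int p + (int j - 1)) (?F (merge_at A (j - 1) (x # l))))"
  proof -
    have *: "{1..p} = Suc ` {0..<p}" by (simp add: image_Suc_atLeastLessThan atLeastLessThanSuc_atLeastAtMost)
    show ?thesis
      unfolding * using mc by (subst W.M.finsum_reindex) (auto intro!: signed_closed[OF W])
  qed
  also have "... = (\<Oplus>\<^bsub>Om p\<^esub>j\<in>{1..p}. signed (Om p) (int p + 1) (signed (Om p) (int j) (?F (merge_at A (j - 1) (x # l)))))"
  proof (rule W.M.finsum_cong')
    fix j assume "j \<in> {1..p}"
    then have "j - 1 < p" by auto
    from mc[OF this] show "signed (Om p) (int p + (int j - 1)) (?F (merge_at A (j - 1) (x # l))) =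
      signed (Om p) (int p + 1) (signed (Om p) (int j) (?F (merge_at A (j - 1) (x # l))))"
      by (simp add: signed_signed[OF W]) (simp add: signed_def)
  qed (use mc in "auto intro!: signed_closed[OF W]")
  also have "... = signed (Om p) (int p + 1) (\<Oplus>\<^bsub>Om p\<^esub>j\<in>{1..p}. signed (Om p) (int j) (?F (merge_at A (j - 1) (x # l))))"
    by (rule linear_finsum[OF linear_signed_self[OF W] W W, symmetric])
      (use mc in "auto intro!: signed_closed[OF W]")
  also have "?t p = signed (Om p) (int p + 1) (signed (Om p) (int p + 1) (?H (x # l)))"
    unfolding tp' using signed_cancel[OF W Hc[OF xl]] by simp
  also have "signed (Om p) (int p + 1) (signed (Om p) (int p + 1) (?H (x # l))) \<oplus>\<^bsub>Om p\<^esub>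
    signed (Om p) (int p + 1) (\<Oplus>\<^bsub>Om p\<^esub>j\<in>{1..p}. signed (Om p) (int j) (?F (merge_at A (j - 1) (x # l)))) =
    signed (Om p) (int p + 1) (signed (Om p) (int p + 1) (?H (x # l)) \<oplus>\<^bsub>Om p\<^esub>
     (\<Oplus>\<^bsub>Om p\<^esub>j\<in>{1..p}. signed (Om p) (int j) (?F (merge_at A (j - 1) (x # l)))))"
    by (rule signed_add[OF W, symmetric])
      (use mc Hc[OF xl] in "auto intro!: signed_closed[OF W] W.M.finsum_closed")
  also have "signed (Om p) (int p + 1) (?H (x # l)) \<oplus>\<^bsub>Om p\<^esub>
     (\<Oplus>\<^bsub>Om p\<^esub>j\<in>{1..p}. signed (Om p) (int j) (?F (merge_at A (j - 1) (x # l)))) =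
     (\<Oplus>\<^bsub>Om p\<^esub>j\<in>{1..p}. signed (Om p) (int j) (?F (merge_at A (j - 1) (x # l)))) \<oplus>\<^bsub>Om p\<^esub> signed (Om p) (int p + 1) (?H (x # l))"
    by (rule W.M.a_comm) (use mc Hc[OF xl] in "auto intro!: signed_closed[OF W] W.M.finsum_closed")
  also have "... = \<ominus>\<^bsub>Om p\<^esub> tsum (Om p) ?F ?H x l"
    by (rule tsum_eq_sum[OF W Fc Hc x l])
  also have "signed (Om p) (int p + 1) (\<ominus>\<^bsub>Om p\<^esub> tsum (Om p) ?F ?H x l) = signed (Om p) (int p) (tsum (Om p) ?F ?H x l)"
    using t by (auto simp: signed_def)
  finally show ?thesis .
qed

lemma right_sum_linear:
  assumes b: "b IN A" and l: "l \<in> tp p"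
  shows "linear K A (Om p) (%x. right_sum p b (x # l))"
  unfolding right_sum_def
proof (rule linear_sum[OF linear_signed_comp[OF Om_module] module_A Om_module])
  fix i assume i: "i \<in> {0..p}"
  obtain c m where cm: "l @ [b] = c # m" "c IN A" "m \<in> tp p"
    using tuples_snocI[OF l b] by (auto simp: tuples_Suc)
  show "linear K A (Om p) (%x. fm (merge_at A i ((x # l) @ [b])))"
  proof (cases i)
    case 0
    then show ?thesis
      using linear_comp[OF linear_mult_right[OF cm(2)] form_linear[OF cm(3)]] cm by (simp add: merge_at_0)
  next
    case (Suc j)
    have "merge_at A j (l @ [b]) \<in> tp p"
      by (rule merge_at_closed[OF tuples_snocI[OF l b]]) (use i Suc in auto)
    from form_linear[OF this] show ?thesis by (simp add: Suc merge_at_Suc)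
  qed
qed

text \<open>With the first entry of \<open>l\<close> split off, the sum has the form of a
  differential whose outer term multiplies that entry into \<open>x\<close>. Normalization then
  follows from the general statement about \<open>tsum\<close>.\<close>

lemma right_sum_mlin:
  assumes b: "b IN A" and x: "x IN A"
  shows "nlin (Om p) p (%l. right_sum p b (x # l))"
proof (cases p)
  case 0
  then show ?thesis
    using linear_closed[OF right_sum_linear[OF b, of "[]" 0] x] by simp
next
  case (Suc q)
  let ?W = "Om p"
  let ?F = "%m. fm (x # m @ [b])" and ?H = "%m. fm (x # butlast m @ [last m \<otimes> b])"
  have m1: "nlin ?W (Suc q) (%l. fm (x # l))" using form_mlin[OF x, of p] by (simp only: Suc)
  have ok: "tsum_ok ?W q ?F ?H" by (rule tsum_ok_mult_last[OF m1 b])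
  have "nlin ?W (Suc q)
      (%l. fm ((x \<otimes> hd l) # tl l @ [b]) \<ominus>\<^bsub>?W\<^esub> tsum ?W ?F ?H (hd l) (tl l))"
  proof (rule tsum_differential_mlin[OF Om_module ok])
    fix c assume c: "c IN A"
    have "nlin ?W (Suc q) (%l. fm ((x \<otimes> c) # l))"
      using form_mlin[OF mult_A[OF x c], of p] by (simp only: Suc)
    from mlin_snoc[OF this b] show "nlin ?W q (%l. fm ((x \<otimes> c) # l @ [b]))" .
  next
    fix l assume l: "l \<in> tp q"
    then have "l @ [b] \<in> tp p" using tuples_snocI[OF l b] Suc by simp
    from linear_comp[OF linear_mult_left[OF x] form_linear[OF this]]
    show "linear K A ?W (%c. fm ((x \<otimes> c) # l @ [b]))" .
    show "fm ((x \<otimes> \<one>) # l @ [b]) = fm (x # l @ [b])" by (simp add: one_mult_A x)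
  qed
  from mlin_signed[OF Om_module this, of "int p"]
  have "nlin ?W p (%l. signed ?W (int p)
     (fm ((x \<otimes> hd l) # tl l @ [b]) \<ominus>\<^bsub>?W\<^esub> tsum ?W ?F ?H (hd l) (tl l)))"
    using Suc by simp
  then show ?thesis
  proof (rule mlin_cong[OF _ module_A])
    fix l assume l: "l \<in> tp p"
    then obtain c m where cm: "l = c # m" "c IN A" "m \<in> tp q" using Suc by (auto simp: tuples_Suc)
    have "tsum ?W (%l. fm ((x # l) @ [b])) (%l. fm (butlast (x # l) @ [last (x # l) \<otimes> b])) c m = tsum ?W ?F ?H c m"
      by (rule tsum_cong[of q]) (use cm in "auto simp: tuples_Suc")
    then show "signed ?W (int p) (fm ((x \<otimes> hd l) # tl l @ [b]) \<ominus>\<^bsub>?W\<^esub> tsum ?W ?F ?H (hd l) (tl l)) = right_sum p b (x # l)"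
      unfolding right_sum_tsum[OF b x l] by (simp add: cm)
  qed (simp add: one_A)
qed

lemma form_right:
  assumes b: "b IN A"
  shows "linear K (Om p) (Om p) (fr p b)"
    and "!!l. l \<in> tp (Suc p) ==> fr p b (fm l) = right_sum p b l"
proof -
  have ex: "\<exists>h. linear K (Om p) (Om p) h \<and> (\<forall>l\<in>tp (p + 1). h (fm l) = right_sum p b l)"
    using form_lift[OF Om_module[of p], of p "right_sum p b"] right_sum_linear[OF b] right_sum_mlin[OF b]
    by simp
  note le = lin_ext[OF Om_module Om_module form_spans' ex]
  have *: "fr p b = lin_ext K (Om p) (Om p) (tp (p + 1)) fm (right_sum p b)"
    unfolding form_right_def right_sum_def ..
  show "linear K (Om p) (Om p) (fr p b)" unfolding * by (rule le(2))
  show "fr p b (fm l) = right_sum p b l" if "l \<in> tp (Suc p)" for l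
    unfolding * using le(3)[of l] that by simp
qed

lemma form_right_0: "b IN A ==> x IN A ==> fr 0 b (fm [x]) = fm [x \<otimes> b]"
proof -
  assume b: "b IN A" and x: "x IN A"
  interpret W: module K "Om 0" by (rule Om_module)
  show ?thesis
    using form_closed[of "[x \<otimes> b]" 0] mult_A[OF x b]
    by (subst form_right(2)[OF b]) (auto simp: right_sum_def x merge_at_def)
qed

text \<open>In symbols, \<open>(w \<otimes> sc) b = w \<otimes> s(cb) - (wc) \<otimes> sb\<close>:
  the top summand merges \<open>c\<close> with \<open>b\<close>, and the others are the summands of
  \<open>wc\<close> with reversed sign and \<open>sb\<close> appended. This recursion in
  \<open>p\<close> replaces the alternating sum in the proofs of the bimodule axioms.\<close>

lemma form_right_append:
  assumes b: "b IN A" and c: "c IN A" and w: "w IN Om p"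
  shows "fr (Suc p) b (fa p c w) =
    fa p (c \<otimes> b) w \<ominus>\<^bsub>Om (Suc p)\<^esub> fa p b (fr p c w)"
proof (rule linear_eq_form[OF Om_module linear_comp[OF form_append(1)[OF c] form_right(1)[OF b]] _ _ w])
  note W = Om_module[of "Suc p"]
  interpret W: module K "Om (Suc p)" by (rule W)
  show "linear K (Om p) (Om (Suc p)) (%w. fa p (c \<otimes> b) w \<ominus>\<^bsub>Om (Suc p)\<^esub>
      fa p b (fr p c w))"
    by (intro linear_diff[OF _ _ W] form_append linear_comp[OF form_right(1)[OF c]] mult_A b c)
  fix l assume l: "l \<in> tp (Suc p)"
  note lc = tuples_snocI[OF l c]
  have len: "length l = Suc p" using tuples_length[OF l] .
  let ?t = "%i. signed (Om (Suc p)) (int (Suc p) - int i) (fm (merge_at A i ((l @ [c]) @ [b])))"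
  let ?u = "%i. signed (Om p) (int p - int i) (fm (merge_at A i (l @ [c])))"
  have mc: "merge_at A i (l @ [c]) \<in> tp (Suc p)" if "i \<le> p" for i
    by (rule merge_at_closed[OF lc]) (use that in auto)
  have uc: "fm (merge_at A i (l @ [c])) IN Om p" if "i \<le> p" for i
    by (rule form_closed[OF mc[OF that]])
  have ti: "?t i = \<ominus>\<^bsub>Om (Suc p)\<^esub> fa p b (?u i)" if i: "i \<le> p" for i
  proof -
    have "merge_at A i ((l @ [c]) @ [b]) = merge_at A i (l @ [c]) @ [b]"
      by (rule merge_at_append) (use len i in auto)
    then have 1: "fm (merge_at A i ((l @ [c]) @ [b])) = fa p b (fm (merge_at A i (l @ [c])))"
      using form_append(2)[OF b mc[OF i]] by simp
    have "?t i = signed (Om (Suc p)) ((int p - int i) + 1) (fa p b (fm (merge_at A i (l @ [c]))))"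
      unfolding 1 by (simp add: algebra_simps)
    also have "... = \<ominus>\<^bsub>Om (Suc p)\<^esub> signed (Om (Suc p)) (int p - int i) (fa p b (fm (merge_at A i (l @ [c]))))"
      by (rule signed_Suc[OF W]) (rule linear_closed[OF form_append(1)[OF b] uc[OF i]])
    also have "signed (Om (Suc p)) (int p - int i) (fa p b (fm (merge_at A i (l @ [c])))) = fa p b (?u i)"
      by (rule linear_signed[OF form_append(1)[OF b] Om_module W uc[OF i], symmetric])
    finally show ?thesis .
  qed
  have neg: "linear K (Om p) (Om (Suc p)) (%w. \<ominus>\<^bsub>Om (Suc p)\<^esub> fa p b w)"
    by (rule linear_neg[OF form_append(1)[OF b] W])
  have tS: "?t (Suc p) = fm (l @ [c \<otimes> b])"
    using merge_at_last[of "l @ [c]" "Suc p" b] len by simp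
  have tSc: "fm (l @ [c \<otimes> b]) IN Om (Suc p)"
    by (rule form_closed[OF tuples_snocI[OF l mult_A[OF c b]]])
  have "fr (Suc p) b (fa p c (fm l)) = right_sum (Suc p) b (l @ [c])"
    by (simp only: form_append(2)[OF c l] form_right(2)[OF b lc])
  also have "... = ?t (Suc p) \<oplus>\<^bsub>Om (Suc p)\<^esub> (\<Oplus>\<^bsub>Om (Suc p)\<^esub>i\<in>{0..p}. ?t i)"
  proof -
    have *: "{0..Suc p} = insert (Suc p) {0..p}" by auto
    have c1: "?t i IN Om (Suc p)" if "i \<le> p" for i
      unfolding ti[OF that]
      by (rule linear_closed[OF neg]) (rule signed_closed[OF Om_module uc[OF that]])
    have c2: "?t (Suc p) IN Om (Suc p)" unfolding tS by (rule tSc)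
    show ?thesis
      unfolding right_sum_def * by (rule W.M.finsum_insert) (use c1 c2 in auto)
  qed
  also have "(\<Oplus>\<^bsub>Om (Suc p)\<^esub>i\<in>{0..p}. ?t i) = (\<Oplus>\<^bsub>Om (Suc p)\<^esub>i\<in>{0..p}. \<ominus>\<^bsub>Om (Suc p)\<^esub> fa p b (?u i))"
    by (rule W.M.finsum_cong') (use ti linear_closed[OF neg] signed_closed[OF Om_module uc] in auto)
  also have "... = \<ominus>\<^bsub>Om (Suc p)\<^esub> fa p b (right_sum p c l)"
    unfolding right_sum_def
    by (rule linear_finsum[OF neg Om_module W, symmetric]) (use signed_closed[OF Om_module uc] in auto)
  finally show "fr (Suc p) b (fa p c (fm l)) =
     fa p (c \<otimes> b) (fm l) \<ominus>\<^bsub>Om (Suc p)\<^esub> fa p b (fr p c (fm l))"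
    by (simp only: tS form_append(2)[OF mult_A[OF c b] l] form_right(2)[OF c l] a_minus_def)
qed

lemma linear_eq_append:
  assumes W: "module K W" and f: "linear K (Om (Suc p)) W f" and g: "linear K (Om (Suc p)) W g"
    and eq: "!!w c. w IN Om p ==> c IN A ==> f (fa p c w) = g (fa p c w)"
    and x: "x IN Om (Suc p)"
  shows "f x = g x"
proof (rule linear_eq_form[OF W f g _ x])
  fix l assume "l \<in> tp (Suc (Suc p))"
  then obtain m c where mc: "l = m @ [c]" "m \<in> tp (Suc p)" "c IN A" by (auto simp: tuples_snoc[of _ _ "Suc p"])
  then show "f (fm l) = g (fm l)" using eq[OF form_closed[OF mc(2)] mc(3)] form_append(2)[OF mc(3,2)] by simp
qed

lemma form_append_linear:
  assumes w: "w IN Om p"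
  shows "linear K A (Om (Suc p)) (%b. fa p b w)"
proof (rule linearI)
  have gen: "linear K A (Om (Suc p)) (%b. fm (l @ [b]))" if l: "l \<in> tp (Suc p)" for l
  proof -
    obtain x m where xm: "l = x # m" "x IN A" "m \<in> tp p" using l by (auto simp: tuples_Suc)
    show ?thesis using mlin_last_linear[OF form_mlin[OF xm(2)] xm(3) one_A] xm(1) by simp
  qed
  show "fa p b w IN Om (Suc p)" if "b IN A" for b
    using linear_closed[OF form_append(1)[OF that] w] .
  show "fa p (x \<oplus> y) w = fa p x w \<oplus>\<^bsub>Om (Suc p)\<^esub> fa p y w"
    if x: "x IN A" and y: "y IN A" for x y
    by (rule linear_eq_form[OF Om_module form_append(1) linear_plus[OF form_append(1) form_append(1) Om_module] _ w])
      (use x y in "auto simp: form_append(2) linear_add[OF gen]")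
  show "fa p (c \<odot> x) w = c \<odot>\<^bsub>Om (Suc p)\<^esub> fa p x w"
    if x: "x IN A" and c: "c IN K" for x c
    by (rule linear_eq_form[OF Om_module form_append(1) linear_scale[OF form_append(1) Om_module] _ w])
      (use x c in "auto simp: form_append(2) linear_smult[OF gen]")
qed

lemma form_append_one: "w IN Om p ==> fa p \<one> w = \<zero>\<^bsub>Om (Suc p)\<^esub>"
proof (rule linear_eq_form[OF Om_module form_append(1)[OF one_A] linear_const_zero[OF Om_module]])
  fix l assume "l \<in> tp (Suc p)"
  then obtain x m where xm: "l = x # m" "x IN A" "m \<in> tp p" by (auto simp: tuples_Suc)
  then show "fa p \<one> (fm l) = \<zero>\<^bsub>Om (Suc p)\<^esub>"
    using mlin_linear(2)[OF form_mlin[OF xm(2)] tuples_snocI[OF xm(3) one_A], of "\<one>"]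
    by (simp add: form_append(2) one_A)
qed

lemma form_left_append:
  assumes a: "a IN A" and b: "b IN A" and w: "w IN Om p"
  shows "fl (Suc p) a (fa p b w) = fa p b (fl p a w)"
proof (rule linear_eq_form[OF Om_module linear_comp[OF form_append(1)[OF b] form_left(1)[OF a]]
      linear_comp[OF form_left(1)[OF a] form_append(1)[OF b]] _ w])
  fix l assume l: "l \<in> tp (Suc p)"
  then obtain x m where xm: "l = x # m" "x IN A" "m \<in> tp p" by (auto simp: tuples_Suc)
  have "m @ [b] \<in> tp (Suc p)" by (rule tuples_snocI[OF xm(3) b])
  then show "fl (Suc p) a (fa p b (fm l)) = fa p b (fl p a (fm l))"
    using form_append(2)[OF b l] form_append(2)[OF b, of "(a \<otimes> x) # m" p] xm form_left(2)[OF a xm(2)]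
    by (simp add: mult_A a)
qed

end

section \<open>Hochschild cochains with coefficients in a bimodule\<close>

text \<open>The right action is written as an operator \<open>R b w\<close> for \<open>wb\<close>,
  whence the order of the factors in \<open>RR\<close>. Linearity in the algebra element is required
  as well, because the differential has to return multilinear maps.\<close>

locale bimod = hochschild_base K A for K :: "'k ring" and A :: "('k, 'a) module" (structure) +
  fixes W :: "('k, 'w) module" and L R :: "'a => 'w => 'w"
  assumes W: "module K W"
    and L: "!!a. a IN A ==> linear K W W (L a)"
    and R: "!!a. a IN A ==> linear K W W (R a)"
    and LA: "!!w. w IN W ==> linear K A W (%a. L a w)"
    and RA: "!!w. w IN W ==> linear K A W (%a. R a w)"
    and L1: "!!w. w IN W ==> L \<one> w = w"
    and R1: "!!w. w IN W ==> R \<one> w = w"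
    and LL: "!!a b w. a IN A ==> b IN A ==> w IN W ==> L a (L b w) = L (a \<otimes> b) w"
    and RR: "!!a b w. a IN A ==> b IN A ==> w IN W ==> R b (R a w) = R (a \<otimes> b) w"
    and LR: "!!a b w. a IN A ==> b IN A ==> w IN W ==> L a (R b w) = R b (L a w)"
begin

sublocale W: module K W by (rule W)

text \<open>For fixed \<open>a\<close>, \<open>TT F a\<close> is the right action of
  \<open>a\<close> on the cochain \<open>F\<close>: what remains of the Hochschild differential,
  with opposite sign, once its leftmost term is removed. Thus \<open>hdiff F (a # l)\<close> is the
  value at \<open>l\<close> of the commutator of \<open>a\<close> with \<open>F\<close>.\<close>

definition TT :: "('a list => 'w) => 'a => 'a list => 'w" where
  "TT F = tsum W F (%m. R (last m) (F (butlast m)))"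

text \<open>The differential without the sign \<open>(-1)\<^sup>m\<^sup>+\<^sup>1\<close>, so that
  it depends on the bimodule alone; \<open>dl\<close> restores the sign.\<close>

definition hdiff :: "('a list => 'w) => 'a list => 'w" where
  "hdiff F l = L (hd l) (F (tl l)) \<ominus>\<^bsub>W\<^esub> TT F (hd l) (tl l)"

lemma L_closed: "a IN A ==> w IN W ==> L a w IN W"
  by (rule linear_closed[OF L])

lemma R_closed: "a IN A ==> w IN W ==> R a w IN W"
  by (rule linear_closed[OF R])

lemma last_closed: "l \<in> tp (Suc n) ==> last l IN A"
  by (auto simp: tuples_snoc)

lemma butlast_closed: "l \<in> tp (Suc n) ==> butlast l \<in> tp n"
  by (auto simp: tuples_snoc)

lemma TT_Nil: "TT F a [] = R a (F [])"
  by (simp add: TT_def)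

lemma TT_Cons:
  assumes "b IN A" "bs \<in> tp n"
  shows "TT F a (b # bs) = F ((a \<otimes> b) # bs) \<ominus>\<^bsub>W\<^esub> TT (%l. F (a # l)) b bs"
proof -
  have "tsum W (%l. F (a # l)) (%l. R (last (a # l)) (F (butlast (a # l)))) b bs = TT (%l. F (a # l)) b bs"
    unfolding TT_def by (rule tsum_cong[of n]) (use assms in "auto simp: tuples_Suc")
  then show ?thesis by (simp add: TT_def)
qed

lemma TT_cong:
  assumes "!!l. l \<in> tp n ==> F l = G l" "a IN A" "l \<in> tp n"
  shows "TT F a l = TT G a l"
  unfolding TT_def by (rule tsum_cong[of n]) (use assms butlast_closed in auto)

lemma TT_closed:
  assumes F: "!!l. l \<in> tp n ==> F l IN W" and "a IN A" "l \<in> tp n"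
  shows "TT F a l IN W"
  unfolding TT_def
  by (rule tsum_closed[OF W, of n]) (use assms R_closed last_closed butlast_closed in auto)

lemma TT_diff:
  assumes F: "!!l. l \<in> tp n ==> F l IN W" and G: "!!l. l \<in> tp n ==> G l IN W"
    and al: "a IN A" "l \<in> tp n"
  shows "TT (%l. F l \<ominus>\<^bsub>W\<^esub> G l) a l = TT F a l \<ominus>\<^bsub>W\<^esub> TT G a l"
proof -
  have "TT (%l. F l \<ominus>\<^bsub>W\<^esub> G l) a l =
    tsum W (%l. F l \<ominus>\<^bsub>W\<^esub> G l) (%m. R (last m) (F (butlast m)) \<ominus>\<^bsub>W\<^esub> R (last m) (G (butlast m))) a l"
    unfolding TT_def
    by (rule tsum_cong[of n]) (use al F G linear_minus[OF R W W] last_closed butlast_closed in auto)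
  also have "... = TT F a l \<ominus>\<^bsub>W\<^esub> TT G a l"
    unfolding TT_def by (rule tsum_diff[OF W, of n])
      (use al F G R_closed last_closed butlast_closed in auto)
  finally show ?thesis .
qed

text \<open>Associativity of the right action on cochains. When one more argument \<open>c\<close>
  is split off, the terms in which \<open>b\<close> and \<open>c\<close> are multiplied occur twice
  and cancel.\<close>

lemma TT_assoc:
  assumes F: "!!l. l \<in> tp n ==> F l IN W" and "a IN A" "b IN A" "l \<in> tp n"
  shows "TT (TT F a) b l = TT F (a \<otimes> b) l"
  using assms
proof (induct n arbitrary: F a b l)
  case 0
  then show ?case by (simp add: TT_Nil RR)
next
  case (Suc n)
  obtain c cs where l: "l = c # cs" "c IN A" "cs \<in> tp n" using Suc(5) by (auto simp: tuples_Suc)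
  let ?Fa = "%l. F (a # l)" and ?Fab = "%l. F ((a \<otimes> b) # l)"
  have Fa: "!!l. l \<in> tp n ==> ?Fa l IN W" and Fab: "!!l. l \<in> tp n ==> ?Fab l IN W"
    using Suc(2-4) by (auto simp: mult_A)
  note bc = mult_A[OF Suc(4) l(2)] and ab = mult_A[OF Suc(3,4)]
  have "TT (%l. TT F a (b # l)) c cs = TT (%l. ?Fab l \<ominus>\<^bsub>W\<^esub> TT ?Fa b l) c cs"
    by (rule TT_cong[of n]) (use l TT_Cons[OF Suc(4)] in auto)
  also have "... = TT ?Fab c cs \<ominus>\<^bsub>W\<^esub> TT (TT ?Fa b) c cs"
    by (rule TT_diff[OF Fab TT_closed[OF Fa Suc(4)] l(2,3)])
  also have "TT (TT ?Fa b) c cs = TT ?Fa (b \<otimes> c) cs"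
    by (rule Suc(1)[OF Fa Suc(4) l(2,3)])
  finally have 1: "TT (%l. TT F a (b # l)) c cs = TT ?Fab c cs \<ominus>\<^bsub>W\<^esub> TT ?Fa (b \<otimes> c) cs" .
  have "TT (TT F a) b l = TT F a ((b \<otimes> c) # cs) \<ominus>\<^bsub>W\<^esub> TT (%l. TT F a (b # l)) c cs"
    using TT_Cons[OF l(2,3), of "TT F a" b] l(1) by simp
  also have "... = (F ((a \<otimes> (b \<otimes> c)) # cs) \<ominus>\<^bsub>W\<^esub> TT ?Fa (b \<otimes> c) cs) \<ominus>\<^bsub>W\<^esub>
      (TT ?Fab c cs \<ominus>\<^bsub>W\<^esub> TT ?Fa (b \<otimes> c) cs)"
    unfolding 1 TT_Cons[OF bc l(3)] ..
  also have "... = F ((a \<otimes> (b \<otimes> c)) # cs) \<ominus>\<^bsub>W\<^esub> TT ?Fab c cs"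
    by (rule W.M.diff_telescope)
      (use Suc(2,3) bc l TT_closed[OF Fa bc l(3)] TT_closed[OF Fab l(2,3)] in "auto simp: mult_A")
  also have "... = TT F (a \<otimes> b) l"
    using TT_Cons[OF l(2,3), of F "a \<otimes> b"] l(1) assoc_A[OF Suc(3,4) l(2)] by simp
  finally show ?case .
qed

text \<open>The left action on values commutes with the right action on cochains, because
  \<open>L\<close> and \<open>R\<close> commute.\<close>

lemma TT_L:
  assumes F: "!!l. l \<in> tp n ==> F l IN W" and "c IN A" "a IN A" "l \<in> tp n"
  shows "TT (%l. L c (F l)) a l = L c (TT F a l)"
proof -
  have "L c (TT F a l) = tsum W (%l. L c (F l)) (%m. L c (R (last m) (F (butlast m)))) a l"
    unfolding TT_def by (rule tsum_map[OF L W W, of c n])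
      (use assms R_closed last_closed butlast_closed in auto)
  also have "... = TT (%l. L c (F l)) a l"
    unfolding TT_def by (rule tsum_cong[of n]) (use assms LR last_closed butlast_closed in auto)
  finally show ?thesis by simp
qed

lemma hdiff_closed:
  assumes F: "!!l. l \<in> tp n ==> F l IN W" and "l \<in> tp (Suc n)"
  shows "hdiff F l IN W"
  using assms TT_closed[OF F] by (auto simp: hdiff_def tuples_Suc L_closed)

lemma hdiff_cong:
  assumes "!!l. l \<in> tp n ==> F l = G l" and "l \<in> tp (Suc n)"
  shows "hdiff F l = hdiff G l"
  using assms TT_cong[of n F G] by (auto simp: hdiff_def tuples_Suc)

text \<open>With \<open>hdiff F (a # _)\<close> read as \<open>aF - Fa\<close>, the square of the
  differential at \<open>a, b\<close> is \<open>a(bF - Fb) - ((ab)F - F(ab)) + (aF - Fa)b\<close>.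
  It vanishes by associativity and commutation of the two actions.\<close>

lemma hdiff_hdiff:
  assumes F: "!!l. l \<in> tp n ==> F l IN W" and l: "l \<in> tp (Suc (Suc n))"
  shows "hdiff (hdiff F) l = \<zero>\<^bsub>W\<^esub>"
proof -
  obtain a b m where m: "l = a # b # m" "a IN A" "b IN A" "m \<in> tp n"
    using l by (auto simp: tuples_Suc)
  note ab = mult_A[OF m(2,3)]
  have T1: "TT F b m IN W" and T2: "TT F (a \<otimes> b) m IN W" and Fm: "F m IN W"
    using TT_closed[OF F] m ab F by auto
  have "TT (%l. hdiff F (a # l)) b m = TT (%l. L a (F l) \<ominus>\<^bsub>W\<^esub> TT F a l) b m"
    by (rule TT_cong[of n]) (use m in "auto simp: hdiff_def")
  also have "... = TT (%l. L a (F l)) b m \<ominus>\<^bsub>W\<^esub> TT (TT F a) b m"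
    by (rule TT_diff[of n]) (use m F TT_closed[OF F] L_closed in auto)
  also have "... = L a (TT F b m) \<ominus>\<^bsub>W\<^esub> TT F (a \<otimes> b) m"
    using TT_L[OF F m(2,3,4)] TT_assoc[OF F m(2,3,4)] by simp
  finally have 1: "TT (%l. hdiff F (a # l)) b m = L a (TT F b m) \<ominus>\<^bsub>W\<^esub> TT F (a \<otimes> b) m" .
  have "hdiff (hdiff F) l = L a (L b (F m) \<ominus>\<^bsub>W\<^esub> TT F b m) \<ominus>\<^bsub>W\<^esub> TT (hdiff F) a (b # m)"
    by (simp add: hdiff_def m(1))
  also have "TT (hdiff F) a (b # m) = (L (a \<otimes> b) (F m) \<ominus>\<^bsub>W\<^esub> TT F (a \<otimes> b) m) \<ominus>\<^bsub>W\<^esub>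
      (L a (TT F b m) \<ominus>\<^bsub>W\<^esub> TT F (a \<otimes> b) m)"
    unfolding TT_Cons[OF m(3,4)] 1 by (simp add: hdiff_def)
  also have "L a (L b (F m) \<ominus>\<^bsub>W\<^esub> TT F b m) = L (a \<otimes> b) (F m) \<ominus>\<^bsub>W\<^esub> L a (TT F b m)"
    using linear_minus[OF L W W L_closed T1] LL m Fm by simp
  also have "(L (a \<otimes> b) (F m) \<ominus>\<^bsub>W\<^esub> L a (TT F b m)) \<ominus>\<^bsub>W\<^esub>
     ((L (a \<otimes> b) (F m) \<ominus>\<^bsub>W\<^esub> TT F (a \<otimes> b) m) \<ominus>\<^bsub>W\<^esub> (L a (TT F b m) \<ominus>\<^bsub>W\<^esub> TT F (a \<otimes> b) m)) = \<zero>\<^bsub>W\<^esub>"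
    by (rule W.M.diff_diff_swap) (use T1 T2 Fm L_closed m ab in auto)
  finally show ?thesis .
qed

lemma TT_ok:
  assumes "nlin W n F"
  shows "tsum_ok W n F (%m. R (last m) (F (butlast m)))"
  using assms
proof (induct n arbitrary: F)
  case 0
  then show ?case by (simp add: RA R1)
next
  case (Suc n)
  have "tsum_ok W n (%l. F (a # l)) (%m. R (last (a # m)) (F (butlast (a # m))))" if a: "a IN A" for a
  proof (rule tsum_ok_cong)
    show "tsum_ok W n (%l. F (a # l)) (%m. R (last m) (F (a # butlast m)))"
      by (rule Suc(1)[of "%l. F (a # l)"]) (use Suc(2) a in simp)
  qed (auto simp: tuples_Suc)
  moreover have "linear K A W (%a. R (last (a # l)) (F (butlast (a # l)))) \<and>
      R (last (\<one> # l)) (F (butlast (\<one> # l))) = \<zero>\<^bsub>W\<^esub>" if l: "l \<in> tp (Suc n)" for l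
  proof -
    obtain m c where m: "l = m @ [c]" "m \<in> tp n" "c IN A" using l by (auto simp: tuples_snoc)
    have "linear K A W (%a. F (a # m))" "F (\<one> # m) = \<zero>\<^bsub>W\<^esub>" using Suc(2) m by auto
    then show ?thesis
      using linear_comp[OF _ R[OF m(3)]] linear_zero[OF R[OF m(3)] W W]
      by (simp add: m(1) butlast_append)
  qed
  ultimately show ?case using Suc(2) by simp
qed

lemma hdiff_mlin:
  assumes F: "nlin W n F"
  shows "nlin W (Suc n) (hdiff F)"
proof -
  note Fc = mlin_closed[OF F]
  have "nlin W (Suc n) (%l. L (hd l) (F (tl l)) \<ominus>\<^bsub>W\<^esub> TT F (hd l) (tl l))"
    unfolding TT_def
    by (rule tsum_differential_mlin[OF W TT_ok[OF F], of "%a l. L a (F l)"])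
      (use mlin_comp[OF F L W W] LA[OF Fc] L1[OF Fc] in auto)
  then show ?thesis by (simp add: hdiff_def[abs_def])
qed

lemma hdiff_diff:
  assumes F: "!!l. l \<in> tp n ==> F l IN W" and G: "!!l. l \<in> tp n ==> G l IN W"
    and l: "l \<in> tp (Suc n)"
  shows "hdiff (%l. F l \<ominus>\<^bsub>W\<^esub> G l) l = hdiff F l \<ominus>\<^bsub>W\<^esub> hdiff G l"
proof -
  obtain a m where m: "l = a # m" "a IN A" "m \<in> tp n" using l by (auto simp: tuples_Suc)
  have "(f \<ominus>\<^bsub>W\<^esub> g) \<ominus>\<^bsub>W\<^esub> (t \<ominus>\<^bsub>W\<^esub> u) = (f \<ominus>\<^bsub>W\<^esub> t) \<ominus>\<^bsub>W\<^esub> (g \<ominus>\<^bsub>W\<^esub> u)"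
    if "f IN W" "g IN W" "t IN W" "u IN W" for f g t u
    using that by (simp add: a_minus_def W.M.minus_add W.M.a_ac)
  from this[of "L a (F m)" "L a (G m)" "TT F a m" "TT G a m"]
  show ?thesis
    using m F G TT_closed[OF F m(2,3)] TT_closed[OF G m(2,3)] TT_diff[OF F G m(2,3)]
    by (simp add: hdiff_def linear_minus[OF L W W] L_closed)
qed

lemma hdiff_signed:
  assumes F: "!!l. l \<in> tp n ==> F l IN W" and l: "l \<in> tp (Suc n)"
  shows "hdiff (%l. signed W j (F l)) l = signed W j (hdiff F l)"
proof (cases "even j")
  case False
  have "hdiff (%l. \<ominus>\<^bsub>W\<^esub> F l) l = hdiff (%l. \<zero>\<^bsub>W\<^esub> \<ominus>\<^bsub>W\<^esub> F l) l"
    by (rule hdiff_cong[of n]) (use F l in "auto simp: a_minus_def")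
  also have "... = hdiff (%l. \<zero>\<^bsub>W\<^esub>) l \<ominus>\<^bsub>W\<^esub> hdiff F l" by (rule hdiff_diff[OF _ F l]) simp
  also have "hdiff (%l. \<zero>\<^bsub>W\<^esub>) l = \<zero>\<^bsub>W\<^esub>"
    using hdiff_diff[of n "%_. \<zero>\<^bsub>W\<^esub>" "%_. \<zero>\<^bsub>W\<^esub>", OF _ _ l] hdiff_closed[of n "%_. \<zero>\<^bsub>W\<^esub>", OF _ l]
    by (simp add: a_minus_def W.M.minus_zero' W.M.r_neg)
  finally show ?thesis using False hdiff_closed[OF F l] by (simp add: signed_def a_minus_def)
qed (simp add: signed_def)

end

lemma hdiff_map:
  assumes B1: "bimod K A W L R" and B2: "bimod K A W' L' R'"
    and g: "linear K W W' g"
    and gL: "!!a w. a IN A ==> w IN W ==> g (L a w) = L' a (g w)"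
    and gR: "!!a w. a IN A ==> w IN W ==> g (R a w) = R' a (g w)"
    and F: "!!l. l \<in> tuples (carrier A) n ==> F l IN W" and l: "l \<in> tuples (carrier A) (Suc n)"
  shows "g (bimod.hdiff A W L R F l) = bimod.hdiff A W' L' R' (%l. g (F l)) l"
proof -
  interpret B1: bimod K A W L R by fact
  interpret B2: bimod K A W' L' R' by fact
  obtain a m where m: "l = a # m" "a IN A" "m \<in> tuples (carrier A) n" using l by (auto simp: tuples_Suc)
  have "g (B1.TT F a m) = B1.tsum W' (%l. g (F l)) (%m. g (R (last m) (F (butlast m)))) a m"
    unfolding B1.TT_def
    by (rule B1.tsum_map[OF g B1.W B2.W, of n])
      (use m F B1.R_closed B1.last_closed B1.butlast_closed in auto)
  also have "... = B2.TT (%l. g (F l)) a m"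
    unfolding B2.TT_def
    by (rule B1.tsum_cong[of n]) (use m F gR B1.last_closed B1.butlast_closed in auto)
  finally show ?thesis
    using m F B1.TT_closed[OF F m(2,3)] gL
    by (simp add: B1.hdiff_def B2.hdiff_def linear_minus[OF g B1.W B2.W] B1.L_closed)
qed

text \<open>For fixed parameters, both sides of additivity in \<open>b\<close> are linear in
  \<open>w\<close>, so they may be compared on generators. Linearity of the actions in the algebra
  element is obtained in this way.\<close>

lemma linear_parameter:
  assumes S: "spans K V S" and V: "module K V" and W: "module K W" and X: "module K X"
    and T: "!!b. b IN X ==> linear K V W (T b)"
    and gen: "!!s. s \<in> S ==> linear K X W (%b. T b s)" and w: "w IN V"
  shows "linear K X W (%b. T b w)"
proof (rule linearI)
  interpret X: module K X by fact
  show "T b w IN W" if "b IN X" for b using linear_closed[OF T[OF that] w] .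
  show "T (x \<oplus>\<^bsub>X\<^esub> y) w = T x w \<oplus>\<^bsub>W\<^esub> T y w" if "x IN X" "y IN X" for x y
    by (rule linear_eq_spans[OF S V W T linear_plus[OF T T W] _ w])
      (use that linear_add[OF gen] in auto)
  show "T (c \<odot>\<^bsub>X\<^esub> x) w = c \<odot>\<^bsub>W\<^esub> T x w" if "c IN K" "x IN X" for c x
    by (rule linear_eq_spans[OF S V W T linear_scale[OF T W] _ w])
      (use that linear_smult[OF gen] in auto)
qed

lemma (in abelian_group) diff_diff_cancel:
  "[|x IN G; y IN G|] ==> x \<ominus> (x \<ominus> y) = y"
  by algebra

section \<open>The bimodule axioms for noncommutative forms\<close>

context hochschild_base
begin

lemma append_spans: "spans K (Om (Suc p)) {fa p c w | c w. c IN A \<and> w IN Om p}"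
proof -
  have 1: "{fa p c w | c w. c IN A \<and> w IN Om p} \<subseteq> carrier (Om (Suc p))"
    using linear_closed[OF form_append(1)] by blast
  have 2: "fm ` tp (Suc (Suc p)) \<subseteq> {fa p c w | c w. c IN A \<and> w IN Om p}"
  proof
    fix x assume "x \<in> fm ` tp (Suc (Suc p))"
    then obtain l c where lc: "x = fm (l @ [c])" "l \<in> tp (Suc p)" "c IN A"
      by (auto simp: tuples_snoc[of _ _ "Suc p"])
    then have "x = fa p c (fm l)" using form_append(2) by simp
    then show "x \<in> {fa p c w | c w. c IN A \<and> w IN Om p}"
      using lc form_closed by blast
  qed
  show ?thesis
  proof (rule spansI[OF Om_module 1])
    fix H x assume H: "submodule H K (Om (Suc p))"
      and sub: "{fa p c w | c w. c IN A \<and> w IN Om p} \<subseteq> H"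
      and x: "x IN Om (Suc p)"
    have "mod_span K (Om (Suc p)) (fm ` tp (Suc (Suc p))) \<subseteq> H"
      by (rule mod_span_least[OF H]) (use 2 sub in blast)
    then show "x \<in> H" using form_spans[of "Suc p"] x by (auto simp: spans_def)
  qed
qed

lemma form_left_linear:
  assumes w: "w IN Om p"
  shows "linear K A (Om p) (%a. fl p a w)"
proof (rule linear_parameter[OF form_spans Om_module Om_module module_A form_left(1) _ w])
  fix s assume "s \<in> fm ` tp (Suc p)"
  then obtain x l where xl: "s = fm (x # l)" "x IN A" "l \<in> tp p" by (auto simp: tuples_Suc)
  have "linear K A (Om p) (%a. fm ((a \<otimes> x) # l))"
    by (rule linear_comp[OF linear_mult_right[OF xl(2)] form_linear[OF xl(3)]])
  then show "linear K A (Om p) (%a. fl p a s)"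
    by (rule linear_cong[OF _ module_A]) (use xl form_left(2) in auto)
qed

lemma form_right_linear:
  "w IN Om p ==> linear K A (Om p) (%b. fr p b w)"
proof (induct p arbitrary: w)
  case 0
  show ?case
  proof (rule linear_parameter[OF form_spans Om_module Om_module module_A form_right(1) _ 0])
    fix s assume "s \<in> fm ` tp (Suc 0)"
    then obtain x where x: "s = fm [x]" "x IN A" by (auto simp: tuples_Suc)
    have "linear K A (Om 0) (%a. fm [x \<otimes> a])"
      by (rule linear_comp[OF linear_mult_left[OF x(2)] form_linear]) simp
    then show "linear K A (Om 0) (%b. fr 0 b s)"
      by (rule linear_cong[OF _ module_A]) (use x form_right_0 in auto)
  qed
next
  case (Suc p)
  show ?case
  proof (rule linear_parameter[OF append_spans Om_module Om_module module_A form_right(1) _ Suc(2)])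
    fix s assume "s \<in> {fa p c w | c w. c IN A \<and> w IN Om p}"
    then obtain c w where cw: "s = fa p c w" "c IN A" "w IN Om p" by blast
    have "linear K A (Om (Suc p)) (%b. fa p (c \<otimes> b) w \<ominus>\<^bsub>Om (Suc p)\<^esub>
        fa p b (fr p c w))"
      by (intro linear_diff[OF _ _ Om_module] linear_comp[OF linear_mult_left[OF cw(2)] form_append_linear[OF cw(3)]]
          form_append_linear linear_closed[OF form_right(1)] cw)
    then show "linear K A (Om (Suc p)) (%b. fr (Suc p) b s)"
      by (rule linear_cong[OF _ module_A]) (use cw form_right_append in auto)
  qed
qed

lemma form_left_right:
  assumes a: "a IN A"
  shows "b IN A ==> w IN Om p ==>
    fl p a (fr p b w) = fr p b (fl p a w)"
proof (induct p arbitrary: w b)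
  case 0
  note b = 0(1)
  show ?case
  proof (rule linear_eq_form[OF Om_module linear_comp[OF form_right(1)[OF b] form_left(1)[OF a]]
        linear_comp[OF form_left(1)[OF a] form_right(1)[OF b]] _ 0(2)])
    fix l assume "l \<in> tp (Suc 0)"
    then obtain x where x: "l = [x]" "x IN A" by (auto simp: tuples_Suc)
    then show "fl 0 a (fr 0 b (fm l)) = fr 0 b (fl 0 a (fm l))"
      using form_left(2)[OF a, of _ "[]"] a b by (simp add: form_right_0 mult_A assoc_A)
  qed
next
  case (Suc p)
  note b = Suc(2)
  show ?case
  proof (rule linear_eq_append[OF Om_module linear_comp[OF form_right(1)[OF b] form_left(1)[OF a]]
        linear_comp[OF form_left(1)[OF a] form_right(1)[OF b]] _ Suc(3)])
    fix w c assume w: "w IN Om p" and c: "c IN A"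
    let ?a = "fa p" and ?R = "fr p" and ?L = "fl p a"
    note Rc = linear_closed[OF form_right(1)[OF c] w] and Lc = linear_closed[OF form_left(1)[OF a] w]
    note ac = linear_closed[OF form_append(1)]
    have "fl (Suc p) a (fr (Suc p) b (?a c w)) =
        fl (Suc p) a (?a (c \<otimes> b) w \<ominus>\<^bsub>Om (Suc p)\<^esub> ?a b (?R c w))"
      by (simp only: form_right_append[OF b c w])
    also have "... = fl (Suc p) a (?a (c \<otimes> b) w) \<ominus>\<^bsub>Om (Suc p)\<^esub> fl (Suc p) a (?a b (?R c w))"
      by (rule linear_minus[OF form_left(1)[OF a] Om_module Om_module ac[OF mult_A[OF c b] w] ac[OF b Rc]])
    also have "... = ?a (c \<otimes> b) (?L w) \<ominus>\<^bsub>Om (Suc p)\<^esub> ?a b (?R c (?L w))"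
      by (simp only: form_left_append[OF a mult_A[OF c b] w] form_left_append[OF a b Rc] Suc(1)[OF c w])
    also have "... = fr (Suc p) b (fl (Suc p) a (?a c w))"
      by (simp only: form_left_append[OF a c w] form_right_append[OF b c Lc])
    finally show "fl (Suc p) a (fr (Suc p) b (?a c w)) =
       fr (Suc p) b (fl (Suc p) a (?a c w))" .
  qed
qed

text \<open>Both sides are expanded by \<open>form_right_append\<close>; the two terms that end in
  \<open>c\<close> agree by the induction hypothesis and cancel.\<close>

lemma form_right_right:
  assumes b: "b IN A" and c: "c IN A"
  shows "w IN Om p ==> fr p c (fr p b w) = fr p (b \<otimes> c) w"
  using b c
proof (induct p arbitrary: w b c)
  case 0
  note b = 0(2) and c = 0(3)
  show ?case
  proof (rule linear_eq_form[OF Om_module linear_comp[OF form_right(1)[OF b] form_right(1)[OF c]]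
        form_right(1)[OF mult_A[OF b c]] _ 0(1)])
    fix l assume "l \<in> tp (Suc 0)"
    then obtain x where x: "l = [x]" "x IN A" by (auto simp: tuples_Suc)
    then show "fr 0 c (fr 0 b (fm l)) = fr 0 (b \<otimes> c) (fm l)"
      using b c by (simp add: form_right_0 mult_A assoc_A)
  qed
next
  case (Suc p)
  note b = Suc(3) and c = Suc(4)
  interpret W: module K "Om (Suc p)" by (rule Om_module)
  show ?case
  proof (rule linear_eq_append[OF Om_module linear_comp[OF form_right(1)[OF b] form_right(1)[OF c]]
        form_right(1)[OF mult_A[OF b c]] _ Suc(2)])
    fix w d assume w: "w IN Om p" and d: "d IN A"
    let ?a = "fa p" and ?R = "fr p"
    note Rc = linear_closed[OF form_right(1)] and ac = linear_closed[OF form_append(1)]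
    have "fr (Suc p) c (fr (Suc p) b (?a d w)) =
        fr (Suc p) c (?a (d \<otimes> b) w \<ominus>\<^bsub>Om (Suc p)\<^esub> ?a b (?R d w))"
      by (simp only: form_right_append[OF b d w])
    also have "... = fr (Suc p) c (?a (d \<otimes> b) w) \<ominus>\<^bsub>Om (Suc p)\<^esub> fr (Suc p) c (?a b (?R d w))"
      by (rule linear_minus[OF form_right(1)[OF c] Om_module Om_module])
        (use b c d w Rc ac mult_A in auto)
    also have "... = (?a (d \<otimes> b \<otimes> c) w \<ominus>\<^bsub>Om (Suc p)\<^esub> ?a c (?R (d \<otimes> b) w)) \<ominus>\<^bsub>Om (Suc p)\<^esub>
        (?a (b \<otimes> c) (?R d w) \<ominus>\<^bsub>Om (Suc p)\<^esub> ?a c (?R b (?R d w)))"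
      by (simp only: form_right_append[OF c mult_A[OF d b] w] form_right_append[OF c b Rc[OF d w]])
    also have "... = ?a (d \<otimes> b \<otimes> c) w \<ominus>\<^bsub>Om (Suc p)\<^esub> ?a (b \<otimes> c) (?R d w)"
      unfolding Suc(1)[OF w d b]
      by (rule W.M.diff_telescope) (use b c d w Rc ac mult_A in auto)
    also have "... = fr (Suc p) (b \<otimes> c) (?a d w)"
      by (simp only: form_right_append[OF mult_A[OF b c] d w] assoc_A[OF d b c])
    finally show "fr (Suc p) c (fr (Suc p) b (?a d w)) =
      fr (Suc p) (b \<otimes> c) (?a d w)" .
  qed
qed

lemma form_right_one: "w IN Om p ==> fr p \<one> w = w"
proof (cases p)
  case 0
  assume w: "w IN Om p"
  have "fr 0 \<one> w = w"
  proof (rule linear_eq_form[OF Om_module form_right(1)[OF one_A] linear_id])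
    fix l assume "l \<in> tp (Suc 0)"
    then obtain x where x: "l = [x]" "x IN A" by (auto simp: tuples_Suc)
    then show "fr 0 \<one> (fm l) = fm l" by (simp add: form_right_0 one_A one_mult_A)
  qed (use w 0 in simp)
  then show ?thesis using 0 by simp
next
  case (Suc q)
  interpret W: module K "Om (Suc q)" by (rule Om_module)
  assume w: "w IN Om p"
  have "fr (Suc q) \<one> w = w"
  proof (rule linear_eq_append[OF Om_module form_right(1)[OF one_A] linear_id])
    fix w d assume w: "w IN Om q" and d: "d IN A"
    show "fr (Suc q) \<one> (fa q d w) = fa q d w"
      using linear_closed[OF form_append(1)[OF d] w]
      by (simp add: form_right_append[OF one_A d w] one_mult_A d
          form_append_one[OF linear_closed[OF form_right(1)[OF d] w]] a_minus_def W.M.minus_zero')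
  qed (use w Suc in simp)
  then show ?thesis using Suc by simp
qed

lemma Om_bimod: "bimod K A (Om p) (fl p) (fr p)"
proof (intro bimod.intro bimod_axioms.intro hochschild_base_axioms)
  fix w assume w: "w IN Om p"
  show "fl p \<one> w = w"
    by (rule linear_eq_form[OF Om_module form_left(1)[OF one_A] linear_id _ w])
      (use form_left(2)[OF one_A] in "auto simp: tuples_Suc one_mult_A")
  fix a b assume a: "a IN A" and b: "b IN A"
  show "fl p a (fl p b w) = fl p (a \<otimes> b) w"
    by (rule linear_eq_form[OF Om_module linear_comp[OF form_left(1)[OF b] form_left(1)[OF a]]
          form_left(1)[OF mult_A[OF a b]] _ w])
      (use form_left(2) a b in "auto simp: tuples_Suc mult_A assoc_A")
qed (simp_all add: Om_module form_left(1) form_right(1) form_left_linear form_right_linear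
    form_right_one form_right_right form_left_right)

sublocale Om: bimod K A "Om p" "fl p" "fr p" for p
  by (rule Om_bimod)

section \<open>The singular Hochschild cochain complex\<close>

abbreviation "NC \<equiv> nc_cochains K A"
abbreviation "dl \<equiv> hoch_diff K A"
abbreviation "th \<equiv> theta K A"

lemma NC_carrier: "0 \<le> m + int p ==> carrier (NC m p) = lin_maps K (BP (nat (m + int p))) (Om p)"
  by (simp add: nc_cochains_def Let_def)

lemma NC_carrier_neg: "m + int p < 0 ==> carrier (NC m p) = {\<zero>\<^bsub>NC m p\<^esub>}"
  by (simp add: nc_cochains_def Let_def)

lemma NC_ops:
  "\<zero>\<^bsub>NC m p\<^esub> = (\<lambda>x\<in>carrier (BP (nat (m + int p))). \<zero>\<^bsub>Om p\<^esub>)"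
  "f \<oplus>\<^bsub>NC m p\<^esub> g = (\<lambda>x\<in>carrier (BP (nat (m + int p))). f x \<oplus>\<^bsub>Om p\<^esub> g x)"
  "c \<odot>\<^bsub>NC m p\<^esub> f = (\<lambda>x\<in>carrier (BP (nat (m + int p))). c \<odot>\<^bsub>Om p\<^esub> f x)"
  by (auto simp: nc_cochains_def Let_def)

lemma NC_module: "module K (NC m p)"
proof -
  let ?H = "hom_mod K (BP (nat (m + int p))) (Om p)"
  have H: "module K ?H" by (rule hom_mod[OF bar_pow_module Om_module])
  interpret H: module K ?H by (rule H)
  show ?thesis
  proof (cases "m + int p < 0")
    case True
    have "submodule {\<zero>\<^bsub>?H\<^esub>} K ?H"
      by (rule submoduleI'[OF H]) (use H.M.zero_closed H.M.l_zero[OF H.M.zero_closed] H.smult_r_null in blast)+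
    then have "module K (?H\<lparr>carrier := {\<zero>\<^bsub>?H\<^esub>}\<rparr>)" by (rule submodule.submodule_is_module[OF _ H])
    then show ?thesis using True unfolding nc_cochains_def Let_def by simp
  next
    case False
    then show ?thesis using H unfolding nc_cochains_def Let_def by simp
  qed
qed

lemma NC_zero: "l \<in> tp (nat (m + int p)) ==> \<zero>\<^bsub>NC m p\<^esub> (br l) = \<zero>\<^bsub>Om p\<^esub>"
  by (simp add: NC_ops bar_closed)

lemma NC_add: "l \<in> tp (nat (m + int p)) ==> (f \<oplus>\<^bsub>NC m p\<^esub> g) (br l) = f (br l) \<oplus>\<^bsub>Om p\<^esub> g (br l)"
  by (simp add: NC_ops bar_closed)

lemma NC_smult: "l \<in> tp (nat (m + int p)) ==> (c \<odot>\<^bsub>NC m p\<^esub> f) (br l) = c \<odot>\<^bsub>Om p\<^esub> f (br l)"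
  by (simp add: NC_ops bar_closed)

lemma NC_mlin:
  assumes "0 \<le> m + int p" "f IN NC m p"
  shows "nlin (Om p) (nat (m + int p)) (%l. f (br l))"
  using assms by (intro mlin_comp[OF bar_mlin _ bar_pow_module Om_module]) (simp add: NC_carrier lin_maps_linear)

lemma NC_val_closed:
  assumes "f IN NC m p" "l \<in> tp (nat (m + int p))"
  shows "f (br l) IN Om p"
proof (cases "0 \<le> m + int p")
  case True
  then show ?thesis using mlin_closed[OF NC_mlin] assms by blast
next
  case False
  then show ?thesis using assms NC_carrier_neg[of m p] NC_zero[of l m p] module_zero[OF Om_module] by auto
qed

text \<open>Equality is tested on bar tensors. If the number of arguments would be negative, the
  module is zero and there is nothing to test.\<close>

lemma NC_eqI:
  assumes f: "f IN NC m p" and g: "g IN NC m p"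
    and eq: "!!l. 0 \<le> m + int p ==> l \<in> tp (nat (m + int p)) ==> f (br l) = g (br l)"
  shows "f = g"
proof (cases "0 \<le> m + int p")
  case True
  then have fg: "f \<in> lin_maps K (BP (nat (m + int p))) (Om p)" "g \<in> lin_maps K (BP (nat (m + int p))) (Om p)"
    using f g by (auto simp: NC_carrier)
  have "f x = g x" if "x \<in> carrier (BP (nat (m + int p)))" for x
    by (rule linear_eq_bar[OF Om_module fg[THEN lin_maps_linear] eq[OF True] that])
  then show ?thesis using fg by (auto simp: lin_maps_iff intro: extensionalityI)
next
  case False
  then show ?thesis using f g NC_carrier_neg[of m p] by auto
qed

lemma bar_ext:
  assumes W: "module K W" and F: "nlin W n F"
  shows "lin_ext K (BP n) W (tp n) br F \<in> lin_maps K (BP n) W"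
    and "!!l. l \<in> tp n ==> lin_ext K (BP n) W (tp n) br F (br l) = F l"
  using lin_ext[OF bar_pow_module W bar_spans bar_lift[OF W F]] by auto

lemma NC_ex:
  assumes "0 \<le> m + int p" and "nlin (Om p) (nat (m + int p)) F"
  shows "\<exists>f\<in>carrier (NC m p). \<forall>l\<in>tp (nat (m + int p)). f (br l) = F l"
  using bar_ext[OF Om_module assms(2)] assms(1) by (auto simp: NC_carrier)

lemma hoch_diff_sum:
  assumes f: "!!l. l \<in> tp N ==> F l IN Om p" and l: "l \<in> tp (Suc N)"
  shows "fl p (hd l) (F (tl l)) \<oplus>\<^bsub>Om p\<^esub>
      (\<Oplus>\<^bsub>Om p\<^esub>j\<in>{1..N}. signed (Om p) (int j) (F (merge_at A (j - 1) l))) \<oplus>\<^bsub>Om p\<^esub>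
      signed (Om p) (int N + 1) (fr p (last l) (F (butlast l))) = Om.hdiff p F l"
proof -
  obtain a m where m: "l = a # m" "a IN A" "m \<in> tp N" using l by (auto simp: tuples_Suc)
  let ?H = "%m. fr p (last m) (F (butlast m))"
  have Hc: "?H m IN Om p" if "m \<in> tp (Suc N)" for m
    using that Om.R_closed Om.last_closed Om.butlast_closed f by blast
  have mc: "F (merge_at A (j - 1) l) IN Om p" if "j \<in> {1..N}" for j
    by (rule f[OF merge_at_closed[OF l]]) (use that in auto)
  have sc: "(\<Oplus>\<^bsub>Om p\<^esub>j\<in>{1..N}. signed (Om p) (int j) (F (merge_at A (j - 1) l))) IN Om p"
    using mc by (intro Om.W.M.finsum_closed) (auto intro!: signed_closed[OF Om_module])
  have "(\<Oplus>\<^bsub>Om p\<^esub>j\<in>{1..N}. signed (Om p) (int j) (F (merge_at A (j - 1) l))) \<oplus>\<^bsub>Om p\<^esub>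
      signed (Om p) (int N + 1) (?H l) = \<ominus>\<^bsub>Om p\<^esub> Om.TT p F a m"
    unfolding m(1) Om.TT_def by (rule tsum_eq_sum[OF Om_module f Hc m(2,3)])
  moreover have "fl p (hd l) (F (tl l)) IN Om p" using m f Om.L_closed by auto
  ultimately show ?thesis
    using sc signed_closed[OF Om_module Hc[OF l], of "int N + 1"] m(1)
    by (simp add: Om.W.M.a_assoc Om.hdiff_def a_minus_def)
qed

lemma dl_neg: "m + int p < 0 ==> dl m p f = \<zero>\<^bsub>NC (m + 1) p\<^esub>"
  by (simp add: hoch_diff_def)

lemma dl:
  assumes mp: "0 \<le> m + int p" and f: "f IN NC m p"
  shows "dl m p f IN NC (m + 1) p"
    and "!!l. l \<in> tp (Suc (nat (m + int p))) ==>
      dl m p f (br l) = signed (Om p) (m + 1) (Om.hdiff p (%l. f (br l)) l)"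
proof -
  let ?N = "nat (m + int p)"
  let ?F = "%l. f (br l)"
  let ?G = "%as. signed (Om p) (m + 1)
             (fl p (hd as) (f (br (tl as)))
              \<oplus>\<^bsub>Om p\<^esub> (\<Oplus>\<^bsub>Om p\<^esub>j\<in>{1..?N}. signed (Om p) (int j) (f (br (merge_at A (j - 1) as))))
              \<oplus>\<^bsub>Om p\<^esub> signed (Om p) (int ?N + 1) (fr p (last as) (f (br (butlast as)))))"
  note F = NC_mlin[OF mp f]
  have G: "?G l = signed (Om p) (m + 1) (Om.hdiff p ?F l)" if "l \<in> tp (Suc ?N)" for l
    using hoch_diff_sum[where F = ?F and p = p, OF mlin_closed[OF F] that] by simp
  \<comment> \<open>Multilinearity of the prescribed values has to be known first; it is what makes
    \<open>lin_ext\<close> a map with these values.\<close>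
  have Gm: "nlin (Om p) (?N + 1) ?G"
    using mlin_cong[OF mlin_signed[OF Om_module Om.hdiff_mlin[OF F]] module_A _ G[symmetric]] one_A by simp
  have d: "dl m p f = lin_ext K (BP (?N + 1)) (Om p) (tp (?N + 1)) br ?G"
    using mp unfolding hoch_diff_def Let_def by simp
  have N1: "nat (m + 1 + int p) = ?N + 1" using mp by (simp add: nat_add_distrib)
  show "dl m p f IN NC (m + 1) p"
    using bar_ext(1)[OF Om_module Gm] mp N1 d by (simp add: NC_carrier)
  show "dl m p f (br l) = signed (Om p) (m + 1) (Om.hdiff p ?F l)" if "l \<in> tp (Suc ?N)" for l
    using bar_ext(2)[OF Om_module Gm, of l] that G d by simp
qed

lemma dl_closed: "f IN NC m p ==> dl m p f IN NC (m + 1) p"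
  by (cases "0 \<le> m + int p") (auto simp: dl dl_neg module_zero[OF NC_module])

lemma hdiff_linear:
  assumes l: "l \<in> tp (Suc n)"
    and F: "!!l. l \<in> tp n ==> F l IN Om p" and G: "!!l. l \<in> tp n ==> G l IN Om p"
  shows "Om.hdiff p (%l. F l \<oplus>\<^bsub>Om p\<^esub> G l) l = Om.hdiff p F l \<oplus>\<^bsub>Om p\<^esub> Om.hdiff p G l"
    and "c IN K ==> Om.hdiff p (%l. c \<odot>\<^bsub>Om p\<^esub> F l) l = c \<odot>\<^bsub>Om p\<^esub> Om.hdiff p F l"
proof -
  note neg = linear_neg[OF linear_id Om_module[of p]]
  have G': "!!l. l \<in> tp n ==> \<ominus>\<^bsub>Om p\<^esub> G l IN Om p" using G by auto
  have n: "Om.hdiff p (%l. \<ominus>\<^bsub>Om p\<^esub> G l) l = \<ominus>\<^bsub>Om p\<^esub> Om.hdiff p G l"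
    using Om.hdiff_signed[where j = 1, OF G l] by simp
  have "Om.hdiff p (%l. F l \<oplus>\<^bsub>Om p\<^esub> G l) l = Om.hdiff p (%l. F l \<ominus>\<^bsub>Om p\<^esub> \<ominus>\<^bsub>Om p\<^esub> G l) l"
    by (rule Om.hdiff_cong[of n]) (use G l in "auto simp: a_minus_def")
  also have "... = Om.hdiff p F l \<ominus>\<^bsub>Om p\<^esub> Om.hdiff p (%l. \<ominus>\<^bsub>Om p\<^esub> G l) l"
    by (rule Om.hdiff_diff[of n]) (use F G' l in auto)
  also have "... = Om.hdiff p F l \<ominus>\<^bsub>Om p\<^esub> \<ominus>\<^bsub>Om p\<^esub> Om.hdiff p G l"
    by (simp only: n)
  finally show "Om.hdiff p (%l. F l \<oplus>\<^bsub>Om p\<^esub> G l) l = Om.hdiff p F l \<oplus>\<^bsub>Om p\<^esub> Om.hdiff p G l"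
    using Om.hdiff_closed[OF G l] by (simp add: a_minus_def)
  assume c: "c IN K"
  show "Om.hdiff p (%l. c \<odot>\<^bsub>Om p\<^esub> F l) l = c \<odot>\<^bsub>Om p\<^esub> Om.hdiff p F l"
    by (rule hdiff_map[OF Om_bimod Om_bimod linear_scale[OF linear_id Om_module c] _ _ F l, symmetric])
      (use c in "auto simp: linear_smult[OF form_left(1)] linear_smult[OF form_right(1)]")
qed

lemma dl_linear: "linear K (NC m p) (NC (m + 1) p) (dl m p)"
proof (cases "0 \<le> m + int p")
  case True
  let ?N = "nat (m + int p)"
  have N1: "nat (m + 1 + int p) = Suc ?N" using True by (simp add: nat_add_distrib)
  interpret V: module K "NC m p" by (rule NC_module)
  interpret W: module K "NC (m + 1) p" by (rule NC_module)
  show ?thesis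
  proof (rule linearI)
    fix f assume "f IN NC m p" then show "dl m p f IN NC (m + 1) p" by (rule dl_closed)
  next
    fix f g assume f: "f IN NC m p" and g: "g IN NC m p"
    note fc = NC_val_closed[OF f] and gc = NC_val_closed[OF g]
    show "dl m p (f \<oplus>\<^bsub>NC m p\<^esub> g) = dl m p f \<oplus>\<^bsub>NC (m + 1) p\<^esub> dl m p g"
    proof (rule NC_eqI)
      fix l assume "l \<in> tp (nat (m + 1 + int p))"
      then have l: "l \<in> tp (Suc ?N)" by (simp add: N1)
      have "Om.hdiff p (%l. (f \<oplus>\<^bsub>NC m p\<^esub> g) (br l)) l = Om.hdiff p (%l. f (br l) \<oplus>\<^bsub>Om p\<^esub> g (br l)) l"
        by (rule Om.hdiff_cong[OF NC_add l])
      also have "... = Om.hdiff p (%l. f (br l)) l \<oplus>\<^bsub>Om p\<^esub> Om.hdiff p (%l. g (br l)) l"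
        by (rule hdiff_linear(1)[OF l fc gc])
      finally show "dl m p (f \<oplus>\<^bsub>NC m p\<^esub> g) (br l) = (dl m p f \<oplus>\<^bsub>NC (m + 1) p\<^esub> dl m p g) (br l)"
        using l f g by (simp add: NC_add N1 dl[OF True] signed_add[OF Om_module] Om.hdiff_closed[OF fc] Om.hdiff_closed[OF gc])
    qed (use f g in "auto intro!: dl_closed")
  next
    fix c f assume c: "c IN K" and f: "f IN NC m p"
    note fc = NC_val_closed[OF f]
    show "dl m p (c \<odot>\<^bsub>NC m p\<^esub> f) = c \<odot>\<^bsub>NC (m + 1) p\<^esub> dl m p f"
    proof (rule NC_eqI)
      fix l assume "l \<in> tp (nat (m + 1 + int p))"
      then have l: "l \<in> tp (Suc ?N)" by (simp add: N1)
      have "Om.hdiff p (%l. (c \<odot>\<^bsub>NC m p\<^esub> f) (br l)) l = Om.hdiff p (%l. c \<odot>\<^bsub>Om p\<^esub> f (br l)) l"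
        by (rule Om.hdiff_cong[OF NC_smult l])
      also have "... = c \<odot>\<^bsub>Om p\<^esub> Om.hdiff p (%l. f (br l)) l"
        by (rule hdiff_linear(2)[OF l fc fc c])
      finally show "dl m p (c \<odot>\<^bsub>NC m p\<^esub> f) (br l) = (c \<odot>\<^bsub>NC (m + 1) p\<^esub> dl m p f) (br l)"
        using l f c by (simp add: NC_smult N1 dl[OF True] Om.hdiff_closed[OF fc]
            linear_smult[OF linear_signed_self[OF Om_module]])
    qed (use f c in "auto intro!: dl_closed")
  qed
next
  case False
  then have "dl m p = (%f. \<zero>\<^bsub>NC (m + 1) p\<^esub>)" by (intro ext) (simp add: dl_neg)
  then show ?thesis using linear_const_zero[OF NC_module] by simp
qed

lemma dl_dl:
  assumes f: "f IN NC m p"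
  shows "dl (m + 1) p (dl m p f) = \<zero>\<^bsub>NC (m + 2) p\<^esub>"
proof (cases "0 \<le> m + int p")
  case True
  let ?N = "nat (m + int p)"
  have N: "nat (m + 1 + int p) = Suc ?N" "nat (m + 2 + int p) = Suc (Suc ?N)"
    using True by (simp_all add: nat_add_distrib)
  have m2: "m + 1 + 1 = m + 2" by simp
  note fc = NC_val_closed[OF f]
  have c2: "dl (m + 1) p (dl m p f) IN NC (m + 2) p"
    using dl_closed[OF dl_closed[OF f]] unfolding m2 .
  show ?thesis
  proof (rule NC_eqI[OF c2 module_zero[OF NC_module]])
    fix l assume "l \<in> tp (nat (m + 2 + int p))"
    then have l: "l \<in> tp (Suc (Suc ?N))" by (simp add: N)
    have "Om.hdiff p (%l. dl m p f (br l)) l = Om.hdiff p (%l. signed (Om p) (m + 1) (Om.hdiff p (%l. f (br l)) l)) l"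
      by (rule Om.hdiff_cong[OF _ l]) (rule dl(2)[OF True f])
    also have "... = signed (Om p) (m + 1) (Om.hdiff p (Om.hdiff p (%l. f (br l))) l)"
      by (rule Om.hdiff_signed[OF Om.hdiff_closed[OF fc] l])
    also have "... = \<zero>\<^bsub>Om p\<^esub>"
      by (simp add: Om.hdiff_hdiff[OF fc l] signed_zero[OF Om_module])
    finally show "dl (m + 1) p (dl m p f) (br l) = \<zero>\<^bsub>NC (m + 2) p\<^esub> (br l)"
      using dl(2)[of "m + 1" p "dl m p f" l] dl_closed[OF f] True l
      by (simp add: N NC_zero signed_zero[OF Om_module])
  qed
next
  case False
  then have "dl m p f = \<zero>\<^bsub>NC (m + 1) p\<^esub>" by (simp add: dl_neg)
  then show ?thesis
    using linear_zero[OF dl_linear NC_module NC_module, of "m + 1" p] by (simp add: add.commute)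
qed

subsection \<open>The transition maps\<close>

text \<open>The transition map \<open>\<theta>\<close> on the level of functions of tuples, free of
  degrees and of \<open>lin_ext\<close>.\<close>

definition Th :: "nat => ('a list => ('k, 'a) nc_form) => 'a list => ('k, 'a) nc_form" where
  "Th p F l = fa p (last l) (F (butlast l))"

lemma Th_closed: "(!!l. l \<in> tp n ==> F l IN Om p) ==> l \<in> tp (Suc n) ==> Th p F l IN Om (Suc p)"
  unfolding Th_def using linear_closed[OF form_append(1)] Om.last_closed Om.butlast_closed by metis

lemma Th_mlin:
  "nlin (Om p) n F ==> nlin (Om (Suc p)) (Suc n) (Th p F)"
proof (induct n arbitrary: F)
  case 0
  then show ?case
    using form_append_linear[of "F []" p] form_append_one[of "F []" p]
    by (auto simp: Th_def dest: linear_closed)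
next
  case (Suc n)
  have "nlin (Om (Suc p)) (Suc n) (%l. Th p F (a # l))" if a: "a IN A" for a
  proof (rule mlin_cong)
    show "nlin (Om (Suc p)) (Suc n) (Th p (%l. F (a # l)))"
      by (rule Suc(1)) (use Suc(2) a in simp)
  qed (auto simp: module_A one_A Th_def tuples_Suc)
  moreover have "linear K A (Om (Suc p)) (%a. Th p F (a # l)) \<and> Th p F (\<one> # l) = \<zero>\<^bsub>Om (Suc p)\<^esub>"
    if l: "l \<in> tp (Suc n)" for l
  proof -
    obtain m c where m: "l = m @ [c]" "m \<in> tp n" "c IN A" using l by (auto simp: tuples_snoc)
    have "linear K A (Om p) (%a. F (a # m))" "F (\<one> # m) = \<zero>\<^bsub>Om p\<^esub>" using Suc(2) m by auto
    then show ?thesis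
      using linear_comp[OF _ form_append(1)[OF m(3)]] linear_zero[OF form_append(1)[OF m(3)] Om_module Om_module]
      by (simp add: m(1) butlast_append Th_def)
  qed
  ultimately show ?case by (subst mlin.simps(2)) blast
qed

text \<open>Let \<open>c\<close> be the argument before \<open>b\<close>. The last two terms are
  \<open>F \<otimes> s(cb)\<close> and \<open>(F \<otimes> sc) b\<close>, with opposite signs; their
  difference is \<open>(Fc) \<otimes> sb\<close> by \<open>form_right_append\<close>, which is the
  last term of \<open>TT F\<close> with \<open>sb\<close> appended. All other terms just carry
  \<open>sb\<close> along.\<close>

lemma TT_Th:
  assumes "!!l. l \<in> tp n ==> F l IN Om p" "a IN A" "b IN A" "l \<in> tp n"
  shows "Om.TT (Suc p) (Th p F) a (l @ [b]) = fa p b (Om.TT p F a l)"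
  using assms
proof (induct n arbitrary: F a l)
  case 0
  have f: "F [] IN Om p" using 0 by simp
  have "Om.TT (Suc p) (Th p F) a [b] = Th p F [a \<otimes> b] \<ominus>\<^bsub>Om (Suc p)\<^esub> fr (Suc p) b (Th p F [a])"
    using Om.TT_Cons[OF 0(3), of "[]" 0 "Suc p" "Th p F" a] by (simp add: Om.TT_Nil)
  also have "... = fa p (a \<otimes> b) (F []) \<ominus>\<^bsub>Om (Suc p)\<^esub>
      (fa p (a \<otimes> b) (F []) \<ominus>\<^bsub>Om (Suc p)\<^esub> fa p b (fr p a (F [])))"
    by (simp add: Th_def form_right_append[OF 0(3,2) f])
  also have "... = fa p b (fr p a (F []))"
    by (rule Om.W.M.diff_diff_cancel) (use 0 f linear_closed[OF form_append(1)] linear_closed[OF form_right(1)] mult_A in auto)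
  finally show ?case using 0 by (simp add: Om.TT_Nil)
next
  case (Suc n)
  obtain c cs where l: "l = c # cs" "c IN A" "cs \<in> tp n" using Suc(5) by (auto simp: tuples_Suc)
  have Fa: "!!l. l \<in> tp n ==> F (a # l) IN Om p" using Suc(2,3) by auto
  note csb = tuples_snocI[OF l(3) Suc(4)]
  have "Om.TT (Suc p) (Th p F) a (c # cs @ [b]) = Th p F ((a \<otimes> c) # cs @ [b]) \<ominus>\<^bsub>Om (Suc p)\<^esub>
      Om.TT (Suc p) (%l. Th p F (a # l)) c (cs @ [b])"
    by (rule Om.TT_Cons[OF l(2) csb])
  also have "Om.TT (Suc p) (%l. Th p F (a # l)) c (cs @ [b]) = Om.TT (Suc p) (Th p (%l. F (a # l))) c (cs @ [b])"
    by (rule Om.TT_cong[OF _ l(2) csb]) (auto simp: Th_def tuples_Suc)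
  also have "... = fa p b (Om.TT p (%l. F (a # l)) c cs)"
    by (rule Suc(1)[OF Fa l(2) Suc(4) l(3)])
  also have "Th p F ((a \<otimes> c) # cs @ [b]) = fa p b (F ((a \<otimes> c) # cs))"
    by (simp add: Th_def butlast_append)
  also have "fa p b (F ((a \<otimes> c) # cs)) \<ominus>\<^bsub>Om (Suc p)\<^esub> fa p b (Om.TT p (%l. F (a # l)) c cs) =
     fa p b (F ((a \<otimes> c) # cs) \<ominus>\<^bsub>Om p\<^esub> Om.TT p (%l. F (a # l)) c cs)"
    by (rule linear_minus[OF form_append(1)[OF Suc(4)] Om_module Om_module, symmetric])
      (use Suc(2,3) l Om.TT_closed[OF Fa l(2,3)] mult_A in auto)
  also have "... = fa p b (Om.TT p F a l)"
    using Om.TT_Cons[OF l(2,3), of p F a] l(1) by simp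
  finally show ?case using l(1) by simp
qed

lemma hdiff_Th:
  assumes F: "!!l. l \<in> tp n ==> F l IN Om p" and l: "l \<in> tp (Suc (Suc n))"
  shows "Om.hdiff (Suc p) (Th p F) l = Th p (Om.hdiff p F) l"
proof -
  obtain k b where k: "l = k @ [b]" "k \<in> tp (Suc n)" "b IN A" using l by (auto simp: tuples_snoc[of _ _ "Suc n"])
  obtain a m where m: "k = a # m" "a IN A" "m \<in> tp n" using k(2) by (auto simp: tuples_Suc)
  have "Om.hdiff (Suc p) (Th p F) l = fl (Suc p) a (Th p F (m @ [b])) \<ominus>\<^bsub>Om (Suc p)\<^esub> Om.TT (Suc p) (Th p F) a (m @ [b])"
    by (simp add: Om.hdiff_def k(1) m(1))
  also have "... = fa p b (fl p a (F m)) \<ominus>\<^bsub>Om (Suc p)\<^esub> fa p b (Om.TT p F a m)"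
    using TT_Th[OF F m(2) k(3) m(3)] F[OF m(3)] by (simp add: Th_def form_left_append m(2) k(3))
  also have "... = fa p b (fl p a (F m) \<ominus>\<^bsub>Om p\<^esub> Om.TT p F a m)"
    by (rule linear_minus[OF form_append(1)[OF k(3)] Om_module Om_module, symmetric])
      (use F m Om.TT_closed[OF F m(2,3)] Om.L_closed in auto)
  also have "... = Th p (Om.hdiff p F) l"
    by (simp add: Th_def Om.hdiff_def k(1) m(1) butlast_append)
  finally show ?thesis .
qed

lemma th_neg: "m + int p < 0 ==> th m p f = \<zero>\<^bsub>NC m (Suc p)\<^esub>"
  by (simp add: theta_def)

lemma th:
  assumes mp: "0 \<le> m + int p" and f: "f IN NC m p"
  shows "th m p f IN NC m (Suc p)"
    and "!!l. l \<in> tp (Suc (nat (m + int p))) ==> th m p f (br l) = Th p (%l. f (br l)) l"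
proof -
  let ?N = "nat (m + int p)"
  have G: "nlin (Om (Suc p)) (?N + 1) (Th p (%l. f (br l)))"
    using Th_mlin[OF NC_mlin[OF mp f]] by simp
  have d: "th m p f = lin_ext K (BP (?N + 1)) (Om (Suc p)) (tp (?N + 1)) br (Th p (%l. f (br l)))"
    using mp unfolding theta_def Let_def Th_def by simp
  have N1: "nat (m + int (Suc p)) = ?N + 1" using mp by (simp add: nat_add_distrib)
  show "th m p f IN NC m (Suc p)"
    using bar_ext(1)[OF Om_module G] mp N1 d by (simp add: NC_carrier)
  show "th m p f (br l) = Th p (%l. f (br l)) l" if "l \<in> tp (Suc ?N)" for l
    using bar_ext(2)[OF Om_module G, of l] that d by simp
qed

lemma th_closed: "f IN NC m p ==> th m p f IN NC m (Suc p)"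
  by (cases "0 \<le> m + int p") (auto simp: th th_neg module_zero[OF NC_module])

lemma th_linear: "linear K (NC m p) (NC m (Suc p)) (th m p)"
proof (cases "0 \<le> m + int p")
  case True
  let ?N = "nat (m + int p)"
  have N1: "nat (m + int (Suc p)) = Suc ?N" using True by (simp add: nat_add_distrib)
  interpret V: module K "NC m p" by (rule NC_module)
  interpret W: module K "NC m (Suc p)" by (rule NC_module)
  note lb = Om.last_closed Om.butlast_closed
  show ?thesis
  proof (rule linearI)
    fix f assume "f IN NC m p" then show "th m p f IN NC m (Suc p)" by (rule th_closed)
  next
    fix f g assume f: "f IN NC m p" and g: "g IN NC m p"
    show "th m p (f \<oplus>\<^bsub>NC m p\<^esub> g) = th m p f \<oplus>\<^bsub>NC m (Suc p)\<^esub> th m p g"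
    proof (rule NC_eqI)
      fix l assume "l \<in> tp (nat (m + int (Suc p)))"
      then have l: "l \<in> tp (Suc ?N)" by (simp only: N1)
      then show "th m p (f \<oplus>\<^bsub>NC m p\<^esub> g) (br l) = (th m p f \<oplus>\<^bsub>NC m (Suc p)\<^esub> th m p g) (br l)"
        using f g lb[OF l] NC_val_closed[OF f lb(2)[OF l]] NC_val_closed[OF g lb(2)[OF l]]
        by (simp add: NC_add N1 th[OF True] Th_def linear_add[OF form_append(1)] del: of_nat_Suc)
    qed (use f g in "auto intro!: th_closed")
  next
    fix c f assume c: "c IN K" and f: "f IN NC m p"
    show "th m p (c \<odot>\<^bsub>NC m p\<^esub> f) = c \<odot>\<^bsub>NC m (Suc p)\<^esub> th m p f"
    proof (rule NC_eqI)
      fix l assume "l \<in> tp (nat (m + int (Suc p)))"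
      then have l: "l \<in> tp (Suc ?N)" by (simp only: N1)
      then show "th m p (c \<odot>\<^bsub>NC m p\<^esub> f) (br l) = (c \<odot>\<^bsub>NC m (Suc p)\<^esub> th m p f) (br l)"
        using f c lb[OF l] NC_val_closed[OF f lb(2)[OF l]]
        by (simp add: NC_smult N1 th[OF True] Th_def linear_smult[OF form_append(1)] del: of_nat_Suc)
    qed (use f c in "auto intro!: th_closed")
  qed
next
  case False
  then have "th m p = (%f. \<zero>\<^bsub>NC m (Suc p)\<^esub>)" by (intro ext) (simp add: th_neg)
  then show ?thesis using linear_const_zero[OF NC_module] by simp
qed

text \<open>The sign of \<open>dl\<close> depends on \<open>m\<close> only, which
  \<open>\<theta>\<close> preserves, so the compatibility for \<open>hdiff\<close> carries over
  without a sign.\<close>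

lemma dl_th:
  assumes f: "f IN NC m p"
  shows "dl m (Suc p) (th m p f) = th (m + 1) p (dl m p f)"
proof (cases "0 \<le> m + int p")
  case True
  let ?N = "nat (m + int p)"
  have N: "nat (m + int (Suc p)) = Suc ?N" "nat (m + 1 + int p) = Suc ?N" "nat (m + 1 + int (Suc p)) = Suc (Suc ?N)"
    using True by (simp_all add: nat_add_distrib)
  note fc = NC_val_closed[OF f]
  have mS: "0 \<le> m + int (Suc p)" "0 \<le> m + 1 + int p" using True by auto
  show ?thesis
  proof (rule NC_eqI[OF dl_closed[OF th_closed[OF f]] th_closed[OF dl_closed[OF f]]])
    fix l assume "l \<in> tp (nat (m + 1 + int (Suc p)))"
    then have l: "l \<in> tp (Suc (Suc ?N))" by (simp only: N)
    have l2: "butlast l \<in> tp (Suc ?N)" "last l IN A" using Om.butlast_closed[OF l] Om.last_closed[OF l] .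
    have "dl m (Suc p) (th m p f) (br l) = signed (Om (Suc p)) (m + 1) (Om.hdiff (Suc p) (%l. th m p f (br l)) l)"
      by (rule dl(2)[OF mS(1) th_closed[OF f]]) (simp only: N l)
    also have "Om.hdiff (Suc p) (%l. th m p f (br l)) l = Om.hdiff (Suc p) (Th p (%l. f (br l))) l"
      by (rule Om.hdiff_cong[OF _ l]) (rule th(2)[OF True f])
    also have "... = Th p (Om.hdiff p (%l. f (br l))) l" by (rule hdiff_Th[OF fc l])
    also have "signed (Om (Suc p)) (m + 1) ... = Th p (%l. dl m p f (br l)) l"
      using linear_signed[where j = "m + 1", OF form_append(1)[OF l2(2)] Om_module Om_module
          Om.hdiff_closed[where F = "%l. f (br l)", OF fc l2(1)]]
      by (simp add: Th_def dl(2)[OF True f l2(1)])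
    also have "... = th (m + 1) p (dl m p f) (br l)"
      by (rule th(2)[OF mS(2) dl_closed[OF f], symmetric]) (simp only: N l)
    finally show "dl m (Suc p) (th m p f) (br l) = th (m + 1) p (dl m p f) (br l)" .
  qed
next
  case False
  show ?thesis
    using False linear_zero[OF dl_linear NC_module NC_module, of m "Suc p"]
      linear_zero[OF th_linear NC_module NC_module, of "m + 1" p]
    by (simp add: dl_neg th_neg)
qed

end

lemma (in abelian_group) diff_zero: "x IN G ==> x \<ominus> \<zero> = x"
  by (simp add: a_minus_def minus_zero')

lemma (in abelian_group) diff_add_cancel:
  "[|x IN G; y IN G|] ==> (x \<ominus> y) \<oplus> y = x"
  by algebra

lemma (in abelian_group) add_diff_cancel:
  "[|x IN G; y IN G|] ==> (x \<oplus> y) \<ominus> y = x"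
  by algebra

lemma (in abelian_group) diff_add_swap:
  "[|x IN G; y IN G; z IN G|] ==> x \<ominus> (y \<oplus> z) = (x \<ominus> y) \<ominus> z"
  by algebra

section \<open>Splitting off the last argument\<close>

context hochschild_base
begin

lemma mlin_parameter:
  assumes S: "spans K V S" and V: "module K V" and W: "module K W"
    and lin: "!!l. l \<in> tp n ==> linear K V W (%z. \<beta> z l)"
    and gen: "!!s. s \<in> S ==> nlin W n (\<beta> s)" and z: "z IN V"
  shows "nlin W n (\<beta> z)"
  using S V z
proof (induct rule: spans_induct)
  case zero
  show ?case
    by (rule mlin_cong[OF mlin_const_zero[OF W] module_A]) (use linear_zero[OF lin V W] one_A in auto)
next
  case (gen s)
  then show ?case by (rule assms(5))
next
  case (add x y)
  show ?case
    by (rule mlin_cong[OF mlin_plus[OF W add(3,4)] module_A])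
      (use linear_add[OF lin add(1,2)] one_A in auto)
next
  case (smult c x)
  show ?case
    by (rule mlin_cong[OF mlin_scale[OF W smult(1,3)] module_A])
      (use linear_smult[OF lin smult(1,2)] one_A in auto)
qed

lemma mlin_snocI:
  assumes "!!b. b IN A ==> nlin W n (%l. G l b)"
    and "!!l. l \<in> tp n ==> linear K A W (G l)" and "!!l. l \<in> tp n ==> G l \<one> = \<zero>\<^bsub>W\<^esub>"
  shows "nlin W (Suc n) (%m. G (butlast m) (last m))"
  using assms
proof (induct n arbitrary: G)
  case 0
  then show ?case by (auto dest: linear_closed)
next
  case (Suc n)
  have "nlin W (Suc n) (%m. G (butlast (a # m)) (last (a # m)))" if a: "a IN A" for a
  proof (rule mlin_cong)
    show "nlin W (Suc n) (%m. G (a # butlast m) (last m))"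
      by (rule Suc(1)) (use Suc(2)[of b for b] Suc(3,4) a in auto)
  qed (auto simp: module_A one_A tuples_Suc)
  moreover have "linear K A W (%a. G (butlast (a # l)) (last (a # l))) \<and>
      G (butlast (\<one> # l)) (last (\<one> # l)) = \<zero>\<^bsub>W\<^esub>" if l: "l \<in> tp (Suc n)" for l
  proof -
    obtain m c where m: "l = m @ [c]" "m \<in> tp n" "c IN A" using l by (auto simp: tuples_snoc)
    then show ?thesis using Suc(2)[OF m(3)] by (simp add: butlast_append)
  qed
  ultimately show ?case by (subst mlin.simps(2)) blast
qed

lemma tsum_ok_snocI:
  assumes "nlin W n F"
    and "!!b. b IN A ==> nlin W n (%l. G l b)"
    and "!!l. l \<in> tp n ==> linear K A W (G l)" and "!!l. l \<in> tp n ==> G l \<one> = F l"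
  shows "tsum_ok W n F (%m. G (butlast m) (last m))"
  using assms
proof (induct n arbitrary: F G)
  case 0
  then show ?case by auto
next
  case (Suc n)
  have "tsum_ok W n (%l. F (a # l)) (%m. G (butlast (a # m)) (last (a # m)))" if a: "a IN A" for a
  proof (rule tsum_ok_cong)
    show "tsum_ok W n (%l. F (a # l)) (%m. G (a # butlast m) (last m))"
      by (rule Suc(1)) (use Suc(2,4,5) Suc(3)[of b for b] a in auto)
  qed (auto simp: tuples_Suc)
  moreover have "linear K A W (%a. G (butlast (a # l)) (last (a # l))) \<and>
      G (butlast (\<one> # l)) (last (\<one> # l)) = \<zero>\<^bsub>W\<^esub>" if l: "l \<in> tp (Suc n)" for l
  proof -
    obtain m c where m: "l = m @ [c]" "m \<in> tp n" "c IN A" using l by (auto simp: tuples_snoc)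
    then show ?thesis using Suc(3)[OF m(3)] by (simp add: butlast_append)
  qed
  ultimately show ?case using Suc(2) by simp
qed

text \<open>Separates the final term, in which the last argument acts, from those in which it is an
  entry or is multiplied into one. This is used when the final term is a right multiplication of
  forms, which can itself be expanded.\<close>

lemma tsum_snoc:
  assumes W: "module K W"
    and "!!l. l \<in> tp (Suc n) ==> F l IN W" "!!l. l \<in> tp (Suc (Suc n)) ==> H l IN W"
    and "a IN A" "b IN A" "l \<in> tp n"
  shows "tsum W F H a (l @ [b]) =
    tsum W (%m. F (m @ [b])) (%m. F (butlast m @ [last m \<otimes> b])) a l \<oplus>\<^bsub>W\<^esub>
    signed W (int n + 1) (H (a # l @ [b]))"
proof -
  interpret W: module K W by fact
  show ?thesis
    using assms(2-)
  proof (induct n arbitrary: F H a l)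
    case 0
    then show ?case by (simp add: a_minus_def)
  next
    case (Suc n)
    obtain c m where l: "l = c # m" "c IN A" "m \<in> tp n" using Suc(6) by (auto simp: tuples_Suc)
    let ?t = "tsum W (%m. F (a # m @ [b])) (%m. F (a # butlast m @ [last m \<otimes> b])) c m"
    have Fa: "F (a # k) IN W" if "k \<in> tp (Suc n)" for k using Suc(2,4) that by auto
    have IH: "tsum W (%l. F (a # l)) (%l. H (a # l)) c (m @ [b]) = ?t \<oplus>\<^bsub>W\<^esub> signed W (int n + 1) (H (a # c # m @ [b]))"
      using Suc(1)[of "%l. F (a # l)" "%l. H (a # l)" c m] Suc(2-5) l by auto
    have t: "?t IN W"
      by (rule tsum_closed[OF W, of n])
        (use l Suc(5) in "auto intro!: Fa tuples_snocI mult_A Om.last_closed Om.butlast_closed")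
    have h: "H (a # c # m @ [b]) IN W" using Suc(3)[of "a # c # m @ [b]"] Suc(4,5) l tuples_snocI[OF l(3) Suc(5)] by simp
    have f: "F ((a \<otimes> c) # m @ [b]) IN W" using Suc(2)[of "(a \<otimes> c) # m @ [b]"] Suc(4,5) l tuples_snocI[OF l(3) Suc(5)] by (simp add: mult_A)
    have t2: "tsum W (%l. F ((a # l) @ [b])) (%l. F (butlast (a # l) @ [last (a # l) \<otimes> b])) c m = ?t"
      by (rule tsum_cong[of n]) (use l in "auto simp: tuples_Suc")
    have s: "signed W (int (Suc n) + 1) (H (a # l @ [b])) = \<ominus>\<^bsub>W\<^esub> signed W (int n + 1) (H (a # c # m @ [b]))"
      using signed_Suc[OF W h, of "int n + 1"] l by (simp add: add.commute)
    have "f \<ominus>\<^bsub>W\<^esub> (t \<oplus>\<^bsub>W\<^esub> h) = (f \<ominus>\<^bsub>W\<^esub> t) \<oplus>\<^bsub>W\<^esub> \<ominus>\<^bsub>W\<^esub> h"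
      if "f IN W" "t IN W" "h IN W" for f t h
      using W.M.diff_add_swap[OF that] by (simp add: a_minus_def)
    from this[OF f t signed_closed[OF W h]] show ?case
      unfolding s using IH t2 by (simp add: l(1))
  qed
qed

section \<open>The bimodules \<open>A \<otimes> A\<^sup>\<otimes>\<^sup>p \<otimes> A\<close>\<close>

abbreviation "AA2 \<equiv> AA K A"
abbreviation "ae \<equiv> tensor_el K A A"

lemma AA2_module: "module K AA2"
  unfolding AA_def by (rule tensor_mod(1)[OF module_A module_A])

lemma ae_linear: "y IN A ==> linear K A AA2 (%x. ae x y)" "x IN A ==> linear K A AA2 (ae x)"
  unfolding AA_def using tensor_mod(3,4)[OF module_A module_A] by auto

lemma ae_closed: "x IN A ==> y IN A ==> ae x y IN AA2"
  using linear_closed[OF ae_linear(2)] .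

lemma ae_spans: "spans K AA2 ((%(x, y). ae x y) ` (carrier A \<times> carrier A))"
  unfolding AA_def by (rule tensor_mod(2)[OF module_A module_A])

lemma linear_eq_ae:
  assumes "module K W" "linear K AA2 W f" "linear K AA2 W g"
    and "!!x y. x IN A ==> y IN A ==> f (ae x y) = g (ae x y)" and "z IN AA2"
  shows "f z = g z"
  by (rule linear_eq_spans[OF ae_spans AA2_module assms(1-3) _ assms(5)]) (use assms(4) in auto)

text \<open>A map provided by the universal property, chosen once, so that it can be used without
  repeating the existence argument. \<open>bil_ext\<close> connects it with the
  \<open>lin_ext\<close> of the definitions.\<close>

definition bil :: "('k, 'w) module => ('a => 'a => 'w) => ('a \<times> 'a => 'k) set => 'w" where
  "bil W \<gamma> = (SOME h. linear K AA2 W h \<and> (\<forall>x\<in>carrier A. \<forall>y\<in>carrier A. h (ae x y) = \<gamma> x y))"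

lemma bil:
  assumes W: "module K W" and "!!y. y IN A ==> linear K A W (%x. \<gamma> x y)"
    and "!!x. x IN A ==> linear K A W (\<gamma> x)"
  shows "linear K AA2 W (bil W \<gamma>)"
    and "!!x y. x IN A ==> y IN A ==> bil W \<gamma> (ae x y) = \<gamma> x y"
proof -
  have "\<exists>h. linear K AA2 W h \<and> (\<forall>x\<in>carrier A. \<forall>y\<in>carrier A. h (ae x y) = \<gamma> x y)"
    unfolding AA_def by (rule tensor_mod(5)[OF module_A module_A W assms(2,3)])
  from someI_ex[OF this] show "linear K AA2 W (bil W \<gamma>)"
    "!!x y. x IN A ==> y IN A ==> bil W \<gamma> (ae x y) = \<gamma> x y"
    unfolding bil_def by auto
qed

lemma bil_ext:
  assumes W: "module K W" and 1: "!!y. y IN A ==> linear K A W (%x. \<gamma> x y)"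
    and 2: "!!x. x IN A ==> linear K A W (\<gamma> x)" and z: "z IN AA2"
  shows "lin_ext K AA2 W (carrier A \<times> carrier A) (%(x, y). ae x y) (%(x, y). \<gamma> x y) z = bil W \<gamma> z"
proof -
  have "lin_ext K AA2 W (carrier A \<times> carrier A) (%(x, y). ae x y) (%(x, y). \<gamma> x y) = restrict (bil W \<gamma>) (carrier AA2)"
    by (rule lin_ext_eq_restrict[OF AA2_module W ae_spans bil(1)[OF W 1 2]]) (use bil(2)[OF W 1 2] in auto)
  then show ?thesis using z by simp
qed

text \<open>The map \<open>\<alpha> \<otimes> \<beta>\<close>; the outer and the inner
  multiplications on \<open>A \<otimes> A\<close> are both of this kind.\<close>

definition AAm :: "('a => 'a) => ('a => 'a) => ('a \<times> 'a => 'k) set => ('a \<times> 'a => 'k) set" where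
  "AAm \<alpha> \<beta> = bil AA2 (%x y. ae (\<alpha> x) (\<beta> y))"

lemma AAm_bilinear:
  assumes "linear K A A \<alpha>" "linear K A A \<beta>"
  shows "!!y. y IN A ==> linear K A AA2 (%x. ae (\<alpha> x) (\<beta> y))"
    "!!x. x IN A ==> linear K A AA2 (%y. ae (\<alpha> x) (\<beta> y))"
  using linear_comp[OF assms(1) ae_linear(1)] linear_comp[OF assms(2) ae_linear(2)]
    linear_closed[OF assms(1)] linear_closed[OF assms(2)] by auto

lemma AAm:
  assumes "linear K A A \<alpha>" "linear K A A \<beta>"
  shows "linear K AA2 AA2 (AAm \<alpha> \<beta>)"
    and "!!x y. x IN A ==> y IN A ==> AAm \<alpha> \<beta> (ae x y) = ae (\<alpha> x) (\<beta> y)"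
  unfolding AAm_def using bil[OF AA2_module, of "%x y. ae (\<alpha> x) (\<beta> y)"] AAm_bilinear[OF assms] by auto

lemma AAm_ext:
  assumes "linear K A A \<alpha>" "linear K A A \<beta>" "z IN AA2"
  shows "lin_ext K AA2 AA2 (carrier A \<times> carrier A) (%(x, y). ae x y) (%(x, y). ae (\<alpha> x) (\<beta> y)) z = AAm \<alpha> \<beta> z"
  unfolding AAm_def by (rule bil_ext[OF AA2_module AAm_bilinear[OF assms(1,2)] assms(3)])

lemma AAm_AAm:
  assumes "linear K A A \<alpha>" "linear K A A \<beta>" "linear K A A \<alpha>'" "linear K A A \<beta>'" "z IN AA2"
  shows "AAm \<alpha> \<beta> (AAm \<alpha>' \<beta>' z) = AAm (%x. \<alpha> (\<alpha>' x)) (%y. \<beta> (\<beta>' y)) z"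
proof -
  note l = linear_comp[OF assms(3,1)] linear_comp[OF assms(4,2)]
  show ?thesis
    by (rule linear_eq_ae[OF AA2_module linear_comp[OF AAm(1)[OF assms(3,4)] AAm(1)[OF assms(1,2)]]
          AAm(1)[OF l] _ assms(5)])
      (simp add: AAm(2)[OF assms(1,2)] AAm(2)[OF assms(3,4)] AAm(2)[OF l]
        linear_closed[OF assms(3)] linear_closed[OF assms(4)])
qed

lemma AAm_cong:
  assumes "linear K A A \<alpha>" "linear K A A \<beta>" "linear K A A \<alpha>'" "linear K A A \<beta>'" "z IN AA2"
    and "!!x. x IN A ==> \<alpha> x = \<alpha>' x" "!!x. x IN A ==> \<beta> x = \<beta>' x"
  shows "AAm \<alpha> \<beta> z = AAm \<alpha>' \<beta>' z"
  by (rule linear_eq_ae[OF AA2_module AAm(1)[OF assms(1,2)] AAm(1)[OF assms(3,4)] _ assms(5)])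
    (simp add: AAm(2)[OF assms(1,2)] AAm(2)[OF assms(3,4)] assms(6,7))

lemmas lin_id = linear_id[of K A]

definition TBm :: "('k, 'x) module => ('k, 'y) module => nat => ('x => 'y) =>
    ('x \<times> ('k, 'a) bar_tensor => 'k) set => ('y \<times> ('k, 'a) bar_tensor => 'k) set" where
  "TBm X Y n \<alpha> = (SOME h. linear K (TB X n) (TB Y n) h \<and> (\<forall>x\<in>carrier X. \<forall>l\<in>tp n. h (tb X x l) = tb Y (\<alpha> x) l))"

lemma TBm:
  assumes X: "module K X" and Y: "module K Y" and \<alpha>: "linear K X Y \<alpha>"
  shows "linear K (TB X n) (TB Y n) (TBm X Y n \<alpha>)"
    and "!!x l. x IN X ==> l \<in> tp n ==> TBm X Y n \<alpha> (tb X x l) = tb Y (\<alpha> x) l"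
proof -
  have "\<exists>h. linear K (TB X n) (TB Y n) h \<and> (\<forall>x\<in>carrier X. \<forall>l\<in>tp n. h (tb X x l) = tb Y (\<alpha> x) l)"
    by (rule tb_lift[OF X TB_module[OF Y]])
      (auto intro!: linear_comp[OF \<alpha> tb_linear[OF Y]] tb_mlin[OF Y] linear_closed[OF \<alpha>])
  from someI_ex[OF this] show "linear K (TB X n) (TB Y n) (TBm X Y n \<alpha>)"
    "!!x l. x IN X ==> l \<in> tp n ==> TBm X Y n \<alpha> (tb X x l) = tb Y (\<alpha> x) l"
    unfolding TBm_def by auto
qed

text \<open>The right-hand factor \<open>A\<close> is moved next to the left-hand one;
  \<open>fe x l y\<close> still stands for \<open>x \<otimes> l \<otimes> y\<close>. In this order
  the chains with values in the dual bimodule map to \<open>F_p\<close> through the inclusion of the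
  first tensor factor.\<close>

abbreviation "Fp p \<equiv> TB AA2 p"

abbreviation fe :: "'a => 'a list => 'a => (('a \<times> 'a => 'k) set \<times> ('k, 'a) bar_tensor => 'k) set" where
  "fe x l y \<equiv> tb AA2 (ae x y) l"

lemma Fp_module: "module K (Fp p)"
  by (rule TB_module[OF AA2_module])

lemma fe_closed: "x IN A ==> l \<in> tp p ==> y IN A ==> fe x l y IN Fp p"
  by (intro tb_closed[OF AA2_module] ae_closed)

lemma linear_eq_fe:
  assumes W: "module K W" and f: "linear K (Fp p) W f" and g: "linear K (Fp p) W g"
    and eq: "!!x l y. x IN A ==> l \<in> tp p ==> y IN A ==> f (fe x l y) = g (fe x l y)"
    and \<xi>: "\<xi> IN Fp p"
  shows "f \<xi> = g \<xi>"
proof (rule linear_eq_tb[OF AA2_module W f g _ \<xi>])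
  fix z l assume z: "z IN AA2" and l: "l \<in> tp p"
  show "f (tb AA2 z l) = g (tb AA2 z l)"
    by (rule linear_eq_ae[OF W linear_comp[OF tb_linear[OF AA2_module l] f]
          linear_comp[OF tb_linear[OF AA2_module l] g] _ z]) (use eq l in auto)
qed

lemma fe_lift:
  assumes W: "module K W"
    and 1: "!!l y. l \<in> tp p ==> y IN A ==> linear K A W (%x. \<gamma> x l y)"
    and 2: "!!x l. x IN A ==> l \<in> tp p ==> linear K A W (\<gamma> x l)"
    and 3: "!!x y. x IN A ==> y IN A ==> nlin W p (%l. \<gamma> x l y)"
  shows "\<exists>h. linear K (Fp p) W h \<and> (\<forall>x\<in>carrier A. \<forall>l\<in>tp p. \<forall>y\<in>carrier A. h (fe x l y) = \<gamma> x l y)"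
proof -
  let ?\<beta> = "%z l. bil W (%x y. \<gamma> x l y) z"
  note b = bil[OF W 1 2]
  have "\<exists>h. linear K (Fp p) W h \<and> (\<forall>z\<in>carrier AA2. \<forall>l\<in>tp p. h (tb AA2 z l) = ?\<beta> z l)"
  proof (rule tb_lift[OF AA2_module W b(1)])
    fix z assume z: "z IN AA2"
    show "nlin W p (?\<beta> z)"
    proof (rule mlin_parameter[OF ae_spans AA2_module W b(1) _ z])
      fix s assume "s \<in> (%(x, y). ae x y) ` (carrier A \<times> carrier A)"
      then obtain x y where xy: "x IN A" "y IN A" "s = ae x y" by auto
      show "nlin W p (?\<beta> s)"
        by (rule mlin_cong[OF 3[OF xy(1,2)] module_A]) (use xy b(2) one_A in auto)
    qed auto
  qed auto
  then obtain h where "linear K (Fp p) W h" "\<forall>z\<in>carrier AA2. \<forall>l\<in>tp p. h (tb AA2 z l) = ?\<beta> z l" by blast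
  then show ?thesis using b(2) ae_closed by (intro exI[of _ h]) auto
qed

text \<open>Outer actions: \<open>FL\<close> multiplies the left factor \<open>A\<close> from the
  left, \<open>FR\<close> the right factor from the right. The bimodule structure of the dual uses
  the inner ones, see \<open>act\<close>.\<close>

definition FL :: "nat => 'a => (('a \<times> 'a => 'k) set \<times> ('k, 'a) bar_tensor => 'k) set => _" where
  "FL p a = TBm AA2 AA2 p (AAm (%x. a \<otimes> x) (%y. y))"

definition FR :: "nat => 'a => (('a \<times> 'a => 'k) set \<times> ('k, 'a) bar_tensor => 'k) set => _" where
  "FR p a = TBm AA2 AA2 p (AAm (%x. x) (%y. y \<otimes> a))"

lemma FL:
  assumes a: "a IN A"
  shows "linear K (Fp p) (Fp p) (FL p a)"
    and "!!z l. z IN AA2 ==> l \<in> tp p ==> FL p a (tb AA2 z l) = tb AA2 (AAm (%x. a \<otimes> x) (%y. y) z) l"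
    and "!!x l y. x IN A ==> l \<in> tp p ==> y IN A ==> FL p a (fe x l y) = fe (a \<otimes> x) l y"
proof -
  note m = AAm[OF linear_mult_left[OF a] lin_id]
  show "linear K (Fp p) (Fp p) (FL p a)"
    "!!z l. z IN AA2 ==> l \<in> tp p ==> FL p a (tb AA2 z l) = tb AA2 (AAm (%x. a \<otimes> x) (%y. y) z) l"
    unfolding FL_def using TBm[OF AA2_module AA2_module m(1)] by auto
  then show "FL p a (fe x l y) = fe (a \<otimes> x) l y" if "x IN A" "l \<in> tp p" "y IN A" for x l y
    using that m(2) ae_closed by simp
qed

lemma FR:
  assumes a: "a IN A"
  shows "linear K (Fp p) (Fp p) (FR p a)"
    and "!!z l. z IN AA2 ==> l \<in> tp p ==> FR p a (tb AA2 z l) = tb AA2 (AAm (%x. x) (%y. y \<otimes> a) z) l"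
    and "!!x l y. x IN A ==> l \<in> tp p ==> y IN A ==> FR p a (fe x l y) = fe x l (y \<otimes> a)"
proof -
  note m = AAm[OF lin_id linear_mult_right[OF a]]
  show "linear K (Fp p) (Fp p) (FR p a)"
    "!!z l. z IN AA2 ==> l \<in> tp p ==> FR p a (tb AA2 z l) = tb AA2 (AAm (%x. x) (%y. y \<otimes> a) z) l"
    unfolding FR_def using TBm[OF AA2_module AA2_module m(1)] by auto
  then show "FR p a (fe x l y) = fe x l (y \<otimes> a)" if "x IN A" "l \<in> tp p" "y IN A" for x l y
    using that m(2) ae_closed by simp
qed

lemma fe_linear:
  "l \<in> tp p ==> y IN A ==> linear K A (Fp p) (%x. fe x l y)"
  "x IN A ==> l \<in> tp p ==> linear K A (Fp p) (%y. fe x l y)"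
  using linear_comp[OF ae_linear(1) tb_linear[OF AA2_module]] linear_comp[OF ae_linear(2) tb_linear[OF AA2_module]]
  by auto

lemma fe_mlin: "x IN A ==> y IN A ==> nlin (Fp p) p (%l. fe x l y)"
  by (intro tb_mlin[OF AA2_module] ae_closed)

text \<open>The projection of \<open>F_p\<close> modulo a submodule \<open>H\<close> that contains
  all \<open>fe x l y\<close> vanishes on these elements, hence is zero by
  \<open>linear_eq_fe\<close>; so \<open>H\<close> is everything.\<close>

lemma fe_spans: "spans K (Fp p) {fe x l y | x l y. x IN A \<and> l \<in> tp p \<and> y IN A}"
proof (rule spansI[OF Fp_module])
  show "{fe x l y | x l y. x IN A \<and> l \<in> tp p \<and> y IN A} \<subseteq> carrier (Fp p)"
    using fe_closed by blast
  fix H \<xi> assume H: "submodule H K (Fp p)"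
    and sub: "{fe x l y | x l y. x IN A \<and> l \<in> tp p \<and> y IN A} \<subseteq> H" and \<xi>: "\<xi> IN Fp p"
  note q = quot_mod[OF Fp_module H]
  have "H +>\<^bsub>Fp p\<^esub> \<xi> = \<zero>\<^bsub>quot_mod (Fp p) H\<^esub>"
  proof (rule linear_eq_fe[OF q(1) q(2) linear_const_zero[OF q(1)] _ \<xi>])
    fix x l y assume "x IN A" "l \<in> tp p" "y IN A"
    then have "fe x l y IN Fp p" "fe x l y \<in> H" using sub fe_closed by blast+
    then show "H +>\<^bsub>Fp p\<^esub> fe x l y = \<zero>\<^bsub>quot_mod (Fp p) H\<^esub>" using q(5) by blast
  qed
  then show "\<xi> \<in> H" using q(5)[OF \<xi>] by simp
qed

lemma Fp_bimod: "bimod K A (Fp p) (FL p) (FR p)"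
proof (intro bimod.intro bimod_axioms.intro hochschild_base_axioms)
  fix w assume w: "w IN Fp p"
  show "linear K A (Fp p) (%a. FL p a w)"
  proof (rule linear_parameter[OF fe_spans Fp_module Fp_module module_A FL(1) _ w])
    fix s assume "s \<in> {fe x l y | x l y. x IN A \<and> l \<in> tp p \<and> y IN A}"
    then obtain x l y where s: "s = fe x l y" "x IN A" "l \<in> tp p" "y IN A" by blast
    show "linear K A (Fp p) (%a. FL p a s)"
      by (rule linear_cong[OF linear_comp[OF linear_mult_right[OF s(2)] fe_linear(1)[OF s(3,4)]] module_A])
        (use s FL(3) in auto)
  qed
  show "linear K A (Fp p) (%a. FR p a w)"
  proof (rule linear_parameter[OF fe_spans Fp_module Fp_module module_A FR(1) _ w])
    fix s assume "s \<in> {fe x l y | x l y. x IN A \<and> l \<in> tp p \<and> y IN A}"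
    then obtain x l y where s: "s = fe x l y" "x IN A" "l \<in> tp p" "y IN A" by blast
    show "linear K A (Fp p) (%a. FR p a s)"
      by (rule linear_cong[OF linear_comp[OF linear_mult_left[OF s(4)] fe_linear(2)[OF s(2,3)]] module_A])
        (use s FR(3) in auto)
  qed
  show "FL p \<one> w = w"
    by (rule linear_eq_fe[OF Fp_module FL(1)[OF one_A] linear_id _ w]) (simp add: FL(3) one_A one_mult_A)
  show "FR p \<one> w = w"
    by (rule linear_eq_fe[OF Fp_module FR(1)[OF one_A] linear_id _ w]) (simp add: FR(3) one_A one_mult_A)
  fix a b assume a: "a IN A" and b: "b IN A"
  show "FL p a (FL p b w) = FL p (a \<otimes> b) w"
    by (rule linear_eq_fe[OF Fp_module linear_comp[OF FL(1)[OF b] FL(1)[OF a]] FL(1)[OF mult_A[OF a b]] _ w])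
      (simp add: FL(3) a b mult_A assoc_A)
  show "FR p b (FR p a w) = FR p (a \<otimes> b) w"
    by (rule linear_eq_fe[OF Fp_module linear_comp[OF FR(1)[OF a] FR(1)[OF b]] FR(1)[OF mult_A[OF a b]] _ w])
      (simp add: FR(3) a b mult_A assoc_A)
  show "FL p a (FR p b w) = FR p b (FL p a w)"
    by (rule linear_eq_fe[OF Fp_module linear_comp[OF FR(1)[OF b] FL(1)[OF a]] linear_comp[OF FL(1)[OF a] FR(1)[OF b]] _ w])
      (simp add: FR(3) FL(3) a b mult_A)
qed (simp_all add: Fp_module FL(1) FR(1))

sublocale Fp: bimod K A "Fp p" "FL p" "FR p" for p
  by (rule Fp_bimod)

text \<open>The splitting of \<open>0 \<rightarrow> \<Omega>\<^sup>p\<^sup>+\<^sup>1 \<rightarrow> A \<otimes> A\<^sup>\<otimes>\<^sup>p \<otimes> A \<rightarrow> \<Omega>\<^sup>p \<rightarrow> 0\<close> as left modules: \<open>\<sigma>\<close> and \<open>\<psi>\<close> are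
  the bimodule maps of the sequence, \<open>\<phi>\<close> and \<open>\<tau> 1\<close> split it.\<close>

definition \<tau> :: "nat => 'a => ('k, 'a) nc_form => (('a \<times> 'a => 'k) set \<times> ('k, 'a) bar_tensor => 'k) set" where
  "\<tau> p y = (SOME h. linear K (Om p) (Fp p) h \<and> (\<forall>l\<in>tp (Suc p). h (fm l) = fe (hd l) (tl l) y))"

definition \<phi> :: "nat => (('a \<times> 'a => 'k) set \<times> ('k, 'a) bar_tensor => 'k) set => ('k, 'a) nc_form" where
  "\<phi> p = (SOME h. linear K (Fp p) (Om (Suc p)) h \<and>
     (\<forall>x\<in>carrier A. \<forall>l\<in>tp p. \<forall>y\<in>carrier A. h (fe x l y) = fm (x # l @ [y])))"

definition \<psi> :: "nat => (('a \<times> 'a => 'k) set \<times> ('k, 'a) bar_tensor => 'k) set => ('k, 'a) nc_form" where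
  "\<psi> p = (SOME h. linear K (Fp p) (Om p) h \<and>
     (\<forall>x\<in>carrier A. \<forall>l\<in>tp p. \<forall>y\<in>carrier A. h (fe x l y) = fr p y (fm (x # l))))"

text \<open>\<open>w \<otimes> sy\<close> goes to \<open>w \<otimes> y - wy \<otimes> 1\<close>, an
  element of the kernel of the right multiplication \<open>\<psi>\<close>. The correction term makes
  the expression vanish for \<open>y = 1\<close>, as it must in order to depend on the class of
  \<open>y\<close> in \<open>A/k\<close>.\<close>

definition \<sigma> :: "nat => ('k, 'a) nc_form => (('a \<times> 'a => 'k) set \<times> ('k, 'a) bar_tensor => 'k) set" where
  "\<sigma> p = (SOME h. linear K (Om (Suc p)) (Fp p) h \<and> (\<forall>l\<in>tp (Suc (Suc p)). h (fm l) =
     \<tau> p (last l) (fm (butlast l)) \<ominus>\<^bsub>Fp p\<^esub> \<tau> p \<one> (fr p (last l) (fm (butlast l)))))"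

lemma \<tau>:
  assumes y: "y IN A"
  shows "linear K (Om p) (Fp p) (\<tau> p y)"
    and "!!x l. x IN A ==> l \<in> tp p ==> \<tau> p y (fm (x # l)) = fe x l y"
proof -
  have "\<exists>h. linear K (Om p) (Fp p) h \<and> (\<forall>l\<in>tp (Suc p). h (fm l) = fe (hd l) (tl l) y)"
    by (rule form_lift[OF Fp_module]) (use fe_linear(1) fe_mlin y in auto)
  from someI_ex[OF this] show "linear K (Om p) (Fp p) (\<tau> p y)"
    "!!x l. x IN A ==> l \<in> tp p ==> \<tau> p y (fm (x # l)) = fe x l y"
    unfolding \<tau>_def by auto
qed

lemma \<phi>:
  shows "linear K (Fp p) (Om (Suc p)) (\<phi> p)"
    and "!!x l y. x IN A ==> l \<in> tp p ==> y IN A ==> \<phi> p (fe x l y) = fm (x # l @ [y])"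
proof -
  have "\<exists>h. linear K (Fp p) (Om (Suc p)) h \<and>
     (\<forall>x\<in>carrier A. \<forall>l\<in>tp p. \<forall>y\<in>carrier A. h (fe x l y) = fm (x # l @ [y]))"
  proof (rule fe_lift[OF Om_module])
    fix x l assume "x IN A" "l \<in> tp p"
    then show "linear K A (Om (Suc p)) (%y. fm (x # l @ [y]))"
      using mlin_last_linear[OF form_mlin _ one_A] by blast
  qed (auto intro!: form_linear tuples_snocI mlin_snoc[OF form_mlin])
  from someI_ex[OF this] show "linear K (Fp p) (Om (Suc p)) (\<phi> p)"
    "!!x l y. x IN A ==> l \<in> tp p ==> y IN A ==> \<phi> p (fe x l y) = fm (x # l @ [y])"
    unfolding \<phi>_def by auto
qed

lemma \<psi>:
  shows "linear K (Fp p) (Om p) (\<psi> p)"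
    and "!!x l y. x IN A ==> l \<in> tp p ==> y IN A ==> \<psi> p (fe x l y) = fr p y (fm (x # l))"
proof -
  have "\<exists>h. linear K (Fp p) (Om p) h \<and>
     (\<forall>x\<in>carrier A. \<forall>l\<in>tp p. \<forall>y\<in>carrier A. h (fe x l y) = fr p y (fm (x # l)))"
    by (rule fe_lift[OF Om_module])
      (auto intro!: linear_comp[OF form_linear form_right(1)] form_right_linear form_closed
        mlin_comp[OF form_mlin form_right(1) Om_module Om_module])
  from someI_ex[OF this] show "linear K (Fp p) (Om p) (\<psi> p)"
    "!!x l y. x IN A ==> l \<in> tp p ==> y IN A ==> \<psi> p (fe x l y) = fr p y (fm (x # l))"
    unfolding \<psi>_def by auto
qed

lemma \<tau>_linear:
  assumes w: "w IN Om p"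
  shows "linear K A (Fp p) (%y. \<tau> p y w)"
proof (rule linear_parameter[OF form_spans Om_module Fp_module module_A \<tau>(1) _ w])
  fix s assume "s \<in> fm ` tp (Suc p)"
  then obtain x l where xl: "s = fm (x # l)" "x IN A" "l \<in> tp p" by (auto simp: tuples_Suc)
  show "linear K A (Fp p) (%y. \<tau> p y s)"
    by (rule linear_cong[OF fe_linear(2)[OF xl(2,3)] module_A]) (use xl \<tau>(2) in auto)
qed

lemma \<sigma>:
  shows "linear K (Om (Suc p)) (Fp p) (\<sigma> p)"
    and "!!y w. y IN A ==> w IN Om p ==>
      \<sigma> p (fa p y w) = \<tau> p y w \<ominus>\<^bsub>Fp p\<^esub> \<tau> p \<one> (fr p y w)"
proof -
  let ?G = "%l y. \<tau> p y (fm l) \<ominus>\<^bsub>Fp p\<^esub> \<tau> p \<one> (fr p y (fm l))"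
  note W = Fp_module[of p]
  have ex: "\<exists>h. linear K (Om (Suc p)) (Fp p) h \<and> (\<forall>l\<in>tp (Suc (Suc p)). h (fm l) = ?G (butlast l) (last l))"
  proof (rule form_lift[OF W])
    fix m assume "m \<in> tp (Suc p)"
    then obtain l y where l: "m = l @ [y]" "l \<in> tp p" "y IN A" by (auto simp: tuples_snoc)
    have "linear K A (Fp p) (%x. ?G (x # l) y)"
      by (intro linear_diff[OF _ _ W] linear_comp[OF form_linear[OF l(2)] \<tau>(1)[OF l(3)]]
          linear_comp[OF linear_comp[OF form_linear[OF l(2)] form_right(1)[OF l(3)]] \<tau>(1)[OF one_A]])
    then show "linear K A (Fp p) (%x. ?G (butlast (x # m)) (last (x # m)))"
      by (simp add: l(1) butlast_append)
  next
    fix x assume x: "x IN A"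
    have "nlin (Fp p) (Suc p) (%m. ?G (x # butlast m) (last m))"
    proof (rule mlin_snocI[of _ _ "%l y. ?G (x # l) y"])
      fix b assume b: "b IN A"
      show "nlin (Fp p) p (%l. ?G (x # l) b)"
        by (intro mlin_diff[OF W] mlin_comp[OF form_mlin[OF x] \<tau>(1)[OF b] Om_module W]
          mlin_comp[OF form_mlin[OF x] linear_comp[OF form_right(1)[OF b] \<tau>(1)[OF one_A]] Om_module W])
    next
      fix l assume l: "l \<in> tp p"
      have f: "fm (x # l) IN Om p" by (rule form_closed) (use x l in simp)
      show "linear K A (Fp p) (%y. ?G (x # l) y)"
        by (intro linear_diff[OF _ _ W] \<tau>_linear f linear_comp[OF form_right_linear[OF f] \<tau>(1)[OF one_A]])
      show "?G (x # l) \<one> = \<zero>\<^bsub>Fp p\<^esub>"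
        using linear_closed[OF \<tau>(1)[OF one_A] f] by (simp add: form_right_one[OF f] Fp.W.M.diff_eq_zero_iff)
    qed
    then show "nlin (Fp p) (Suc p) (%m. ?G (butlast (x # m)) (last (x # m)))"
      by (rule mlin_cong) (auto simp: module_A one_A tuples_Suc)
  qed
  from someI_ex[OF ex] have s: "linear K (Om (Suc p)) (Fp p) (\<sigma> p)"
    "!!l. l \<in> tp (Suc (Suc p)) ==> \<sigma> p (fm l) = ?G (butlast l) (last l)"
    unfolding \<sigma>_def by auto
  show "linear K (Om (Suc p)) (Fp p) (\<sigma> p)" by (rule s(1))
  fix y w assume y: "y IN A" and w: "w IN Om p"
  show "\<sigma> p (fa p y w) = \<tau> p y w \<ominus>\<^bsub>Fp p\<^esub> \<tau> p \<one> (fr p y w)"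
  proof (rule linear_eq_form[OF W linear_comp[OF form_append(1)[OF y] s(1)] _ _ w])
    show "linear K (Om p) (Fp p) (%w. \<tau> p y w \<ominus>\<^bsub>Fp p\<^esub> \<tau> p \<one> (fr p y w))"
      by (intro linear_diff[OF _ _ W] \<tau> y one_A linear_comp[OF form_right(1)[OF y] \<tau>(1)])
    fix l assume l: "l \<in> tp (Suc p)"
    show "\<sigma> p (fa p y (fm l)) = \<tau> p y (fm l) \<ominus>\<^bsub>Fp p\<^esub> \<tau> p \<one> (fr p y (fm l))"
      using s(2)[OF tuples_snocI[OF l y]] by (simp add: form_append(2)[OF y l] butlast_append)
  qed
qed

lemma \<tau>_closed: "y IN A ==> w IN Om p ==> \<tau> p y w IN Fp p"
  by (rule linear_closed[OF \<tau>(1)])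

lemma \<sigma>_closed: "w IN Om (Suc p) ==> \<sigma> p w IN Fp p"
  by (rule linear_closed[OF \<sigma>(1)])

lemma \<phi>_closed: "\<xi> IN Fp p ==> \<phi> p \<xi> IN Om (Suc p)"
  by (rule linear_closed[OF \<phi>(1)])

lemma \<psi>_closed: "\<xi> IN Fp p ==> \<psi> p \<xi> IN Om p"
  by (rule linear_closed[OF \<psi>(1)])

lemma append_closed: "y IN A ==> w IN Om p ==> fa p y w IN Om (Suc p)"
  by (rule linear_closed[OF form_append(1)])

lemma linear_eq_\<tau>:
  assumes W: "module K W" and f: "linear K (Fp p) W f" and g: "linear K (Fp p) W g"
    and eq: "!!y w. y IN A ==> w IN Om p ==> f (\<tau> p y w) = g (\<tau> p y w)"
    and \<xi>: "\<xi> IN Fp p"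
  shows "f \<xi> = g \<xi>"
proof (rule linear_eq_fe[OF W f g _ \<xi>])
  fix x l y assume x: "x IN A" "l \<in> tp p" "y IN A"
  have "fm (x # l) IN Om p" by (rule form_closed) (use x in simp)
  from eq[OF x(3) this] show "f (fe x l y) = g (fe x l y)" using x by (simp add: \<tau>(2))
qed

lemma \<phi>_\<tau>: "y IN A ==> w IN Om p ==> \<phi> p (\<tau> p y w) = fa p y w"
  by (rule linear_eq_form[OF Om_module linear_comp[OF \<tau>(1) \<phi>(1)] form_append(1)])
    (auto simp: tuples_Suc \<tau>(2) \<phi>(2) form_append(2))

lemma \<psi>_\<tau>: "y IN A ==> w IN Om p ==> \<psi> p (\<tau> p y w) = fr p y w"
  by (rule linear_eq_form[OF Om_module linear_comp[OF \<tau>(1) \<psi>(1)] form_right(1)])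
    (auto simp: tuples_Suc \<tau>(2) \<psi>(2))

lemma FR_\<tau>: "y IN A ==> b IN A ==> w IN Om p ==> FR p b (\<tau> p y w) = \<tau> p (y \<otimes> b) w"
  by (rule linear_eq_form[OF Fp_module linear_comp[OF \<tau>(1) FR(1)] \<tau>(1)])
    (auto simp: tuples_Suc \<tau>(2) FR(3) mult_A)

lemma FL_\<tau>: "y IN A ==> a IN A ==> w IN Om p ==> FL p a (\<tau> p y w) = \<tau> p y (fl p a w)"
  by (rule linear_eq_form[OF Fp_module linear_comp[OF \<tau>(1) FL(1)] linear_comp[OF form_left(1) \<tau>(1)]])
    (auto simp: tuples_Suc \<tau>(2) FL(3) form_left(2) mult_A)

lemma \<phi>_\<tau>_one: "w IN Om p ==> \<phi> p (\<tau> p \<one> w) = \<zero>\<^bsub>Om (Suc p)\<^esub>"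
  by (simp add: \<phi>_\<tau> one_A form_append_one)

lemma \<psi>_\<tau>_one: "w IN Om p ==> \<psi> p (\<tau> p \<one> w) = w"
  by (simp add: \<psi>_\<tau> one_A form_right_one)

lemma \<phi>_\<sigma>:
  assumes w: "w IN Om (Suc p)" shows "\<phi> p (\<sigma> p w) = w"
proof (rule linear_eq_append[OF Om_module linear_comp[OF \<sigma>(1) \<phi>(1)] linear_id _ w])
  fix w c assume w: "w IN Om p" and c: "c IN A"
  show "\<phi> p (\<sigma> p (fa p c w)) = fa p c w"
    using w c append_closed[OF c w]
    by (simp add: \<sigma>(2) linear_minus[OF \<phi>(1) Fp_module Om_module] \<tau>_closed one_A Om.R_closed \<phi>_\<tau> \<phi>_\<tau>_one
        Om.W.M.diff_zero form_append_one)
qed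

lemma \<psi>_\<sigma>:
  assumes w: "w IN Om (Suc p)" shows "\<psi> p (\<sigma> p w) = \<zero>\<^bsub>Om p\<^esub>"
proof (rule linear_eq_append[OF Om_module linear_comp[OF \<sigma>(1) \<psi>(1)] linear_const_zero[OF Om_module] _ w])
  fix w c assume w: "w IN Om p" and c: "c IN A"
  show "\<psi> p (\<sigma> p (fa p c w)) = \<zero>\<^bsub>Om p\<^esub>"
    using w c Om.R_closed[OF c w]
    by (simp add: \<sigma>(2) linear_minus[OF \<psi>(1) Fp_module Om_module] \<tau>_closed one_A \<psi>_\<tau> form_right_one
        Om.W.M.diff_eq_zero_iff)
qed

text \<open>On \<open>w \<otimes> y\<close> the two summands are
  \<open>w \<otimes> y - wy \<otimes> 1\<close> and \<open>wy \<otimes> 1\<close>. Elements of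
  \<open>F_p\<close> are henceforth handled through their components under \<open>\<phi>\<close> and
  \<open>\<psi>\<close>.\<close>

lemma \<sigma>_\<phi>_\<tau>_\<psi>:
  assumes \<xi>: "\<xi> IN Fp p" shows "\<sigma> p (\<phi> p \<xi>) \<oplus>\<^bsub>Fp p\<^esub> \<tau> p \<one> (\<psi> p \<xi>) = \<xi>"
proof (rule linear_eq_\<tau>[OF Fp_module _ linear_id _ \<xi>])
  show "linear K (Fp p) (Fp p) (%\<xi>. \<sigma> p (\<phi> p \<xi>) \<oplus>\<^bsub>Fp p\<^esub> \<tau> p \<one> (\<psi> p \<xi>))"
    by (intro linear_plus[OF _ _ Fp_module] linear_comp[OF \<phi>(1) \<sigma>(1)] linear_comp[OF \<psi>(1) \<tau>(1)] one_A)
  fix y w assume "y IN A" "w IN Om p"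
  then show "\<sigma> p (\<phi> p (\<tau> p y w)) \<oplus>\<^bsub>Fp p\<^esub> \<tau> p \<one> (\<psi> p (\<tau> p y w)) = \<tau> p y w"
    by (simp add: \<phi>_\<tau> \<psi>_\<tau> \<sigma>(2) Fp.W.M.diff_add_cancel \<tau>_closed one_A Om.R_closed)
qed

lemma \<sigma>_left:
  assumes a: "a IN A" and w: "w IN Om (Suc p)"
  shows "\<sigma> p (fl (Suc p) a w) = FL p a (\<sigma> p w)"
proof (rule linear_eq_append[OF Fp_module linear_comp[OF form_left(1)[OF a] \<sigma>(1)] linear_comp[OF \<sigma>(1) FL(1)[OF a]] _ w])
  fix w c assume w: "w IN Om p" and c: "c IN A"
  show "\<sigma> p (fl (Suc p) a (fa p c w)) = FL p a (\<sigma> p (fa p c w))"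
    using w c a by (simp add: form_left_append \<sigma>(2) linear_minus[OF FL(1)[OF a] Fp_module Fp_module]
        \<tau>_closed one_A Om.R_closed Om.L_closed FL_\<tau> form_left_right)
qed

text \<open>Right multiplication of forms has two terms by \<open>form_right_append\<close>; the
  parts ending in \<open>1\<close> which \<open>\<sigma>\<close> adds to them are equal and cancel.
  What is left is right multiplication in the last factor of \<open>F_p\<close>.\<close>

lemma \<sigma>_right:
  assumes b: "b IN A" and w: "w IN Om (Suc p)"
  shows "\<sigma> p (fr (Suc p) b w) = FR p b (\<sigma> p w)"
proof (rule linear_eq_append[OF Fp_module linear_comp[OF form_right(1)[OF b] \<sigma>(1)] linear_comp[OF \<sigma>(1) FR(1)[OF b]] _ w])
  fix w c assume w: "w IN Om p" and c: "c IN A"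
  note cb = mult_A[OF c b] and Rc = Om.R_closed[OF c w]
  have "\<sigma> p (fr (Suc p) b (fa p c w)) =
      \<sigma> p (fa p (c \<otimes> b) w) \<ominus>\<^bsub>Fp p\<^esub> \<sigma> p (fa p b (fr p c w))"
    unfolding form_right_append[OF b c w]
    by (rule linear_minus[OF \<sigma>(1) Om_module Fp_module]) (use append_closed cb b w Rc in auto)
  also have "... = (\<tau> p (c \<otimes> b) w \<ominus>\<^bsub>Fp p\<^esub> \<tau> p \<one> (fr p (c \<otimes> b) w)) \<ominus>\<^bsub>Fp p\<^esub>
      (\<tau> p b (fr p c w) \<ominus>\<^bsub>Fp p\<^esub> \<tau> p \<one> (fr p (c \<otimes> b) w))"
    by (simp only: \<sigma>(2)[OF cb w] \<sigma>(2)[OF b Rc] form_right_right[OF c b w])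
  also have "... = \<tau> p (c \<otimes> b) w \<ominus>\<^bsub>Fp p\<^esub> \<tau> p b (fr p c w)"
    by (rule Fp.W.M.diff_telescope) (use \<tau>_closed cb b w Rc Om.R_closed one_A in auto)
  also have "... = FR p b (\<tau> p c w) \<ominus>\<^bsub>Fp p\<^esub> FR p b (\<tau> p \<one> (fr p c w))"
    using b c w Rc by (simp add: FR_\<tau> one_A one_mult_A)
  also have "... = FR p b (\<sigma> p (fa p c w))"
    unfolding \<sigma>(2)[OF c w]
    by (rule linear_minus[OF FR(1)[OF b] Fp_module Fp_module, symmetric]) (use \<tau>_closed c w Rc one_A in auto)
  finally show "\<sigma> p (fr (Suc p) b (fa p c w)) = FR p b (\<sigma> p (fa p c w))" .
qed

text \<open>The section \<open>w \<mapsto> w \<otimes> 1\<close> of \<open>\<psi>\<close> is left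
  linear, and its defect of right linearity at \<open>b\<close> is \<open>\<sigma>\<close> of
  \<open>w \<otimes> sb\<close>. This defect is the source of \<open>\<theta>\<close>.\<close>

lemma FR_\<tau>_one:
  assumes b: "b IN A" and w: "w IN Om p"
  shows "FR p b (\<tau> p \<one> w) = \<sigma> p (fa p b w) \<oplus>\<^bsub>Fp p\<^esub> \<tau> p \<one> (fr p b w)"
  using b w by (simp add: FR_\<tau> one_A one_mult_A \<sigma>(2) Fp.W.M.diff_add_cancel \<tau>_closed Om.R_closed)

lemma \<psi>_left:
  assumes a: "a IN A" and \<xi>: "\<xi> IN Fp p"
  shows "\<psi> p (FL p a \<xi>) = fl p a (\<psi> p \<xi>)"
  by (rule linear_eq_\<tau>[OF Om_module linear_comp[OF FL(1)[OF a] \<psi>(1)] linear_comp[OF \<psi>(1) form_left(1)[OF a]] _ \<xi>])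
    (simp add: FL_\<tau> \<psi>_\<tau> a Om.L_closed form_left_right)

lemma \<psi>_right:
  assumes a: "a IN A" and \<xi>: "\<xi> IN Fp p"
  shows "\<psi> p (FR p a \<xi>) = fr p a (\<psi> p \<xi>)"
  by (rule linear_eq_\<tau>[OF Om_module linear_comp[OF FR(1)[OF a] \<psi>(1)] linear_comp[OF \<psi>(1) form_right(1)[OF a]] _ \<xi>])
    (simp add: FR_\<tau> \<psi>_\<tau> a mult_A form_right_right)

lemma \<phi>_left:
  assumes a: "a IN A" and \<xi>: "\<xi> IN Fp p"
  shows "\<phi> p (FL p a \<xi>) = fl (Suc p) a (\<phi> p \<xi>)"
  by (rule linear_eq_\<tau>[OF Om_module linear_comp[OF FL(1)[OF a] \<phi>(1)] linear_comp[OF \<phi>(1) form_left(1)[OF a]] _ \<xi>])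
    (simp add: FL_\<tau> \<phi>_\<tau> a Om.L_closed form_left_append)

text \<open>The complementary defect: the projection \<open>\<phi>\<close> is left linear, and on
  the right it picks up the second component with \<open>a\<close> appended.\<close>

lemma \<phi>_right:
  assumes a: "a IN A" and \<xi>: "\<xi> IN Fp p"
  shows "\<phi> p (FR p a \<xi>) = fr (Suc p) a (\<phi> p \<xi>) \<oplus>\<^bsub>Om (Suc p)\<^esub> fa p a (\<psi> p \<xi>)"
proof (rule linear_eq_\<tau>[OF Om_module linear_comp[OF FR(1)[OF a] \<phi>(1)] _ _ \<xi>])
  show "linear K (Fp p) (Om (Suc p)) (%\<xi>. fr (Suc p) a (\<phi> p \<xi>) \<oplus>\<^bsub>Om (Suc p)\<^esub> fa p a (\<psi> p \<xi>))"
    by (intro linear_plus[OF _ _ Om_module] linear_comp[OF \<phi>(1) form_right(1)] linear_comp[OF \<psi>(1) form_append(1)] a)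
  fix y w assume "y IN A" "w IN Om p"
  then show "\<phi> p (FR p a (\<tau> p y w)) = fr (Suc p) a (\<phi> p (\<tau> p y w)) \<oplus>\<^bsub>Om (Suc p)\<^esub> fa p a (\<psi> p (\<tau> p y w))"
    by (simp add: FR_\<tau> \<phi>_\<tau> \<psi>_\<tau> a mult_A form_right_append Om.W.M.diff_add_cancel append_closed Om.R_closed)
qed

end

context hochschild_base
begin

section \<open>The generalized Tate--Hochschild complex in negative degrees\<close>

lemma tsum_linear:
  assumes W: "module K W" and F: "!!l. l \<in> tp n ==> linear K V W (%z. F z l)"
    and H: "!!l. l \<in> tp (Suc n) ==> linear K V W (%z. H z l)"
    and a: "a IN A" and l: "l \<in> tp n"
  shows "linear K V W (%z. tsum W (F z) (H z) a l)"
  using F H a l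
proof (induct n arbitrary: F H a l)
  case 0
  then show ?case by simp
next
  case (Suc n)
  obtain b bs where l: "l = b # bs" "b IN A" "bs \<in> tp n" using Suc(5) by (auto simp: tuples_Suc)
  have "linear K V W (%z. tsum W (%l. F z (a # l)) (%l. H z (a # l)) b bs)"
    by (rule Suc(1)) (use Suc(2-4) l in auto)
  moreover have "linear K V W (%z. F z ((a \<otimes> b) # bs))"
    by (rule Suc(2)) (use Suc(4) l in "auto simp: mult_A")
  ultimately show ?case unfolding l tsum.simps by (intro linear_diff[OF _ _ W])
qed

abbreviation "D \<equiv> dual_mod K A"

lemma D_ops [simp]: "zero D = zero AA2" "add D = add AA2" "smult D = smult AA2"
  by (simp_all add: dual_mod_def)

lemma D_carrier:
  "carrier D = {z \<in> carrier AA2. \<forall>a\<in>carrier A. AAm (%x. a \<otimes> x) (%y. y) z = AAm (%x. x) (%y. y \<otimes> a) z}"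
proof -
  have "lin_ext K AA2 AA2 (carrier A \<times> carrier A) (%(x, y). ae x y) (%(x, y). ae (a \<otimes> x) y) z =
      AAm (%x. a \<otimes> x) (%y. y) z"
    "lin_ext K AA2 AA2 (carrier A \<times> carrier A) (%(x, y). ae x y) (%(x, y). ae x (y \<otimes> a)) z =
      AAm (%x. x) (%y. y \<otimes> a) z" if "a IN A" "z IN AA2" for a z
    using AAm_ext[OF linear_mult_left[OF that(1)] lin_id that(2)]
      AAm_ext[OF lin_id linear_mult_right[OF that(1)] that(2)] by simp_all
  then show ?thesis by (auto simp: dual_mod_def)
qed

lemma D_sub: "z IN D ==> z IN AA2"
  by (simp add: D_carrier)

lemma D_module: "module K D"
proof -
  have "submodule {z \<in> carrier AA2. \<forall>a\<in>carrier A. AAm (%x. a \<otimes> x) (%y. y) z = AAm (%x. x) (%y. y \<otimes> a) z} K AA2"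
  proof -
    note L = AAm(1)[OF linear_mult_left lin_id] and R = AAm(1)[OF lin_id linear_mult_right]
    interpret AA2: module K AA2 by (rule AA2_module)
    show ?thesis
      by (rule submoduleI'[OF AA2_module])
        (auto simp: linear_zero[OF L AA2_module AA2_module] linear_zero[OF R AA2_module AA2_module]
          linear_add[OF L] linear_add[OF R] linear_smult[OF L] linear_smult[OF R])
  qed
  from submodule.submodule_is_module[OF this AA2_module] show ?thesis
    unfolding D_carrier[symmetric] by (simp add: dual_mod_def)
qed

lemma D_incl: "linear K D AA2 (%z. z)"
  by (rule linearI) (auto simp: D_sub)

lemma linear_into_D:
  assumes "linear K V AA2 f" "!!x. x IN V ==> f x IN D"
  shows "linear K V D f"
  using assms by (auto simp: linear_def)

definition act :: "'a => ('a \<times> 'a => 'k) set => 'a => ('a \<times> 'a => 'k) set" where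
  "act a z b = AAm (%x. x \<otimes> b) (%y. a \<otimes> y) z"

text \<open>The dual is cut out by the outer multiplications, and the inner ones commute with them
  by associativity; this is why \<open>act\<close> preserves it. On \<open>A \<otimes> A\<close> it
  agrees with \<open>dual_act\<close>, whose \<open>lin_ext\<close> then need not be unfolded
  again.\<close>

lemma act:
  assumes a: "a IN A" and b: "b IN A"
  shows "linear K AA2 AA2 (%z. act a z b)"
    and "!!x y. x IN A ==> y IN A ==> act a (ae x y) b = ae (x \<otimes> b) (a \<otimes> y)"
    and "!!z. z IN AA2 ==> dual_act K A a z b = act a z b"
    and "!!z. z IN D ==> act a z b IN D"
proof -
  note m = linear_mult_right[OF b] linear_mult_left[OF a]
  show "linear K AA2 AA2 (%z. act a z b)"
    and val: "!!x y. x IN A ==> y IN A ==> act a (ae x y) b = ae (x \<otimes> b) (a \<otimes> y)"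
    unfolding act_def using AAm[OF m] by auto
  show "dual_act K A a z b = act a z b" if "z IN AA2" for z
    using AAm_ext[OF m that] by (simp add: dual_act_def act_def)
  show "act a z b IN D" if z: "z IN D" for z
  proof -
    have z2: "z IN AA2" by (rule D_sub[OF z])
    have "AAm (%x. c \<otimes> x) (%y. y) (act a z b) = AAm (%x. x) (%y. y \<otimes> c) (act a z b)" if c: "c IN A" for c
    proof -
      note lc = linear_mult_left[OF c] and rc = linear_mult_right[OF c]
      have "AAm (%x. c \<otimes> x) (%y. y) (act a z b) = AAm (%x. c \<otimes> (x \<otimes> b)) (%y. a \<otimes> y) z"
        unfolding act_def by (rule AAm_AAm[OF lc lin_id m z2])
      also have "... = AAm (%x. (c \<otimes> x) \<otimes> b) (%y. a \<otimes> y) z"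
        by (rule AAm_cong[OF linear_comp[OF m(1) lc] m(2) linear_comp[OF lc m(1)] m(2) z2])
          (use b c in "auto simp: assoc_A")
      also have "... = AAm (%x. x \<otimes> b) (%y. a \<otimes> y) (AAm (%x. c \<otimes> x) (%y. y) z)"
        by (rule AAm_AAm[OF m lc lin_id z2, symmetric])
      also have "AAm (%x. c \<otimes> x) (%y. y) z = AAm (%x. x) (%y. y \<otimes> c) z"
        using z c by (simp add: D_carrier)
      also have "AAm (%x. x \<otimes> b) (%y. a \<otimes> y) (AAm (%x. x) (%y. y \<otimes> c) z) =
          AAm (%x. x \<otimes> b) (%y. a \<otimes> (y \<otimes> c)) z"
        by (rule AAm_AAm[OF m lin_id rc z2])
      also have "... = AAm (%x. x \<otimes> b) (%y. (a \<otimes> y) \<otimes> c) z"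
        by (rule AAm_cong[OF m(1) linear_comp[OF rc m(2)] m(1) linear_comp[OF m(2) rc] z2])
          (use a c in "auto simp: assoc_A")
      also have "... = AAm (%x. x) (%y. y \<otimes> c) (act a z b)"
        unfolding act_def by (rule AAm_AAm[OF lin_id rc m z2, symmetric])
      finally show ?thesis .
    qed
    then show ?thesis
      using linear_closed[OF AAm(1)[OF m] z2] by (simp add: D_carrier act_def)
  qed
qed

lemma act_linear_D:
  "a IN A ==> b IN A ==> linear K D D (%z. act a z b)"
  using linear_comp[OF D_incl act(1)] by (rule linear_into_D) (auto intro: act(4))

lemma act_linear1:
  assumes z: "z IN AA2" and a: "a IN A"
  shows "linear K A AA2 (%b. act a z b)"
proof (rule linear_parameter[OF ae_spans AA2_module AA2_module module_A _ _ z])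
  show "linear K AA2 AA2 (%z. act a z b)" if "b IN A" for b by (rule act(1)[OF a that])
  fix s assume "s \<in> (%(x, y). ae x y) ` (carrier A \<times> carrier A)"
  then obtain x y where s: "s = ae x y" "x IN A" "y IN A" by auto
  show "linear K A AA2 (%b. act a s b)"
    by (rule linear_cong[OF linear_comp[OF linear_mult_left[OF s(2)] ae_linear(1)[OF mult_A[OF a s(3)]]] module_A])
      (use s act(2) a in auto)
qed

lemma act_linear2:
  assumes z: "z IN AA2" and b: "b IN A"
  shows "linear K A AA2 (%a. act a z b)"
proof (rule linear_parameter[OF ae_spans AA2_module AA2_module module_A _ _ z])
  show "linear K AA2 AA2 (%z. act a z b)" if "a IN A" for a by (rule act(1)[OF that b])
  fix s assume "s \<in> (%(x, y). ae x y) ` (carrier A \<times> carrier A)"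
  then obtain x y where s: "s = ae x y" "x IN A" "y IN A" by auto
  show "linear K A AA2 (%a. act a s b)"
    by (rule linear_cong[OF linear_comp[OF linear_mult_right[OF s(3)] ae_linear(2)[OF mult_A[OF s(2) b]]] module_A])
      (use s act(2) b in auto)
qed

lemma act_one: "z IN AA2 ==> act \<one> z \<one> = z"
  by (rule linear_eq_ae[OF AA2_module act(1)[OF one_A one_A] linear_id])
    (auto simp: act(2) one_A one_mult_A)

abbreviation "CH \<equiv> hoch_chains K A"

lemma CH_TB: "CH p = TB D p"
  by (simp add: hoch_chains_def)

lemma hoch_chain_el_tb: "hoch_chain_el K A (z, l) = tb D z l"
  by (simp add: hoch_chain_el_def tb_def)

lemma hoch_chain_el_spans: "spans K (TB D p) (hoch_chain_el K A ` (carrier D \<times> tp p))"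
proof -
  have "hoch_chain_el K A = (%(z, l). tb D z l)" by (auto simp: hoch_chain_el_tb)
  then show ?thesis using tb_spans[OF D_module] by simp
qed

text \<open>\<open>gb X q z as\<close> is the value of the Hochschild differential on \<open>z \<otimes> as\<close>, computed in \<open>X \<otimes> A\<^sup>\<otimes>\<^sup>q\<close> for
  \<open>X\<close> the dual bimodule or all of \<open>A \<otimes> A\<close>.\<close>

definition gb :: "('k, ('a \<times> 'a => 'k) set) module => nat => ('a \<times> 'a => 'k) set => 'a list =>
    (('a \<times> 'a => 'k) set \<times> ('k, 'a) bar_tensor => 'k) set" where
  "gb X q z as = tb X (act \<one> z (hd as)) (tl as) \<ominus>\<^bsub>TB X q\<^esub>
     tsum (TB X q) (tb X z) (%m. tb X (act (last m) z \<one>) (butlast m)) (hd as) (tl as)"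

lemma gb_linear:
  assumes X: "module K X" and actX: "!!a b. a IN A ==> b IN A ==> linear K X X (%z. act a z b)"
    and as: "as \<in> tp (Suc q)"
  shows "linear K X (TB X q) (%z. gb X q z as)"
proof -
  obtain a l where l: "as = a # l" "a IN A" "l \<in> tp q" using as by (auto simp: tuples_Suc)
  have 1: "linear K X (TB X q) (%z. tb X (act \<one> z a) l)"
    by (rule linear_comp[OF actX[OF one_A l(2)] tb_linear[OF X l(3)]])
  have 2: "linear K X (TB X q) (%z. tsum (TB X q) (tb X z) (%m. tb X (act (last m) z \<one>) (butlast m)) a l)"
    by (rule tsum_linear[OF TB_module[OF X] tb_linear[OF X]
          linear_comp[OF actX[OF Om.last_closed one_A] tb_linear[OF X Om.butlast_closed]] l(2,3)])
  show ?thesis unfolding gb_def l by (simp add: linear_diff[OF 1 2 TB_module[OF X]])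
qed

text \<open>When the unit acts, both outer terms reduce to \<open>z\<close> with the remaining
  arguments. This is the compatibility that the alternating sum needs at its two ends.\<close>

lemma gb_mlin:
  assumes z: "z IN D"
  shows "nlin (TB D q) (Suc q) (gb D q z)"
proof -
  have z2: "z IN AA2" by (rule D_sub[OF z])
  have a1: "linear K A D (%a. act \<one> z a)"
    by (rule linear_into_D[OF act_linear1[OF z2 one_A] act(4)[OF one_A _ z]])
  have a2: "linear K A D (%a. act a z \<one>)"
    by (rule linear_into_D[OF act_linear2[OF z2 one_A] act(4)[OF _ one_A z]])
  have ok: "tsum_ok (TB D q) q (tb D z) (%m. tb D (act (last m) z \<one>) (butlast m))"
    by (rule tsum_ok_snocI[where G = "%l b. tb D (act b z \<one>) l"])
      (use z z2 in "auto intro!: tb_mlin[OF D_module] act(4) one_A linear_comp[OF a2 tb_linear[OF D_module]] simp: act_one")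
  have "nlin (TB D q) (Suc q) (%as. tb D (act \<one> z (hd as)) (tl as) \<ominus>\<^bsub>TB D q\<^esub>
     tsum (TB D q) (tb D z) (%m. tb D (act (last m) z \<one>) (butlast m)) (hd as) (tl as))"
    by (rule tsum_differential_mlin[OF TB_module[OF D_module] ok, of "%a l. tb D (act \<one> z a) l"])
      (use z z2 in "auto intro!: tb_mlin[OF D_module] act(4) one_A linear_comp[OF a1 tb_linear[OF D_module]] simp: act_one")
  then show ?thesis by (simp add: gb_def[abs_def])
qed

lemma hoch_b:
  shows "linear K (TB D (Suc q)) (TB D q) (hoch_b K A (Suc q))"
    and "hoch_b K A (Suc q) \<in> lin_maps K (TB D (Suc q)) (TB D q)"
    and "!!z as. z IN D ==> as \<in> tp (Suc q) ==> hoch_b K A (Suc q) (tb D z as) = gb D q z as"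
proof -
  let ?W = "TB D q"
  note W = TB_module[OF D_module, of q]
  interpret W: module K ?W by (rule W)
  define V where "V = (%(z, as).
        hoch_chain_el K A (dual_act K A \<one> z (hd as), tl as)
        \<oplus>\<^bsub>?W\<^esub> (\<Oplus>\<^bsub>?W\<^esub>j\<in>{1..q}. signed ?W (int j) (hoch_chain_el K A (z, merge_at A (j - 1) as)))
        \<oplus>\<^bsub>?W\<^esub> signed ?W (int (Suc q)) (hoch_chain_el K A (dual_act K A (last as) z \<one>, butlast as)))"
  have V: "V (z, as) = gb D q z as" if z: "z IN D" and as: "as \<in> tp (Suc q)" for z as
  proof -
    obtain a l where l: "as = a # l" "a IN A" "l \<in> tp q" using as by (auto simp: tuples_Suc)
    note z2 = D_sub[OF z]
    let ?F = "tb D z" and ?H = "%m. tb D (act (last m) z \<one>) (butlast m)"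
    have Fc: "!!l. l \<in> tp q ==> ?F l IN ?W" by (rule tb_closed[OF D_module z])
    have Hc: "!!l. l \<in> tp (Suc q) ==> ?H l IN ?W"
      by (intro tb_closed[OF D_module] act(4) one_A z Om.last_closed Om.butlast_closed)
    have s: "(\<Oplus>\<^bsub>?W\<^esub>j\<in>{1..q}. signed ?W (int j) (?F (merge_at A (j - 1) as))) \<oplus>\<^bsub>?W\<^esub> signed ?W (int q + 1) (?H as) =
        \<ominus>\<^bsub>?W\<^esub> tsum ?W ?F ?H a l"
      unfolding l(1) by (rule tsum_eq_sum[OF W Fc Hc l(2,3)])
    have c: "(\<Oplus>\<^bsub>?W\<^esub>j\<in>{1..q}. signed ?W (int j) (?F (merge_at A (j - 1) as))) IN ?W"
      using merge_at_closed[OF as] by (intro W.M.finsum_closed) (auto intro!: signed_closed[OF W] Fc)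
    have d: "dual_act K A \<one> z a = act \<one> z a" "dual_act K A (last as) z \<one> = act (last as) z \<one>"
      using act(3)[OF one_A l(2) z2] act(3)[OF Om.last_closed[OF as] one_A z2] by auto
    have t: "tb D (act \<one> z a) l IN ?W"
      by (intro tb_closed[OF D_module] act(4) one_A z l)
    have "V (z, as) = tb D (act \<one> z a) l \<oplus>\<^bsub>?W\<^esub>
        (\<Oplus>\<^bsub>?W\<^esub>j\<in>{1..q}. signed ?W (int j) (?F (merge_at A (j - 1) as))) \<oplus>\<^bsub>?W\<^esub> signed ?W (int q + 1) (?H as)"
      unfolding V_def using d l(1) by (simp add: hoch_chain_el_tb add.commute)
    also have "... = tb D (act \<one> z a) l \<oplus>\<^bsub>?W\<^esub>
       ((\<Oplus>\<^bsub>?W\<^esub>j\<in>{1..q}. signed ?W (int j) (?F (merge_at A (j - 1) as))) \<oplus>\<^bsub>?W\<^esub> signed ?W (int q + 1) (?H as))"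
      by (rule W.M.a_assoc[OF t c signed_closed[OF W Hc[OF as]]])
    also have "... = gb D q z as" unfolding s by (simp add: gb_def l(1) a_minus_def)
    finally show ?thesis .
  qed
  have "\<exists>h. linear K (TB D (Suc q)) ?W h \<and> (\<forall>z\<in>carrier D. \<forall>as\<in>tp (Suc q). h (tb D z as) = gb D q z as)"
    by (rule tb_lift[OF D_module W gb_linear[OF D_module act_linear_D] gb_mlin])
  then obtain h where h: "linear K (TB D (Suc q)) ?W h"
    "!!z as. z IN D ==> as \<in> tp (Suc q) ==> h (tb D z as) = gb D q z as" by blast
  have ex: "\<exists>h. linear K (TB D (Suc q)) ?W h \<and> (\<forall>i\<in>carrier D \<times> tp (Suc q). h (hoch_chain_el K A i) = V i)"
    using h V by (intro exI[of _ h]) (auto simp: hoch_chain_el_tb)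
  have eq: "hoch_b K A (Suc q) = lin_ext K (TB D (Suc q)) ?W (carrier D \<times> tp (Suc q)) (hoch_chain_el K A) V"
    unfolding hoch_b_def V_def CH_TB by simp
  note le = lin_ext[OF TB_module[OF D_module] W hoch_chain_el_spans ex, folded eq]
  show "linear K (TB D (Suc q)) ?W (hoch_b K A (Suc q))" "hoch_b K A (Suc q) \<in> lin_maps K (TB D (Suc q)) ?W"
    using le(2,1) .
  show "hoch_b K A (Suc q) (tb D z as) = gb D q z as" if "z IN D" "as \<in> tp (Suc q)" for z as
    using le(3)[of "(z, as)"] that V by (simp add: hoch_chain_el_tb)
qed

text \<open>The inclusion of the dual into \<open>A \<otimes> A\<close>, tensored with the identity.
  Followed by \<open>\<phi>\<close> and \<open>\<psi>\<close> it gives the two components of a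
  chain.\<close>

definition J where "J p = TBm D AA2 p (%z. z)"

lemma J:
  shows "linear K (TB D p) (Fp p) (J p)"
    and "!!z l. z IN D ==> l \<in> tp p ==> J p (tb D z l) = tb AA2 z l"
  unfolding J_def using TBm[OF D_module AA2_module D_incl] by auto

lemma J_closed: "\<zeta> IN TB D p ==> J p \<zeta> IN Fp p"
  by (rule linear_closed[OF J(1)])

lemma J_gb:
  assumes z: "z IN D" and as: "as \<in> tp (Suc q)"
  shows "J q (gb D q z as) = gb AA2 q z as"
proof -
  obtain a l where l: "as = a # l" "a IN A" "l \<in> tp q" using as by (auto simp: tuples_Suc)
  let ?H = "%m. tb D (act (last m) z \<one>) (butlast m)"
  have Fc: "!!l. l \<in> tp q ==> tb D z l IN TB D q" by (rule tb_closed[OF D_module z])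
  have Hc: "!!l. l \<in> tp (Suc q) ==> ?H l IN TB D q"
    by (intro tb_closed[OF D_module] act(4) one_A z Om.last_closed Om.butlast_closed)
  have "J q (tsum (TB D q) (tb D z) ?H a l) = tsum (Fp q) (%l. J q (tb D z l)) (%l. J q (?H l)) a l"
    by (rule tsum_map[OF J(1) TB_module[OF D_module] Fp_module Fc Hc l(2,3)])
  also have "... = tsum (Fp q) (tb AA2 z) (%m. tb AA2 (act (last m) z \<one>) (butlast m)) a l"
    by (rule tsum_cong[of q]) (use l z in "auto intro!: J(2) act(4) one_A Om.last_closed Om.butlast_closed")
  finally have 1: "J q (tsum (TB D q) (tb D z) ?H a l) = ..." .
  have "J q (gb D q z as) = J q (tb D (act \<one> z a) l) \<ominus>\<^bsub>Fp q\<^esub> J q (tsum (TB D q) (tb D z) ?H a l)"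
    unfolding gb_def l list.sel
    by (rule linear_minus[OF J(1) TB_module[OF D_module] Fp_module])
      (use tb_closed[OF D_module] act(4)[OF one_A l(2) z] l tsum_closed[OF TB_module[OF D_module] Fc Hc] in auto)
  then show ?thesis unfolding 1 using J(2)[OF act(4)[OF one_A l(2) z] l(3)] by (simp add: gb_def l(1))
qed

lemma gb_ae:
  assumes x: "x IN A" and y: "y IN A" and as: "as \<in> tp (Suc q)"
  shows "gb AA2 q (ae x y) as = fe (x \<otimes> hd as) (tl as) y \<ominus>\<^bsub>Fp q\<^esub>
    tsum (Fp q) (%l. fe x l y) (%m. fe x (butlast m) (last m \<otimes> y)) (hd as) (tl as)"
proof -
  obtain a l where l: "as = a # l" "a IN A" "l \<in> tp q" using as by (auto simp: tuples_Suc)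
  have "tsum (Fp q) (tb AA2 (ae x y)) (%m. tb AA2 (act (last m) (ae x y) \<one>) (butlast m)) a l =
     tsum (Fp q) (%l. fe x l y) (%m. fe x (butlast m) (last m \<otimes> y)) a l"
    by (rule tsum_cong[of q]) (use l x y in "auto simp: act(2) one_A one_mult_A Om.last_closed")
  then show ?thesis using l x y by (simp add: gb_def act(2) one_A one_mult_A)
qed

text \<open>The boundary of \<open>(x \<otimes> y) \<otimes> as\<close> multiplies neighbours in the
  word \<open>x, as, y\<close>, since inner multiplication joins the ends of \<open>as\<close> to
  \<open>x\<close> and to \<open>y\<close>. Right multiplication of the form
  \<open>x \<otimes> as\<close> by \<open>y\<close> runs over the same products with signs counted
  from the other end, whence the factor \<open>(-1)\<^sup>q\<^sup>+\<^sup>1\<close>.\<close>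

lemma \<phi>_gb:
  assumes z: "z IN AA2" and as: "as \<in> tp (Suc q)"
  shows "\<phi> q (gb AA2 q z as) = signed (Om (Suc q)) (int (Suc q)) (\<psi> (Suc q) (tb AA2 z as))"
proof (rule linear_eq_ae[OF Om_module linear_comp[OF gb_linear[OF AA2_module act(1) as] \<phi>(1)]
      linear_signed_comp[OF Om_module linear_comp[OF tb_linear[OF AA2_module as] \<psi>(1)]] _ z])
  fix x y assume x: "x IN A" and y: "y IN A"
  obtain a l where l: "as = a # l" "a IN A" "l \<in> tp q" using as by (auto simp: tuples_Suc)
  let ?F = "%l. fe x l y" and ?H = "%m. fe x (butlast m) (last m \<otimes> y)"
  have Fc: "!!l. l \<in> tp q ==> ?F l IN Fp q" using fe_closed x y by blast
  have Hc: "!!l. l \<in> tp (Suc q) ==> ?H l IN Fp q"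
    by (intro fe_closed mult_A x y Om.last_closed Om.butlast_closed)
  let ?T = "tsum (Om (Suc q)) (%m. fm (m @ [y])) (%m. fm (butlast m @ [last m \<otimes> y])) x as"
  have Tc: "?T IN Om (Suc q)"
    by (rule tsum_closed[OF Om_module, of "Suc q"])
      (use x y as in "auto intro!: form_closed tuples_snocI mult_A Om.last_closed Om.butlast_closed")
  have g: "gb AA2 q (ae x y) as = fe (x \<otimes> a) l y \<ominus>\<^bsub>Fp q\<^esub> tsum (Fp q) ?F ?H a l"
    using gb_ae[OF x y as] by (simp add: l(1))
  have "\<phi> q (gb AA2 q (ae x y) as) = \<phi> q (fe (x \<otimes> a) l y) \<ominus>\<^bsub>Om (Suc q)\<^esub> \<phi> q (tsum (Fp q) ?F ?H a l)"
    unfolding g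
    by (rule linear_minus[OF \<phi>(1) Fp_module Om_module])
      (use fe_closed mult_A x y l tsum_closed[OF Fp_module Fc Hc] in auto)
  also have "\<phi> q (tsum (Fp q) ?F ?H a l) = tsum (Om (Suc q)) (%l. \<phi> q (?F l)) (%l. \<phi> q (?H l)) a l"
    by (rule tsum_map[OF \<phi>(1) Fp_module Om_module Fc Hc l(2,3)])
  also have "... = tsum (Om (Suc q)) (%m. fm ((x # m) @ [y])) (%m. fm (butlast (x # m) @ [last (x # m) \<otimes> y])) a l"
    by (rule tsum_cong[of q]) (use x y l in "auto simp: \<phi>(2) mult_A Om.last_closed Om.butlast_closed tuples_Suc")
  also have "\<phi> q (fe (x \<otimes> a) l y) \<ominus>\<^bsub>Om (Suc q)\<^esub> ... = ?T"
    using x y l by (simp add: \<phi>(2) mult_A)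
  also have "... = signed (Om (Suc q)) (int (Suc q)) (right_sum (Suc q) y (x # as))"
    unfolding right_sum_tsum[OF y x as] using signed_cancel[OF Om_module Tc] by simp
  also have "... = signed (Om (Suc q)) (int (Suc q)) (\<psi> (Suc q) (tb AA2 (ae x y) as))"
    using \<psi>(2)[OF x as y] form_right(2)[OF y, of "x # as" "Suc q"] x as by simp
  finally show "\<phi> q (gb AA2 q (ae x y) as) = signed (Om (Suc q)) (int (Suc q)) (\<psi> (Suc q) (tb AA2 (ae x y) as))" .
qed

text \<open>The sum ends with the right action of the last argument on a form. Expanded, this action
  reproduces all other terms with the opposite sign.\<close>

lemma TT_form:
  assumes x: "x IN A" and as: "as \<in> tp (Suc q)"
  shows "Om.TT q fm x as = \<zero>\<^bsub>Om q\<^esub>"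
proof -
  obtain l b where l: "as = l @ [b]" "l \<in> tp q" "b IN A" using as by (auto simp: tuples_snoc)
  let ?H = "%m. fr q (last m) (fm (butlast m))"
  let ?T = "tsum (Om q) (%m. fm (m @ [b])) (%m. fm (butlast m @ [last m \<otimes> b])) x l"
  have Tc: "?T IN Om q"
    by (rule tsum_closed[OF Om_module, of q])
      (use x l in "auto intro!: form_closed tuples_snocI mult_A Om.last_closed Om.butlast_closed")
  have "Om.TT q fm x as = ?T \<oplus>\<^bsub>Om q\<^esub> signed (Om q) (int q + 1) (?H (x # l @ [b]))"
    unfolding Om.TT_def l(1)
    by (rule tsum_snoc[OF Om_module _ _ x l(3,2)])
      (auto intro!: form_closed Om.R_closed Om.last_closed Om.butlast_closed)
  also have "?H (x # l @ [b]) = signed (Om q) (int q) ?T"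
    using form_right(2)[OF l(3), of "x # l" q] right_sum_tsum[OF l(3) x l(2)] x l by (simp add: butlast_append)
  also have "signed (Om q) (int q + 1) (signed (Om q) (int q) ?T) = \<ominus>\<^bsub>Om q\<^esub> ?T"
    using signed_Suc[OF Om_module signed_closed[OF Om_module Tc, of "int q"], of "int q"]
      signed_cancel[OF Om_module Tc, of "int q"] by simp
  finally show ?thesis using Tc by (simp add: Om.W.M.r_neg)
qed

text \<open>Once the last factor \<open>y\<close> is multiplied in, the whole expression is the
  right multiple by \<open>y\<close> of the sum in \<open>TT_form\<close>, which is zero.\<close>

lemma \<psi>_gb:
  assumes z: "z IN AA2" and as: "as \<in> tp (Suc q)"
  shows "\<psi> q (gb AA2 q z as) = \<zero>\<^bsub>Om q\<^esub>"
proof (rule linear_eq_ae[OF Om_module linear_comp[OF gb_linear[OF AA2_module act(1) as] \<psi>(1)]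
      linear_const_zero[OF Om_module] _ z])
  fix x y assume x: "x IN A" and y: "y IN A"
  obtain a l where l: "as = a # l" "a IN A" "l \<in> tp q" using as by (auto simp: tuples_Suc)
  let ?F = "%l. fe x l y" and ?H = "%m. fe x (butlast m) (last m \<otimes> y)"
  let ?G = "%m. fm (x # m)"
  have Fc: "!!l. l \<in> tp q ==> ?F l IN Fp q" using fe_closed x y by blast
  have Hc: "!!l. l \<in> tp (Suc q) ==> ?H l IN Fp q"
    by (intro fe_closed mult_A x y Om.last_closed Om.butlast_closed)
  have Gc: "!!l. l \<in> tp q ==> ?G l IN Om q" using x by (auto intro!: form_closed)
  have g: "gb AA2 q (ae x y) as = fe (x \<otimes> a) l y \<ominus>\<^bsub>Fp q\<^esub> tsum (Fp q) ?F ?H a l"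
    using gb_ae[OF x y as] by (simp add: l(1))
  have "\<psi> q (gb AA2 q (ae x y) as) = \<psi> q (fe (x \<otimes> a) l y) \<ominus>\<^bsub>Om q\<^esub> \<psi> q (tsum (Fp q) ?F ?H a l)"
    unfolding g
    by (rule linear_minus[OF \<psi>(1) Fp_module Om_module])
      (use fe_closed mult_A x y l tsum_closed[OF Fp_module Fc Hc] in auto)
  also have "\<psi> q (tsum (Fp q) ?F ?H a l) = tsum (Om q) (%l. \<psi> q (?F l)) (%l. \<psi> q (?H l)) a l"
    by (rule tsum_map[OF \<psi>(1) Fp_module Om_module Fc Hc l(2,3)])
  also have "... = tsum (Om q) (%l. fr q y (?G l))
      (%m. fr q y (fr q (last m) (?G (butlast m)))) a l"
    by (rule tsum_cong[of q])
      (use x y l Gc in "auto simp: \<psi>(2) mult_A Om.last_closed Om.butlast_closed form_right_right")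
  also have "... = fr q y (Om.TT q ?G a l)"
    unfolding Om.TT_def
    by (rule tsum_map[OF form_right(1)[OF y] Om_module Om_module, symmetric, of q])
      (use l Gc Om.R_closed Om.last_closed Om.butlast_closed in auto)
  also have "\<psi> q (fe (x \<otimes> a) l y) \<ominus>\<^bsub>Om q\<^esub> fr q y (Om.TT q ?G a l) =
     fr q y (fm ((x \<otimes> a) # l) \<ominus>\<^bsub>Om q\<^esub> Om.TT q ?G a l)"
    unfolding \<psi>(2)[OF mult_A[OF x l(2)] l(3) y]
    by (rule linear_minus[OF form_right(1)[OF y] Om_module Om_module, symmetric])
      (use x l mult_A Om.TT_closed[of q ?G, OF Gc l(2,3)] in "auto intro!: form_closed")
  also have "fm ((x \<otimes> a) # l) \<ominus>\<^bsub>Om q\<^esub> Om.TT q ?G a l = \<zero>\<^bsub>Om q\<^esub>"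
    using TT_form[OF x as] Om.TT_Cons[OF l(2,3), of q fm x] l(1) by simp
  also have "fr q y \<zero>\<^bsub>Om q\<^esub> = \<zero>\<^bsub>Om q\<^esub>"
    by (rule linear_zero[OF form_right(1)[OF y] Om_module Om_module])
  finally show "\<psi> q (gb AA2 q (ae x y) as) = \<zero>\<^bsub>Om q\<^esub>" .
qed

lemma \<phi>_J_hoch_b:
  assumes \<zeta>: "\<zeta> IN TB D (Suc q)"
  shows "\<phi> q (J q (hoch_b K A (Suc q) \<zeta>)) = signed (Om (Suc q)) (int (Suc q)) (\<psi> (Suc q) (J (Suc q) \<zeta>))"
  by (rule linear_eq_tb[OF D_module Om_module linear_comp[OF linear_comp[OF hoch_b(1) J(1)] \<phi>(1)]
        linear_signed_comp[OF Om_module linear_comp[OF J(1) \<psi>(1)]] _ \<zeta>])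
    (simp add: hoch_b(3) J(2) J_gb \<phi>_gb D_sub del: of_nat_Suc)

lemma \<psi>_J_hoch_b:
  assumes \<zeta>: "\<zeta> IN TB D (Suc q)"
  shows "\<psi> q (J q (hoch_b K A (Suc q) \<zeta>)) = \<zero>\<^bsub>Om q\<^esub>"
  by (rule linear_eq_tb[OF D_module Om_module linear_comp[OF linear_comp[OF hoch_b(1) J(1)] \<psi>(1)]
        linear_const_zero[OF Om_module] _ \<zeta>])
    (simp add: hoch_b(3) J_gb \<psi>_gb D_sub)

lemma J_central:
  assumes \<zeta>: "\<zeta> IN TB D p" and a: "a IN A"
  shows "FL p a (J p \<zeta>) = FR p a (J p \<zeta>)"
  by (rule linear_eq_tb[OF D_module Fp_module linear_comp[OF J(1) FL(1)[OF a]] linear_comp[OF J(1) FR(1)[OF a]] _ \<zeta>])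
    (use a in "simp add: J(2) FL(2) FR(2) D_sub, simp add: D_carrier")

text \<open>Centrality in \<open>F_p\<close>, read through the splitting. For components
  \<open>w\<close> and \<open>u\<close> it says \<open>aw - wa = u \<otimes> sa\<close> and
  \<open>au = ua\<close>: the second component is a cocycle, and its image under
  \<open>\<theta>\<close> is, up to sign, the coboundary of the first.\<close>

lemma J_central_forms:
  assumes \<zeta>: "\<zeta> IN TB D p" and a: "a IN A"
  shows "fl (Suc p) a (\<phi> p (J p \<zeta>)) =
      fr (Suc p) a (\<phi> p (J p \<zeta>)) \<oplus>\<^bsub>Om (Suc p)\<^esub> fa p a (\<psi> p (J p \<zeta>))"
    and "fl p a (\<psi> p (J p \<zeta>)) = fr p a (\<psi> p (J p \<zeta>))"
  using J_central[OF assms] \<phi>_left[OF a J_closed[OF \<zeta>]] \<phi>_right[OF a J_closed[OF \<zeta>]]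
    \<psi>_left[OF a J_closed[OF \<zeta>]] \<psi>_right[OF a J_closed[OF \<zeta>]] by simp_all

definition cc :: "nat => ('k, 'a) nc_form => ('k, 'a) nc_cochain" where
  "cc p = const_cochain K A p"

lemma cc:
  assumes w: "w IN Om p"
  shows "cc p w IN NC (- int p) p" "cc p w (br []) = w"
proof -
  have "nlin (Om p) 0 (%_. w)" using w by simp
  note b = bar_ext[OF Om_module this]
  have *: "tp 0 = {[]}" by auto
  have c: "cc p w = lin_ext K (BP 0) (Om p) (tp 0) br (%_. w)"
    unfolding cc_def const_cochain_def * ..
  show "cc p w IN NC (- int p) p" using b(1) by (simp add: c NC_carrier)
  show "cc p w (br []) = w" using b(2)[of "[]"] by (simp add: c)
qed

lemma cc_eq: "f IN NC (- int p) p ==> cc p (f (br [])) = f"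
  by (rule NC_eqI) (use cc NC_val_closed[of f "- int p" p "[]"] in auto)

lemma cc_linear: "linear K (Om p) (NC (- int p) p) (cc p)"
proof (rule linearI)
  interpret N: module K "NC (- int p) p" by (rule NC_module)
  show "cc p w IN NC (- int p) p" if "w IN Om p" for w by (rule cc(1)[OF that])
  show "cc p (v \<oplus>\<^bsub>Om p\<^esub> w) = cc p v \<oplus>\<^bsub>NC (- int p) p\<^esub> cc p w" if "v IN Om p" "w IN Om p" for v w
    by (rule NC_eqI) (use that cc in "auto simp: NC_add")
  show "cc p (c \<odot>\<^bsub>Om p\<^esub> w) = c \<odot>\<^bsub>NC (- int p) p\<^esub> cc p w" if "c IN K" "w IN Om p" for c w
    by (rule NC_eqI) (use that cc in "auto simp: NC_smult")
qed

text \<open>In \<open>\<Omega>\<^sup>0 = A\<close> right multiplication is the product of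
  \<open>A\<close>, so \<open>\<mu>\<close> is the second component of a chain in the case
  \<open>p = 0\<close>.\<close>

lemma mu_eq:
  shows "mu K A \<in> lin_maps K (TB D 0) (NC 0 0)"
    and "!!\<zeta>. \<zeta> IN TB D 0 ==> mu K A \<zeta> = cc 0 (\<psi> 0 (J 0 \<zeta>))"
proof -
  let ?h = "%\<zeta>. cc 0 (\<psi> 0 (J 0 \<zeta>))"
  have h: "linear K (TB D 0) (NC 0 0) ?h"
    using linear_comp[OF linear_comp[OF J(1) \<psi>(1)] cc_linear, of 0] by simp
  have m: "lin_ext K AA2 A (carrier A \<times> carrier A) (%(x, y). ae x y) (%(x, y). x \<otimes> y) z IN A"
    "\<psi> 0 (tb AA2 z []) = fm [lin_ext K AA2 A (carrier A \<times> carrier A) (%(x, y). ae x y) (%(x, y). x \<otimes> y) z]"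
    if z: "z IN AA2" for z
  proof -
    note b = bil[of A "%x y. x \<otimes> y", OF module_A linear_mult_right linear_mult_left]
    have e: "lin_ext K AA2 A (carrier A \<times> carrier A) (%(x, y). ae x y) (%(x, y). x \<otimes> y) z = bil A (%x y. x \<otimes> y) z"
      by (rule bil_ext[OF module_A linear_mult_right linear_mult_left z])
    show "lin_ext K AA2 A (carrier A \<times> carrier A) (%(x, y). ae x y) (%(x, y). x \<otimes> y) z IN A"
      unfolding e by (rule linear_closed[OF b(1) z])
    have n: "[] \<in> tp 0" by simp
    show "\<psi> 0 (tb AA2 z []) = fm [lin_ext K AA2 A (carrier A \<times> carrier A) (%(x, y). ae x y) (%(x, y). x \<otimes> y) z]"
      unfolding e
      by (rule linear_eq_ae[OF Om_module linear_comp[OF tb_linear[OF AA2_module n] \<psi>(1)]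
            linear_comp[OF b(1) form_linear[OF n]] _ z])
        (simp_all add: \<psi>(2) b(2) form_right_0)
  qed
  have eq: "mu K A = restrict ?h (carrier (TB D 0))"
    unfolding mu_def CH_TB
    by (rule lin_ext_eq_restrict[OF TB_module[OF D_module] NC_module hoch_chain_el_spans h])
      (auto simp: hoch_chain_el_tb J(2) m(2) D_sub cc_def)
  show "mu K A \<in> lin_maps K (TB D 0) (NC 0 0)"
    unfolding eq by (rule restrict_lin_maps[OF TB_module[OF D_module] h])
  show "mu K A \<zeta> = cc 0 (\<psi> 0 (J 0 \<zeta>))" if "\<zeta> IN TB D 0" for \<zeta>
    using that by (simp add: eq)
qed

lemma iota_inner:
  assumes \<zeta>: "\<zeta> IN TB D p"
  shows "lin_ext K (CH p) (NC (- int (Suc p)) (p + 1)) (carrier D \<times> tp p) (hoch_chain_el K A)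
     (%(z, as). const_cochain K A (p + 1) (form_insert K A as z)) \<zeta> = cc (Suc p) (\<phi> p (J p \<zeta>))"
proof -
  let ?h = "%\<zeta>. cc (Suc p) (\<phi> p (J p \<zeta>))"
  have h: "linear K (TB D p) (NC (- int (Suc p)) (p + 1)) ?h"
    using linear_comp[OF linear_comp[OF J(1) \<phi>(1)] cc_linear, of p] by (simp del: of_nat_Suc)
  have m: "form_insert K A l z = \<phi> p (tb AA2 z l)" if z: "z IN AA2" and l: "l \<in> tp p" for z l
  proof -
    have 1: "linear K A (Om (Suc p)) (%x. fm (x # l @ [y]))" if "y IN A" for y
      by (rule form_linear[OF tuples_snocI[OF l that]])
    have 2: "linear K A (Om (Suc p)) (%y. fm (x # l @ [y]))" if "x IN A" for x
      by (rule mlin_last_linear[OF form_mlin[OF that] l one_A])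
    note b = bil[of "Om (Suc p)" "%x y. fm (x # l @ [y])", OF Om_module 1 2]
    note e = bil_ext[of "Om (Suc p)" "%x y. fm (x # l @ [y])", OF Om_module 1 2 z]
    have "form_insert K A l z = bil (Om (Suc p)) (%x y. fm (x # l @ [y])) z"
      using e tuples_length[OF l] by (simp add: form_insert_def)
    also have "... = \<phi> p (tb AA2 z l)"
      by (rule linear_eq_ae[OF Om_module b(1) linear_comp[OF tb_linear[OF AA2_module l] \<phi>(1)] _ z])
        (simp_all add: b(2) \<phi>(2) l)
    finally show ?thesis .
  qed
  have "lin_ext K (CH p) (NC (- int (Suc p)) (p + 1)) (carrier D \<times> tp p) (hoch_chain_el K A)
     (%(z, as). const_cochain K A (p + 1) (form_insert K A as z)) = restrict ?h (carrier (TB D p))"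
    unfolding CH_TB
    by (rule lin_ext_eq_restrict[OF TB_module[OF D_module] NC_module hoch_chain_el_spans h])
      (auto simp: hoch_chain_el_tb J(2) m D_sub cc_def)
  then show ?thesis using \<zeta> by simp
qed

end

section \<open>Chains as central elements of the bimodules \<open>F_p\<close>\<close>

locale hochschild_fd = hochschild_base K A for K :: "'k ring" and A :: "('k, 'a) module" (structure) +
  assumes fd_A: "finite_dimensional K A"
begin

text \<open>Coordinates on both sides of \<open>J\<close>, taken from one dual basis of the bar
  power. In coordinates \<open>J\<close> is the inclusion of the dual into
  \<open>A \<otimes> A\<close>, and the outer actions operate on each coordinate separately.\<close>

definition J_coords where
  "J_coords p S CD CF \<longleftrightarrow> finite S \<and> (\<forall>s\<in>S. linear K (TB D p) D (CD s) \<and> linear K (Fp p) AA2 (CF s) \<and> s \<in> carrier (BP p) \<and>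
      (\<forall>\<zeta>\<in>carrier (TB D p). CF s (J p \<zeta>) = CD s \<zeta>) \<and>
      (\<forall>a\<in>carrier A. \<forall>\<xi>\<in>carrier (Fp p). CF s (FL p a \<xi>) = AAm (%x. a \<otimes> x) (%y. y) (CF s \<xi>) \<and>
          CF s (FR p a \<xi>) = AAm (%x. x) (%y. y \<otimes> a) (CF s \<xi>))) \<and>
    (\<forall>\<zeta>\<in>carrier (TB D p). \<zeta> = (\<Oplus>\<^bsub>TB D p\<^esub>s\<in>S. tensor_el K D (BP p) (CD s \<zeta>) s)) \<and>
    (\<forall>\<xi>\<in>carrier (Fp p). \<xi> = (\<Oplus>\<^bsub>Fp p\<^esub>s\<in>S. tensor_el K AA2 (BP p) (CF s \<xi>) s))"

lemma J_coordinates: "\<exists>S CD CF. J_coords p S CD CF"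
proof -
  obtain S c where db: "dual_basis K (BP p) S c"
    using ex_dual_basis[OF field_K bar_pow_module bar_pow_finite_dimensional[OF fd_A]] by blast
  obtain CD where "\<forall>s\<in>S. linear K (TB D p) D (CD s)"
    "\<forall>s\<in>S. \<forall>x\<in>carrier D. \<forall>y\<in>carrier (BP p). CD s (tensor_el K D (BP p) x y) = c s y \<odot>\<^bsub>D\<^esub> x"
    and expCD: "\<forall>\<zeta>\<in>carrier (TB D p). \<zeta> = (\<Oplus>\<^bsub>TB D p\<^esub>s\<in>S. tensor_el K D (BP p) (CD s \<zeta>) s)"
    using tensor_coordinates[OF D_module bar_pow_module db] by (elim exE conjE) (rule that)
  then have CD: "!!s. s \<in> S ==> linear K (TB D p) D (CD s)"
    "!!s x y. s \<in> S ==> x IN D ==> y IN BP p ==> CD s (tensor_el K D (BP p) x y) = c s y \<odot>\<^bsub>D\<^esub> x"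
    by auto
  obtain CF where "\<forall>s\<in>S. linear K (Fp p) AA2 (CF s)"
    "\<forall>s\<in>S. \<forall>x\<in>carrier AA2. \<forall>y\<in>carrier (BP p). CF s (tensor_el K AA2 (BP p) x y) = c s y \<odot>\<^bsub>AA2\<^esub> x"
    and expCF: "\<forall>\<xi>\<in>carrier (Fp p). \<xi> = (\<Oplus>\<^bsub>Fp p\<^esub>s\<in>S. tensor_el K AA2 (BP p) (CF s \<xi>) s)"
    using tensor_coordinates[OF AA2_module bar_pow_module db] by (elim exE conjE) (rule that)
  then have CF: "!!s. s \<in> S ==> linear K (Fp p) AA2 (CF s)"
    "!!s x y. s \<in> S ==> x IN AA2 ==> y IN BP p ==> CF s (tensor_el K AA2 (BP p) x y) = c s y \<odot>\<^bsub>AA2\<^esub> x"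
    by auto
  have cK: "c s v IN K" if "s \<in> S" "v IN BP p" for s v
    using db that linear_closed[of K "BP p" "regular_module K" "c s"] by (auto simp: dual_basis_def)
  have Cb: "CF s (tb AA2 z l) = c s (br l) \<odot>\<^bsub>AA2\<^esub> z" if "s \<in> S" "z IN AA2" "l \<in> tp p" for s z l
    using CF(2)[OF that(1,2) bar_closed[OF that(3)]] tuples_length[OF that(3)] by (simp add: tb_def)
  have Cd: "CD s (tb D z l) = c s (br l) \<odot>\<^bsub>AA2\<^esub> z" if "s \<in> S" "z IN D" "l \<in> tp p" for s z l
    using CD(2)[OF that(1,2) bar_closed[OF that(3)]] tuples_length[OF that(3)] by (simp add: tb_def)
  have 1: "CF s (J p \<zeta>) = CD s \<zeta>" if s: "s \<in> S" and \<zeta>: "\<zeta> IN TB D p" for s \<zeta>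
    by (rule linear_eq_tb[OF D_module AA2_module linear_comp[OF J(1) CF(1)[OF s]]
          linear_comp[OF CD(1)[OF s] D_incl] _ \<zeta>]) (simp add: J(2) Cb Cd s D_sub)
  have 2: "CF s (TBm AA2 AA2 p \<alpha> \<xi>) = \<alpha> (CF s \<xi>)"
    if s: "s \<in> S" and \<alpha>: "linear K AA2 AA2 \<alpha>" and \<xi>: "\<xi> IN Fp p" for s \<alpha> \<xi>
  proof (rule linear_eq_tb[OF AA2_module AA2_module linear_comp[OF TBm(1)[OF AA2_module AA2_module \<alpha>] CF(1)[OF s]]
        linear_comp[OF CF(1)[OF s] \<alpha>] _ \<xi>])
    fix z l assume z: "z IN AA2" and l: "l \<in> tp p"
    show "CF s (TBm AA2 AA2 p \<alpha> (tb AA2 z l)) = \<alpha> (CF s (tb AA2 z l))"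
      by (simp add: TBm(2)[OF AA2_module AA2_module \<alpha> z l] Cb[OF s z l] Cb[OF s linear_closed[OF \<alpha> z] l]
          linear_smult[OF \<alpha> cK[OF s bar_closed[OF l]] z])
  qed
  have S: "finite S" "!!s. s \<in> S ==> s IN BP p" using db by (auto simp: dual_basis_def)
  show ?thesis
    unfolding J_coords_def
    by (rule exI[of _ S], rule exI[of _ CD], rule exI[of _ CF], intro conjI ballI)
      (rule S(1) S(2) CD(1) CF(1) 1 2[OF _ AAm(1)[OF linear_mult_left lin_id], folded FL_def]
        2[OF _ AAm(1)[OF lin_id linear_mult_right], folded FR_def] bspec[OF expCD] bspec[OF expCF]; assumption)+
qed

lemma J_inj:
  assumes \<zeta>: "\<zeta> IN TB D p" and 0: "J p \<zeta> = \<zero>\<^bsub>Fp p\<^esub>"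
  shows "\<zeta> = \<zero>\<^bsub>TB D p\<^esub>"
proof -
  interpret TD: module K "TB D p" by (rule TB_module[OF D_module])
  obtain S CD CF where Js: "J_coords p S CD CF" using J_coordinates by blast
  note Js = Js[unfolded J_coords_def]
  note Cs = bspec[OF conjunct1[OF conjunct2[OF Js]]]
  have lin: "linear K (TB D p) D (CD s)" "linear K (Fp p) AA2 (CF s)" "s IN BP p" if "s \<in> S" for s
    using Cs[OF that] by auto
  have CJ: "CF s (J p \<zeta>) = CD s \<zeta>" if "s \<in> S" for s
    using Cs[OF that] \<zeta> by (elim conjE) (erule bspec)
  have "CD s \<zeta> = \<zero>\<^bsub>D\<^esub>" if s: "s \<in> S" for s
    using CJ[OF s] 0 linear_zero[OF lin(2)[OF s] Fp_module AA2_module] by simp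
  then have "tensor_el K D (BP p) (CD s \<zeta>) s = \<zero>\<^bsub>TB D p\<^esub>" if s: "s \<in> S" for s
    using s linear_zero[OF tensor_mod(3)[OF D_module bar_pow_module lin(3)[OF s]] D_module TB_module[OF D_module]] by simp
  then have "(\<Oplus>\<^bsub>TB D p\<^esub>s\<in>S. tensor_el K D (BP p) (CD s \<zeta>) s) = (\<Oplus>\<^bsub>TB D p\<^esub>s\<in>S. \<zero>\<^bsub>TB D p\<^esub>)"
    by (intro TD.M.finsum_cong') auto
  then show ?thesis using bspec[OF conjunct1[OF conjunct2[OF conjunct2[OF Js]]] \<zeta>] TD.M.finsum_zero by simp
qed

lemma J_tensor_el:
  assumes z: "z IN D" and v: "v IN BP p"
  shows "J p (tensor_el K D (BP p) z v) = tensor_el K AA2 (BP p) z v"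
proof (rule linear_eq_bar[OF Fp_module linear_comp[OF tensor_mod(4)[OF D_module bar_pow_module z] J(1)]
      tensor_mod(4)[OF AA2_module bar_pow_module D_sub[OF z]] _ v])
  fix l assume l: "l \<in> tp p"
  show "J p (tensor_el K D (BP p) z (br l)) = tensor_el K AA2 (BP p) z (br l)"
    using J(2)[OF z l] tuples_length[OF l] by (simp add: tb_def)
qed

text \<open>A central element of \<open>F_p\<close> has central coordinates, because the outer
  actions work coordinatewise, and the central elements of \<open>A \<otimes> A\<close> are the dual
  by definition. Reassembling the coordinates over the dual gives the preimage.\<close>

lemma J_surj:
  assumes \<xi>: "\<xi> IN Fp p" and cent: "!!a. a IN A ==> FL p a \<xi> = FR p a \<xi>"
  shows "\<exists>\<zeta>\<in>carrier (TB D p). J p \<zeta> = \<xi>"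
proof -
  obtain S CD CF where Js: "J_coords p S CD CF" using J_coordinates by blast
  note Js = Js[unfolded J_coords_def]
  note Cs = bspec[OF conjunct1[OF conjunct2[OF Js]]]
  have lin: "linear K (TB D p) D (CD s)" "linear K (Fp p) AA2 (CF s)" "s IN BP p" if "s \<in> S" for s
    using Cs[OF that] by auto
  interpret TD: module K "TB D p" by (rule TB_module[OF D_module])
  have cD: "CF s \<xi> IN D" if s: "s \<in> S" for s
  proof -
    have "CF s \<xi> IN AA2" by (rule linear_closed[OF lin(2)[OF s] \<xi>])
    moreover have "AAm (%x. a \<otimes> x) (%y. y) (CF s \<xi>) = AAm (%x. x) (%y. y \<otimes> a) (CF s \<xi>)" if a: "a IN A" for a
    proof -
      have "\<forall>a\<in>carrier A. \<forall>\<xi>\<in>carrier (Fp p). CF s (FL p a \<xi>) = AAm (%x. a \<otimes> x) (%y. y) (CF s \<xi>) \<and>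
          CF s (FR p a \<xi>) = AAm (%x. x) (%y. y \<otimes> a) (CF s \<xi>)"
        using Cs[OF s] by (elim conjE)
      from bspec[OF bspec[OF this a] \<xi>] show ?thesis unfolding cent[OF a] by (elim conjE) (rule trans[OF sym])
    qed
    ultimately show ?thesis by (simp add: D_carrier)
  qed
  have tc: "tensor_el K D (BP p) (CF s \<xi>) s IN TB D p" if s: "s \<in> S" for s
    by (rule tensor_el_closed[OF D_module bar_pow_module cD[OF s] lin(3)[OF s]])
  let ?\<zeta> = "\<Oplus>\<^bsub>TB D p\<^esub>s\<in>S. tensor_el K D (BP p) (CF s \<xi>) s"
  have "J p ?\<zeta> = (\<Oplus>\<^bsub>Fp p\<^esub>s\<in>S. J p (tensor_el K D (BP p) (CF s \<xi>) s))"
    by (rule linear_finsum[OF J(1) TB_module[OF D_module] Fp_module]) (use tc in auto)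
  also have "... = (\<Oplus>\<^bsub>Fp p\<^esub>s\<in>S. tensor_el K AA2 (BP p) (CF s \<xi>) s)"
    by (rule Fp.W.M.finsum_cong')
      (use lin(3) cD J_tensor_el tensor_el_closed[OF AA2_module bar_pow_module] D_sub in auto)
  also have "... = \<xi>" by (rule bspec[OF conjunct2[OF conjunct2[OF conjunct2[OF Js]]] \<xi>, symmetric])
  finally show ?thesis using tc by (intro bexI[of _ ?\<zeta>]) auto
qed

lemma J_pair_inj:
  assumes \<zeta>: "\<zeta> IN TB D p" and "\<phi> p (J p \<zeta>) = \<zero>\<^bsub>Om (Suc p)\<^esub>" "\<psi> p (J p \<zeta>) = \<zero>\<^bsub>Om p\<^esub>"
  shows "\<zeta> = \<zero>\<^bsub>TB D p\<^esub>"
proof (rule J_inj[OF \<zeta>])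
  have "J p \<zeta> = \<sigma> p \<zero>\<^bsub>Om (Suc p)\<^esub> \<oplus>\<^bsub>Fp p\<^esub> \<tau> p \<one> \<zero>\<^bsub>Om p\<^esub>"
    using \<sigma>_\<phi>_\<tau>_\<psi>[OF J_closed[OF \<zeta>]] assms by simp
  then show "J p \<zeta> = \<zero>\<^bsub>Fp p\<^esub>"
    using linear_zero[OF \<sigma>(1) Om_module Fp_module] linear_zero[OF \<tau>(1)[OF one_A] Om_module Fp_module] by simp
qed

text \<open>The candidate is \<open>\<sigma> w + u \<otimes> 1\<close>. Its outer left and right
  multiples by \<open>a\<close> differ by \<open>\<sigma>\<close> of
  \<open>aw - wa - u \<otimes> sa\<close> plus \<open>(au - ua) \<otimes> 1\<close>, so the two
  conditions are what centrality demands.\<close>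

lemma J_pair_surj:
  assumes w: "w IN Om (Suc p)" and u: "u IN Om p"
    and cw: "!!a. a IN A ==> fl (Suc p) a w = fr (Suc p) a w \<oplus>\<^bsub>Om (Suc p)\<^esub> fa p a u"
    and cu: "!!a. a IN A ==> fl p a u = fr p a u"
  shows "\<exists>\<zeta>\<in>carrier (TB D p). \<phi> p (J p \<zeta>) = w \<and> \<psi> p (J p \<zeta>) = u"
proof -
  let ?\<xi> = "\<sigma> p w \<oplus>\<^bsub>Fp p\<^esub> \<tau> p \<one> u"
  note sc = \<sigma>_closed[OF w] and tc = \<tau>_closed[OF one_A u]
  have "FL p a ?\<xi> = FR p a ?\<xi>" if a: "a IN A" for a
  proof -
    have "FL p a ?\<xi> = \<sigma> p (fl (Suc p) a w) \<oplus>\<^bsub>Fp p\<^esub> \<tau> p \<one> (fl p a u)"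
      using linear_add[OF FL(1)[OF a] sc tc] a w u by (simp add: \<sigma>_left FL_\<tau> one_A)
    also have "... = (\<sigma> p (fr (Suc p) a w) \<oplus>\<^bsub>Fp p\<^esub> \<sigma> p (fa p a u)) \<oplus>\<^bsub>Fp p\<^esub> \<tau> p \<one> (fr p a u)"
      using linear_add[OF \<sigma>(1) Om.R_closed[OF a w] append_closed[OF a u]] by (simp add: cw[OF a] cu[OF a])
    also have "... = \<sigma> p (fr (Suc p) a w) \<oplus>\<^bsub>Fp p\<^esub> (\<sigma> p (fa p a u) \<oplus>\<^bsub>Fp p\<^esub> \<tau> p \<one> (fr p a u))"
      by (rule Fp.W.M.a_assoc)
        (use a w u \<sigma>_closed[OF Om.R_closed[OF a w]] \<sigma>_closed[OF append_closed[OF a u]] \<tau>_closed[OF one_A Om.R_closed[OF a u]] in auto)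
    also have "... = FR p a ?\<xi>"
      using linear_add[OF FR(1)[OF a] sc tc] a w u by (simp add: \<sigma>_right FR_\<tau>_one)
    finally show ?thesis .
  qed
  then obtain \<zeta> where \<zeta>: "\<zeta> IN TB D p" "J p \<zeta> = ?\<xi>"
    using J_surj[of ?\<xi> p] sc tc by auto
  have "\<phi> p ?\<xi> = w" "\<psi> p ?\<xi> = u"
    using linear_add[OF \<phi>(1) sc tc] linear_add[OF \<psi>(1) sc tc] w u
    by (simp_all add: \<phi>_\<sigma> \<psi>_\<sigma> \<phi>_\<tau>_one \<psi>_\<tau>_one)
  then show ?thesis using \<zeta> by (intro bexI[of _ \<zeta>]) auto
qed

end

lemma submodule_finsum:
  fixes V (structure)
  assumes V: "module K V" and H: "submodule H K V" and f: "!!i. i \<in> I ==> f i \<in> H"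
  shows "(\<Oplus>i\<in>I. f i) \<in> H"
proof -
  interpret V: module K V by fact
  note HE = V.submoduleE[OF H]
  have 0: "\<zero> \<in> H" using subgroup.one_closed[OF submodule.axioms(1)[OF H]] by simp
  show ?thesis
  proof (cases "finite I")
    case True
    then show ?thesis using f
    proof induct
      case empty
      then show ?case using 0 by simp
    next
      case (insert i I)
      have "(\<Oplus>i\<in>insert i I. f i) = f i \<oplus> (\<Oplus>i\<in>I. f i)"
        by (rule V.M.finsum_insert) (use insert HE(1) in auto)
      then show ?case using insert HE(5) by simp
    qed
  qed (use 0 in "simp add: V.M.finsum_infinite")
qed

lemma finsum_swap:
  fixes W (structure)
  assumes W: "module K W" and "finite I" "finite J" and f: "!!i j. i \<in> I ==> j \<in> J ==> f i j IN W"
  shows "(\<Oplus>i\<in>I. \<Oplus>j\<in>J. f i j) = (\<Oplus>j\<in>J. \<Oplus>i\<in>I. f i j)"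
proof -
  interpret W: module K W by fact
  show ?thesis
    using assms(2) f
  proof induct
    case empty
    then show ?case by (simp add: W.M.finsum_zero)
  next
    case (insert i I)
    have "(\<Oplus>i\<in>insert i I. \<Oplus>j\<in>J. f i j) = (\<Oplus>j\<in>J. f i j) \<oplus> (\<Oplus>i\<in>I. \<Oplus>j\<in>J. f i j)"
      by (rule W.M.finsum_insert) (use insert in "auto intro!: W.M.finsum_closed")
    also have "... = (\<Oplus>j\<in>J. f i j) \<oplus> (\<Oplus>j\<in>J. \<Oplus>i\<in>I. f i j)" using insert by simp
    also have "... = (\<Oplus>j\<in>J. f i j \<oplus> (\<Oplus>i\<in>I. f i j))"
      by (rule W.M.finsum_addf[symmetric]) (use insert in "auto intro!: W.M.finsum_closed")
    also have "... = (\<Oplus>j\<in>J. \<Oplus>i\<in>insert i I. f i j)"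
    proof (rule W.M.finsum_cong')
      fix j assume "j \<in> J"
      then show "f i j \<oplus> (\<Oplus>i\<in>I. f i j) = (\<Oplus>i\<in>insert i I. f i j)"
        using insert by (subst W.M.finsum_insert) auto
    qed (use insert in "auto intro!: W.M.finsum_closed")
    finally show ?case .
  qed
qed

context hochschild_base
begin

section \<open>Self-injectivity\<close>

lemma l_distr_A:
  "a IN A ==> b IN A ==> x IN A ==> (a \<oplus> b) \<otimes> x = a \<otimes> x \<oplus> b \<otimes> x"
  using linear_add[OF linear_mult_right] .

lemma r_distr_A:
  "a IN A ==> b IN A ==> x IN A ==> x \<otimes> (a \<oplus> b) = x \<otimes> a \<oplus> x \<otimes> b"
  using linear_add[OF linear_mult_left] .

lemma l_minus_A: "a IN A ==> x IN A ==> (\<ominus> a) \<otimes> x = \<ominus> (a \<otimes> x)"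
  using linear_uminus[OF linear_mult_right module_A module_A] .

text \<open>Left submodules given as sets. In the situation below, closure under scalars follows,
  since scalars act through multiples of the unit.\<close>

definition stable :: "('k, 'v) module => ('a => 'v => 'v) => 'v set => bool" where
  "stable V la X \<longleftrightarrow> X \<subseteq> carrier V \<and> \<zero>\<^bsub>V\<^esub> \<in> X \<and> (\<forall>x\<in>X. \<forall>y\<in>X. x \<oplus>\<^bsub>V\<^esub> y \<in> X) \<and> (\<forall>a\<in>carrier A. \<forall>x\<in>X. la a x \<in> X)"

definition equivariant :: "('k, 'v) module => ('a => 'v => 'v) => 'v set => ('v => 'a) => bool" where
  "equivariant V la X f \<longleftrightarrow> f ` X \<subseteq> carrier A \<and> (\<forall>x\<in>X. \<forall>y\<in>X. f (x \<oplus>\<^bsub>V\<^esub> y) = f x \<oplus> f y) \<and>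
     (\<forall>a\<in>carrier A. \<forall>x\<in>X. f (la a x) = a \<otimes> f x)"

text \<open>Baer's criterion for a left module \<open>V\<close> that is finitely generated over the ground field.\<close>

context
  fixes V :: "('k, 'v) module" and la :: "'a => 'v => 'v"
  assumes V: "module K V" and si: "self_injective A"
    and la: "!!a. a IN A ==> linear K V V (la a)"
    and laA: "!!v. v IN V ==> linear K A V (%a. la a v)"
    and la1: "!!v. v IN V ==> la \<one> v = v"
    and lala: "!!a b v. a IN A ==> b IN A ==> v IN V ==> la a (la b v) = la (a \<otimes> b) v"
begin

lemma la_scalar:
  assumes "c IN K" "v IN V"
  shows "la (c \<odot> \<one>) v = c \<odot>\<^bsub>V\<^esub> v"
  using linear_smult[OF laA[OF assms(2)] assms(1) one_A] la1[OF assms(2)] by simp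

lemma stable_submodule: "stable V la X ==> submodule X K V"
proof (rule submoduleI'[OF V])
  fix c x assume X: "stable V la X" and c: "c IN K" and x: "x \<in> X"
  have "la (c \<odot> \<one>) x \<in> X" using X x A.smult_closed[OF c one_A] by (auto simp: stable_def)
  then show "c \<odot>\<^bsub>V\<^esub> x \<in> X" using la_scalar[OF c] X x by (auto simp: stable_def)
qed (auto simp: stable_def)

text \<open>Self-injectivity enters here, for the inclusion of a left ideal \<open>I\<close> into
  \<open>A\<close>. The extended map \<open>A \<rightarrow> A\<close> is left linear, so it is right
  multiplication by its value \<open>q\<close> at the unit.\<close>

lemma ideal_extension:
  assumes I: "I \<subseteq> carrier A" "\<zero> \<in> I" "!!x y. x \<in> I ==> y \<in> I ==> x \<oplus> y \<in> I"
      "!!a x. a IN A ==> x \<in> I ==> a \<otimes> x \<in> I"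
    and h: "!!x. x \<in> I ==> h x IN A" "!!x y. x \<in> I ==> y \<in> I ==> h (x \<oplus> y) = h x \<oplus> h y"
      "!!a x. a IN A ==> x \<in> I ==> h (a \<otimes> x) = a \<otimes> h x"
  shows "\<exists>q\<in>carrier A. \<forall>x\<in>I. h x = x \<otimes> q"
proof -
  let ?Y = "regular_module A"
  define X :: "('a, 'a) module" where "X = ?Y\<lparr>carrier := I\<rparr>"
  have Xs: "carrier X = I" "zero X = \<zero>" "add X = add A" "smult X = mult A"
    by (simp_all add: X_def)
  \<comment> \<open>A left ideal contains negatives, as \<open>- x\<close> is
    \<open>(- 1) x\<close>.\<close>
  have ex: "\<exists>y\<in>I. y \<oplus> x = \<zero>" if "x \<in> I" for x
  proof (rule bexI[of _ "(\<ominus> \<one>) \<otimes> x"])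
    have "x IN A" using that I by auto
    then show "(\<ominus> \<one>) \<otimes> x \<oplus> x = \<zero>" by (simp add: l_minus_A A.M.l_neg)
  qed (use I(4) that in auto)
  have ab: "abelian_group X"
    by (rule abelian_groupI) (use I ex in "auto simp: Xs A.M.a_ac subsetD")
  have aY: "abelian_group ?Y"
    by (rule abelian_groupI) (auto simp: A.M.a_ac intro: A.M.l_neg)
  have lX: "left_module A X"
    by (intro left_module.intro ring_A ab left_module_axioms.intro)
      (use I in "auto simp: Xs l_distr_A r_distr_A assoc_A subsetD")
  have lY: "left_module A ?Y"
    by (intro left_module.intro ring_A aY left_module_axioms.intro)
      (auto simp: l_distr_A r_distr_A assoc_A)
  have i: "restrict (%x. x) I \<in> lin_maps A X ?Y"
    using I by (auto simp: lin_maps_def Xs)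
  have f: "restrict h I \<in> lin_maps A X ?Y"
    using I h by (auto simp: lin_maps_def Xs)
  have inj: "inj_on (restrict (%x. x) I) (carrier X)" by (auto simp: Xs inj_on_def)
  obtain g where g: "g \<in> lin_maps A ?Y ?Y" "\<forall>x\<in>carrier X. g (restrict (%x. x) I x) = restrict h I x"
    using si lX lY i inj f unfolding self_injective_def injective_module_def by blast
  have gl: "!!x. x IN A ==> g x IN A" "!!a x. a IN A ==> x IN A ==> g (a \<otimes> x) = a \<otimes> g x"
    using g(1) by (auto simp: lin_maps_def)
  have "h x = x \<otimes> g \<one>" if x: "x \<in> I" for x
  proof -
    have xc: "x IN A" using x I by auto
    have "h x = g x" using g(2) x by (auto simp: Xs)
    also have "... = g (x \<otimes> \<one>)" using xc by simp
    also have "... = x \<otimes> g \<one>" by (rule gl(2)[OF xc one_A])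
    finally show ?thesis .
  qed
  then show ?thesis using gl(1)[OF one_A] by (intro bexI[of _ "g \<one>"]) auto
qed

text \<open>The \<open>a\<close> with \<open>as\<close> in \<open>X\<close> form a left ideal, on
  which \<open>a \<mapsto> f(as)\<close> is multiplication by some \<open>q\<close>. Then
  \<open>x + as \<mapsto> f(x) + aq\<close> extends \<open>f\<close> to
  \<open>X + As\<close>.\<close>

lemma baer_step:
  assumes X: "stable V la X" and f: "equivariant V la X f" and s: "s IN V"
  shows "\<exists>X' f'. stable V la X' \<and> equivariant V la X' f' \<and> X \<subseteq> X' \<and> s \<in> X' \<and> (\<forall>x\<in>X. f' x = f x)"
proof -
  interpret V: module K V by (rule V)
  have Xc: "!!x. x \<in> X ==> x IN V" and X0: "\<zero>\<^bsub>V\<^esub> \<in> X"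
    and Xa: "!!x y. x \<in> X ==> y \<in> X ==> x \<oplus>\<^bsub>V\<^esub> y \<in> X" and Xl: "!!a x. a IN A ==> x \<in> X ==> la a x \<in> X"
    using X by (auto simp: stable_def)
  have fc: "!!x. x \<in> X ==> f x IN A" and fa: "!!x y. x \<in> X ==> y \<in> X ==> f (x \<oplus>\<^bsub>V\<^esub> y) = f x \<oplus> f y"
    and fl: "!!a x. a IN A ==> x \<in> X ==> f (la a x) = a \<otimes> f x"
    using f by (auto simp: equivariant_def)
  have Xn: "\<ominus>\<^bsub>V\<^esub> x \<in> X" if "x \<in> X" for x
    using V.submoduleE(3)[OF stable_submodule[OF X] that] .
  note lac = linear_closed[OF la _] linear_closed[OF laA[OF s]]
  note las = linear_add[OF laA[OF s]]
  define I where "I = {a \<in> carrier A. la a s \<in> X}"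
  have "\<exists>q\<in>carrier A. \<forall>x\<in>I. f (la x s) = x \<otimes> q"
  proof (rule ideal_extension)
    show "\<zero> \<in> I" using linear_zero[OF laA[OF s] module_A V] X0 by (simp add: I_def)
    show "x \<oplus> y \<in> I" if "x \<in> I" "y \<in> I" for x y using that Xa las by (auto simp: I_def)
    show "a \<otimes> x \<in> I" if "a IN A" "x \<in> I" for a x
      using that Xl[OF that(1), of "la x s"] lala[OF that(1) _ s, of x] by (auto simp: I_def mult_A)
    show "f (la (a \<otimes> x) s) = a \<otimes> f (la x s)" if "a IN A" "x \<in> I" for a x
      using that fl[OF that(1), of "la x s"] lala[OF that(1) _ s, of x] by (auto simp: I_def)
  qed (auto simp: I_def las fa fc)
  then obtain q where q: "q IN A" "!!a. a IN A ==> la a s \<in> X ==> f (la a s) = a \<otimes> q"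
    by (auto simp: I_def)
  \<comment> \<open>Two presentations of one element differ by \<open>(a - b)s\<close>, which lies
    in \<open>X\<close>; there \<open>f\<close> is already multiplication by
    \<open>q\<close>.\<close>
  have wd: "f x \<oplus> a \<otimes> q = f y \<oplus> b \<otimes> q"
    if x: "x \<in> X" and y: "y \<in> X" and a: "a IN A" and b: "b IN A"
      and eq: "x \<oplus>\<^bsub>V\<^esub> la a s = y \<oplus>\<^bsub>V\<^esub> la b s" for x y a b
  proof -
    have d: "la (a \<ominus> b) s = la a s \<ominus>\<^bsub>V\<^esub> la b s"
      by (rule linear_minus[OF laA[OF s] module_A V a b])
    have "la a s \<ominus>\<^bsub>V\<^esub> la b s = \<ominus>\<^bsub>V\<^esub> x \<oplus>\<^bsub>V\<^esub> ((x \<oplus>\<^bsub>V\<^esub> la a s) \<ominus>\<^bsub>V\<^esub> la b s)"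
      using x a b Xc lac(2) by (simp add: a_minus_def V.M.a_assoc V.M.r_neg1)
    also have "... = \<ominus>\<^bsub>V\<^esub> x \<oplus>\<^bsub>V\<^esub> y"
      unfolding eq using y b Xc lac(2) by (simp add: V.M.add_diff_cancel)
    finally have e: "la a s \<ominus>\<^bsub>V\<^esub> la b s = \<ominus>\<^bsub>V\<^esub> x \<oplus>\<^bsub>V\<^esub> y" .
    then have mem: "la (a \<ominus> b) s \<in> X" using d Xa Xn x y by simp
    have "f x \<oplus> (a \<ominus> b) \<otimes> q = f x \<oplus> f (la (a \<ominus> b) s)"
      using q(2)[OF _ mem] a b by simp
    also have "... = f (x \<oplus>\<^bsub>V\<^esub> (\<ominus>\<^bsub>V\<^esub> x \<oplus>\<^bsub>V\<^esub> y))" using fa[OF x mem] d e by simp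
    also have "x \<oplus>\<^bsub>V\<^esub> (\<ominus>\<^bsub>V\<^esub> x \<oplus>\<^bsub>V\<^esub> y) = y" using x y Xc by (simp add: V.M.r_neg2)
    finally have fy: "f y = f x \<oplus> (a \<ominus> b) \<otimes> q" by simp
    show ?thesis
      unfolding fy using fc[OF x] a b q(1)
      by (simp add: a_minus_def l_distr_A l_minus_A A.M.a_assoc A.M.l_neg)
  qed
  define X' where "X' = {x \<oplus>\<^bsub>V\<^esub> la a s | x a. x \<in> X \<and> a IN A}"
  define f' where "f' v = (SOME r. \<exists>x\<in>X. \<exists>a\<in>carrier A. v = x \<oplus>\<^bsub>V\<^esub> la a s \<and> r = f x \<oplus> a \<otimes> q)" for v
  have f': "f' (x \<oplus>\<^bsub>V\<^esub> la a s) = f x \<oplus> a \<otimes> q" if x: "x \<in> X" and a: "a IN A" for x a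
  proof -
    have "\<exists>y\<in>X. \<exists>b\<in>carrier A. x \<oplus>\<^bsub>V\<^esub> la a s = y \<oplus>\<^bsub>V\<^esub> la b s \<and> f' (x \<oplus>\<^bsub>V\<^esub> la a s) = f y \<oplus> b \<otimes> q"
      unfolding f'_def by (rule someI[of _ "f x \<oplus> a \<otimes> q"]) (use x a in blast)
    then show ?thesis using wd x a by metis
  qed
  have sum: "(x \<oplus>\<^bsub>V\<^esub> la a s) \<oplus>\<^bsub>V\<^esub> (y \<oplus>\<^bsub>V\<^esub> la b s) = (x \<oplus>\<^bsub>V\<^esub> y) \<oplus>\<^bsub>V\<^esub> la (a \<oplus> b) s"
    if "x \<in> X" "y \<in> X" "a IN A" "b IN A" for x y a b
    using that Xc lac(2) by (simp add: las V.M.a_ac)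
  have lsum: "la c (x \<oplus>\<^bsub>V\<^esub> la a s) = la c x \<oplus>\<^bsub>V\<^esub> la (c \<otimes> a) s"
    if "x \<in> X" "c IN A" "a IN A" for x c a
    using that Xc lac(2) linear_add[OF la] lala[OF that(2,3) s] by simp
  have X'e: "v \<in> X' \<longleftrightarrow> (\<exists>x a. x \<in> X \<and> a IN A \<and> v = x \<oplus>\<^bsub>V\<^esub> la a s)" for v
    by (auto simp: X'_def)
  have z: "la \<zero> s = \<zero>\<^bsub>V\<^esub>" by (rule linear_zero[OF laA[OF s] module_A V])
  have sub: "x \<in> X'" "f' x = f x" if "x \<in> X" for x
  proof -
    have e: "x \<oplus>\<^bsub>V\<^esub> la \<zero> s = x" using that Xc z by simp
    show "x \<in> X'" unfolding X'e using that e by (metis A.M.zero_closed)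
    show "f' x = f x" using f'[OF that A.M.zero_closed] e q(1) fc[OF that] by simp
  qed
  have "stable V la X'"
    unfolding stable_def
  proof (intro conjI ballI subsetI)
    show "v IN V" if "v \<in> X'" for v using that Xc lac(2) by (auto simp: X'e)
    show "\<zero>\<^bsub>V\<^esub> \<in> X'" by (rule sub(1)[OF X0])
    show "v \<oplus>\<^bsub>V\<^esub> w \<in> X'" if vw: "v \<in> X'" "w \<in> X'" for v w
    proof -
      obtain x a y b where "x \<in> X" "a IN A" "v = x \<oplus>\<^bsub>V\<^esub> la a s" "y \<in> X" "b IN A" "w = y \<oplus>\<^bsub>V\<^esub> la b s"
        using vw unfolding X'e by auto
      then show ?thesis unfolding X'e by (intro exI[of _ "x \<oplus>\<^bsub>V\<^esub> y"] exI[of _ "a \<oplus> b"]) (simp add: sum Xa)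
    qed
    show "la c v \<in> X'" if c: "c IN A" and v: "v \<in> X'" for c v
    proof -
      obtain x a where "x \<in> X" "a IN A" "v = x \<oplus>\<^bsub>V\<^esub> la a s" using v unfolding X'e by auto
      then show ?thesis unfolding X'e by (intro exI[of _ "la c x"] exI[of _ "c \<otimes> a"]) (simp add: lsum Xl c)
    qed
  qed
  moreover have "equivariant V la X' f'"
    unfolding equivariant_def
  proof (intro conjI ballI subsetI)
    show "v IN A" if "v \<in> f' ` X'" for v using that fc q(1) by (auto simp: X'e f')
    show "f' (v \<oplus>\<^bsub>V\<^esub> w) = f' v \<oplus> f' w" if vw: "v \<in> X'" "w \<in> X'" for v w
    proof -
      obtain x a y b where e: "x \<in> X" "a IN A" "v = x \<oplus>\<^bsub>V\<^esub> la a s" "y \<in> X" "b IN A" "w = y \<oplus>\<^bsub>V\<^esub> la b s"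
        using vw unfolding X'e by auto
      then show ?thesis using fc q(1) by (simp add: sum f' Xa fa l_distr_A A.M.a_ac)
    qed
    show "f' (la c v) = c \<otimes> f' v" if c: "c IN A" and v: "v \<in> X'" for c v
    proof -
      obtain x a where "x \<in> X" "a IN A" "v = x \<oplus>\<^bsub>V\<^esub> la a s" using v unfolding X'e by auto
      then show ?thesis using fc q(1) c by (simp add: lsum f' Xl fl r_distr_A assoc_A)
    qed
  qed
  moreover have "s \<in> X'"
    unfolding X'e by (intro exI[of _ "\<zero>\<^bsub>V\<^esub>"] exI[of _ "\<one>"]) (simp add: X0 one_A la1 s)
  ultimately show ?thesis using sub by blast
qed

text \<open>A finite spanning set is adjoined one generator at a time, so ordinary induction takes
  the place of Zorn's lemma.\<close>

lemma baer_extension: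
  assumes X: "stable V la X" and f: "equivariant V la X f" and S: "finite S" "spans K V S"
  shows "\<exists>g. equivariant V la (carrier V) g \<and> (\<forall>x\<in>X. g x = f x)"
proof -
  have Sc: "S \<subseteq> carrier V" using S(2) by (simp add: spans_def)
  have "\<exists>X' f'. stable V la X' \<and> equivariant V la X' f' \<and> X \<subseteq> X' \<and> T \<subseteq> X' \<and> (\<forall>x\<in>X. f' x = f x)" if "T \<subseteq> S" for T
    using finite_subset[OF that S(1)] that
  proof induct
    case empty
    then show ?case using X f by blast
  next
    case (insert s T)
    then obtain X1 f1 where 1: "stable V la X1" "equivariant V la X1 f1" "X \<subseteq> X1" "T \<subseteq> X1" "\<forall>x\<in>X. f1 x = f x" by auto
    have "s IN V" using insert Sc by auto
    from baer_step[OF 1(1,2) this] obtain X2 f2 where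
      2: "stable V la X2" "equivariant V la X2 f2" "X1 \<subseteq> X2" "s \<in> X2" "\<forall>x\<in>X1. f2 x = f1 x" by blast
    have "X \<subseteq> X2" "insert s T \<subseteq> X2" "\<forall>x\<in>X. f2 x = f x" using 1(3-5) 2(3-5) by auto
    with 2(1,2) show ?case by blast
  qed
  from this[OF subset_refl] obtain X' f' where X': "stable V la X'" "equivariant V la X' f'" "S \<subseteq> X'" "\<forall>x\<in>X. f' x = f x" by blast
  have "mod_span K V S \<subseteq> X'" by (rule mod_span_least[OF stable_submodule[OF X'(1)] X'(3)])
  then have "X' = carrier V" using S(2) X'(1) by (auto simp: spans_def stable_def)
  then show ?thesis using X' by blast
qed

end

end

locale hochschild_tate = hochschild_fd K A for K :: "'k ring" and A :: "('k, 'a) module" (structure) +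
  assumes self_injective_A: "self_injective A"
begin

text \<open>
  A left linear retraction \<open>g\<close> of \<open>q \<mapsto> (b \<mapsto> b q)\<close>, \<open>A \<rightarrow> Hom(A, A)\<close>, written in terms of a dual basis:
  \<open>r e q = g (b \<mapsto> c e b \<cdot> q)\<close>.
\<close>

lemma ex_retraction:
  "\<exists>E c r. dual_basis K A E c \<and> (\<forall>e\<in>E. linear K A A (r e)) \<and>
     (\<forall>x\<in>carrier A. (\<Oplus>e\<in>E. r e (e \<otimes> x)) = x) \<and>
     (\<forall>a\<in>carrier A. \<forall>x\<in>carrier A. \<forall>j\<in>E. (\<Oplus>e\<in>E. c j (e \<otimes> a) \<odot> r e x) = a \<otimes> r j x)"
proof -
  obtain E c where db: "dual_basis K A E c"
    using ex_dual_basis[OF field_K module_A fd_A] by blast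
  have fin: "finite E" and Ec: "!!e. e \<in> E ==> e IN A"
    and cl: "!!e. e \<in> E ==> linear K A (regular_module K) (c e)"
    and exp: "!!v. v IN A ==> v = (\<Oplus>e\<in>E. c e v \<odot> e)"
    using db by (auto simp: dual_basis_def)
  have cK: "c e v IN K" if "e \<in> E" "v IN A" for e v
    using linear_closed[OF cl that(2)] that by simp
  let ?V = "hom_mod K A A"
  have V: "module K ?V" by (rule hom_mod[OF module_A module_A])
  interpret V: module K ?V by (rule V)
  have Veq: "f = g" if "f IN ?V" "g IN ?V" "!!b. b IN A ==> f b = g b" for f g
    using that by (auto simp: lin_maps_iff intro: extensionalityI)
  have Vlin: "linear K A A f" if "f IN ?V" for f using that by (simp add: lin_maps_iff)
  have VI: "restrict f (carrier A) IN ?V" if "linear K A A f" for f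
    using restrict_lin_maps[OF module_A that] by simp
  have ev: "linear K ?V A (%f. f b)" if b: "b IN A" for b
    by (rule linearI) (use b linear_closed[OF Vlin] in auto)
  \<comment> \<open>The left action \<open>(a\<phi>)(b) = \<phi>(ba)\<close> on
    \<open>Hom(A, A)\<close>, for which the embedding \<open>m\<close> below is equivariant.\<close>
  define la where "la a \<phi> = (\<lambda>b\<in>carrier A. \<phi> (b \<otimes> a))" for a and \<phi> :: "'a => 'a"
  have lac: "la a \<phi> IN ?V" if "a IN A" "\<phi> IN ?V" for a \<phi>
    unfolding la_def by (rule VI[OF linear_comp[OF linear_mult_right[OF that(1)] Vlin[OF that(2)]]])
  have lav: "la a \<phi> b = \<phi> (b \<otimes> a)" if "b IN A" for a b \<phi>
    using that by (simp add: la_def)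
  have addv: "(\<phi> \<oplus>\<^bsub>?V\<^esub> \<chi>) b = \<phi> b \<oplus> \<chi> b" "(k \<odot>\<^bsub>?V\<^esub> \<phi>) b = k \<odot> \<phi> b" if "b IN A" for \<phi> \<chi> b k
    using that by simp_all
  have la_lin: "linear K ?V ?V (la a)" if a: "a IN A" for a
    by (rule linearI; (rule Veq)?)
      (use a lac V.M.a_closed V.smult_closed in "simp_all add: lav addv mult_A del: hom_mod_simps")
  have la_linA: "linear K A ?V (%a. la a \<phi>)" if \<phi>: "\<phi> IN ?V" for \<phi>
    by (rule linearI; (rule Veq)?)
      (use \<phi> lac V.M.a_closed V.smult_closed linear_add[OF Vlin[OF \<phi>]] linear_smult[OF Vlin[OF \<phi>]] in
        \<open>simp_all add: lav addv mult_A r_distr_A A.smult_mult_right del: hom_mod_simps\<close>)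
  have la_1: "la \<one> \<phi> = \<phi>" if \<phi>: "\<phi> IN ?V" for \<phi>
    by (rule Veq[OF lac[OF one_A \<phi>] \<phi>]) (simp add: lav)
  have la_la: "la a (la b \<phi>) = la (a \<otimes> b) \<phi>" if "a IN A" "b IN A" "\<phi> IN ?V" for a b \<phi>
    by (rule Veq[OF lac[OF that(1) lac[OF that(2,3)]] lac[OF mult_A[OF that(1,2)] that(3)]])
      (use that in "simp add: lav mult_A assoc_A")
  note ctx = V self_injective_A la_lin la_linA la_1 la_la
  define m where "m q = (\<lambda>b\<in>carrier A. b \<otimes> q)" for q
  have mc: "m q IN ?V" if "q IN A" for q
    unfolding m_def by (rule VI[OF linear_mult_right[OF that]])
  have mv: "m q b = b \<otimes> q" if "b IN A" for q b using that by (simp add: m_def)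
  have ma: "m x \<oplus>\<^bsub>?V\<^esub> m y = m (x \<oplus> y)" if "x IN A" "y IN A" for x y
    by (rule Veq) (use that mc V.M.a_closed in "simp_all add: mv addv r_distr_A del: hom_mod_simps")
  have ml: "la a (m x) = m (a \<otimes> x)" if "x IN A" "a IN A" for x a
    by (rule Veq) (use that mc lac in "simp_all add: mv lav assoc_A mult_A del: hom_mod_simps")
  have m0: "m \<zero> = \<zero>\<^bsub>?V\<^esub>"
    by (rule Veq[OF mc[OF A.M.zero_closed] V.M.zero_closed]) (simp add: mv)
  \<comment> \<open>Maps \<open>b \<mapsto> c e b \<cdot> q\<close> of rank at most one. With
    \<open>q\<close> also taken from \<open>E\<close> they give the finite spanning set of
    \<open>Hom(A, A)\<close> that the extension argument needs.\<close>
  define \<epsilon> where "\<epsilon> e q = (\<lambda>b\<in>carrier A. c e b \<odot> q)" for e q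
  have \<epsilon>c: "\<epsilon> e q IN ?V" if e: "e \<in> E" and q: "q IN A" for e q
  proof -
    have "linear K (regular_module K) A (%k. k \<odot> q)"
      using q by (intro linearI) (auto simp: A.smult_l_distr A.smult_assoc1)
    from linear_comp[OF cl[OF e] this] show ?thesis unfolding \<epsilon>_def by (rule VI)
  qed
  have \<epsilon>v: "\<epsilon> e q b = c e b \<odot> q" if "b IN A" for e q b using that by (simp add: \<epsilon>_def)
  have \<epsilon>lin: "linear K A ?V (\<epsilon> e)" if e: "e \<in> E" for e
    by (rule linearI; (rule Veq)?)
      (use e \<epsilon>c V.M.a_closed V.smult_closed cK in
        \<open>simp_all add: \<epsilon>v addv A.smult_r_distr A.smult_assoc1[symmetric] K.m_comm del: hom_mod_simps\<close>)
  have sumv: "(\<Oplus>\<^bsub>?V\<^esub>i\<in>I. f i) b = (\<Oplus>i\<in>I. f i b)" if "b IN A" "f \<in> I \<rightarrow> carrier ?V" for b f I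
    by (rule linear_finsum[OF ev[OF that(1)] V module_A that(2)])
  let ?S = "(%(e, j). \<epsilon> e j) ` (E \<times> E)"
  have spS: "spans K ?V ?S"
  proof (rule spansI[OF V])
    show "?S \<subseteq> carrier ?V" using \<epsilon>c Ec by auto
    fix H \<phi> assume H: "submodule H K ?V" and sub: "?S \<subseteq> H" and \<phi>: "\<phi> IN ?V"
    note HE = V.submoduleE[OF H]
    have \<phi>c: "\<phi> e IN A" if "e \<in> E" for e using linear_closed[OF Vlin[OF \<phi>] Ec[OF that]] .
    have 1: "\<epsilon> e q \<in> H" if e: "e \<in> E" and q: "q IN A" for e q
    proof -
      have "\<epsilon> e q = \<epsilon> e (\<Oplus>j\<in>E. c j q \<odot> j)" using exp[OF q] by simp
      also have "... = (\<Oplus>\<^bsub>?V\<^esub>j\<in>E. \<epsilon> e (c j q \<odot> j))"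
        by (rule linear_finsum[OF \<epsilon>lin[OF e] module_A V]) (use cK q Ec in auto)
      also have "... \<in> H"
      proof (rule submodule_finsum[OF V H])
        fix j assume j: "j \<in> E"
        have "c j q \<odot>\<^bsub>?V\<^esub> \<epsilon> e j \<in> H" by (rule HE(4)[OF cK[OF j q]]) (use sub e j in auto)
        then show "\<epsilon> e (c j q \<odot> j) \<in> H" using linear_smult[OF \<epsilon>lin[OF e] cK[OF j q] Ec[OF j]] by simp
      qed
      finally show ?thesis .
    qed
    have "\<phi> = (\<Oplus>\<^bsub>?V\<^esub>e\<in>E. \<epsilon> e (\<phi> e))"
    proof (rule Veq[OF \<phi>])
      show "(\<Oplus>\<^bsub>?V\<^esub>e\<in>E. \<epsilon> e (\<phi> e)) IN ?V" by (rule V.M.finsum_closed) (use \<epsilon>c \<phi>c in auto)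
      fix b assume b: "b IN A"
      have "\<phi> b = \<phi> (\<Oplus>e\<in>E. c e b \<odot> e)" using exp[OF b] by simp
      also have "... = (\<Oplus>e\<in>E. \<phi> (c e b \<odot> e))"
        by (rule linear_finsum[OF Vlin[OF \<phi>] module_A module_A]) (use cK b Ec in auto)
      also have "... = (\<Oplus>e\<in>E. \<epsilon> e (\<phi> e) b)"
        by (rule A.M.finsum_cong') (use cK b Ec \<phi>c linear_smult[OF Vlin[OF \<phi>]] in "auto simp: \<epsilon>v")
      also have "... = (\<Oplus>\<^bsub>?V\<^esub>e\<in>E. \<epsilon> e (\<phi> e)) b" by (rule sumv[symmetric, OF b]) (use \<epsilon>c \<phi>c in auto)
      finally show "\<phi> b = (\<Oplus>\<^bsub>?V\<^esub>e\<in>E. \<epsilon> e (\<phi> e)) b" .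
    qed
    also have "... \<in> H" by (rule submodule_finsum[OF V H]) (use 1 \<phi>c in auto)
    finally show "\<phi> \<in> H" .
  qed
  have finS: "finite ?S" using fin by auto
  have st: "stable ?V la (m ` carrier A)"
    unfolding stable_def
    by (auto simp: mc m0[symmetric] ma ml mult_A simp del: hom_mod_simps)
  have m1: "m q \<one> = q" if "q IN A" for q using that by (simp add: mv one_A)
  \<comment> \<open>On the image of \<open>m\<close>, evaluation at the unit inverts
    \<open>m\<close>; Baer's criterion extends this inverse to all of
    \<open>Hom(A, A)\<close>.\<close>
  have eq: "equivariant ?V la (m ` carrier A) (%\<phi>. \<phi> \<one>)"
    unfolding equivariant_def
    by (auto simp: m1 ma ml mult_A simp del: hom_mod_simps)
  obtain g where g: "equivariant ?V la (carrier ?V) g" "\<forall>\<phi>\<in>m ` carrier A. g \<phi> = \<phi> \<one>"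
    using baer_extension[OF ctx st eq finS spS] by blast
  have gm: "g (m q) = q" if "q IN A" for q using g(2) m1 that by simp
  have gc: "!!\<phi>. \<phi> IN ?V ==> g \<phi> IN A"
    and ga: "!!\<phi> \<chi>. \<phi> IN ?V ==> \<chi> IN ?V ==> g (\<phi> \<oplus>\<^bsub>?V\<^esub> \<chi>) = g \<phi> \<oplus> g \<chi>"
    and gl: "!!a \<phi>. a IN A ==> \<phi> IN ?V ==> g (la a \<phi>) = a \<otimes> g \<phi>"
    using g(1) unfolding equivariant_def by (auto simp del: hom_mod_simps)
  have glin: "linear K ?V A g"
  proof (rule linearI)
    fix k \<phi> assume k: "k IN K" and \<phi>: "\<phi> IN ?V"
    have "g (k \<odot>\<^bsub>?V\<^esub> \<phi>) = g (la (k \<odot> \<one>) \<phi>)" using la_scalar[OF ctx k \<phi>] by simp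
    also have "... = k \<odot> g \<phi>"
      using gl[OF A.smult_closed[OF k one_A] \<phi>] A.smult_mult_left[OF k one_A gc[OF \<phi>]] gc[OF \<phi>] by simp
    finally show "g (k \<odot>\<^bsub>?V\<^esub> \<phi>) = k \<odot> g \<phi>" .
  qed (use gc ga in auto)
  let ?r = "%e q. g (\<epsilon> e q)"
  have rl: "linear K A A (?r e)" if "e \<in> E" for e by (rule linear_comp[OF \<epsilon>lin[OF that] glin])
  \<comment> \<open>The sum is \<open>g\<close> applied to \<open>m x\<close>, because
    \<open>b \<mapsto> bx\<close> is the sum of the maps \<open>\<epsilon> e (ex)\<close>.\<close>
  have r1: "(\<Oplus>e\<in>E. ?r e (e \<otimes> x)) = x" if x: "x IN A" for x
  proof -
    have ec: "\<epsilon> e (e \<otimes> x) IN ?V" if "e \<in> E" for e using \<epsilon>c[OF that mult_A[OF Ec[OF that] x]] .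
    have "(\<Oplus>e\<in>E. ?r e (e \<otimes> x)) = g (\<Oplus>\<^bsub>?V\<^esub>e\<in>E. \<epsilon> e (e \<otimes> x))"
      by (rule linear_finsum[OF glin V module_A, symmetric]) (use ec in auto)
    also have "(\<Oplus>\<^bsub>?V\<^esub>e\<in>E. \<epsilon> e (e \<otimes> x)) = m x"
    proof (rule Veq[OF _ mc[OF x]])
      show "(\<Oplus>\<^bsub>?V\<^esub>e\<in>E. \<epsilon> e (e \<otimes> x)) IN ?V" by (rule V.M.finsum_closed) (use ec in auto)
      fix b assume b: "b IN A"
      have "(\<Oplus>\<^bsub>?V\<^esub>e\<in>E. \<epsilon> e (e \<otimes> x)) b = (\<Oplus>e\<in>E. \<epsilon> e (e \<otimes> x) b)" by (rule sumv[OF b]) (use ec in auto)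
      also have "... = (\<Oplus>e\<in>E. (c e b \<odot> e) \<otimes> x)"
        by (rule A.M.finsum_cong') (use b x Ec cK in "auto simp: \<epsilon>v A.smult_mult_left mult_A")
      also have "... = (\<Oplus>e\<in>E. c e b \<odot> e) \<otimes> x"
        by (rule linear_finsum[OF linear_mult_right[OF x] module_A module_A, symmetric]) (use b Ec cK in auto)
      also have "... = m x b" using exp[OF b] mv[OF b] by simp
      finally show "(\<Oplus>\<^bsub>?V\<^esub>e\<in>E. \<epsilon> e (e \<otimes> x)) b = m x b" .
    qed
    finally show ?thesis using gm[OF x] by simp
  qed
  \<comment> \<open>Left linearity of \<open>g\<close> in the dual basis:
    \<open>b \<mapsto> c j (ba) \<cdot> x\<close> is the combination of the maps
    \<open>\<epsilon> e x\<close> with coefficients \<open>c j (ea)\<close>.\<close>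
  have r2: "(\<Oplus>e\<in>E. c j (e \<otimes> a) \<odot> ?r e x) = a \<otimes> ?r j x"
    if a: "a IN A" and x: "x IN A" and j: "j \<in> E" for a x j
  proof -
    have ck: "c j (e \<otimes> a) IN K" if "e \<in> E" for e by (rule cK[OF j mult_A[OF Ec[OF that] a]])
    have ec: "c j (e \<otimes> a) \<odot>\<^bsub>?V\<^esub> \<epsilon> e x IN ?V" if "e \<in> E" for e
      by (rule V.smult_closed[OF ck[OF that] \<epsilon>c[OF that x]])
    have "(\<Oplus>e\<in>E. c j (e \<otimes> a) \<odot> ?r e x) = (\<Oplus>e\<in>E. g (c j (e \<otimes> a) \<odot>\<^bsub>?V\<^esub> \<epsilon> e x))"
      by (rule A.M.finsum_cong') (use linear_smult[OF glin ck \<epsilon>c[OF _ x]] gc[OF ec] in auto)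
    also have "... = g (\<Oplus>\<^bsub>?V\<^esub>e\<in>E. c j (e \<otimes> a) \<odot>\<^bsub>?V\<^esub> \<epsilon> e x)"
      by (rule linear_finsum[OF glin V module_A, symmetric]) (use ec in blast)
    also have "(\<Oplus>\<^bsub>?V\<^esub>e\<in>E. c j (e \<otimes> a) \<odot>\<^bsub>?V\<^esub> \<epsilon> e x) = la a (\<epsilon> j x)"
    proof (rule Veq[OF _ lac[OF a \<epsilon>c[OF j x]]])
      show "(\<Oplus>\<^bsub>?V\<^esub>e\<in>E. c j (e \<otimes> a) \<odot>\<^bsub>?V\<^esub> \<epsilon> e x) IN ?V" by (rule V.M.finsum_closed) (use ec in blast)
      fix b assume b: "b IN A"
      have lk: "linear K (regular_module K) A (%k. k \<odot> x)"
        using x by (intro linearI) (auto simp: A.smult_l_distr A.smult_assoc1)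
      have lin: "linear K A A (%b. c j (b \<otimes> a) \<odot> x)"
        by (rule linear_comp[OF linear_comp[OF linear_mult_right[OF a] cl[OF j]] lk])
      have "(\<Oplus>\<^bsub>?V\<^esub>e\<in>E. c j (e \<otimes> a) \<odot>\<^bsub>?V\<^esub> \<epsilon> e x) b = (\<Oplus>e\<in>E. (c j (e \<otimes> a) \<odot>\<^bsub>?V\<^esub> \<epsilon> e x) b)"
        by (rule sumv[OF b]) (use ec in blast)
      also have "... = (\<Oplus>e\<in>E. c j ((c e b \<odot> e) \<otimes> a) \<odot> x)"
      proof (rule A.M.finsum_cong')
        fix e assume e: "e \<in> E"
        show "(c j (e \<otimes> a) \<odot>\<^bsub>?V\<^esub> \<epsilon> e x) b = c j ((c e b \<odot> e) \<otimes> a) \<odot> x"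
          using linear_smult[OF lin cK[OF e b] Ec[OF e]] addv(2)[OF b] \<epsilon>v[OF b] ck[OF e] cK[OF e b] x
          by (simp add: A.smult_assoc1[symmetric] K.m_comm del: hom_mod_simps)
      qed (use linear_closed[OF lin] cK b Ec in auto)
      also have "... = c j ((\<Oplus>e\<in>E. c e b \<odot> e) \<otimes> a) \<odot> x"
        by (rule linear_finsum[OF lin module_A module_A, symmetric]) (use cK b Ec in auto)
      also have "... = la a (\<epsilon> j x) b" using exp[OF b] lav[OF b] \<epsilon>v[OF mult_A[OF b a]] by simp
      finally show "(\<Oplus>\<^bsub>?V\<^esub>e\<in>E. c j (e \<otimes> a) \<odot>\<^bsub>?V\<^esub> \<epsilon> e x) b = la a (\<epsilon> j x) b" .
    qed
    also have "g (la a (\<epsilon> j x)) = a \<otimes> ?r j x" by (rule gl[OF a \<epsilon>c[OF j x]])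
    finally show ?thesis .
  qed
  show ?thesis
    by (rule exI[of _ E], rule exI[of _ c], rule exI[of _ ?r], intro conjI ballI)
      (rule db rl r1 r2; assumption?)+
qed

end

section \<open>Cochains under a map with a defect of right linearity\<close>

lemma (in abelian_group) twisted_step:
  "[|x IN G; y IN G; z IN G|] ==> x \<ominus> (y \<oplus> z) = (x \<ominus> y) \<oplus> \<ominus> z"
  by (simp add: a_minus_def minus_add a_assoc)

lemma finsum_diff:
  fixes W :: "('k, 'w) module" (structure)
  assumes W: "module K W" and "!!i. i \<in> I ==> f i IN W" "!!i. i \<in> I ==> g i IN W"
  shows "(\<Oplus>i\<in>I. f i \<ominus> g i) = (\<Oplus>i\<in>I. f i) \<ominus> (\<Oplus>i\<in>I. g i)"
proof -
  interpret W: module K W by fact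
  have neg: "linear K W W (%x. \<ominus> x)" by (rule linear_neg[OF linear_id W])
  have "(\<Oplus>i\<in>I. f i \<ominus> g i) = (\<Oplus>i\<in>I. f i) \<oplus> (\<Oplus>i\<in>I. \<ominus> g i)"
    unfolding a_minus_def by (rule W.M.finsum_addf) (use assms in auto)
  also have "(\<Oplus>i\<in>I. \<ominus> g i) = \<ominus> (\<Oplus>i\<in>I. g i)"
    by (rule linear_finsum[OF neg W W, symmetric]) (use assms in auto)
  finally show ?thesis by (simp add: a_minus_def)
qed

context
  fixes K :: "'k ring" and A :: "('k, 'a) module" (structure)
    and W :: "('k, 'w) module" and L R and W' :: "('k, 'v) module" and L' R' and g and \<chi>
  assumes B1: "bimod K A W L R" and B2: "bimod K A W' L' R'"
    and g: "linear K W W' g" and \<chi>: "!!a. a IN A ==> linear K W W' (\<chi> a)"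
    and gL: "!!a w. a IN A ==> w IN W ==> g (L a w) = L' a (g w)"
    and gR: "!!a w. a IN A ==> w IN W ==> g (R a w) = R' a (g w) \<oplus>\<^bsub>W'\<^esub> \<chi> a w"
begin

interpretation B1: bimod K A W L R by (rule B1)
interpretation B2: bimod K A W' L' R' by (rule B2)

text \<open>The right action occurs in a single term of the sum, the last one, whose sign is
  \<open>(-1)\<^sup>n\<close>; hence the defect \<open>\<chi>\<close> enters exactly once.\<close>

lemma TT_twisted:
  assumes F: "!!l. l \<in> tuples (carrier A) n ==> F l IN W"
    and a: "a IN A" and l: "l \<in> tuples (carrier A) n"
  shows "g (B1.TT F a l) = B2.TT (%l. g (F l)) a l \<oplus>\<^bsub>W'\<^esub>
    signed W' (int n) (\<chi> (last (a # l)) (F (butlast (a # l))))"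
  using assms
proof (induct n arbitrary: F a l)
  case 0
  then show ?case by (simp add: B1.TT_Nil B2.TT_Nil gR)
next
  case (Suc n)
  obtain c cs where l: "l = c # cs" "c IN A" "cs \<in> tuples (carrier A) n" using Suc(4) by (auto simp: tuples_Suc)
  let ?Fa = "%l. F (a # l)"
  have Fa: "!!l. l \<in> tuples (carrier A) n ==> ?Fa l IN W" using Suc(2,3) by auto
  have ac: "F ((a \<otimes> c) # cs) IN W" using Suc(2,3) l B1.mult_A by auto
  have x: "\<chi> (last (c # cs)) (F (a # butlast (c # cs))) IN W'"
  proof (rule linear_closed[OF \<chi>])
    have cs: "c # cs \<in> tuples (carrier A) (Suc n)" using l by simp
    show "last (c # cs) IN A" by (rule B1.last_closed[OF cs])
    show "F (a # butlast (c # cs)) IN W" by (rule Fa[OF B1.butlast_closed[OF cs]])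
  qed
  have T: "B2.TT (%l. g (?Fa l)) c cs IN W'"
    by (rule B2.TT_closed[of n]) (use Fa l linear_closed[OF g] in auto)
  have "g (B1.TT F a l) = g (F ((a \<otimes> c) # cs) \<ominus>\<^bsub>W\<^esub> B1.TT ?Fa c cs)"
    unfolding l(1) by (simp only: B1.TT_Cons[OF l(2,3)])
  also have "... = g (F ((a \<otimes> c) # cs)) \<ominus>\<^bsub>W'\<^esub> g (B1.TT ?Fa c cs)"
    by (rule linear_minus[OF g B1.W B2.W ac B1.TT_closed[OF Fa l(2,3)]])
  also have "g (B1.TT ?Fa c cs) = B2.TT (%l. g (?Fa l)) c cs \<oplus>\<^bsub>W'\<^esub>
      signed W' (int n) (\<chi> (last (c # cs)) (?Fa (butlast (c # cs))))"
    by (rule Suc(1)[OF Fa l(2,3)])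
  also have "g (F ((a \<otimes> c) # cs)) \<ominus>\<^bsub>W'\<^esub> ... = (g (F ((a \<otimes> c) # cs)) \<ominus>\<^bsub>W'\<^esub> B2.TT (%l. g (?Fa l)) c cs) \<oplus>\<^bsub>W'\<^esub>
      \<ominus>\<^bsub>W'\<^esub> signed W' (int n) (\<chi> (last (c # cs)) (?Fa (butlast (c # cs))))"
    by (rule B2.W.M.twisted_step[OF linear_closed[OF g ac] T signed_closed[OF B2.W x]])
  also have "... = B2.TT (%l. g (F l)) a l \<oplus>\<^bsub>W'\<^esub> signed W' (int (Suc n)) (\<chi> (last (a # l)) (F (butlast (a # l))))"
    using signed_Suc[OF B2.W x, of "int n"] B2.TT_Cons[OF l(2,3), of "%l. g (F l)" a] by (simp add: l(1) add.commute)
  finally show ?case .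
qed

lemma hdiff_twisted:
  assumes F: "!!l. l \<in> tuples (carrier A) n ==> F l IN W" and l: "l \<in> tuples (carrier A) (Suc n)"
  shows "g (B1.hdiff F l) = B2.hdiff (%l. g (F l)) l \<ominus>\<^bsub>W'\<^esub> signed W' (int n) (\<chi> (last l) (F (butlast l)))"
proof -
  obtain a m where m: "l = a # m" "a IN A" "m \<in> tuples (carrier A) n" using l by (auto simp: tuples_Suc)
  have x: "\<chi> (last l) (F (butlast l)) IN W'"
    by (rule linear_closed[OF \<chi>[OF B1.last_closed[OF l]] F[OF B1.butlast_closed[OF l]]])
  have T: "B2.TT (%l. g (F l)) a m IN W'"
    by (rule B2.TT_closed[of n]) (use F m linear_closed[OF g] in auto)
  have Lc: "L' a (g (F m)) IN W'" by (rule B2.L_closed[OF m(2) linear_closed[OF g F[OF m(3)]]])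
  have "g (B1.hdiff F l) = g (L a (F m)) \<ominus>\<^bsub>W'\<^esub> g (B1.TT F a m)"
    using linear_minus[OF g B1.W B2.W B1.L_closed[OF m(2) F[OF m(3)]] B1.TT_closed[OF F m(2,3)]]
    by (simp add: B1.hdiff_def m(1))
  also have "... = L' a (g (F m)) \<ominus>\<^bsub>W'\<^esub> (B2.TT (%l. g (F l)) a m \<oplus>\<^bsub>W'\<^esub> signed W' (int n) (\<chi> (last l) (F (butlast l))))"
    using TT_twisted[OF F m(2,3)] gL[OF m(2) F[OF m(3)]] by (simp add: m(1))
  also have "... = (L' a (g (F m)) \<ominus>\<^bsub>W'\<^esub> B2.TT (%l. g (F l)) a m) \<ominus>\<^bsub>W'\<^esub> signed W' (int n) (\<chi> (last l) (F (butlast l)))"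
    by (rule B2.W.M.diff_add_swap[OF Lc T signed_closed[OF B2.W x]])
  finally show ?thesis by (simp add: B2.hdiff_def m(1))
qed

end

context hochschild_tate
begin

section \<open>Vanishing of Hochschild cohomology with coefficients in \<open>A \<otimes> V \<otimes> A\<close>\<close>

text \<open>\<open>\<rho>\<close> retracts \<open>Hom(A, F_p)\<close> onto \<open>F_p\<close> and
  respects both actions. Applied to the cocycle identity as a function of its first argument
  \<open>b\<close>, it turns \<open>bG(l)\<close> into \<open>G(l)\<close> and the other terms into
  the differential of \<open>H(l) = \<rho>(b \<mapsto> G(b, l))\<close>. One argument of
  \<open>G\<close> is consumed, which is why there has to be one.\<close>

lemma Fp_acyclic:
  assumes G: "nlin (Fp p) (Suc N) G"
    and cocycle: "!!l. l \<in> tp (Suc (Suc N)) ==> Fp.hdiff p G l = \<zero>\<^bsub>Fp p\<^esub>"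
  shows "\<exists>H. nlin (Fp p) N H \<and> (\<forall>l\<in>tp (Suc N). Fp.hdiff p H l = G l)"
proof -
  obtain E c r where db: "dual_basis K A E c" and r: "!!e. e \<in> E ==> linear K A A (r e)"
    and r1: "!!x. x IN A ==> (\<Oplus>e\<in>E. r e (e \<otimes> x)) = x"
    and r2: "!!a x j. a IN A ==> x IN A ==> j \<in> E ==> (\<Oplus>e\<in>E. c j (e \<otimes> a) \<odot> r e x) = a \<otimes> r j x"
    using ex_retraction by (elim exE conjE) (rule that, auto)
  have fin: "finite E" and Ec: "!!e. e \<in> E ==> e IN A"
    and cl: "!!e. e \<in> E ==> linear K A (regular_module K) (c e)"
    and exp: "!!v. v IN A ==> v = (\<Oplus>e\<in>E. c e v \<odot> e)"
    using db by (auto simp: dual_basis_def)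
  have cK: "c e v IN K" if "e \<in> E" "v IN A" for e v
    using linear_closed[OF cl that(2)] that by simp
  let ?F = "Fp p"
  note W = Fp_module[of p]
  \<comment> \<open>\<open>r e\<close> acts on the left factor of \<open>F_p\<close> only and
    therefore commutes with the right action.\<close>
  define rh where "rh e = TBm AA2 AA2 p (AAm (r e) (%y. y))" for e
  have rh: "linear K ?F ?F (rh e)" "!!x l y. x IN A ==> l \<in> tp p ==> y IN A ==> rh e (fe x l y) = fe (r e x) l y"
    if "e \<in> E" for e
  proof -
    note m = AAm[OF r[OF that] lin_id]
    show "linear K ?F ?F (rh e)" unfolding rh_def by (rule TBm(1)[OF AA2_module AA2_module m(1)])
    show "rh e (fe x l y) = fe (r e x) l y" if "x IN A" "l \<in> tp p" "y IN A" for x l y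
      unfolding rh_def using TBm(2)[OF AA2_module AA2_module m(1) ae_closed[OF that(1,3)] that(2)] m(2)[OF that(1,3)] by simp
  qed
  note rhc = linear_closed[OF rh(1)]
  have rc: "r e x IN A" if "e \<in> E" "x IN A" for e x using linear_closed[OF r[OF that(1)] that(2)] .
  \<comment> \<open>The retraction of \<open>ex_retraction\<close>, tensored with the identity: only
    the values of \<open>\<gamma>\<close> at the basis elements \<open>e\<close> are used.
    \<open>H1\<close> is the retraction property, \<open>H2\<close> and \<open>H3\<close> are left
    and right linearity.\<close>
  define \<rho> where "\<rho> \<gamma> = (\<Oplus>\<^bsub>?F\<^esub>e\<in>E. rh e (\<gamma> e))" for \<gamma>
  have \<rho>c: "\<rho> \<gamma> IN ?F" if "!!b. b IN A ==> \<gamma> b IN ?F" for \<gamma>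
    unfolding \<rho>_def by (rule Fp.W.M.finsum_closed) (use that rhc Ec in auto)
  have \<rho>cong: "\<rho> \<gamma> = \<rho> \<gamma>'" if "!!b. b IN A ==> \<gamma> b = \<gamma>' b" "!!b. b IN A ==> \<gamma> b IN ?F" for \<gamma> \<gamma>'
    unfolding \<rho>_def by (rule Fp.W.M.finsum_cong') (use that rhc Ec in auto)
  have H1: "\<rho> (%b. FL p b \<xi>) = \<xi>" if \<xi>: "\<xi> IN ?F" for \<xi>
    unfolding \<rho>_def
  proof (rule linear_eq_fe[OF W _ linear_id _ \<xi>])
    show "linear K ?F ?F (%\<xi>. \<Oplus>\<^bsub>?F\<^esub>e\<in>E. rh e (FL p e \<xi>))"
      by (rule linear_sum[OF linear_comp[OF FL(1)[OF Ec] rh(1)] W W])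
    fix x l y assume x: "x IN A" "l \<in> tp p" "y IN A"
    have "(\<Oplus>\<^bsub>?F\<^esub>e\<in>E. rh e (FL p e (fe x l y))) = (\<Oplus>\<^bsub>?F\<^esub>e\<in>E. fe (r e (e \<otimes> x)) l y)"
      by (rule Fp.W.M.finsum_cong') (use x Ec rh(2) rc in "auto simp: FL(3) mult_A intro!: fe_closed")
    also have "... = fe (\<Oplus>e\<in>E. r e (e \<otimes> x)) l y"
      by (rule linear_finsum[OF fe_linear(1)[OF x(2,3)] module_A W, symmetric]) (use x Ec rc in "auto simp: mult_A")
    also have "... = fe x l y" using r1[OF x(1)] by simp
    finally show "(\<Oplus>\<^bsub>?F\<^esub>e\<in>E. rh e (FL p e (fe x l y))) = fe x l y" .
  qed
  have P2: "(\<Oplus>\<^bsub>?F\<^esub>e\<in>E. c j (e \<otimes> a) \<odot>\<^bsub>?F\<^esub> rh e \<xi>) = FL p a (rh j \<xi>)"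
    if a: "a IN A" and j: "j \<in> E" and \<xi>: "\<xi> IN ?F" for a j \<xi>
  proof (rule linear_eq_fe[OF W _ linear_comp[OF rh(1)[OF j] FL(1)[OF a]] _ \<xi>])
    have ck: "c j (e \<otimes> a) IN K" if "e \<in> E" for e by (rule cK[OF j mult_A[OF Ec[OF that] a]])
    show "linear K ?F ?F (%\<xi>. \<Oplus>\<^bsub>?F\<^esub>e\<in>E. c j (e \<otimes> a) \<odot>\<^bsub>?F\<^esub> rh e \<xi>)"
      by (rule linear_sum[OF linear_scale[OF rh(1) W ck] W W])
    fix x l y assume x: "x IN A" "l \<in> tp p" "y IN A"
    have "(\<Oplus>\<^bsub>?F\<^esub>e\<in>E. c j (e \<otimes> a) \<odot>\<^bsub>?F\<^esub> rh e (fe x l y)) = (\<Oplus>\<^bsub>?F\<^esub>e\<in>E. fe (c j (e \<otimes> a) \<odot> r e x) l y)"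
      by (rule Fp.W.M.finsum_cong')
        (use x rh(2) rc ck linear_smult[OF fe_linear(1)[OF x(2,3)]] in "auto intro!: fe_closed")
    also have "... = fe (\<Oplus>e\<in>E. c j (e \<otimes> a) \<odot> r e x) l y"
      by (rule linear_finsum[OF fe_linear(1)[OF x(2,3)] module_A W, symmetric]) (use x ck rc in auto)
    also have "... = FL p a (rh j (fe x l y))"
      using r2[OF a x(1) j] rh(2)[OF j x] FL(3)[OF a rc[OF j x(1)] x(2,3)] by simp
    finally show "(\<Oplus>\<^bsub>?F\<^esub>e\<in>E. c j (e \<otimes> a) \<odot>\<^bsub>?F\<^esub> rh e (fe x l y)) = FL p a (rh j (fe x l y))" .
  qed
  have H2: "\<rho> (%b. \<gamma> (b \<otimes> a)) = FL p a (\<rho> \<gamma>)" if \<gamma>: "linear K A ?F \<gamma>" and a: "a IN A" for \<gamma> a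
  proof -
    note \<gamma>c = linear_closed[OF \<gamma>]
    have ck: "c j (e \<otimes> a) IN K" if "e \<in> E" "j \<in> E" for e j by (rule cK[OF that(2) mult_A[OF Ec[OF that(1)] a]])
    have 1: "rh e (\<gamma> (e \<otimes> a)) = (\<Oplus>\<^bsub>?F\<^esub>j\<in>E. c j (e \<otimes> a) \<odot>\<^bsub>?F\<^esub> rh e (\<gamma> j))" if e: "e \<in> E" for e
    proof -
      have lin: "linear K A ?F (%x. rh e (\<gamma> x))" by (rule linear_comp[OF \<gamma> rh(1)[OF e]])
      have "rh e (\<gamma> (e \<otimes> a)) = rh e (\<gamma> (\<Oplus>j\<in>E. c j (e \<otimes> a) \<odot> j))"
        using exp[OF mult_A[OF Ec[OF e] a]] by simp
      also have "... = (\<Oplus>\<^bsub>?F\<^esub>j\<in>E. rh e (\<gamma> (c j (e \<otimes> a) \<odot> j)))"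
        by (rule linear_finsum[OF lin module_A W]) (use ck[OF e] Ec in auto)
      also have "... = (\<Oplus>\<^bsub>?F\<^esub>j\<in>E. c j (e \<otimes> a) \<odot>\<^bsub>?F\<^esub> rh e (\<gamma> j))"
        by (rule Fp.W.M.finsum_cong') (use linear_smult[OF lin ck[OF e] Ec] rhc[OF e \<gamma>c[OF Ec]] ck[OF e] in auto)
      finally show ?thesis .
    qed
    have "\<rho> (%b. \<gamma> (b \<otimes> a)) = (\<Oplus>\<^bsub>?F\<^esub>e\<in>E. \<Oplus>\<^bsub>?F\<^esub>j\<in>E. c j (e \<otimes> a) \<odot>\<^bsub>?F\<^esub> rh e (\<gamma> j))"
      unfolding \<rho>_def
      by (rule Fp.W.M.finsum_cong') (use 1 ck rhc \<gamma>c Ec in "auto intro!: Fp.W.M.finsum_closed")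
    also have "... = (\<Oplus>\<^bsub>?F\<^esub>j\<in>E. \<Oplus>\<^bsub>?F\<^esub>e\<in>E. c j (e \<otimes> a) \<odot>\<^bsub>?F\<^esub> rh e (\<gamma> j))"
      by (rule finsum_swap[OF W fin fin]) (use ck rhc \<gamma>c Ec in auto)
    also have "... = (\<Oplus>\<^bsub>?F\<^esub>j\<in>E. FL p a (rh j (\<gamma> j)))"
      by (rule Fp.W.M.finsum_cong') (use P2[OF a _ \<gamma>c[OF Ec]] Fp.L_closed[OF a rhc[OF _ \<gamma>c[OF Ec]]] in auto)
    also have "... = FL p a (\<rho> \<gamma>)"
      unfolding \<rho>_def by (rule linear_finsum[OF FL(1)[OF a] W W, symmetric]) (use rhc \<gamma>c Ec in auto)
    finally show ?thesis .
  qed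
  have rhFR: "rh e (FR p a \<xi>) = FR p a (rh e \<xi>)" if "e \<in> E" "a IN A" "\<xi> IN ?F" for e a \<xi>
    by (rule linear_eq_fe[OF W linear_comp[OF FR(1)[OF that(2)] rh(1)[OF that(1)]]
          linear_comp[OF rh(1)[OF that(1)] FR(1)[OF that(2)]] _ that(3)])
      (simp add: FR(3) rh(2) rc that mult_A)
  have H3: "\<rho> (%b. FR p a (\<gamma> b)) = FR p a (\<rho> \<gamma>)" if \<gamma>: "!!b. b IN A ==> \<gamma> b IN ?F" and a: "a IN A" for \<gamma> a
  proof -
    have "\<rho> (%b. FR p a (\<gamma> b)) = (\<Oplus>\<^bsub>?F\<^esub>e\<in>E. FR p a (rh e (\<gamma> e)))"
      unfolding \<rho>_def
      by (rule Fp.W.M.finsum_cong') (use rhFR[OF _ a \<gamma>[OF Ec]] Fp.R_closed[OF a rhc[OF _ \<gamma>[OF Ec]]] in auto)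
    also have "... = FR p a (\<rho> \<gamma>)"
      unfolding \<rho>_def by (rule linear_finsum[OF FR(1)[OF a] W W, symmetric]) (use rhc \<gamma> Ec in auto)
    finally show ?thesis .
  qed
  have H4: "\<rho> (%b. \<gamma> b \<ominus>\<^bsub>?F\<^esub> \<gamma>' b) = \<rho> \<gamma> \<ominus>\<^bsub>?F\<^esub> \<rho> \<gamma>'"
    if \<gamma>: "!!b. b IN A ==> \<gamma> b IN ?F" and \<gamma>': "!!b. b IN A ==> \<gamma>' b IN ?F" for \<gamma> \<gamma>'
  proof -
    have "\<rho> (%b. \<gamma> b \<ominus>\<^bsub>?F\<^esub> \<gamma>' b) = (\<Oplus>\<^bsub>?F\<^esub>e\<in>E. rh e (\<gamma> e) \<ominus>\<^bsub>?F\<^esub> rh e (\<gamma>' e))"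
      unfolding \<rho>_def
      by (rule Fp.W.M.finsum_cong')
        (use linear_minus[OF rh(1) W W \<gamma>[OF Ec] \<gamma>'[OF Ec]] rhc[OF _ \<gamma>[OF Ec]] rhc[OF _ \<gamma>'[OF Ec]] in auto)
    also have "... = \<rho> \<gamma> \<ominus>\<^bsub>?F\<^esub> \<rho> \<gamma>'"
      unfolding \<rho>_def by (rule finsum_diff[OF W]) (use rhc \<gamma> \<gamma>' Ec in auto)
    finally show ?thesis .
  qed
  have TT\<rho>: "\<rho> (%b. Fp.TT p (\<Gamma> b) a l) = Fp.TT p (%l. \<rho> (%b. \<Gamma> b l)) a l"
    if "!!b l. b IN A ==> l \<in> tp k ==> \<Gamma> b l IN ?F" "a IN A" "l \<in> tp k" for k \<Gamma> a l
    using that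
  proof (induct k arbitrary: \<Gamma> a l)
    case 0
    then show ?case by (simp add: Fp.TT_Nil H3)
  next
    case (Suc k)
    obtain d cs where l: "l = d # cs" "d IN A" "cs \<in> tp k" using Suc(4) by (auto simp: tuples_Suc)
    have g1: "\<Gamma> b ((a \<otimes> d) # cs) IN ?F" if "b IN A" for b using Suc(2,3) l that mult_A by auto
    have g2: "\<Gamma> b (a # m) IN ?F" if "b IN A" "m \<in> tp k" for b m using Suc(2,3) that by auto
    have g3: "Fp.TT p (%l. \<Gamma> b (a # l)) d cs IN ?F" if "b IN A" for b
      by (rule Fp.TT_closed[OF _ l(2,3)]) (rule g2[OF that])
    have "\<rho> (%b. Fp.TT p (\<Gamma> b) a l) = \<rho> (%b. \<Gamma> b ((a \<otimes> d) # cs) \<ominus>\<^bsub>?F\<^esub> Fp.TT p (%l. \<Gamma> b (a # l)) d cs)"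
      unfolding l(1) by (simp only: Fp.TT_Cons[OF l(2,3)])
    also have "... = \<rho> (%b. \<Gamma> b ((a \<otimes> d) # cs)) \<ominus>\<^bsub>?F\<^esub> \<rho> (%b. Fp.TT p (%l. \<Gamma> b (a # l)) d cs)"
      by (rule H4[OF g1 g3])
    also have "\<rho> (%b. Fp.TT p (%l. \<Gamma> b (a # l)) d cs) = Fp.TT p (%l. \<rho> (%b. \<Gamma> b (a # l))) d cs"
      by (rule Suc(1)[OF g2 l(2,3)])
    also have "\<rho> (%b. \<Gamma> b ((a \<otimes> d) # cs)) \<ominus>\<^bsub>?F\<^esub> ... = Fp.TT p (%l. \<rho> (%b. \<Gamma> b l)) a l"
      unfolding l(1) by (simp only: Fp.TT_Cons[OF l(2,3)])
    finally show ?case .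
  qed
  define H where "H l = \<rho> (%b. G (b # l))" for l
  have Gc: "G l IN ?F" if "l \<in> tp (Suc N)" for l by (rule mlin_closed[OF G that])
  have Ga: "nlin ?F N (%l. G (a # l))" if "a IN A" for a using G that by simp
  have Hm: "nlin ?F N H"
    unfolding H_def \<rho>_def
    by (rule mlin_sum[OF module_A _ W fin mlin_comp[OF Ga[OF Ec] rh(1) W W]]) (auto simp: one_A)
  have "Fp.hdiff p H l = G l" if l: "l \<in> tp (Suc N)" for l
  proof -
    obtain a m where m: "l = a # m" "a IN A" "m \<in> tp N" using l by (auto simp: tuples_Suc)
    have Gm: "G (b # m) IN ?F" if "b IN A" for b using Gc m that by auto
    have Gl: "FL p b (G l) IN ?F" if "b IN A" for b by (rule Fp.L_closed[OF that Gc[OF l]])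
    have Gbm: "G ((b \<otimes> a) # m) IN ?F" if "b IN A" for b using Gm mult_A[OF that m(2)] by blast
    have Gb: "G (b # k) IN ?F" if "b IN A" "k \<in> tp N" for b k using Gc that by auto
    have T: "Fp.TT p (%l. G (b # l)) a m IN ?F" if "b IN A" for b
      by (rule Fp.TT_closed[OF _ m(2,3)]) (rule Gb[OF that])
    have D: "G ((b \<otimes> a) # m) \<ominus>\<^bsub>?F\<^esub> Fp.TT p (%l. G (b # l)) a m IN ?F" if "b IN A" for b
      using Gbm T that by auto
    \<comment> \<open>The cocycle condition at \<open>b, a, m\<close>, to be read as an identity
      between functions of \<open>b\<close>.\<close>
    have 0: "FL p b (G l) \<ominus>\<^bsub>?F\<^esub> (G ((b \<otimes> a) # m) \<ominus>\<^bsub>?F\<^esub> Fp.TT p (%l. G (b # l)) a m) = \<zero>\<^bsub>?F\<^esub>" if b: "b IN A" for b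
      using cocycle[of "b # l"] b l Fp.TT_Cons[OF m(2,3), of p G b] by (simp add: Fp.hdiff_def m(1))
    have lin: "linear K A ?F (%b. G (b # m))" using G m(3) by simp
    have "\<zero>\<^bsub>?F\<^esub> = \<rho> (%b. \<zero>\<^bsub>?F\<^esub>)"
      using H4[of "%_. \<zero>\<^bsub>?F\<^esub>" "%_. \<zero>\<^bsub>?F\<^esub>"] \<rho>c[of "%_. \<zero>\<^bsub>?F\<^esub>"] by (simp add: Fp.W.M.diff_eq_zero_iff Fp.W.M.diff_zero)
        (metis Fp.W.M.diff_eq_zero_iff)
    also have "... = \<rho> (%b. FL p b (G l) \<ominus>\<^bsub>?F\<^esub> (G ((b \<otimes> a) # m) \<ominus>\<^bsub>?F\<^esub> Fp.TT p (%l. G (b # l)) a m))"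
      by (rule \<rho>cong) (use 0 in auto)
    also have "... = \<rho> (%b. FL p b (G l)) \<ominus>\<^bsub>?F\<^esub> \<rho> (%b. G ((b \<otimes> a) # m) \<ominus>\<^bsub>?F\<^esub> Fp.TT p (%l. G (b # l)) a m)"
      by (rule H4[OF Gl D])
    also have "\<rho> (%b. FL p b (G l)) = G l" by (rule H1[OF Gc[OF l]])
    also have "\<rho> (%b. G ((b \<otimes> a) # m) \<ominus>\<^bsub>?F\<^esub> Fp.TT p (%l. G (b # l)) a m) =
        \<rho> (%b. G ((b \<otimes> a) # m)) \<ominus>\<^bsub>?F\<^esub> \<rho> (%b. Fp.TT p (%l. G (b # l)) a m)"
      by (rule H4[OF Gbm T])
    also have "\<rho> (%b. G ((b \<otimes> a) # m)) = FL p a (H m)" unfolding H_def by (rule H2[OF lin m(2)])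
    also have "\<rho> (%b. Fp.TT p (%l. G (b # l)) a m) = Fp.TT p H a m"
      unfolding H_def by (rule TT\<rho>[OF Gb m(2,3)])
    also have "FL p a (H m) \<ominus>\<^bsub>?F\<^esub> Fp.TT p H a m = Fp.hdiff p H l" by (simp add: Fp.hdiff_def m(1))
    finally have "G l \<ominus>\<^bsub>?F\<^esub> Fp.hdiff p H l = \<zero>\<^bsub>?F\<^esub>" by simp
    then show ?thesis
      using Gc[OF l] Fp.hdiff_closed[OF mlin_closed[OF Hm] l] by (simp add: Fp.W.M.diff_eq_zero_iff)
  qed
  with Hm show ?thesis by blast
qed

section \<open>Comparison of consecutive terms of the colimit\<close>

text \<open>\<open>\<phi>\<close> is left linear, and its right defect appends an argument to the
  second component. So it commutes with the differential up to \<open>\<theta>\<close> of that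
  component.\<close>

lemma hdiff_\<phi>:
  assumes H: "!!l. l \<in> tp n ==> H l IN Fp p" and l: "l \<in> tp (Suc n)"
  shows "\<phi> p (Fp.hdiff p H l) = Om.hdiff (Suc p) (%l. \<phi> p (H l)) l \<ominus>\<^bsub>Om (Suc p)\<^esub>
    signed (Om (Suc p)) (int n) (Th p (%l. \<psi> p (H l)) l)"
  unfolding Th_def
  by (rule hdiff_twisted[where \<chi> = "%a \<xi>. fa p a (\<psi> p \<xi>)", OF Fp_bimod Om_bimod \<phi>(1) _ _ _ H l])
    (simp_all add: \<phi>_left \<phi>_right linear_comp[OF \<psi>(1) form_append(1)])

lemma hdiff_\<psi>:
  assumes H: "!!l. l \<in> tp n ==> H l IN Fp p" and l: "l \<in> tp (Suc n)"
  shows "\<psi> p (Fp.hdiff p H l) = Om.hdiff p (%l. \<psi> p (H l)) l"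
  by (rule hdiff_map[OF Fp_bimod Om_bimod \<psi>(1) _ _ _ l]) (simp_all add: \<psi>_left \<psi>_right H)

lemma hdiff_\<sigma>:
  assumes H: "!!l. l \<in> tp n ==> H l IN Om (Suc p)" and l: "l \<in> tp (Suc n)"
  shows "\<sigma> p (Om.hdiff (Suc p) H l) = Fp.hdiff p (%l. \<sigma> p (H l)) l"
  by (rule hdiff_map[OF Om_bimod Fp_bimod \<sigma>(1) _ _ _ l]) (simp_all add: \<sigma>_left \<sigma>_right H)

text \<open>The defect carries a minus sign here: \<open>w \<otimes> 1\<close> times
  \<open>a\<close> exceeds \<open>wa \<otimes> 1\<close> by \<open>\<sigma>\<close> of
  \<open>w \<otimes> sa\<close>, so \<open>wa \<otimes> 1\<close> is the former minus that
  term.\<close>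

lemma hdiff_\<tau>:
  assumes F: "!!l. l \<in> tp n ==> F l IN Om p" and l: "l \<in> tp (Suc n)"
  shows "\<tau> p \<one> (Om.hdiff p F l) = Fp.hdiff p (%l. \<tau> p \<one> (F l)) l \<oplus>\<^bsub>Fp p\<^esub>
    signed (Fp p) (int n) (\<sigma> p (Th p F l))"
proof -
  have lb: "last l IN A" "F (butlast l) IN Om p"
    using Om.last_closed[OF l] F[OF Om.butlast_closed[OF l]] .
  have sc: "\<sigma> p (Th p F l) IN Fp p"
    unfolding Th_def by (rule \<sigma>_closed[OF append_closed[OF lb]])
  have "\<tau> p \<one> (Om.hdiff p F l) = Fp.hdiff p (%l. \<tau> p \<one> (F l)) l \<ominus>\<^bsub>Fp p\<^esub>
    signed (Fp p) (int n) (\<ominus>\<^bsub>Fp p\<^esub> \<sigma> p (fa p (last l) (F (butlast l))))"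
  proof (rule hdiff_twisted[where \<chi> = "%a w. \<ominus>\<^bsub>Fp p\<^esub> \<sigma> p (fa p a w)", OF Om_bimod Fp_bimod \<tau>(1)[OF one_A] _ _ _ F l])
    fix a assume a: "a IN A"
    show "linear K (Om p) (Fp p) (%w. \<ominus>\<^bsub>Fp p\<^esub> \<sigma> p (fa p a w))"
      by (rule linear_neg[OF linear_comp[OF form_append(1)[OF a] \<sigma>(1)] Fp_module])
    fix w assume w: "w IN Om p"
    show "\<tau> p \<one> (fl p a w) = FL p a (\<tau> p \<one> w)" by (simp add: FL_\<tau> one_A a w)
    have "FR p a (\<tau> p \<one> w) \<oplus>\<^bsub>Fp p\<^esub> \<ominus>\<^bsub>Fp p\<^esub> \<sigma> p (fa p a w) =
        (\<tau> p \<one> (fr p a w) \<oplus>\<^bsub>Fp p\<^esub> \<sigma> p (fa p a w)) \<ominus>\<^bsub>Fp p\<^esub> \<sigma> p (fa p a w)"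
      unfolding FR_\<tau>_one[OF a w]
      using Fp.W.M.a_comm[OF \<sigma>_closed[OF append_closed[OF a w]] \<tau>_closed[OF one_A Om.R_closed[OF a w]]] by (simp add: a_minus_def)
    also have "... = \<tau> p \<one> (fr p a w)"
      by (rule Fp.W.M.add_diff_cancel[OF \<tau>_closed[OF one_A Om.R_closed[OF a w]] \<sigma>_closed[OF append_closed[OF a w]]])
    finally show "\<tau> p \<one> (fr p a w) = FR p a (\<tau> p \<one> w) \<oplus>\<^bsub>Fp p\<^esub> \<ominus>\<^bsub>Fp p\<^esub> \<sigma> p (fa p a w)" by simp
  qed
  then show ?thesis
    using sc by (simp add: Th_def signed_def a_minus_def split: if_splits)
qed

lemma dl_zero_iff:
  assumes mp: "0 \<le> m + int p" and f: "f IN NC m p"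
  shows "dl m p f = \<zero>\<^bsub>NC (m + 1) p\<^esub> \<longleftrightarrow> (\<forall>l\<in>tp (Suc (nat (m + int p))). Om.hdiff p (%l. f (br l)) l = \<zero>\<^bsub>Om p\<^esub>)"
proof -
  have N1: "nat (m + 1 + int p) = Suc (nat (m + int p))" using mp by (simp add: nat_add_distrib)
  have hc: "Om.hdiff p (%l. f (br l)) l IN Om p" if "l \<in> tp (Suc (nat (m + int p)))" for l
    by (rule Om.hdiff_closed[OF NC_val_closed[OF f] that])
  show ?thesis
  proof
    assume 0: "dl m p f = \<zero>\<^bsub>NC (m + 1) p\<^esub>"
    show "\<forall>l\<in>tp (Suc (nat (m + int p))). Om.hdiff p (%l. f (br l)) l = \<zero>\<^bsub>Om p\<^esub>"
    proof
      fix l assume l: "l \<in> tp (Suc (nat (m + int p)))"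
      have "signed (Om p) (m + 1) (Om.hdiff p (%l. f (br l)) l) = \<zero>\<^bsub>Om p\<^esub>"
        using dl(2)[OF mp f l] NC_zero[of l "m + 1" p] l N1 0 by simp
      then show "Om.hdiff p (%l. f (br l)) l = \<zero>\<^bsub>Om p\<^esub>"
        using signed_cancel[OF Om_module hc[OF l], of "m + 1"] signed_zero[OF Om_module] by metis
    qed
  next
    assume 0: "\<forall>l\<in>tp (Suc (nat (m + int p))). Om.hdiff p (%l. f (br l)) l = \<zero>\<^bsub>Om p\<^esub>"
    show "dl m p f = \<zero>\<^bsub>NC (m + 1) p\<^esub>"
      by (rule NC_eqI[OF dl_closed[OF f] module_zero[OF NC_module]])
        (use 0 dl(2)[OF mp f] N1 in "simp add: NC_zero signed_zero[OF Om_module]")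
  qed
qed

text \<open>\<open>\<sigma> g\<close> is a cocycle with values in \<open>F_p\<close> and with at
  least one argument, hence the differential of some \<open>H\<close>. Applying
  \<open>\<psi>\<close> shows that \<open>\<psi> H\<close> is a cocycle; applying
  \<open>\<phi>\<close> writes \<open>g\<close> as \<open>\<theta>\<close> of it plus the coboundary
  of \<open>\<phi> H\<close>, up to signs.\<close>

lemma theta_surjective:
  assumes mp: "0 \<le> m + int p" and g: "g IN NC m (Suc p)" and dg: "dl m (Suc p) g = \<zero>\<^bsub>NC (m + 1) (Suc p)\<^esub>"
  shows "\<exists>f\<in>carrier (NC m p). \<exists>h\<in>carrier (NC (m - 1) (Suc p)).
    dl m p f = \<zero>\<^bsub>NC (m + 1) p\<^esub> \<and> g = th m p f \<oplus>\<^bsub>NC m (Suc p)\<^esub> dl (m - 1) (Suc p) h"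
proof -
  define N where "N = nat (m + int p)"
  have N: "nat (m + int (Suc p)) = Suc N" "nat (m - 1 + int (Suc p)) = N" "nat (m + int p) = N"
    using mp by (simp_all add: N_def)
  have mp': "0 \<le> m + int (Suc p)" "0 \<le> (m - 1) + int (Suc p)" using mp by simp_all
  let ?W = "Om (Suc p)"
  let ?G = "%l. g (br l)"
  have Gm: "nlin ?W (Suc N) ?G" using NC_mlin[OF mp'(1) g] unfolding N .
  note Gc = mlin_closed[OF Gm]
  have G0: "Om.hdiff (Suc p) ?G l = \<zero>\<^bsub>?W\<^esub>" if "l \<in> tp (Suc (Suc N))" for l
    using dl_zero_iff[OF mp'(1) g] dg that unfolding N by blast
  have \<sigma>G: "Fp.hdiff p (%l. \<sigma> p (?G l)) l = \<zero>\<^bsub>Fp p\<^esub>" if l: "l \<in> tp (Suc (Suc N))" for l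
    using hdiff_\<sigma>[where H = ?G, OF Gc l] G0[OF l] linear_zero[OF \<sigma>(1) Om_module Fp_module] by simp
  obtain H where Hm: "nlin (Fp p) N H" and H: "!!l. l \<in> tp (Suc N) ==> Fp.hdiff p H l = \<sigma> p (?G l)"
    using Fp_acyclic[OF mlin_comp[OF Gm \<sigma>(1) Om_module Fp_module] \<sigma>G] by blast
  note Hc = mlin_closed[OF Hm]
  \<comment> \<open>The sign of \<open>f\<close> undoes the one in \<open>hdiff_\<phi>\<close>,
    including the minus there; the sign of \<open>h\<close> undoes that of \<open>dl\<close> in
    degree \<open>m - 1\<close>.\<close>
  define f where "f = (%l. signed (Om p) (int N + 1) (\<psi> p (H l)))"
  define h where "h = (%l. signed ?W m (\<phi> p (H l)))"
  have \<psi>Hc: "\<psi> p (H l) IN Om p" if "l \<in> tp N" for l by (rule \<psi>_closed[OF Hc[OF that]])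
  have \<phi>Hc: "\<phi> p (H l) IN ?W" if "l \<in> tp N" for l by (rule \<phi>_closed[OF Hc[OF that]])
  have fm': "nlin (Om p) N f"
    unfolding f_def by (rule mlin_signed[OF Om_module mlin_comp[OF Hm \<psi>(1) Fp_module Om_module]])
  have hm: "nlin ?W N h"
    unfolding h_def by (rule mlin_signed[OF Om_module mlin_comp[OF Hm \<phi>(1) Fp_module Om_module]])
  obtain f' where f': "f' IN NC m p" "!!l. l \<in> tp N ==> f' (br l) = f l"
    using NC_ex[OF mp, of f] fm' unfolding N by blast
  obtain h' where h': "h' IN NC (m - 1) (Suc p)" "!!l. l \<in> tp N ==> h' (br l) = h l"
    using NC_ex[OF mp'(2), of h] hm unfolding N by blast
  have fc: "f l IN Om p" if "l \<in> tp N" for l by (rule mlin_closed[OF fm' that])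
  have hf: "Om.hdiff p f l = \<zero>\<^bsub>Om p\<^esub>" if l: "l \<in> tp (Suc N)" for l
  proof -
    have "Om.hdiff p f l = signed (Om p) (int N + 1) (Om.hdiff p (%l. \<psi> p (H l)) l)"
      unfolding f_def by (rule Om.hdiff_signed[OF \<psi>Hc l])
    also have "Om.hdiff p (%l. \<psi> p (H l)) l = \<zero>\<^bsub>Om p\<^esub>"
      using hdiff_\<psi>[where H = H, OF Hc l] H[OF l] \<psi>_\<sigma>[OF Gc[OF l]] by simp
    finally show ?thesis by (simp add: signed_zero[OF Om_module])
  qed
  have "dl m p f' = \<zero>\<^bsub>NC (m + 1) p\<^esub>"
    unfolding dl_zero_iff[OF mp f'(1)] N
  proof
    fix l assume l: "l \<in> tp (Suc N)"
    have "Om.hdiff p (%l. f' (br l)) l = Om.hdiff p f l" by (rule Om.hdiff_cong[OF f'(2) l])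
    then show "Om.hdiff p (%l. f' (br l)) l = \<zero>\<^bsub>Om p\<^esub>" using hf[OF l] by simp
  qed
  moreover have "g = th m p f' \<oplus>\<^bsub>NC m (Suc p)\<^esub> dl (m - 1) (Suc p) h'"
  proof (rule NC_eqI[OF g])
    interpret N: module K "NC m (Suc p)" by (rule NC_module)
    have "dl (m - 1) (Suc p) h' IN NC m (Suc p)" using dl_closed[OF h'(1)] by simp
    then show "th m p f' \<oplus>\<^bsub>NC m (Suc p)\<^esub> dl (m - 1) (Suc p) h' IN NC m (Suc p)"
      using th_closed[OF f'(1)] by simp
    fix l assume "l \<in> tp (nat (m + int (Suc p)))"
    then have l: "l \<in> tp (Suc N)" unfolding N .
    note lb = Om.last_closed[OF l] Om.butlast_closed[OF l]
    let ?T = "Th p (%l. \<psi> p (H l)) l" and ?D = "Om.hdiff (Suc p) (%l. \<phi> p (H l)) l"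
    have Tc: "?T IN ?W" by (rule Th_closed[OF \<psi>Hc l])
    have Dc: "?D IN ?W" by (rule Om.hdiff_closed[OF \<phi>Hc l])
    have t: "th m p f' (br l) = signed ?W (int N + 1) ?T"
    proof -
      have "th m p f' (br l) = Th p (%l. f' (br l)) l" by (rule th(2)[OF mp f'(1)]) (simp add: N l)
      also have "... = fa p (last l) (signed (Om p) (int N + 1) (\<psi> p (H (butlast l))))"
        using f'(2)[OF lb(2)] by (simp add: Th_def f_def)
      also have "... = signed ?W (int N + 1) ?T"
        unfolding Th_def by (rule linear_signed[OF form_append(1)[OF lb(1)] Om_module Om_module \<psi>Hc[OF lb(2)]])
      finally show ?thesis .
    qed
    have d: "dl (m - 1) (Suc p) h' (br l) = ?D"
    proof -
      have "dl (m - 1) (Suc p) h' (br l) = signed ?W (m - 1 + 1) (Om.hdiff (Suc p) (%l. h' (br l)) l)"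
        by (rule dl(2)[OF mp'(2) h'(1)]) (simp only: N l)
      also have "Om.hdiff (Suc p) (%l. h' (br l)) l = Om.hdiff (Suc p) h l" by (rule Om.hdiff_cong[OF h'(2) l])
      also have "... = signed ?W m ?D" unfolding h_def by (rule Om.hdiff_signed[OF \<phi>Hc l])
      finally show ?thesis using signed_cancel[OF Om_module Dc, of m] by simp
    qed
    have "g (br l) = \<phi> p (Fp.hdiff p H l)" using H[OF l] \<phi>_\<sigma>[OF Gc[OF l]] by simp
    also have "... = ?D \<ominus>\<^bsub>?W\<^esub> signed ?W (int N) ?T" by (rule hdiff_\<phi>[OF Hc l])
    also have "... = signed ?W (int N + 1) ?T \<oplus>\<^bsub>?W\<^esub> ?D"
      using signed_Suc[OF Om_module Tc, of "int N"] Dc signed_closed[OF Om_module Tc, of "int N"]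
      by (simp add: a_minus_def Om.W.M.a_comm)
    finally have "g (br l) = signed ?W (int N + 1) ?T \<oplus>\<^bsub>?W\<^esub> ?D" .
    moreover have "l \<in> tp (nat (m + int (Suc p)))" using l unfolding N .
    ultimately show "g (br l) = (th m p f' \<oplus>\<^bsub>NC m (Suc p)\<^esub> dl (m - 1) (Suc p) h') (br l)"
      using NC_add[of l m "Suc p" "th m p f'" "dl (m - 1) (Suc p) h'"] t d by simp
  qed
  ultimately show ?thesis using f'(1) h'(1) by blast
qed

text \<open>\<open>\<sigma> h\<close> and, up to sign, \<open>f \<otimes> 1\<close> have the same
  differential with values in \<open>F_p\<close>, so their difference is the differential of some
  \<open>H\<close>. As \<open>\<psi>\<close> kills \<open>\<sigma> h\<close> and sends
  \<open>f \<otimes> 1\<close> to \<open>f\<close>, the cochain \<open>\<psi> H\<close> bounds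
  \<open>f\<close> up to sign. That difference has at least one argument because \<open>f\<close>
  has, so \<open>Fp_acyclic\<close> applies.\<close>

lemma theta_injective:
  assumes mp: "1 \<le> m + int p" and f: "f IN NC m p" and df: "dl m p f = \<zero>\<^bsub>NC (m + 1) p\<^esub>"
    and h: "h IN NC (m - 1) (Suc p)" and eq: "th m p f = dl (m - 1) (Suc p) h"
  shows "\<exists>f'\<in>carrier (NC (m - 1) p). f = dl (m - 1) p f'"
proof -
  define M where "M = nat (m - 1 + int p)"
  have N: "nat (m - 1 + int (Suc p)) = Suc M" "nat (m + int p) = Suc M" "nat (m - 1 + int p) = M"
    using mp by (auto simp: M_def)
  have mp': "0 \<le> m + int p" "0 \<le> (m - 1) + int (Suc p)" "0 \<le> (m - 1) + int p" using mp by simp_all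
  let ?W = "Om (Suc p)"
  let ?f = "%l. f (br l)" and ?h = "%l. h (br l)"
  have fm': "nlin (Om p) (Suc M) ?f" using NC_mlin[OF mp'(1) f] unfolding N .
  have hm: "nlin ?W (Suc M) ?h" using NC_mlin[OF mp'(2) h] unfolding N .
  note fc = mlin_closed[OF fm'] and hc = mlin_closed[OF hm]
  have f0: "Om.hdiff p ?f l = \<zero>\<^bsub>Om p\<^esub>" if "l \<in> tp (Suc (Suc M))" for l
    using dl_zero_iff[OF mp'(1) f] df that unfolding N by blast
  have thf: "Th p ?f l = signed ?W m (Om.hdiff (Suc p) ?h l)" if l: "l \<in> tp (Suc (Suc M))" for l
  proof -
    have "Th p ?f l = th m p f (br l)" by (rule th(2)[OF mp'(1) f, symmetric]) (simp only: N l)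
    also have "... = signed ?W (m - 1 + 1) (Om.hdiff (Suc p) ?h l)"
      unfolding eq by (rule dl(2)[OF mp'(2) h]) (simp only: N l)
    finally show ?thesis by simp
  qed
  \<comment> \<open>Collects the sign in \<open>hdiff_\<tau>\<close> for \<open>Suc M\<close>
    arguments and the sign of \<open>dl\<close> in degree \<open>m - 1\<close>.\<close>
  let ?s = "int (Suc M) + m"
  define X where "X = (%l. \<sigma> p (?h l))"
  define Y where "Y = (%l. signed (Fp p) ?s (\<ominus>\<^bsub>Fp p\<^esub> \<tau> p \<one> (?f l)))"
  have Xm: "nlin (Fp p) (Suc M) X"
    unfolding X_def by (rule mlin_comp[OF hm \<sigma>(1) Om_module Fp_module])
  have \<tau>m: "nlin (Fp p) (Suc M) (%l. \<tau> p \<one> (?f l))"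
    by (rule mlin_comp[OF fm' \<tau>(1)[OF one_A] Om_module Fp_module])
  have Ym: "nlin (Fp p) (Suc M) Y"
    unfolding Y_def by (rule mlin_signed[OF Fp_module mlin_neg[OF Fp_module \<tau>m]])
  note Xc = mlin_closed[OF Xm] and Yc = mlin_closed[OF Ym] and \<tau>c = mlin_closed[OF \<tau>m]
  have XY: "Fp.hdiff p (%l. X l \<ominus>\<^bsub>Fp p\<^esub> Y l) l = \<zero>\<^bsub>Fp p\<^esub>" if l: "l \<in> tp (Suc (Suc M))" for l
  proof -
    let ?S = "\<sigma> p (Om.hdiff (Suc p) ?h l)"
    have Hc: "Om.hdiff (Suc p) ?h l IN ?W" by (rule Om.hdiff_closed[OF hc l])
    have Sc: "?S IN Fp p" by (rule \<sigma>_closed[OF Hc])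
    let ?T = "Fp.hdiff p (%l. \<tau> p \<one> (?f l)) l"
    have Tc: "?T IN Fp p" by (rule Fp.hdiff_closed[OF \<tau>c l])
    have "\<zero>\<^bsub>Fp p\<^esub> = ?T \<oplus>\<^bsub>Fp p\<^esub> signed (Fp p) (int (Suc M)) (\<sigma> p (Th p ?f l))"
      using hdiff_\<tau>[where F = ?f, OF fc l] f0[OF l] linear_zero[OF \<tau>(1)[OF one_A] Om_module Fp_module] by simp
    also have "\<sigma> p (Th p ?f l) = signed (Fp p) m ?S"
      unfolding thf[OF l] by (rule linear_signed[OF \<sigma>(1) Om_module Fp_module Hc])
    also have "signed (Fp p) (int (Suc M)) (signed (Fp p) m ?S) = signed (Fp p) ?s ?S"
      by (rule signed_signed[OF Fp_module Sc])
    finally have 1: "signed (Fp p) ?s ?S = \<ominus>\<^bsub>Fp p\<^esub> ?T"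
      using Tc signed_closed[OF Fp_module Sc, of ?s] by (metis Fp.W.M.a_comm Fp.W.M.minus_equality)
    have nc: "!!l. l \<in> tp (Suc M) ==> \<ominus>\<^bsub>Fp p\<^esub> \<tau> p \<one> (?f l) IN Fp p" using \<tau>c by simp
    have nT: "Fp.hdiff p (%l. \<ominus>\<^bsub>Fp p\<^esub> \<tau> p \<one> (?f l)) l = \<ominus>\<^bsub>Fp p\<^esub> ?T"
    proof -
      have "Fp.hdiff p (%l. signed (Fp p) 1 (\<tau> p \<one> (?f l))) l = signed (Fp p) 1 ?T"
        by (rule Fp.hdiff_signed[of "Suc M"]) (use \<tau>c l in auto)
      then show ?thesis by simp
    qed
    have "Fp.hdiff p Y l = signed (Fp p) ?s (Fp.hdiff p (%l. \<ominus>\<^bsub>Fp p\<^esub> \<tau> p \<one> (?f l)) l)"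
      unfolding Y_def by (rule Fp.hdiff_signed[of "Suc M"]) (use nc l in auto)
    also have "... = ?S" unfolding nT 1[symmetric] by (rule signed_cancel[OF Fp_module Sc])
    finally have Y: "Fp.hdiff p Y l = ?S" .
    have X: "Fp.hdiff p X l = ?S" unfolding X_def by (rule hdiff_\<sigma>[OF hc l, symmetric])
    have "Fp.hdiff p (%l. X l \<ominus>\<^bsub>Fp p\<^esub> Y l) l = Fp.hdiff p X l \<ominus>\<^bsub>Fp p\<^esub> Fp.hdiff p Y l"
      by (rule Fp.hdiff_diff[OF Xc Yc l])
    then show ?thesis unfolding X Y using Sc by (simp add: Fp.W.M.diff_eq_zero_iff)
  qed
  obtain H where Hm: "nlin (Fp p) M H"
    and H: "!!l. l \<in> tp (Suc M) ==> Fp.hdiff p H l = X l \<ominus>\<^bsub>Fp p\<^esub> Y l"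
    using Fp_acyclic[OF mlin_diff[OF Fp_module Xm Ym] XY] by blast
  note Hc = mlin_closed[OF Hm]
  have \<psi>Hc: "\<psi> p (H l) IN Om p" if "l \<in> tp M" for l by (rule \<psi>_closed[OF Hc[OF that]])
  have key: "Om.hdiff p (%l. \<psi> p (H l)) l = signed (Om p) ?s (?f l)" if l: "l \<in> tp (Suc M)" for l
  proof -
    have "Om.hdiff p (%l. \<psi> p (H l)) l = \<psi> p (X l \<ominus>\<^bsub>Fp p\<^esub> Y l)" using hdiff_\<psi>[where H = H, OF Hc l] H[OF l] by simp
    also have "... = \<psi> p (X l) \<ominus>\<^bsub>Om p\<^esub> \<psi> p (Y l)"
      by (rule linear_minus[OF \<psi>(1) Fp_module Om_module Xc[OF l] Yc[OF l]])
    also have "\<psi> p (X l) = \<zero>\<^bsub>Om p\<^esub>" unfolding X_def by (rule \<psi>_\<sigma>[OF hc[OF l]])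
    also have "\<psi> p (Y l) = signed (Om p) ?s (\<psi> p (\<ominus>\<^bsub>Fp p\<^esub> \<tau> p \<one> (?f l)))"
      unfolding Y_def by (rule linear_signed[OF \<psi>(1) Fp_module Om_module]) (use \<tau>c[OF l] in simp)
    also have "\<psi> p (\<ominus>\<^bsub>Fp p\<^esub> \<tau> p \<one> (?f l)) = \<ominus>\<^bsub>Om p\<^esub> ?f l"
      using linear_uminus[OF \<psi>(1) Fp_module Om_module \<tau>c[OF l]] \<psi>_\<tau>_one[OF fc[OF l]] by simp
    finally show ?thesis using fc[OF l] by (auto simp: signed_def a_minus_def)
  qed
  \<comment> \<open>The remaining sign is chosen so that the exponents \<open>Suc M\<close>,
    \<open>?s\<close> and the \<open>m\<close> of the differential have an even sum.\<close>
  define F' where "F' = (%l. signed (Om p) (int (Suc M)) (\<psi> p (H l)))"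
  have "nlin (Om p) M F'"
    unfolding F'_def by (rule mlin_signed[OF Om_module mlin_comp[OF Hm \<psi>(1) Fp_module Om_module]])
  then obtain f' where f': "f' IN NC (m - 1) p" "!!l. l \<in> tp M ==> f' (br l) = F' l"
    using NC_ex[OF mp'(3), of F'] unfolding N by blast
  have "f = dl (m - 1) p f'"
  proof (rule NC_eqI[OF f])
    show "dl (m - 1) p f' IN NC m p" using dl_closed[OF f'(1)] by simp
    fix l assume "l \<in> tp (nat (m + int p))"
    then have l: "l \<in> tp (Suc M)" unfolding N .
    have "dl (m - 1) p f' (br l) = signed (Om p) (m - 1 + 1) (Om.hdiff p (%l. f' (br l)) l)"
      by (rule dl(2)[OF mp'(3) f'(1)]) (simp only: N l)
    also have "Om.hdiff p (%l. f' (br l)) l = Om.hdiff p F' l" by (rule Om.hdiff_cong[OF f'(2) l])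
    also have "... = signed (Om p) (int (Suc M)) (Om.hdiff p (%l. \<psi> p (H l)) l)"
      unfolding F'_def by (rule Om.hdiff_signed[OF \<psi>Hc l])
    also have "... = signed (Om p) (int (Suc M)) (signed (Om p) ?s (?f l))" unfolding key[OF l] ..
    also have "signed (Om p) (m - 1 + 1) ... = ?f l"
      using fc[OF l] by (auto simp: signed_def)
    finally show "f (br l) = dl (m - 1) p f' (br l)" by simp
  qed
  then show ?thesis using f'(1) by blast
qed

text \<open>Without arguments, \<open>h\<close> is a form \<open>w\<close>. That \<open>u\<close> is
  a cocycle means \<open>au = ua\<close>, and the equation for \<open>\<theta>\<close> becomes
  \<open>aw - wa = u \<otimes> sa\<close> after a sign is moved into \<open>w\<close>. Such a pair
  comes from a chain by \<open>J_pair_surj\<close>.\<close>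

lemma theta_kernel_bottom:
  assumes u: "u IN Om p" and du: "dl (- int p) p (cc p u) = \<zero>\<^bsub>NC (- int p + 1) p\<^esub>"
    and h: "h IN NC (- int p - 1) (Suc p)" and eq: "th (- int p) p (cc p u) = dl (- int p - 1) (Suc p) h"
  shows "\<exists>\<zeta>\<in>carrier (TB D p). \<psi> p (J p \<zeta>) = u"
proof -
  let ?W = "Om (Suc p)"
  let ?w = "h (br [])"
  have m0: "0 \<le> - int p + int p" "0 \<le> - int p - 1 + int (Suc p)" by simp_all
  have n0: "nat (- int p + int p) = 0" "nat (- int p - 1 + int (Suc p)) = 0" by simp_all
  have w: "?w IN ?W" using NC_val_closed[OF h, of "[]"] by simp
  have cw: "fl p a u = fr p a u" if a: "a IN A" for a
  proof -
    have "Om.hdiff p (%l. cc p u (br l)) [a] = \<zero>\<^bsub>Om p\<^esub>"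
      using dl_zero_iff[OF m0(1) cc(1)[OF u]] du a unfolding n0 by simp
    then have "fl p a u \<ominus>\<^bsub>Om p\<^esub> fr p a u = \<zero>\<^bsub>Om p\<^esub>"
      by (simp add: Om.hdiff_def Om.TT_Nil cc(2)[OF u])
    then show ?thesis using Om.L_closed[OF a u] Om.R_closed[OF a u] by (simp add: Om.W.M.diff_eq_zero_iff)
  qed
  let ?s = "signed ?W (- int p)"
  have "fl (Suc p) a (?s ?w) = fr (Suc p) a (?s ?w) \<oplus>\<^bsub>?W\<^esub> fa p a u" if a: "a IN A" for a
  proof -
    have a1: "[a] \<in> tp (Suc 0)" using a by simp
    have "fa p a u = th (- int p) p (cc p u) (br [a])"
      using th(2)[OF m0(1) cc(1)[OF u], of "[a]"] a cc(2)[OF u] by (simp add: Th_def)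
    also have "... = signed ?W (- int p - 1 + 1) (Om.hdiff (Suc p) (%l. h (br l)) [a])"
      unfolding eq by (rule dl(2)[OF m0(2) h]) (simp only: n0 a1)
    also have "... = ?s (fl (Suc p) a ?w \<ominus>\<^bsub>?W\<^esub> fr (Suc p) a ?w)"
      by (simp add: Om.hdiff_def Om.TT_Nil)
    also have "... = fl (Suc p) a (?s ?w) \<ominus>\<^bsub>?W\<^esub> fr (Suc p) a (?s ?w)"
      using linear_minus[OF linear_signed_self[OF Om_module] Om_module Om_module Om.L_closed[OF a w] Om.R_closed[OF a w]]
        linear_signed[OF form_left(1)[OF a] Om_module Om_module w] linear_signed[OF form_right(1)[OF a] Om_module Om_module w]
      by simp
    finally show ?thesis
      using Om.L_closed[OF a signed_closed[OF Om_module w]] Om.R_closed[OF a signed_closed[OF Om_module w]]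
      by (simp add: a_minus_def Om.W.M.a_comm[of "fl (Suc p) a (?s ?w)"] Om.W.M.r_neg2)
  qed
  from J_pair_surj[OF signed_closed[OF Om_module w] u this cw] show ?thesis by blast
qed

end

section \<open>Quasi-isomorphisms and sequential colimits\<close>

lemma (in abelian_group) add_diff_right:
  "[|x IN G; y IN G|] ==> (x \<oplus> y) \<ominus> y = x"
  by (simp add: minus_eq a_assoc r_neg)

lemma cohomology_quot:
  assumes C: "cochain_complex K C d"
  shows "module K ((C n)\<lparr>carrier := cocycles C d n\<rparr>)"
    and "submodule (coboundaries C d n) K ((C n)\<lparr>carrier := cocycles C d n\<rparr>)"
proof -
  have mC: "!!n. module K (C n)" and dC: "!!n. linear K (C n) (C (n + 1)) (d n)"
    and dd: "!!n x. x IN C n ==> d (n + 1) (d n x) = \<zero>\<^bsub>C (n + 2)\<^esub>"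
    using C lin_maps_linear unfolding cochain_complex_def by blast+
  interpret V: module K "C n" by (rule mC)
  interpret W: module K "C (n + 1)" by (rule mC)
  interpret U: module K "C (n - 1)" by (rule mC)
  have d': "linear K (C (n - 1)) (C n) (d (n - 1))" using dC[of "n - 1"] by simp
  have Z: "submodule (cocycles C d n) K (C n)"
    by (rule submoduleI'[OF mC])
      (auto simp: cocycles_def linear_zero[OF dC mC mC] linear_add[OF dC] linear_smult[OF dC])
  show Zm: "module K ((C n)\<lparr>carrier := cocycles C d n\<rparr>)"
    using submodule.submodule_is_module[OF Z V.module_axioms] .
  show "submodule (coboundaries C d n) K ((C n)\<lparr>carrier := cocycles C d n\<rparr>)"
  proof (rule submoduleI'[OF Zm])
    show "coboundaries C d n \<subseteq> carrier ((C n)\<lparr>carrier := cocycles C d n\<rparr>)"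
      using dd[of _ "n - 1"] linear_closed[OF d'] by (auto simp: cocycles_def coboundaries_def algebra_simps)
    show "\<zero>\<^bsub>(C n)\<lparr>carrier := cocycles C d n\<rparr>\<^esub> \<in> coboundaries C d n"
      unfolding coboundaries_def by (rule image_eqI[OF _ U.M.zero_closed]) (simp add: linear_zero[OF d' mC mC])
  next
    fix x y assume "x \<in> coboundaries C d n" "y \<in> coboundaries C d n"
    then obtain x' y' where xy: "x = d (n - 1) x'" "x' IN C (n - 1)" "y = d (n - 1) y'" "y' IN C (n - 1)"
      by (auto simp: coboundaries_def)
    show "x \<oplus>\<^bsub>(C n)\<lparr>carrier := cocycles C d n\<rparr>\<^esub> y \<in> coboundaries C d n"
      unfolding coboundaries_def
      by (rule image_eqI[OF _ U.M.a_closed[OF xy(2,4)]]) (simp add: xy(1,3) linear_add[OF d' xy(2,4)])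
  next
    fix c x assume c: "c IN K" and "x \<in> coboundaries C d n"
    then obtain x' where x: "x = d (n - 1) x'" "x' IN C (n - 1)" by (auto simp: coboundaries_def)
    show "c \<odot>\<^bsub>(C n)\<lparr>carrier := cocycles C d n\<rparr>\<^esub> x \<in> coboundaries C d n"
      unfolding coboundaries_def
      by (rule image_eqI[OF _ U.smult_closed[OF c x(2)]]) (simp add: x(1) linear_smult[OF d' c x(2)])
  qed
qed

text \<open>Bijectivity on cohomology in terms of representatives, so that the comparison can be
  made with cocycles and coboundaries instead of their classes.\<close>

lemma quasi_isomorphismI:
  assumes C: "cochain_complex K C d" and C': "cochain_complex K C' d'" and f: "cochain_map K C d C' d' f"
    and surj: "!!n y. y \<in> cocycles C' d' n ==>
      \<exists>x\<in>cocycles C d n. \<exists>h\<in>carrier (C' (n - 1)). y = f n x \<oplus>\<^bsub>C' n\<^esub> d' (n - 1) h"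
    and inj: "!!n x. x \<in> cocycles C d n ==> f n x \<in> coboundaries C' d' n ==> x \<in> coboundaries C d n"
  shows "quasi_isomorphism K C d C' d' f"
proof -
  have "bij_betw (cohomology_map C' d' f n) (carrier (cohomology C d n)) (carrier (cohomology C' d' n))" for n
  proof -
    let ?Z = "cocycles C d n" and ?B = "coboundaries C d n" and ?Z' = "cocycles C' d' n" and ?B' = "coboundaries C' d' n"
    let ?V = "(C n)\<lparr>carrier := ?Z\<rparr>" and ?V' = "(C' n)\<lparr>carrier := ?Z'\<rparr>"
    note q = quot_mod[OF cohomology_quot[OF C, of n]] and q' = quot_mod[OF cohomology_quot[OF C', of n]]
    have mC: "!!n. module K (C n)" and dC: "!!n. linear K (C n) (C (n + 1)) (d n)"
      using C lin_maps_linear unfolding cochain_complex_def by blast+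
    have mC': "!!n. module K (C' n)" and dC': "!!n. linear K (C' n) (C' (n + 1)) (d' n)"
      using C' lin_maps_linear unfolding cochain_complex_def by blast+
    have fl: "!!n. linear K (C n) (C' n) (f n)" and fd: "!!n x. x IN C n ==> f (n + 1) (d n x) = d' n (f n x)"
      using f lin_maps_linear unfolding cochain_map_def by blast+
    interpret V: module K ?V by (rule cohomology_quot(1)[OF C])
    interpret V': module K ?V' by (rule cohomology_quot(1)[OF C'])
    have fZ: "f n x \<in> ?Z'" if "x \<in> ?Z" for x
      using that fd[of x n] linear_closed[OF fl] linear_zero[OF fl mC mC'] by (simp add: cocycles_def)
    have flV: "linear K ?V ?V' (f n)"
      by (rule linearI) (use fZ in "auto simp: cocycles_def linear_add[OF fl] linear_smult[OF fl]")
    have fB: "f n x \<in> ?B'" if xB: "x \<in> ?B" for x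
    proof -
      obtain x' where x': "x' IN C (n - 1)" "x = d (n - 1) x'" using xB by (auto simp: coboundaries_def)
      have "f n x = d' (n - 1) (f (n - 1) x')" using fd[OF x'(1)] x'(2) by simp
      then show ?thesis unfolding coboundaries_def by (rule image_eqI) (rule linear_closed[OF fl x'(1)])
    qed
    have BZ: "?B \<subseteq> ?Z" using submodule.axioms(1)[OF cohomology_quot(2)[OF C]] subgroup.subset by force
    have co: "?B' +>\<^bsub>?V'\<^esub> x = ?B' +>\<^bsub>C' n\<^esub> x" "?B +>\<^bsub>?V\<^esub> y = ?B +>\<^bsub>C n\<^esub> y" for x y
      by (simp_all add: a_r_coset_def')
    have val: "cohomology_map C' d' f n (?B +>\<^bsub>?V\<^esub> x) = ?B' +>\<^bsub>?V'\<^esub> f n x" if x: "x \<in> ?Z" for x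
    proof -
      have 1: "?B' +>\<^bsub>?V'\<^esub> f n y = ?B' +>\<^bsub>?V'\<^esub> f n x" if yx: "y \<in> ?B +>\<^bsub>?V\<^esub> x" for y
      proof -
        obtain b where b: "b \<in> ?B" "y = b \<oplus>\<^bsub>?V\<^esub> x" using yx unfolding a_r_coset_def' by (elim UN_E) auto
        have bZ: "b \<in> ?Z" using b(1) BZ by (rule subsetD[rotated])
        have yZ: "y \<in> ?Z" using V.M.a_closed[of b x] bZ x b(2) by simp
        have "f n y \<ominus>\<^bsub>?V'\<^esub> f n x = f n b"
        proof -
          have "f n y = f n b \<oplus>\<^bsub>?V'\<^esub> f n x" using linear_add[OF flV, of b x] bZ x b(2) by simp
          then show ?thesis using V'.M.add_diff_right[of "f n b" "f n x"] fZ[OF bZ] fZ[OF x] by simp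
        qed
        then show ?thesis using q'(4)[of "f n y" "f n x"] fZ[OF yZ] fZ[OF x] fB[OF b(1)] by simp
      qed
      have 2: "x \<in> ?B +>\<^bsub>?V\<^esub> x"
      proof -
        have "\<zero>\<^bsub>?V\<^esub> \<in> ?B" using subgroup.one_closed[OF submodule.axioms(1)[OF cohomology_quot(2)[OF C]]] by simp
        moreover have "x = \<zero>\<^bsub>?V\<^esub> \<oplus>\<^bsub>?V\<^esub> x" using V.M.l_zero[of x] x by simp
        ultimately show ?thesis unfolding a_r_coset_def' by (intro UN_I) auto
      qed
      \<comment> \<open>\<open>cohomology_map\<close> is a union over all representatives of a
        class; the family is constant.\<close>
      have "(\<Union>y\<in>?B +>\<^bsub>?V\<^esub> x. ?B' +>\<^bsub>?V'\<^esub> f n y) = ?B' +>\<^bsub>?V'\<^esub> f n x"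
        by (rule SUP_eq_const[OF _ 1]) (use 2 in \<open>rule ex_in_conv[THEN iffD1, OF exI]\<close>, assumption)
      then show ?thesis unfolding cohomology_map_def co .
    qed
    show ?thesis
      unfolding cohomology_def q(3) q'(3)
    proof (rule bij_betw_imageI)
      show "inj_on (cohomology_map C' d' f n) ((%x. ?B +>\<^bsub>?V\<^esub> x) ` carrier ?V)"
      proof (rule inj_onI)
        fix X Y assume "X \<in> (%x. ?B +>\<^bsub>?V\<^esub> x) ` carrier ?V" "Y \<in> (%x. ?B +>\<^bsub>?V\<^esub> x) ` carrier ?V"
        then obtain x y where xy: "x \<in> ?Z" "X = ?B +>\<^bsub>?V\<^esub> x" "y \<in> ?Z" "Y = ?B +>\<^bsub>?V\<^esub> y" by auto
        assume "cohomology_map C' d' f n X = cohomology_map C' d' f n Y"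
        then have "?B' +>\<^bsub>?V'\<^esub> f n x = ?B' +>\<^bsub>?V'\<^esub> f n y" using val xy by simp
        then have "f n x \<ominus>\<^bsub>?V'\<^esub> f n y \<in> ?B'" using q'(4)[of "f n x" "f n y"] fZ xy by simp
        moreover have "f n (x \<ominus>\<^bsub>?V\<^esub> y) = f n x \<ominus>\<^bsub>?V'\<^esub> f n y"
          by (rule linear_minus[OF flV V.module_axioms V'.module_axioms]) (use xy in simp_all)
        ultimately have "x \<ominus>\<^bsub>?V\<^esub> y \<in> ?B" using V.M.minus_closed[of x y] xy by (intro inj) simp_all
        then show "X = Y" using q(4)[of x y] xy by simp
      qed
      show "cohomology_map C' d' f n ` (%x. ?B +>\<^bsub>?V\<^esub> x) ` carrier ?V = (%x. ?B' +>\<^bsub>?V'\<^esub> x) ` carrier ?V'"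
      proof
        show "cohomology_map C' d' f n ` (%x. ?B +>\<^bsub>?V\<^esub> x) ` carrier ?V \<subseteq> (%x. ?B' +>\<^bsub>?V'\<^esub> x) ` carrier ?V'"
          using val fZ by auto
        show "(%x. ?B' +>\<^bsub>?V'\<^esub> x) ` carrier ?V' \<subseteq> cohomology_map C' d' f n ` (%x. ?B +>\<^bsub>?V\<^esub> x) ` carrier ?V"
        proof
          fix Y assume "Y \<in> (%x. ?B' +>\<^bsub>?V'\<^esub> x) ` carrier ?V'"
          then obtain y where y: "y \<in> ?Z'" "Y = ?B' +>\<^bsub>?V'\<^esub> y" by auto
          obtain x h where x: "x \<in> ?Z" and h: "h IN C' (n - 1)" and e: "y = f n x \<oplus>\<^bsub>C' n\<^esub> d' (n - 1) h"
            using surj[OF y(1)] by (elim bexE) (rule that)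
          have hB: "d' (n - 1) h \<in> ?B'" using h by (simp add: coboundaries_def)
          then have hZ: "d' (n - 1) h \<in> ?Z'"
            using submodule.axioms(1)[OF cohomology_quot(2)[OF C']] subgroup.subset by force
          have e': "y = f n x \<oplus>\<^bsub>?V'\<^esub> d' (n - 1) h" using e by simp
          have "y \<ominus>\<^bsub>?V'\<^esub> f n x = d' (n - 1) h"
            unfolding e' using V'.M.a_comm[of "f n x" "d' (n - 1) h"] V'.M.add_diff_right[of "d' (n - 1) h" "f n x"] fZ[OF x] hZ
            by simp
          then have "Y = ?B' +>\<^bsub>?V'\<^esub> f n x" using q'(4)[of y "f n x"] y fZ[OF x] hB by simp
          then have "Y = cohomology_map C' d' f n (?B +>\<^bsub>?V\<^esub> x)" using val[OF x] by simp
          then show "Y \<in> cohomology_map C' d' f n ` (%x. ?B +>\<^bsub>?V\<^esub> x) ` carrier ?V" using x by auto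
        qed
      qed
    qed
  qed
  then show ?thesis using C C' f by (simp add: quasi_isomorphism_def)
qed

section \<open>Sequential colimits\<close>

locale seq_system =
  fixes K :: "'k ring" and M :: "nat => ('k, 'v) module" and t :: "nat => 'v => 'v"
  assumes K: "cring K" and M: "!!p. module K (M p)" and t: "!!p. linear K (M p) (M (Suc p)) (t p)"
begin

abbreviation "DS \<equiv> dirsum_mod M"
abbreviation "Col \<equiv> colim_mod K M t"

lemma DS_module: "module K DS"
  by (rule dirsum_mod[OF M K])

lemma M_zero: "\<zero>\<^bsub>M p\<^esub> IN M p"
  by (rule module_zero[OF M])

lemma DS_simps:
  "s IN DS \<longleftrightarrow> (\<forall>p. s p IN M p) \<and> finite {p. s p ~= \<zero>\<^bsub>M p\<^esub>}"
  "\<zero>\<^bsub>DS\<^esub> p = \<zero>\<^bsub>M p\<^esub>" "(s \<oplus>\<^bsub>DS\<^esub> s') p = s p \<oplus>\<^bsub>M p\<^esub> s' p" "(c \<odot>\<^bsub>DS\<^esub> s) p = c \<odot>\<^bsub>M p\<^esub> s p"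
  by (simp_all add: dirsum_mod_def)

lemma dirsum_in_linear: "linear K (M p) DS (dirsum_in M p)"
proof (rule linearI)
  fix x assume "x IN M p"
  moreover have "finite {q. dirsum_in M p x q ~= \<zero>\<^bsub>M q\<^esub>}"
    by (rule finite_subset[of _ "{p}"]) (auto simp: dirsum_in_def)
  ultimately show "dirsum_in M p x IN DS" by (auto simp: DS_simps dirsum_in_def M_zero)
next
  fix x y assume "x IN M p" "y IN M p"
  show "dirsum_in M p (x \<oplus>\<^bsub>M p\<^esub> y) = dirsum_in M p x \<oplus>\<^bsub>DS\<^esub> dirsum_in M p y"
  proof
    fix q interpret Q: module K "M q" by (rule M)
    show "dirsum_in M p (x \<oplus>\<^bsub>M p\<^esub> y) q = (dirsum_in M p x \<oplus>\<^bsub>DS\<^esub> dirsum_in M p y) q"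
      by (auto simp: DS_simps dirsum_in_def)
  qed
next
  fix c x assume c: "c IN K"
  show "dirsum_in M p (c \<odot>\<^bsub>M p\<^esub> x) = c \<odot>\<^bsub>DS\<^esub> dirsum_in M p x"
  proof
    fix q interpret Q: module K "M q" by (rule M)
    show "dirsum_in M p (c \<odot>\<^bsub>M p\<^esub> x) q = (c \<odot>\<^bsub>DS\<^esub> dirsum_in M p x) q"
      using c by (auto simp: DS_simps dirsum_in_def)
  qed
qed

lemma DS_spans: "spans K DS {dirsum_in M p x | p x. x IN M p}" (is "spans K DS ?G")
proof (rule spansI[OF DS_module])
  show "?G \<subseteq> carrier DS" using linear_closed[OF dirsum_in_linear] by auto
  fix H s assume H: "submodule H K DS" and G: "?G \<subseteq> H" and s: "s IN DS"
  interpret S: module K DS by (rule DS_module)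
  have "s \<in> H" if "finite I" "!!p. s p IN M p" "!!p. p \<notin> I ==> s p = \<zero>\<^bsub>M p\<^esub>" for I s
    using that
  proof (induct I arbitrary: s)
    case empty
    have "s = \<zero>\<^bsub>DS\<^esub>" using empty(2) by (intro ext) (simp add: DS_simps)
    then show ?case using subgroup.one_closed[OF submodule.axioms(1)[OF H]] by simp
  next
    case (insert q I)
    let ?s = "s(q := \<zero>\<^bsub>M q\<^esub>)"
    have "?s \<in> H" using insert(4,5) by (intro insert(3)) (auto simp: M_zero)
    moreover have "dirsum_in M q (s q) \<in> H" using G insert(4) by blast
    moreover have "s = ?s \<oplus>\<^bsub>DS\<^esub> dirsum_in M q (s q)"
    proof
      fix p interpret P: module K "M p" by (rule M)
      show "s p = (?s \<oplus>\<^bsub>DS\<^esub> dirsum_in M q (s q)) p" using insert(4)[of p] P.M.l_zero[of "s p"] P.M.r_zero[of "s p"] by (cases "p = q") (auto simp: DS_simps dirsum_in_def)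
    qed
    ultimately show ?case using S.submoduleE(5)[OF H] by metis
  qed
  then show "s \<in> H" using s by (auto simp: DS_simps)
qed

lemma colim_rel_submodule: "submodule (colim_rel K M t) K DS"
proof -
  interpret S: module K DS by (rule DS_module)
  show ?thesis unfolding colim_rel_def
    using linear_closed[OF dirsum_in_linear] linear_closed[OF t]
    by (intro mod_span_submodule[OF DS_module]) auto
qed

lemma Col_module: "module K Col"
  unfolding colim_mod_def by (rule quot_mod(1)[OF DS_module colim_rel_submodule])

lemma colim_in_linear: "linear K (M p) Col (colim_in K M t p)"
proof -
  have "colim_in K M t p = (%x. colim_rel K M t +>\<^bsub>DS\<^esub> dirsum_in M p x)" by (rule ext) (simp add: colim_in_def)
  then show ?thesis
    using linear_comp[OF dirsum_in_linear quot_mod(2)[OF DS_module colim_rel_submodule]] by (simp add: colim_mod_def)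
qed

lemma colim_in_Suc:
  assumes x: "x IN M p"
  shows "colim_in K M t (Suc p) (t p x) = colim_in K M t p x"
proof -
  have "dirsum_in M p x \<ominus>\<^bsub>DS\<^esub> dirsum_in M (Suc p) (t p x) \<in> colim_rel K M t"
    unfolding colim_rel_def using x by (intro subsetD[OF mod_span_subset]) blast
  then show ?thesis
    using quot_mod(4)[OF DS_module colim_rel_submodule linear_closed[OF dirsum_in_linear x]
      linear_closed[OF dirsum_in_linear linear_closed[OF t x]]]
    by (simp add: colim_in_def)
qed

lemma Col_spans: "spans K Col ((%(p, x). colim_in K M t p x) ` (SIGMA p:UNIV. carrier (M p)))"
proof -
  have "(%(p, x). colim_in K M t p x) ` (SIGMA p:UNIV. carrier (M p)) =
      (%s. colim_rel K M t +>\<^bsub>DS\<^esub> s) ` {dirsum_in M p x | p x. x IN M p}"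
    by (auto simp: colim_in_def)
  then show ?thesis
    using spans_quot[OF DS_module colim_rel_submodule DS_spans] by (simp add: colim_mod_def)
qed

primrec transport :: "nat => nat => 'v => 'v" where
  "transport p 0 x = x"
| "transport p (Suc k) x = t (p + k) (transport p k x)"

lemma transport_linear: "linear K (M p) (M (p + k)) (transport p k)"
proof (induct k)
  case 0
  show ?case using linear_cong[OF linear_id M] by simp
next
  case (Suc k)
  show ?case using linear_cong[OF linear_comp[OF Suc t] M] by simp
qed

lemma colim_in_transport: "x IN M p ==> colim_in K M t (p + k) (transport p k x) = colim_in K M t p x"
  by (induct k) (simp_all add: colim_in_Suc linear_closed[OF transport_linear])

text \<open>Classes that come from different stages are brought to a common stage by
  \<open>transport\<close>, which also raises the stage beyond any given \<open>p\<close>.\<close>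

lemma Col_ex:
  assumes X: "X IN Col"
  shows "\<exists>q\<ge>p. \<exists>x\<in>carrier (M q). X = colim_in K M t q x"
proof -
  have "\<exists>q. \<exists>x\<in>carrier (M q). X = colim_in K M t q x"
    using Col_spans Col_module X
  proof (induct rule: spans_induct)
    case zero
    show ?case using linear_zero[OF colim_in_linear M Col_module] M_zero by metis
  next
    case (gen s)
    then show ?case by auto
  next
    case (add X Y)
    obtain p x q y where x: "x IN M p" "X = colim_in K M t p x" and y: "y IN M q" "Y = colim_in K M t q y"
      using add(3,4) by (elim exE bexE) (rule that)
    have x': "transport p q x IN M (p + q)" by (rule linear_closed[OF transport_linear x(1)])
    have y': "transport q p y IN M (p + q)" using linear_closed[OF transport_linear y(1), of p] by (simp add: add.commute)
    interpret N: module K "M (p + q)" by (rule M)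
    have "X \<oplus>\<^bsub>Col\<^esub> Y = colim_in K M t (p + q) (transport p q x \<oplus>\<^bsub>M (p + q)\<^esub> transport q p y)"
      using linear_add[OF colim_in_linear x' y'] x(2) y(2) colim_in_transport[OF x(1), of q] colim_in_transport[OF y(1), of p]
      by (simp add: add.commute)
    then show ?case using N.M.a_closed[OF x' y'] by (intro exI bexI)
  next
    case (smult c X)
    obtain p x where x: "x IN M p" "X = colim_in K M t p x" using smult(3) by (elim exE bexE) (rule that)
    have "c \<odot>\<^bsub>Col\<^esub> X = colim_in K M t p (c \<odot>\<^bsub>M p\<^esub> x)" using linear_smult[OF colim_in_linear smult(1) x(1)] x(2) by simp
    then show ?case using module.smult_closed[OF M smult(1) x(1)] by (intro exI bexI)
  qed
  then obtain q x where x: "x IN M q" "X = colim_in K M t q x" by (elim exE bexE) (rule that)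
  then have "X = colim_in K M t (q + p) (transport q p x)" using colim_in_transport by simp
  then show ?thesis using linear_closed[OF transport_linear x(1), of p] by (intro exI[of _ "q + p"]) auto
qed

lemma transport_transport: "transport (p + j) k (transport p j x) = transport p (j + k) x"
  by (induct k) (simp_all add: add.assoc)

text \<open>\<open>total q s\<close> moves the components of \<open>s\<close> of index at most
  \<open>q\<close> to stage \<open>q\<close> and adds them there. On relations of the colimit it is
  zero at all large stages, so it detects which elements die.\<close>

primrec total :: "nat => (nat => 'v) => 'v" where
  "total 0 s = s 0"
| "total (Suc q) s = t q (total q s) \<oplus>\<^bsub>M (Suc q)\<^esub> s (Suc q)"

lemma total_linear: "linear K DS (M q) (total q)"
proof (induct q)
  case 0
  show ?case by (rule linearI) (simp_all add: DS_simps)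
next
  case (Suc q)
  have 1: "linear K DS (M (Suc q)) (%s. s (Suc q))" by (rule linearI) (simp_all add: DS_simps)
  show ?case
    by (rule linear_cong[OF linear_plus[OF linear_comp[OF Suc t] 1 M] DS_module]) simp
qed

lemma total_dirsum_in:
  assumes x: "x IN M p"
  shows "total (p + k) (dirsum_in M p x) = transport p k x"
proof (induct k)
  case 0
  have low: "q < p ==> total q (dirsum_in M p x) = \<zero>\<^bsub>M q\<^esub>" for q
  proof (induct q)
    case 0
    then show ?case by (simp add: dirsum_in_def)
  next
    case (Suc q)
    interpret Q: module K "M (Suc q)" by (rule M)
    show ?case using Suc by (simp add: dirsum_in_def linear_zero[OF t M M])
  qed
  show ?case
  proof (cases p)
    case 0
    then show ?thesis by (simp add: dirsum_in_def)
  next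
    case (Suc r)
    interpret Q: module K "M (Suc r)" by (rule M)
    show ?thesis using x low[of r] Suc by (simp add: dirsum_in_def linear_zero[OF t M M])
  qed
next
  case (Suc k)
  interpret Q: module K "M (Suc (p + k))" by (rule M)
  show ?case using Suc linear_closed[OF t linear_closed[OF transport_linear x]]
    by (simp add: dirsum_in_def)
qed

lemma transport_Suc: "transport (Suc p) k (t p x) = transport p (Suc k) x"
  by (induct k) simp_all

text \<open>The elements whose \<open>total\<close> is eventually zero form a submodule that
  contains the relations of the colimit. On a single component \<open>total\<close> is
  \<open>transport\<close>, so an element that dies in the colimit dies at a finite stage.\<close>

lemma colim_in_zero:
  assumes x: "x IN M p" and 0: "colim_in K M t p x = \<zero>\<^bsub>Col\<^esub>"
  shows "\<exists>k. transport p k x = \<zero>\<^bsub>M (p + k)\<^esub>"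
proof -
  let ?N = "{s \<in> carrier DS. \<exists>q0. \<forall>q\<ge>q0. total q s = \<zero>\<^bsub>M q\<^esub>}"
  interpret S: module K DS by (rule DS_module)
  have N: "submodule ?N K DS"
  proof (rule submoduleI'[OF DS_module])
    show "\<zero>\<^bsub>DS\<^esub> \<in> ?N" by (simp add: linear_zero[OF total_linear DS_module M])
  next
    fix s s' assume "s \<in> ?N" "s' \<in> ?N"
    then obtain q q' where s: "s IN DS" "\<forall>r\<ge>q. total r s = \<zero>\<^bsub>M r\<^esub>" and s': "s' IN DS" "\<forall>r\<ge>q'. total r s' = \<zero>\<^bsub>M r\<^esub>"
      by auto
    have "total r (s \<oplus>\<^bsub>DS\<^esub> s') = \<zero>\<^bsub>M r\<^esub>" if "r \<ge> max q q'" for r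
    proof -
      interpret R: module K "M r" by (rule M)
      show ?thesis using s s' that by (simp add: linear_add[OF total_linear])
    qed
    then show "s \<oplus>\<^bsub>DS\<^esub> s' \<in> ?N" using s(1) s'(1) by blast
  next
    fix c s assume c: "c IN K" and "s \<in> ?N"
    then obtain q where s: "s IN DS" "\<forall>r\<ge>q. total r s = \<zero>\<^bsub>M r\<^esub>" by auto
    then have "total r (c \<odot>\<^bsub>DS\<^esub> s) = \<zero>\<^bsub>M r\<^esub>" if "r \<ge> q" for r
      using that c by (simp add: linear_smult[OF total_linear] module.smult_r_null[OF M])
    then show "c \<odot>\<^bsub>DS\<^esub> s \<in> ?N" using S.smult_closed[OF c s(1)] by blast
  qed auto
  have "colim_rel K M t \<subseteq> ?N"
    unfolding colim_rel_def
  proof (rule mod_span_least[OF N], rule subsetI)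
    fix s assume "s \<in> {dirsum_in M p x \<ominus>\<^bsub>DS\<^esub> dirsum_in M (Suc p) (t p x) |p x. x IN M p}"
    then obtain p x where s: "s = dirsum_in M p x \<ominus>\<^bsub>DS\<^esub> dirsum_in M (Suc p) (t p x)" and x: "x IN M p" by auto
    note c = linear_closed[OF dirsum_in_linear x] linear_closed[OF dirsum_in_linear linear_closed[OF t x]]
    have "total q s = \<zero>\<^bsub>M q\<^esub>" if q: "q \<ge> Suc p" for q
    proof -
      interpret Q: module K "M q" by (rule M)
      obtain k where k: "q = Suc p + k" using q le_Suc_ex by blast
      have "total q (dirsum_in M p x) = transport p (Suc k) x" using total_dirsum_in[OF x, of "Suc k"] k by simp
      moreover have "total q (dirsum_in M (Suc p) (t p x)) = transport p (Suc k) x"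
        using total_dirsum_in[OF linear_closed[OF t x], of k] unfolding k transport_Suc .
      moreover have "total q s = total q (dirsum_in M p x) \<ominus>\<^bsub>M q\<^esub> total q (dirsum_in M (Suc p) (t p x))"
        unfolding s by (rule linear_minus[OF total_linear DS_module M c])
      ultimately show ?thesis using linear_closed[OF total_linear c(1), of q] by (simp add: Q.M.minus_eq Q.M.r_neg)
    qed
    then show "s \<in> ?N" using S.M.minus_closed[OF c] s by blast
  qed
  moreover have "dirsum_in M p x \<in> colim_rel K M t"
    using 0 quot_mod(5)[OF DS_module colim_rel_submodule linear_closed[OF dirsum_in_linear x]]
    by (simp add: colim_in_def colim_mod_def)
  ultimately obtain q where "\<forall>r\<ge>q. total r (dirsum_in M p x) = \<zero>\<^bsub>M r\<^esub>" by auto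
  then have "total (p + q) (dirsum_in M p x) = \<zero>\<^bsub>M (p + q)\<^esub>" by simp
  then show ?thesis using total_dirsum_in[OF x] by auto
qed

end

text \<open>A compatible family acts componentwise on the direct sums, and after projection to the
  target colimit it kills the relations of the source.\<close>

lemma colim_map:
  fixes K :: "'k ring" and M :: "nat => ('k, 'v) module" and M' :: "nat => ('k, 'w) module"
  assumes S: "seq_system K M t" and S': "seq_system K M' t'"
    and g: "!!p. linear K (M p) (M' p) (g p)"
    and gt: "!!p x. x IN M p ==> g (Suc p) (t p x) = t' p (g p x)"
  shows "\<exists>h. linear K (colim_mod K M t) (colim_mod K M' t') h \<and>
    (\<forall>p. \<forall>x\<in>carrier (M p). h (colim_in K M t p x) = colim_in K M' t' p (g p x))"
proof -
  interpret S: seq_system K M t by fact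
  interpret S': seq_system K M' t' by fact
  define G where "G s p = g p (s p)" for s p
  have G: "linear K S.DS S'.DS G"
  proof (rule linearI)
    fix s assume s: "s IN S.DS"
    have "finite {p. G s p ~= \<zero>\<^bsub>M' p\<^esub>}"
      by (rule finite_subset[of _ "{p. s p ~= \<zero>\<^bsub>M p\<^esub>}"])
        (use s linear_zero[OF g S.M S'.M] in "auto simp: S.DS_simps G_def")
    then show "G s IN S'.DS" using s linear_closed[OF g] by (simp add: S.DS_simps S'.DS_simps G_def)
  next
    fix s s' assume "s IN S.DS" "s' IN S.DS"
    then show "G (s \<oplus>\<^bsub>S.DS\<^esub> s') = G s \<oplus>\<^bsub>S'.DS\<^esub> G s'"
      by (intro ext) (simp add: S.DS_simps S'.DS_simps G_def linear_add[OF g])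
  next
    fix c s assume "c IN K" "s IN S.DS"
    then show "G (c \<odot>\<^bsub>S.DS\<^esub> s) = c \<odot>\<^bsub>S'.DS\<^esub> G s"
      by (intro ext) (simp add: S.DS_simps S'.DS_simps G_def linear_smult[OF g])
  qed
  have Gin: "G (dirsum_in M p x) = dirsum_in M' p (g p x)" for p x
    by (rule ext) (simp add: G_def dirsum_in_def linear_zero[OF g S.M S'.M])
  define H where "H s = colim_rel K M' t' +>\<^bsub>S'.DS\<^esub> G s" for s
  have H: "linear K S.DS S'.Col H"
    using linear_comp[OF G quot_mod(2)[OF S'.DS_module S'.colim_rel_submodule]]
    unfolding H_def[abs_def] colim_mod_def .
  have Hin: "H (dirsum_in M p x) = colim_in K M' t' p (g p x)" for p x by (simp add: H_def Gin colim_in_def)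
  interpret C: module K "S'.Col" by (rule S'.Col_module)
  have "submodule {s \<in> carrier S.DS. H s = \<zero>\<^bsub>S'.Col\<^esub>} K S.DS"
  proof -
    interpret T: module K "S.DS" by (rule S.DS_module)
    show ?thesis
      by (rule submoduleI'[OF S.DS_module])
        (auto simp: linear_zero[OF H S.DS_module S'.Col_module] linear_add[OF H] linear_smult[OF H])
  qed
  then have "colim_rel K M t \<subseteq> {s \<in> carrier S.DS. H s = \<zero>\<^bsub>S'.Col\<^esub>}"
    unfolding colim_rel_def
  proof (rule mod_span_least, intro subsetI)
    interpret T: module K "S.DS" by (rule S.DS_module)
    fix s assume "s \<in> {dirsum_in M p x \<ominus>\<^bsub>S.DS\<^esub> dirsum_in M (Suc p) (t p x) |p x. x IN M p}"
    then obtain p x where s: "s = dirsum_in M p x \<ominus>\<^bsub>S.DS\<^esub> dirsum_in M (Suc p) (t p x)" and x: "x IN M p" by auto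
    note c = linear_closed[OF S.dirsum_in_linear x] linear_closed[OF S.dirsum_in_linear linear_closed[OF S.t x]]
    have "H s = H (dirsum_in M p x) \<ominus>\<^bsub>S'.Col\<^esub> H (dirsum_in M (Suc p) (t p x))"
      unfolding s by (rule linear_minus[OF H S.DS_module S'.Col_module c])
    also have "H (dirsum_in M (Suc p) (t p x)) = H (dirsum_in M p x)"
      unfolding Hin gt[OF x] by (rule S'.colim_in_Suc[OF linear_closed[OF g x]])
    finally show "s \<in> {s \<in> carrier S.DS. H s = \<zero>\<^bsub>S'.Col\<^esub>}"
      using T.M.minus_closed[OF c] linear_closed[OF H c(1)] s by (simp add: C.M.minus_eq C.M.r_neg)
  qed
  then have *: "!!s. s \<in> colim_rel K M t ==> H s = \<zero>\<^bsub>S'.Col\<^esub>" by blast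
  have "\<exists>h. linear K (quot_mod S.DS (colim_rel K M t)) S'.Col h \<and> (\<forall>x\<in>carrier S.DS. h (colim_rel K M t +>\<^bsub>S.DS\<^esub> x) = H x)"
    by (rule quot_mod_lift[OF S.DS_module S.colim_rel_submodule S'.Col_module H *])
  then obtain h where h: "linear K (quot_mod S.DS (colim_rel K M t)) S'.Col h"
    "\<forall>x\<in>carrier S.DS. h (colim_rel K M t +>\<^bsub>S.DS\<^esub> x) = H x"
    by (elim exE conjE) (rule that)
  have "h (colim_in K M t p x) = colim_in K M' t' p (g p x)" if "x IN M p" for p x
    using h(2) linear_closed[OF S.dirsum_in_linear that] Hin by (simp add: colim_in_def)
  moreover have "linear K S.Col S'.Col h" using h(1) by (simp only: colim_mod_def)
  ultimately show ?thesis by (intro exI[of _ h] conjI allI ballI)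
qed

text \<open>Maps out of the Tate complex are known through their values on \<open>Inl\<close> and
  \<open>Inr\<close>; their linearity is transferred from the modules behind these
  injections.\<close>

lemma linear_factor:
  assumes V: "module K V" and e: "linear K V W e" and C: "carrier W = e ` carrier V"
    and g: "linear K V U g" and fe: "!!v. v IN V ==> f (e v) = g v"
  shows "linear K W U f"
proof -
  interpret V: module K V by fact
  show ?thesis
  proof (rule linearI; unfold C; elim imageE; simp only:)
    show "f (e v) IN U" if "v IN V" for v using linear_closed[OF g] fe that by simp
    show "f (e v \<oplus>\<^bsub>W\<^esub> e w) = f (e v) \<oplus>\<^bsub>U\<^esub> f (e w)" if "v IN V" "w IN V" for v w
      using linear_add[OF e that, symmetric] linear_add[OF g that] fe that by simp
    show "f (c \<odot>\<^bsub>W\<^esub> e v) = c \<odot>\<^bsub>U\<^esub> f (e v)" if "c IN K" "v IN V" for c v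
      using linear_smult[OF e that, symmetric] linear_smult[OF g that] fe that by simp
  qed
qed

section \<open>Cocycles of the singular Hochschild complex\<close>

context hochschild_tate
begin

lemma sg_system: "seq_system K (NC m) (th m)"
  by (intro seq_system.intro cring_K NC_module th_linear)

sublocale sg: seq_system K "NC m" "th m" for m
  by (rule sg_system)

abbreviation "SG \<equiv> sg_cochains K A"
abbreviation "si \<equiv> sg_in K A"
abbreviation "sd \<equiv> sg_diff K A"

lemma SG_module: "module K (SG m)"
  unfolding sg_cochains_def by (rule sg.Col_module)

lemma si_linear: "linear K (NC m p) (SG m) (si m p)"
  unfolding sg_cochains_def sg_in_def by (rule sg.colim_in_linear)

lemma si_th: "f IN NC m p ==> si m (Suc p) (th m p f) = si m p f"
  unfolding sg_in_def by (rule sg.colim_in_Suc)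

lemma sd:
  shows "sd m \<in> lin_maps K (SG m) (SG (m + 1))"
    and "!!p f. f IN NC m p ==> sd m (si m p f) = si (m + 1) p (dl m p f)"
proof -
  have S: "spans K (SG m) ((%(p, f). si m p f) ` (SIGMA p:UNIV. carrier (NC m p)))"
    using sg.Col_spans[of m] unfolding sg_cochains_def sg_in_def .
  have "\<exists>h. linear K (SG m) (SG (m + 1)) h \<and>
      (\<forall>p. \<forall>f\<in>carrier (NC m p). h (si m p f) = si (m + 1) p (dl m p f))"
    unfolding sg_cochains_def sg_in_def
    by (rule colim_map[OF sg_system sg_system dl_linear]) (rule dl_th)
  then obtain h where h: "linear K (SG m) (SG (m + 1)) h"
      "\<forall>p. \<forall>f\<in>carrier (NC m p). h (si m p f) = si (m + 1) p (dl m p f)"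
    by (elim exE conjE) (rule that)
  have ex: "\<exists>h. linear K (SG m) (SG (m + 1)) h \<and> (\<forall>i\<in>SIGMA p:UNIV. carrier (NC m p).
      h ((%(p, f). si m p f) i) = (%(p, f). si (m + 1) p (dl m p f)) i)"
    by (intro exI[of _ h] conjI h(1)) (use h(2) in "simp add: split_paired_all")
  note l = lin_ext[OF SG_module SG_module S ex, folded sg_diff_def]
  show "sd m \<in> lin_maps K (SG m) (SG (m + 1))" by (rule l(1))
  show "sd m (si m p f) = si (m + 1) p (dl m p f)" if "f IN NC m p" for p f
    using l(3)[of "(p, f)"] that by simp
qed

lemma sd_linear: "linear K (SG m) (SG (m + 1)) (sd m)"
  by (rule lin_maps_linear[OF sd(1)])

lemma SG_ex: "X IN SG m ==> \<exists>q\<ge>p. \<exists>f\<in>carrier (NC m q). X = si m q f"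
  unfolding sg_cochains_def sg_in_def by (rule sg.Col_ex)

lemma si_zero:
  "f IN NC m p ==> si m p f = \<zero>\<^bsub>SG m\<^esub> ==> \<exists>k. sg.transport m p k f = \<zero>\<^bsub>NC m (p + k)\<^esub>"
  unfolding sg_cochains_def sg_in_def by (rule sg.colim_in_zero)

lemma SG_complex: "cochain_complex K SG sd"
  unfolding cochain_complex_def
proof (intro allI conjI ballI)
  fix m x assume "x IN SG m"
  then obtain q f where f: "f IN NC m q" "x = si m q f" using SG_ex[of x m 0] by blast
  have "sd (m + 1) (sd m x) = si (m + 1 + 1) q (dl (m + 1) q (dl m q f))"
    using f sd(2) dl_closed by simp
  also have "... = si (m + 2) q \<zero>\<^bsub>NC (m + 2) q\<^esub>" using dl_dl[OF f(1)] by (simp add: add.assoc)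
  finally show "sd (m + 1) (sd m x) = \<zero>\<^bsub>SG (m + 2)\<^esub>" using linear_zero[OF si_linear NC_module SG_module] by simp
qed (rule SG_module sd(1))+

lemma dl_transport: "f IN NC m p ==> dl m (p + k) (sg.transport m p k f) = sg.transport (m + 1) p k (dl m p f)"
  by (induct k) (simp_all add: dl_th linear_closed[OF sg.transport_linear])

text \<open>Each use of \<open>theta_surjective\<close> lowers the stage by one and costs a
  coboundary. In the colimit \<open>\<theta>\<close> becomes the identity, so these coboundaries
  simply add up.\<close>

lemma SG_cocycle_descent:
  assumes P: "0 \<le> m + int P" and "g IN NC m (P + k)" and "dl m (P + k) g = \<zero>\<^bsub>NC (m + 1) (P + k)\<^esub>"
  shows "\<exists>f\<in>carrier (NC m P). dl m P f = \<zero>\<^bsub>NC (m + 1) P\<^esub> \<and>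
    (\<exists>Y\<in>carrier (SG (m - 1)). si m (P + k) g = si m P f \<oplus>\<^bsub>SG m\<^esub> sd (m - 1) Y)"
  using assms(2,3)
proof (induct k arbitrary: g)
  case 0
  interpret S: module K "SG m" by (rule SG_module)
  have z: "\<zero>\<^bsub>SG (m - 1)\<^esub> IN SG (m - 1)" by (rule module_zero[OF SG_module])
  have "sd (m - 1) \<zero>\<^bsub>SG (m - 1)\<^esub> = \<zero>\<^bsub>SG m\<^esub>" using linear_zero[OF sd_linear SG_module SG_module, of "m - 1"] by simp
  then show ?case using 0 linear_closed[OF si_linear] z by (intro bexI[of _ g] conjI bexI[OF _ z]) simp_all
next
  case (Suc k)
  interpret S: module K "SG m" by (rule SG_module)
  interpret S1: module K "SG (m - 1)" by (rule SG_module)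
  have P': "0 \<le> m + int (P + k)" using P by simp
  have g: "g \<in> carrier (NC m (Suc (P + k)))" "dl m (Suc (P + k)) g = \<zero>\<^bsub>NC (m + 1) (Suc (P + k))\<^esub>" using Suc by simp_all
  obtain f h where f: "f IN NC m (P + k)" and h: "h \<in> carrier (NC (m - 1) (Suc (P + k)))"
    and df: "dl m (P + k) f = \<zero>\<^bsub>NC (m + 1) (P + k)\<^esub>"
    and e: "g = th m (P + k) f \<oplus>\<^bsub>NC m (Suc (P + k))\<^esub> dl (m - 1) (Suc (P + k)) h"
    using theta_surjective[OF P' g] by (elim bexE conjE) (rule that)
  obtain f' Y where f': "f' IN NC m P" "dl m P f' = \<zero>\<^bsub>NC (m + 1) P\<^esub>" and Y: "Y IN SG (m - 1)"
    and eY: "si m (P + k) f = si m P f' \<oplus>\<^bsub>SG m\<^esub> sd (m - 1) Y"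
    using Suc(1)[OF f df] by (elim bexE conjE) (rule that)
  let ?H = "si (m - 1) (Suc (P + k)) h"
  have Hc: "?H IN SG (m - 1)" by (rule linear_closed[OF si_linear h])
  have sl: "linear K (SG (m - 1)) (SG m) (sd (m - 1))" using sd_linear[of "m - 1"] by simp
  have dh: "dl (m - 1) (Suc (P + k)) h \<in> carrier (NC m (Suc (P + k)))" using dl_closed[OF h] by simp
  have "si m (Suc (P + k)) g = si m (Suc (P + k)) (th m (P + k) f) \<oplus>\<^bsub>SG m\<^esub> si m (Suc (P + k)) (dl (m - 1) (Suc (P + k)) h)"
    unfolding e by (rule linear_add[OF si_linear th_closed[OF f] dh])
  also have "... = (si m P f' \<oplus>\<^bsub>SG m\<^esub> sd (m - 1) Y) \<oplus>\<^bsub>SG m\<^esub> sd (m - 1) ?H"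
    using si_th[OF f] eY sd(2)[OF h] by simp
  also have "... = si m P f' \<oplus>\<^bsub>SG m\<^esub> sd (m - 1) (Y \<oplus>\<^bsub>SG (m - 1)\<^esub> ?H)"
    unfolding linear_add[OF sl Y Hc]
    by (rule S.M.a_assoc[OF linear_closed[OF si_linear f'(1)] linear_closed[OF sl Y] linear_closed[OF sl Hc]])
  finally have "si m (P + Suc k) g = si m P f' \<oplus>\<^bsub>SG m\<^esub> sd (m - 1) (Y \<oplus>\<^bsub>SG (m - 1)\<^esub> ?H)" by simp
  then show ?case using f' S1.M.a_closed[OF Y Hc] by (intro bexI[of _ f'] conjI bexI[of _ "Y \<oplus>\<^bsub>SG (m - 1)\<^esub> ?H"])
qed

lemma SG_cocycle:
  assumes P: "0 \<le> m + int P" and X: "X IN SG m" and dX: "sd m X = \<zero>\<^bsub>SG (m + 1)\<^esub>"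
  shows "\<exists>f\<in>carrier (NC m P). dl m P f = \<zero>\<^bsub>NC (m + 1) P\<^esub> \<and>
    (\<exists>Y\<in>carrier (SG (m - 1)). X = si m P f \<oplus>\<^bsub>SG m\<^esub> sd (m - 1) Y)"
proof -
  obtain q g where q: "P \<le> q" and g: "g IN NC m q" "X = si m q g"
    using SG_ex[OF X, of P] by (elim exE bexE conjE) (rule that)
  have "si (m + 1) q (dl m q g) = \<zero>\<^bsub>SG (m + 1)\<^esub>" using dX g sd(2) by simp
  \<comment> \<open>That the differential of the representative vanishes in the colimit makes it a
    cocycle only after it has been moved to a later stage.\<close>
  then obtain k where k: "sg.transport (m + 1) q k (dl m q g) = \<zero>\<^bsub>NC (m + 1) (q + k)\<^esub>"
    using si_zero[OF dl_closed[OF g(1)]] by blast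
  let ?g = "sg.transport m q k g"
  have e: "P + (q - P + k) = q + k" using q by simp
  have g': "?g IN NC m (q + k)" by (rule linear_closed[OF sg.transport_linear g(1)])
  have dg: "dl m (q + k) ?g = \<zero>\<^bsub>NC (m + 1) (q + k)\<^esub>" using dl_transport[OF g(1)] k by simp
  have Xg: "X = si m (q + k) ?g" using sg.colim_in_transport[OF g(1)] g(2) by (simp add: sg_in_def)
  show ?thesis
    unfolding Xg by (rule SG_cocycle_descent[OF P, of ?g "q - P + k", unfolded e]) (fact g' dg)+
qed

text \<open>An equation in the colimit holds at some later stage. From there
  \<open>theta_injective\<close> brings the bounding cochain down to stage \<open>P\<close>, one
  stage at a time; \<open>1 \<le> m + int P\<close> guarantees an argument all the way.\<close>

lemma SG_coboundary:
  assumes P: "1 \<le> m + int P" and f: "f IN NC m P" and df: "dl m P f = \<zero>\<^bsub>NC (m + 1) P\<^esub>"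
    and Y: "Y IN SG (m - 1)" and eq: "si m P f = sd (m - 1) Y"
  shows "\<exists>h\<in>carrier (NC (m - 1) P). f = dl (m - 1) P h"
proof -
  have descend: "\<exists>h\<in>carrier (NC (m - 1) P). f = dl (m - 1) P h"
    if "h IN NC (m - 1) (P + k)" "sg.transport m P k f = dl (m - 1) (P + k) h" for k h
    using that
  proof (induct k arbitrary: h)
    case 0
    then show ?case by (intro bexI[of _ h]) simp_all
  next
    case (Suc k)
    have P': "1 \<le> m + int (P + k)" using P by simp
    have d0: "dl m (P + k) (sg.transport m P k f) = \<zero>\<^bsub>NC (m + 1) (P + k)\<^esub>"
      using dl_transport[OF f, of k] df linear_zero[OF sg.transport_linear NC_module NC_module, of "m + 1" P k] by simp
    have "h \<in> carrier (NC (m - 1) (Suc (P + k)))" "th m (P + k) (sg.transport m P k f) = dl (m - 1) (Suc (P + k)) h"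
      using Suc(2,3) by simp_all
    from theta_injective[OF P' linear_closed[OF sg.transport_linear f] d0 this]
    obtain h' where "h' IN NC (m - 1) (P + k)" "sg.transport m P k f = dl (m - 1) (P + k) h'"
      by (elim bexE) (rule that)
    then show ?case by (rule Suc(1))
  qed
  obtain q y where q: "P \<le> q" and y: "y IN NC (m - 1) q" "Y = si (m - 1) q y"
    using SG_ex[OF Y, of P] by (elim exE bexE conjE) (rule that)
  obtain j where j: "q = P + j" using q le_Suc_ex by blast
  let ?f = "sg.transport m P j f" and ?g = "dl (m - 1) q y"
  interpret N: module K "NC m q" by (rule NC_module)
  interpret S: module K "SG m" by (rule SG_module)
  have fc: "?f IN NC m q" unfolding j by (rule linear_closed[OF sg.transport_linear f])
  have gc: "?g IN NC m q" using dl_closed[OF y(1)] by simp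
  have "si m q ?f = si m P f" using sg.colim_in_transport[OF f, of j] by (simp add: sg_in_def j)
  moreover have "si m q ?g = sd (m - 1) Y" using sd(2)[OF y(1)] y(2) by simp
  ultimately have "si m q (?f \<ominus>\<^bsub>NC m q\<^esub> ?g) = sd (m - 1) Y \<ominus>\<^bsub>SG m\<^esub> sd (m - 1) Y"
    using linear_minus[OF si_linear NC_module SG_module fc gc] eq by simp
  also have "... = \<zero>\<^bsub>SG m\<^esub>" using linear_closed[OF sd_linear Y] by (simp add: S.M.minus_eq S.M.r_neg)
  finally obtain k where k: "sg.transport m q k (?f \<ominus>\<^bsub>NC m q\<^esub> ?g) = \<zero>\<^bsub>NC m (q + k)\<^esub>"
    using si_zero[OF N.M.minus_closed[OF fc gc]] by blast
  interpret L: module K "NC m (q + k)" by (rule NC_module)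
  have "sg.transport m q k ?f \<ominus>\<^bsub>NC m (q + k)\<^esub> sg.transport m q k ?g = \<zero>\<^bsub>NC m (q + k)\<^esub>"
    using linear_minus[OF sg.transport_linear NC_module NC_module fc gc, of k] k by simp
  then have "sg.transport m q k ?f = sg.transport m q k ?g"
    using linear_closed[OF sg.transport_linear fc, of k] linear_closed[OF sg.transport_linear gc, of k]
    by (simp add: L.M.diff_eq_zero_iff)
  also have "... = dl (m - 1) (q + k) (sg.transport (m - 1) q k y)" using dl_transport[OF y(1), of k] by simp
  finally have "sg.transport m P (j + k) f = dl (m - 1) (P + (j + k)) (sg.transport (m - 1) q k y)"
    using sg.transport_transport[of m P j k f] by (simp add: j add.assoc)
  moreover have "sg.transport (m - 1) q k y \<in> carrier (NC (m - 1) (P + (j + k)))"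
    using linear_closed[OF sg.transport_linear y(1), of k] by (simp add: j add.assoc)
  ultimately show ?thesis by (intro descend)
qed

text \<open>One stage higher the cochains have one more argument, and the preceding statement
  applies. What it yields concerns \<open>\<theta>\<close> of \<open>f\<close>, since at the bottom
  \<open>\<theta>\<close> may have a kernel on cohomology.\<close>

lemma SG_coboundary_bottom:
  assumes P: "0 \<le> m + int P" and f: "f IN NC m P" and df: "dl m P f = \<zero>\<^bsub>NC (m + 1) P\<^esub>"
    and Y: "Y IN SG (m - 1)" and eq: "si m P f = sd (m - 1) Y"
  shows "\<exists>h\<in>carrier (NC (m - 1) (Suc P)). th m P f = dl (m - 1) (Suc P) h"
proof (rule SG_coboundary[OF _ th_closed[OF f] _ Y])
  show "dl m (Suc P) (th m P f) = \<zero>\<^bsub>NC (m + 1) (Suc P)\<^esub>"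
    using dl_th[OF f] df linear_zero[OF th_linear NC_module NC_module] by simp
qed (use P si_th[OF f] eq in simp_all)

section \<open>The generalized Tate-Hochschild complex\<close>

abbreviation "TM \<equiv> tate_mod K A"
abbreviation "TD \<equiv> tate_diff K A"
abbreviation "io \<equiv> iota K A"

lemma tate_index_neg: "tate_index (- int (Suc p)) = p"
  by (simp add: tate_index_def)

lemma tate_cases:
  obtains "0 \<le> n" | p where "n = - int (Suc p)"
proof (cases "0 \<le> n")
  case False
  then have "n = - int (Suc (nat (- n - 1)))" by simp
  then show ?thesis by (rule that(2))
qed (rule that(1))

lemma TM_nonneg:
  assumes n: "0 \<le> n"
  shows "module K (TM n)" "linear K (NC n 0) (TM n) Inl" "carrier (TM n) = Inl ` carrier (NC n 0)"
    "\<zero>\<^bsub>TM n\<^esub> = Inl \<zero>\<^bsub>NC n 0\<^esub>"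
proof -
  show C: "carrier (TM n) = Inl ` carrier (NC n 0)" and z: "\<zero>\<^bsub>TM n\<^esub> = Inl \<zero>\<^bsub>NC n 0\<^esub>"
    using n by (simp_all add: tate_mod_def Let_def)
  show "module K (TM n)" "linear K (NC n 0) (TM n) Inl"
    by (rule module_image[where q = Inl, OF NC_module C z]; use n in "simp add: tate_mod_def Let_def")+
qed

lemma TM_neg:
  shows "module K (TM (- int (Suc p)))" "linear K (TB D p) (TM (- int (Suc p))) Inr"
    "carrier (TM (- int (Suc p))) = Inr ` carrier (TB D p)" "\<zero>\<^bsub>TM (- int (Suc p))\<^esub> = Inr \<zero>\<^bsub>TB D p\<^esub>"
proof -
  have n: "\<not> 0 \<le> - int (Suc p)" by simp
  note TM = tate_mod_def[of K A "- int (Suc p)", unfolded if_not_P[OF n] tate_index_neg CH_TB Let_def]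
  show C: "carrier (TM (- int (Suc p))) = Inr ` carrier (TB D p)" and z: "\<zero>\<^bsub>TM (- int (Suc p))\<^esub> = Inr \<zero>\<^bsub>TB D p\<^esub>"
    by (simp_all only: TM mk_module_simps)
  show "module K (TM (- int (Suc p)))" "linear K (TB D p) (TM (- int (Suc p))) Inr"
    by (rule module_image[where q = Inr, OF TB_module[OF D_module] C z]; simp only: TM mk_module_simps sum.sel)+
qed

lemma TM_module: "module K (TM n)"
  by (cases n rule: tate_cases) (simp_all only: TM_nonneg TM_neg)

lemma TD_nonneg: "0 \<le> n ==> f IN NC n 0 ==> TD n (Inl f) = Inl (dl n 0 f)"
  by (simp add: tate_diff_def TM_nonneg)

lemma TD_neg:
  assumes \<zeta>: "\<zeta> IN TB D p"
  shows "p = 0 ==> TD (- int (Suc p)) (Inr \<zeta>) = Inl (mu K A \<zeta>)"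
    and "p = Suc q ==> TD (- int (Suc p)) (Inr \<zeta>) = Inr (hoch_b K A p \<zeta>)"
proof -
  have "Inr \<zeta> \<in> carrier (TM (- int (Suc p)))" using \<zeta> TM_neg(3) by blast
  then have "TD (- int (Suc p)) (Inr \<zeta>) =
      (if - int (Suc p) = - 1 then Inl (mu K A \<zeta>) else Inr (hoch_b K A p \<zeta>))"
    unfolding tate_diff_def tate_index_neg by simp
  then show "p = 0 ==> TD (- int (Suc p)) (Inr \<zeta>) = Inl (mu K A \<zeta>)"
    "p = Suc q ==> TD (- int (Suc p)) (Inr \<zeta>) = Inr (hoch_b K A p \<zeta>)" by simp_all
qed

lemma io_nonneg: "0 \<le> n ==> f IN NC n 0 ==> io n (Inl f) = si n 0 f"
  by (simp add: iota_def TM_nonneg)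

lemma io_neg:
  assumes \<zeta>: "\<zeta> IN TB D p"
  shows "io (- int (Suc p)) (Inr \<zeta>) = si (- int (Suc p)) (Suc p) (cc (Suc p) (\<phi> p (J p \<zeta>)))"
proof -
  have "Inr \<zeta> \<in> carrier (TM (- int (Suc p)))" using \<zeta> TM_neg(3) by blast
  then show ?thesis
    unfolding iota_def tate_index_neg Let_def
    using iota_inner[OF \<zeta>] by (simp del: of_nat_Suc)
qed

lemma mu_linear: "linear K (TB D 0) (NC 0 0) (mu K A)"
  by (rule lin_maps_linear[OF mu_eq(1)])

lemma TD_linear: "linear K (TM n) (TM (n + 1)) (TD n)"
proof (cases n rule: tate_cases)
  case 1
  have n1: "0 \<le> n + 1" using 1 by simp
  show ?thesis
    by (rule linear_factor[OF NC_module TM_nonneg(2,3)[OF 1] linear_comp[OF dl_linear TM_nonneg(2)[OF n1]] TD_nonneg[OF 1]])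
next
  case (2 p)
  show ?thesis
  proof (cases p)
    case 0
    have n: "n + 1 = 0" using 2 0 by simp
    show ?thesis
      unfolding n unfolding 2
      by (rule linear_factor[where e = Inr and f = "TD (- int (Suc p))" and g = "%\<zeta>. Inl (mu K A \<zeta>)", OF TB_module[OF D_module] TM_neg(2,3) _ TD_neg(1)[OF _ 0]])
        (use linear_comp[OF mu_linear TM_nonneg(2)[of 0]] 0 in simp_all)
  next
    case (Suc q)
    have n: "n + 1 = - int (Suc q)" using 2 Suc by simp
    show ?thesis
      unfolding n unfolding 2
      by (rule linear_factor[where e = Inr and f = "TD (- int (Suc p))" and g = "%\<zeta>. Inr (hoch_b K A p \<zeta>)", OF TB_module[OF D_module] TM_neg(2,3) _ TD_neg(2)[OF _ Suc]])
        (use linear_comp[OF hoch_b(1) TM_neg(2), of q] Suc in simp_all)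
  qed
qed

lemma io_linear: "linear K (TM n) (SG n) (io n)"
proof (cases n rule: tate_cases)
  case 1
  show ?thesis
    by (rule linear_factor[OF NC_module TM_nonneg(2,3)[OF 1] si_linear io_nonneg[OF 1]])
next
  case (2 p)
  have "linear K (TB D p) (SG (- int (Suc p))) (%\<zeta>. si (- int (Suc p)) (Suc p) (cc (Suc p) (\<phi> p (J p \<zeta>))))"
    by (rule linear_comp[OF linear_comp[OF linear_comp[OF J(1) \<phi>(1)] cc_linear] si_linear])
  then show ?thesis
    unfolding 2 by (rule linear_factor[where e = Inr and f = "io (- int (Suc p))", OF TB_module[OF D_module] TM_neg(2,3) _ io_neg])
qed

section \<open>Negative degrees in terms of components\<close>

lemma cc_eq_zero_iff:
  assumes w: "w IN Om p"
  shows "cc p w = \<zero>\<^bsub>NC (- int p) p\<^esub> \<longleftrightarrow> w = \<zero>\<^bsub>Om p\<^esub>"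
proof
  assume "cc p w = \<zero>\<^bsub>NC (- int p) p\<^esub>"
  then have "cc p w (br []) = \<zero>\<^bsub>Om p\<^esub>" by (simp add: NC_zero)
  then show "w = \<zero>\<^bsub>Om p\<^esub>" using cc(2)[OF w] by simp
qed (simp add: linear_zero[OF cc_linear Om_module NC_module])

lemma dl_cc_eq_zero_iff:
  assumes w: "w IN Om p"
  shows "dl (- int p) p (cc p w) = \<zero>\<^bsub>NC (- int p + 1) p\<^esub> \<longleftrightarrow>
    (\<forall>a\<in>carrier A. fl p a w = fr p a w)"
proof -
  have n0: "nat (- int p + int p) = 0" by simp
  have "Om.hdiff p (%l. cc p w (br l)) [a] = \<zero>\<^bsub>Om p\<^esub> \<longleftrightarrow> fl p a w = fr p a w"
    if a: "a IN A" for a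
    using Om.L_closed[OF a w] Om.R_closed[OF a w]
    by (simp add: Om.hdiff_def Om.TT_Nil cc(2)[OF w] Om.W.M.diff_eq_zero_iff)
  then show ?thesis
    using dl_zero_iff[of "- int p" p, OF _ cc(1)[OF w]] unfolding n0 by (auto simp: tuples_Suc)
qed

text \<open>For the components of a chain, centrality gives \<open>aw - wa = u \<otimes> sa\<close>:
  the differential of the first is \<open>\<theta>\<close> of the second, up to sign. In the colimit
  this becomes the compatibility of the embedding with the differentials in negative
  degrees.\<close>

lemma dl_cc_\<phi>:
  assumes \<zeta>: "\<zeta> IN TB D p"
  shows "dl (- int (Suc p)) (Suc p) (cc (Suc p) (\<phi> p (J p \<zeta>))) =
    th (- int p) p (cc p (signed (Om p) (int p) (\<psi> p (J p \<zeta>))))"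
proof -
  let ?W = "Om (Suc p)" and ?w = "\<phi> p (J p \<zeta>)" and ?u = "\<psi> p (J p \<zeta>)"
  let ?s = "signed (Om p) (int p) ?u"
  have w: "?w IN ?W" by (rule linear_closed[OF \<phi>(1) J_closed[OF \<zeta>]])
  have u: "?u IN Om p" by (rule linear_closed[OF \<psi>(1) J_closed[OF \<zeta>]])
  have s: "?s IN Om p" by (rule signed_closed[OF Om_module u])
  have m0: "0 \<le> - int (Suc p) + int (Suc p)" "0 \<le> - int p + int p" by simp_all
  have n0: "nat (- int (Suc p) + int (Suc p)) = 0" "nat (- int p + int p) = 0" "- int (Suc p) + 1 = - int p" by simp_all
  show ?thesis
  proof (rule NC_eqI)
    show "dl (- int (Suc p)) (Suc p) (cc (Suc p) ?w) IN NC (- int p) (Suc p)"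
      using dl_closed[OF cc(1)[OF w]] unfolding n0 .
    show "th (- int p) p (cc p ?s) IN NC (- int p) (Suc p)" by (rule th_closed[OF cc(1)[OF s]])
    fix l assume "l \<in> tp (nat (- int p + int (Suc p)))"
    then have l1: "l \<in> tp (Suc 0)" by simp
    then obtain a where a: "a IN A" "l = [a]" by (auto simp: tuples_Suc)
    have ac: "fa p a ?u IN ?W" by (rule linear_closed[OF form_append(1)[OF a(1)] u])
    have "dl (- int (Suc p)) (Suc p) (cc (Suc p) ?w) (br l) =
        signed ?W (- int (Suc p) + 1) (Om.hdiff (Suc p) (%l. cc (Suc p) ?w (br l)) l)"
      by (rule dl(2)[OF m0(1) cc(1)[OF w]]) (simp only: n0 l1)
    also have "... = signed ?W (- int p) (fl (Suc p) a ?w \<ominus>\<^bsub>?W\<^esub> fr (Suc p) a ?w)"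
      unfolding n0 a(2) by (simp add: Om.hdiff_def Om.TT_Nil cc(2)[OF w])
    also have "fl (Suc p) a ?w \<ominus>\<^bsub>?W\<^esub> fr (Suc p) a ?w = fa p a ?u"
      unfolding J_central_forms(1)[OF \<zeta> a(1)]
      using Om.W.M.a_comm[OF Om.R_closed[OF a(1) w] ac] Om.W.M.add_diff_right[OF ac Om.R_closed[OF a(1) w]] by simp
    also have "signed ?W (- int p) (fa p a ?u) = signed ?W (int p) (fa p a ?u)"
      by (simp add: signed_def)
    also have "... = fa p a ?s"
      by (rule linear_signed[OF form_append(1)[OF a(1)] Om_module Om_module u, symmetric])
    also have "... = th (- int p) p (cc p ?s) (br l)"
      using th(2)[OF m0(2) cc(1)[OF s], of l] l1 a(2) cc(2)[OF s] by (simp add: Th_def)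
    finally show "dl (- int (Suc p)) (Suc p) (cc (Suc p) ?w) (br l) = th (- int p) p (cc p ?s) (br l)" .
  qed
qed

lemma J_pair_eq:
  assumes \<zeta>: "\<zeta> IN TB D p" and \<xi>: "\<xi> IN TB D p"
    and 1: "\<phi> p (J p \<zeta>) = \<phi> p (J p \<xi>)" and 2: "\<psi> p (J p \<zeta>) = \<psi> p (J p \<xi>)"
  shows "\<zeta> = \<xi>"
proof -
  interpret T: module K "TB D p" by (rule TB_module[OF D_module])
  note fl = linear_comp[OF J(1) \<phi>(1), of p] and gl = linear_comp[OF J(1) \<psi>(1), of p]
  have "\<phi> p (J p (\<zeta> \<ominus>\<^bsub>TB D p\<^esub> \<xi>)) = \<zero>\<^bsub>Om (Suc p)\<^esub>"
    using linear_minus[OF fl T.module_axioms Om_module \<zeta> \<xi>] 1 linear_closed[OF fl \<xi>]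
    by (simp add: Om.W.M.minus_eq Om.W.M.r_neg)
  moreover have "\<psi> p (J p (\<zeta> \<ominus>\<^bsub>TB D p\<^esub> \<xi>)) = \<zero>\<^bsub>Om p\<^esub>"
    using linear_minus[OF gl T.module_axioms Om_module \<zeta> \<xi>] 2 linear_closed[OF gl \<xi>]
    by (simp add: Om.W.M.minus_eq Om.W.M.r_neg)
  ultimately have "\<zeta> \<ominus>\<^bsub>TB D p\<^esub> \<xi> = \<zero>\<^bsub>TB D p\<^esub>" by (rule J_pair_inj[OF T.M.minus_closed[OF \<zeta> \<xi>]])
  then show ?thesis using T.M.diff_eq_zero_iff[OF \<zeta> \<xi>] by simp
qed

text \<open>The boundary of a chain has \<open>\<psi>\<close>, up to sign, as first component and
  zero as second, and a chain is determined by its components. For \<open>p = 0\<close> the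
  differential is \<open>\<mu>\<close>, which is the second component itself.\<close>

lemma TD_neg_eq_zero_iff:
  assumes \<zeta>: "\<zeta> IN TB D p"
  shows "TD (- int (Suc p)) (Inr \<zeta>) = \<zero>\<^bsub>TM (- int (Suc p) + 1)\<^esub> \<longleftrightarrow> \<psi> p (J p \<zeta>) = \<zero>\<^bsub>Om p\<^esub>"
proof (cases p)
  case 0
  have n: "- int (Suc p) + 1 = 0" using 0 by simp
  have u: "\<psi> p (J p \<zeta>) IN Om p" by (rule linear_closed[OF \<psi>(1) J_closed[OF \<zeta>]])
  have "mu K A \<zeta> = cc p (\<psi> p (J p \<zeta>))" using mu_eq(2) \<zeta> 0 by simp
  then show ?thesis
    unfolding TD_neg(1)[OF \<zeta> 0] n TM_nonneg(4)[OF order_refl]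
    using cc_eq_zero_iff[OF u] 0 by simp
next
  case (Suc q)
  have n: "- int (Suc p) + 1 = - int (Suc q)" using Suc by simp
  have \<zeta>': "\<zeta> IN TB D (Suc q)" using \<zeta> Suc by simp
  have bc: "hoch_b K A p \<zeta> IN TB D q" using linear_closed[OF hoch_b(1) \<zeta>'] Suc by simp
  have u: "\<psi> p (J p \<zeta>) IN Om p" by (rule linear_closed[OF \<psi>(1) J_closed[OF \<zeta>]])
  have \<phi>b: "\<phi> q (J q (hoch_b K A p \<zeta>)) = signed (Om p) (int p) (\<psi> p (J p \<zeta>))"
    using \<phi>_J_hoch_b[OF \<zeta>'] Suc by simp
  have \<psi>b: "\<psi> q (J q (hoch_b K A p \<zeta>)) = \<zero>\<^bsub>Om q\<^esub>"
    using \<psi>_J_hoch_b[OF \<zeta>'] Suc by simp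
  have "hoch_b K A p \<zeta> = \<zero>\<^bsub>TB D q\<^esub> \<longleftrightarrow> \<psi> p (J p \<zeta>) = \<zero>\<^bsub>Om p\<^esub>"
  proof
    assume "hoch_b K A p \<zeta> = \<zero>\<^bsub>TB D q\<^esub>"
    then have "signed (Om p) (int p) (\<psi> p (J p \<zeta>)) = \<zero>\<^bsub>Om p\<^esub>"
      using \<phi>b linear_zero[OF linear_comp[OF J(1) \<phi>(1)] TB_module[OF D_module] Om_module, of q] Suc by simp
    then show "\<psi> p (J p \<zeta>) = \<zero>\<^bsub>Om p\<^esub>"
      using signed_cancel[OF Om_module u, of "int p"] signed_zero[OF Om_module, of p "int p"] by simp
  next
    assume "\<psi> p (J p \<zeta>) = \<zero>\<^bsub>Om p\<^esub>"
    then have "\<phi> q (J q (hoch_b K A p \<zeta>)) = \<zero>\<^bsub>Om (Suc q)\<^esub>" using \<phi>b signed_zero[OF Om_module, of p "int p"] Suc by simp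
    then show "hoch_b K A p \<zeta> = \<zero>\<^bsub>TB D q\<^esub>" using \<psi>b by (rule J_pair_inj[OF bc])
  qed
  then show ?thesis
    unfolding TD_neg(2)[OF \<zeta> Suc] n TM_neg(4) by simp
qed

lemma TM_complex: "cochain_complex K TM TD"
  unfolding cochain_complex_def
proof (intro allI conjI ballI)
  fix n
  show "module K (TM n)" by (rule TM_module)
  show "TD n \<in> lin_maps K (TM n) (TM (n + 1))"
    by (simp add: lin_maps_iff TD_linear) (simp add: tate_diff_def)
  fix x assume x: "x IN TM n"
  show "TD (n + 1) (TD n x) = \<zero>\<^bsub>TM (n + 2)\<^esub>"
  proof (cases n rule: tate_cases)
    case 1
    then have n: "0 \<le> n + 1" "0 \<le> n + 2" by simp_all
    obtain f where f: "f IN NC n 0" "x = Inl f" using x TM_nonneg(3)[OF 1] by auto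
    show ?thesis
      unfolding f(2) TD_nonneg[OF 1 f(1)] TD_nonneg[OF n(1) dl_closed[OF f(1)]] dl_dl[OF f(1)] TM_nonneg(4)[OF n(2)] ..
  next
    case (2 p)
    obtain \<zeta> where \<zeta>: "\<zeta> IN TB D p" "x = Inr \<zeta>" using x TM_neg(3) unfolding 2 by blast
    have u: "\<psi> p (J p \<zeta>) IN Om p" by (rule linear_closed[OF \<psi>(1) J_closed[OF \<zeta>(1)]])
    show ?thesis
    proof (cases p)
      case 0
      have n: "n + 1 = 0" "n + 2 = 1" using 2 0 by simp_all
      have m: "mu K A \<zeta> = cc 0 (\<psi> 0 (J 0 \<zeta>))" using mu_eq(2) \<zeta> 0 by simp
      have u0: "\<psi> 0 (J 0 \<zeta>) IN Om 0" using u 0 by simp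
      have mc: "mu K A \<zeta> IN NC 0 0" using cc(1)[OF u0] m by simp
      \<comment> \<open>The second component of a chain is central, so it is a cocycle of degree
        zero.\<close>
      have "dl 0 0 (mu K A \<zeta>) = \<zero>\<^bsub>NC 1 0\<^esub>"
        using dl_cc_eq_zero_iff[OF u0] J_central_forms(2) \<zeta>(1) 0 m by simp
      then have "TD 0 (Inl (mu K A \<zeta>)) = \<zero>\<^bsub>TM 1\<^esub>" using TD_nonneg[OF order_refl mc] TM_nonneg(4)[of 1] by simp
      then show ?thesis unfolding n unfolding 2 \<zeta>(2) TD_neg(1)[OF \<zeta>(1) 0] .
    next
      case (Suc q)
      have n: "n + 1 = - int (Suc q)" "n + 2 = - int (Suc q) + 1" using 2 Suc by simp_all
      have \<zeta>': "\<zeta> IN TB D (Suc q)" using \<zeta> Suc by simp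
      \<comment> \<open>A boundary has second component zero, and chains with this property are
        cycles.\<close>
      have "TD (- int (Suc q)) (Inr (hoch_b K A p \<zeta>)) = \<zero>\<^bsub>TM (- int (Suc q) + 1)\<^esub>"
        unfolding Suc using TD_neg_eq_zero_iff[OF linear_closed[OF hoch_b(1) \<zeta>']] \<psi>_J_hoch_b[OF \<zeta>'] by blast
      then show ?thesis unfolding n unfolding 2 \<zeta>(2) TD_neg(2)[OF \<zeta>(1) Suc] .
    qed
  qed
qed

lemma io_map: "cochain_map K TM TD SG sd io"
  unfolding cochain_map_def
proof (intro allI conjI ballI)
  fix n
  show "io n \<in> lin_maps K (TM n) (SG n)"
    by (simp add: lin_maps_iff io_linear) (simp add: iota_def)
  fix x assume x: "x IN TM n"
  show "io (n + 1) (TD n x) = sd n (io n x)"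
  proof (cases n rule: tate_cases)
    case 1
    then have n: "0 \<le> n + 1" by simp_all
    obtain f where f: "f IN NC n 0" "x = Inl f" using x TM_nonneg(3)[OF 1] by auto
    show ?thesis
      unfolding f(2) TD_nonneg[OF 1 f(1)] io_nonneg[OF 1 f(1)] io_nonneg[OF n dl_closed[OF f(1)]] sd(2)[OF f(1)] ..
  next
    case (2 p)
    obtain \<zeta> where \<zeta>: "\<zeta> IN TB D p" "x = Inr \<zeta>" using x TM_neg(3) unfolding 2 by blast
    have w: "\<phi> p (J p \<zeta>) IN Om (Suc p)" by (rule linear_closed[OF \<phi>(1) J_closed[OF \<zeta>(1)]])
    have u: "\<psi> p (J p \<zeta>) IN Om p" by (rule linear_closed[OF \<psi>(1) J_closed[OF \<zeta>(1)]])
    let ?s = "signed (Om p) (int p) (\<psi> p (J p \<zeta>))"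
    have s: "?s IN Om p" by (rule signed_closed[OF Om_module u])
    have n1: "- int (Suc p) + 1 = - int p" by simp
    have "sd n (io n x) = si (- int (Suc p) + 1) (Suc p) (dl (- int (Suc p)) (Suc p) (cc (Suc p) (\<phi> p (J p \<zeta>))))"
      unfolding 2 \<zeta>(2) io_neg[OF \<zeta>(1)] by (rule sd(2)[OF cc(1)[OF w]])
    \<comment> \<open>The first component has become \<open>\<theta>\<close> of the second, and
      \<open>\<theta>\<close> is absorbed by the colimit.\<close>
    also have "... = si (- int p) p (cc p ?s)"
      unfolding n1 dl_cc_\<phi>[OF \<zeta>(1)] by (rule si_th[OF cc(1)[OF s]])
    also have "... = io (n + 1) (TD n x)"
    proof (cases p)
      case 0
      have n: "n + 1 = 0" using 2 0 by simp_all
      have m: "mu K A \<zeta> = cc 0 (\<psi> 0 (J 0 \<zeta>))" using mu_eq(2) \<zeta> 0 by simp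
      have u0: "\<psi> 0 (J 0 \<zeta>) IN Om 0" using u 0 by simp
      have mc: "mu K A \<zeta> IN NC 0 0" using cc(1)[OF u0] m by simp
      show ?thesis
        unfolding n unfolding 2 \<zeta>(2) TD_neg(1)[OF \<zeta>(1) 0] io_nonneg[OF order_refl mc] unfolding m using 0 by simp
    next
      case (Suc q)
      have n: "n + 1 = - int (Suc q)" using 2 Suc by simp_all
      have \<zeta>': "\<zeta> IN TB D (Suc q)" using \<zeta> Suc by simp
      have bc: "hoch_b K A p \<zeta> IN TB D q" using linear_closed[OF hoch_b(1) \<zeta>'] Suc by simp
      have \<phi>b: "\<phi> q (J q (hoch_b K A p \<zeta>)) = ?s" using \<phi>_J_hoch_b[OF \<zeta>'] Suc by simp
      show ?thesis
        unfolding n unfolding 2 \<zeta>(2) TD_neg(2)[OF \<zeta>(1) Suc] io_neg[OF bc] \<phi>b unfolding Suc ..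
    qed
    finally show ?thesis ..
  qed
qed

text \<open>A class of negative degree is represented at the stage where cochains have no arguments,
  that is, by a form \<open>w\<close>. The cocycle condition says that \<open>w\<close> is central,
  and the pair \<open>(w, 0)\<close> comes from a chain.\<close>

lemma io_surj:
  assumes y: "y \<in> cocycles SG sd n"
  shows "\<exists>x\<in>cocycles TM TD n. \<exists>h\<in>carrier (SG (n - 1)). y = io n x \<oplus>\<^bsub>SG n\<^esub> sd (n - 1) h"
proof -
  have y': "y IN SG n" "sd n y = \<zero>\<^bsub>SG (n + 1)\<^esub>" using y by (simp_all add: cocycles_def)
  show ?thesis
  proof (cases n rule: tate_cases)
    case 1
    then have n: "0 \<le> n + int 0" "0 \<le> n + 1" by simp_all
    obtain f Y where f: "f IN NC n 0" "dl n 0 f = \<zero>\<^bsub>NC (n + 1) 0\<^esub>"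
      and Y: "Y IN SG (n - 1)" "y = si n 0 f \<oplus>\<^bsub>SG n\<^esub> sd (n - 1) Y"
      using SG_cocycle[OF n(1) y'] by (elim bexE conjE) (rule that)
    have "Inl f \<in> cocycles TM TD n"
      unfolding cocycles_def using f TD_nonneg[OF 1 f(1)] TM_nonneg(3)[OF 1] TM_nonneg(4)[OF n(2)] by simp
    moreover have "y = io n (Inl f) \<oplus>\<^bsub>SG n\<^esub> sd (n - 1) Y" unfolding io_nonneg[OF 1 f(1)] by (rule Y(2))
    ultimately show ?thesis using Y(1) by (intro bexI)
  next
    case (2 p)
    have P: "0 \<le> n + int (Suc p)" using 2 by simp
    obtain f Y where f: "f IN NC n (Suc p)" "dl n (Suc p) f = \<zero>\<^bsub>NC (n + 1) (Suc p)\<^esub>"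
      and Y: "Y IN SG (n - 1)" "y = si n (Suc p) f \<oplus>\<^bsub>SG n\<^esub> sd (n - 1) Y"
      using SG_cocycle[OF P y'] by (elim bexE conjE) (rule that)
    let ?w = "f (br [])"
    have w: "?w IN Om (Suc p)" using NC_val_closed[OF f(1), of "[]"] 2 by simp
    have fw: "cc (Suc p) ?w = f" by (rule cc_eq[OF f(1)[unfolded 2]])
    have cw: "fl (Suc p) a ?w = fr (Suc p) a ?w" if "a IN A" for a
      using dl_cc_eq_zero_iff[OF w] f(2) that unfolding fw 2 by blast
    have z: "\<zero>\<^bsub>Om p\<^esub> IN Om p" by (rule module_zero[OF Om_module])
    have "\<exists>\<zeta>\<in>carrier (TB D p). \<phi> p (J p \<zeta>) = ?w \<and> \<psi> p (J p \<zeta>) = \<zero>\<^bsub>Om p\<^esub>"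
    proof (rule J_pair_surj[OF w z])
      fix a assume a: "a IN A"
      show "fl (Suc p) a ?w = fr (Suc p) a ?w \<oplus>\<^bsub>Om (Suc p)\<^esub> fa p a \<zero>\<^bsub>Om p\<^esub>"
        using cw[OF a] linear_zero[OF form_append(1)[OF a] Om_module Om_module] Om.R_closed[OF a w] by simp
      show "fl p a \<zero>\<^bsub>Om p\<^esub> = fr p a \<zero>\<^bsub>Om p\<^esub>"
        using linear_zero[OF form_left(1)[OF a] Om_module Om_module]
          linear_zero[OF form_right(1)[OF a] Om_module Om_module] by simp
    qed
    then obtain \<zeta> where \<zeta>: "\<zeta> IN TB D p" "\<phi> p (J p \<zeta>) = ?w" "\<psi> p (J p \<zeta>) = \<zero>\<^bsub>Om p\<^esub>"
      by (elim bexE conjE) (rule that)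
    have "Inr \<zeta> \<in> cocycles TM TD n"
      unfolding cocycles_def 2 TM_neg(3) using TD_neg_eq_zero_iff[OF \<zeta>(1)] \<zeta> by blast
    moreover have "y = io n (Inr \<zeta>) \<oplus>\<^bsub>SG n\<^esub> sd (n - 1) Y"
      using Y(2) unfolding 2 io_neg[OF \<zeta>(1)] \<zeta>(2) fw .
    ultimately show ?thesis using Y(1) by (intro bexI)
  qed
qed

text \<open>In degrees at most zero, a cocycle without arguments that bounds in the colimit is
  killed by \<open>\<theta>\<close> on cohomology, hence is the second component of a chain one
  degree lower. In degree zero \<open>\<mu>\<close> of that chain is the cocycle; below, its
  boundary has the cocycle as first component, up to sign.\<close>

lemma io_inj:
  assumes x: "x \<in> cocycles TM TD n" and cob: "io n x \<in> coboundaries SG sd n"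
  shows "x \<in> coboundaries TM TD n"
proof -
  have x': "x IN TM n" "TD n x = \<zero>\<^bsub>TM (n + 1)\<^esub>" using x by (simp_all add: cocycles_def)
  obtain Y where Y: "Y IN SG (n - 1)" "io n x = sd (n - 1) Y" using cob by (auto simp: coboundaries_def)
  have cobI: "x \<in> coboundaries TM TD n" if "z IN TM (n - 1)" "x = TD (n - 1) z" for z
    unfolding coboundaries_def that(2) by (rule imageI[OF that(1)])
  show ?thesis
  proof (cases n rule: tate_cases)
    case 1
    then have n: "0 \<le> n + 1" "0 \<le> n + int 0" by simp_all
    obtain f where f: "f IN NC n 0" "x = Inl f" using x'(1) TM_nonneg(3)[OF 1] by auto
    have df: "dl n 0 f = \<zero>\<^bsub>NC (n + 1) 0\<^esub>"
      using x'(2) unfolding f(2) TD_nonneg[OF 1 f(1)] TM_nonneg(4)[OF n(1)] by simp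
    have e: "si n 0 f = sd (n - 1) Y" using Y(2) unfolding f(2) io_nonneg[OF 1 f(1)] .
    show ?thesis
    proof (cases "n = 0")
      case False
      then have n1: "1 \<le> n + int 0" "0 \<le> n - 1" using 1 by simp_all
      obtain h where h: "h IN NC (n - 1) 0" "f = dl (n - 1) 0 h"
        using SG_coboundary[OF n1(1) f(1) df Y(1) e] by (elim bexE) (rule that)
      show ?thesis
        by (rule cobI[of "Inl h"]) (use h f TM_nonneg(3)[OF n1(2)] TD_nonneg[OF n1(2) h(1)] in simp_all)
    next
      case True
      obtain h where h: "h IN NC (n - 1) (Suc 0)" "th n 0 f = dl (n - 1) (Suc 0) h"
        using SG_coboundary_bottom[OF n(2) f(1) df Y(1) e] by (elim bexE) (rule that)
      have n0: "n = - int 0" using True by simp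
      have u: "f (br []) IN Om 0" using NC_val_closed[OF f(1), of "[]"] True by simp
      have fu: "cc 0 (f (br [])) = f" by (rule cc_eq[OF f(1)[unfolded n0]])
      obtain \<zeta> where \<zeta>: "\<zeta> IN TB D 0" "\<psi> 0 (J 0 \<zeta>) = f (br [])"
        using theta_kernel_bottom[OF u, unfolded fu, OF df[unfolded n0] h[unfolded n0]] by (elim bexE) (rule that)
      have n1: "n - 1 = - int (Suc 0)" using True by simp
      show ?thesis
      proof (rule cobI[of "Inr \<zeta>"]; unfold n1)
        show "Inr \<zeta> \<in> carrier (TM (- int (Suc 0)))" using \<zeta> TM_neg(3)[of 0] by simp
        show "x = TD (- int (Suc 0)) (Inr \<zeta>)"
          unfolding TD_neg(1)[OF \<zeta>(1) refl] mu_eq(2)[OF \<zeta>(1)] \<zeta>(2) fu by (rule f(2))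
      qed
    qed
  next
    case (2 p)
    have P: "0 \<le> n + int (Suc p)" using 2 by simp
    obtain \<zeta> where \<zeta>: "\<zeta> IN TB D p" "x = Inr \<zeta>" using x'(1) TM_neg(3) unfolding 2 by blast
    let ?w = "\<phi> p (J p \<zeta>)"
    have w: "?w IN Om (Suc p)" by (rule linear_closed[OF \<phi>(1) J_closed[OF \<zeta>(1)]])
    have \<psi>0: "\<psi> p (J p \<zeta>) = \<zero>\<^bsub>Om p\<^esub>" using x'(2) TD_neg_eq_zero_iff[OF \<zeta>(1)] unfolding 2 \<zeta>(2) by blast
    have cw: "fl (Suc p) a ?w = fr (Suc p) a ?w" if a: "a IN A" for a
      using J_central_forms(1)[OF \<zeta>(1) a] \<psi>0 linear_zero[OF form_append(1)[OF a] Om_module Om_module] Om.R_closed[OF a w]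
      by simp
    have d0: "dl (- int (Suc p)) (Suc p) (cc (Suc p) ?w) = \<zero>\<^bsub>NC (- int (Suc p) + 1) (Suc p)\<^esub>"
      using dl_cc_eq_zero_iff[OF w] cw by blast
    have e: "si n (Suc p) (cc (Suc p) ?w) = sd (n - 1) Y" using Y(2) unfolding \<zeta>(2) unfolding 2 io_neg[OF \<zeta>(1)] .
    obtain h where h: "h \<in> carrier (NC (n - 1) (Suc (Suc p)))"
        "th n (Suc p) (cc (Suc p) ?w) = dl (n - 1) (Suc (Suc p)) h"
      using SG_coboundary_bottom[OF P cc(1)[OF w, folded 2] d0[folded 2] Y(1) e] by (elim bexE) (rule that)
    obtain \<zeta>' where \<zeta>': "\<zeta>' IN TB D (Suc p)" "\<psi> (Suc p) (J (Suc p) \<zeta>') = ?w"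
      using theta_kernel_bottom[OF w d0 h[unfolded 2]] by (elim bexE) (rule that)
    \<comment> \<open>The sign cancels the one in \<open>\<phi>_J_hoch_b\<close>.\<close>
    let ?\<xi> = "signed (TB D (Suc p)) (int (Suc p)) \<zeta>'"
    have T: "module K (TB D (Suc p))" by (rule TB_module[OF D_module])
    have \<xi>: "?\<xi> IN TB D (Suc p)" by (rule signed_closed[OF T \<zeta>'(1)])
    have "\<psi> (Suc p) (J (Suc p) ?\<xi>) = signed (Om (Suc p)) (int (Suc p)) ?w"
      using linear_signed[OF linear_comp[OF J(1) \<psi>(1)] T Om_module \<zeta>'(1), of "int (Suc p)"] \<zeta>'(2) by simp
    then have "\<phi> p (J p (hoch_b K A (Suc p) ?\<xi>)) = ?w"
      unfolding \<phi>_J_hoch_b[OF \<xi>] using signed_cancel[OF Om_module w, of "int (Suc p)"] by simp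
    \<comment> \<open>Both chains have first component \<open>?w\<close> and second component
      zero.\<close>
    then have b: "hoch_b K A (Suc p) ?\<xi> = \<zeta>"
      by (rule J_pair_eq[OF linear_closed[OF hoch_b(1) \<xi>] \<zeta>(1)]) (simp only: \<psi>_J_hoch_b[OF \<xi>] \<psi>0)
    have n1: "n - 1 = - int (Suc (Suc p))" using 2 by simp
    show ?thesis
    proof (rule cobI[of "Inr ?\<xi>"]; unfold n1)
      show "Inr ?\<xi> \<in> carrier (TM (- int (Suc (Suc p))))" unfolding TM_neg(3) by (rule imageI[OF \<xi>])
      show "x = TD (- int (Suc (Suc p))) (Inr ?\<xi>)" unfolding TD_neg(2)[OF \<xi> refl] b by (rule \<zeta>(2))
    qed
  qed
qed

end

theorem proposition6p9:
  fixes K :: "'k ring" and A :: "('k, 'a) module"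
  assumes "field K"
    and "assoc_algebra K A"
    and "finite_dimensional K A"
    and "self_injective A"
  shows "quasi_isomorphism K (tate_mod K A) (tate_diff K A) (sg_cochains K A) (sg_diff K A) (iota K A)"
proof -
  interpret hochschild_tate K A
    by (intro hochschild_tate.intro hochschild_fd.intro hochschild_base.intro
        hochschild_fd_axioms.intro hochschild_tate_axioms.intro assms)
  show ?thesis by (rule quasi_isomorphismI[OF TM_complex SG_complex io_map io_surj io_inj])
qed

end
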